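(* Let $(\mathbf{X}_i,Y_i)_{i=1,\dots,n}$ be i.i.d. copies of $(\mathbf{X},Y)$ with values in $\mathbb{R}^p\times\mathbb{R}$, let $F=\mathbb{E}[Y\mid\mathbf{X}=\cdot]$ and $\varepsilon=Y-F(\mathbf{X})$ (so $\mathbb{E}[\varepsilon\mid\mathbf{X}]=0$ a.s.). Assume: (1) for constants $K,C\geq 1$ we have $\Vert\mathbf{X}\Vert_\infty\leq K$ a.s. and $\Vert F\Vert_\infty\leq C$; (2) there are constants $\sigma,\Gamma>0$ such that $\mathbb{E}[|\varepsilon|^k\mid\mathbf{X}]\leq\frac{k!}{2}\sigma^2\Gamma^{k-2}$ a.s. for all integers $k\geq2$; (3) there exist $d^\ast\in\{1,\dots,p\}$, $\Theta^\ast\in\mathcal{S}_{d^\ast}$ and $f^\ast:\mathbb{R}^{d^\ast}\to\mathbb{R}$ such that $F=f^\ast(\Theta^\ast\,\cdot)$; (4) $\Vert\Theta^\ast\mathbf{X}\Vert_\infty\leq B_1$ for some $B_1>0$, and $\Theta^\ast\mathbf{X}$ has a Lebesgue density on $\mathbb{R}^{d^\ast}$ bounded by a constant $B_2>0$. Set $Q=8(2C+1)\max(\Gamma,2C+1)$ and $$\lambda=\frac{n}{Q+2\big((2C+1)^2+4\sigma^2\big)},$$ and suppose $n\geq\max(10C^{-1},\,30\sqrt2\,e\,p^{-2})$ and $n\geq2$. Suppose further that $f^\ast\in B^{\alpha}_{2,d^\ast}(\xi)$ with $\xi=C\big(L^{d^\ast}\,2\,N^{d^\ast/2}\,8^{d^\ast/2}\big)^{-1}$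 for some $\alpha>2+d^\ast$. Let $\hat\rho_\lambda$ be the Gibbs posterior and $(\hat d_\lambda,\hat\Theta_\lambda,\hat f_\lambda)\sim\hat\rho_\lambda$ the PAC-Bayes estimator, built with the prior $\pi$ described in the context (with this constant $C$ and with the fixed, sufficiently large constant $N$). Then there is a constant $\Lambda$ depending only on $C,K,\Gamma,\sigma,N,B_1,B_2$ and $d^\ast$ such that for any $\delta\in(0,1)$, with $(\mathbb{P}\otimes\hat\rho_\lambda)$-probability of at least $1-\delta$, $$\mathcal{E}(\hat d_\lambda,\hat\Theta_\lambda,\hat f_\lambda)\leq\Lambda\bigg(\Big(\frac{\log(Cn)}{n}\Big)^{\frac{2\alpha}{2\alpha+d^\ast}}+\frac{\Vert\Theta^\ast\Vert_0\log(pn)}{n}+\frac{\log(\frac{2}{\delta})}{n}\bigg).$$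
   Context: Risks. For $d\in\{1,\dots,p\}$, $\Theta\in\mathbb{R}^{d\times p}$ and measurable $f:\mathbb{R}^d\to\mathbb{R}$: $R(d,\Theta,f)=\mathbb{E}[(Y-f(\Theta\mathbf{X}))^2]$, $R_n(d,\Theta,f)=\frac1n\sum_{i=1}^n(Y_i-f(\Theta\mathbf{X}_i))^2$, and the excess risk is $\mathcal{E}(d,\Theta,f)=R(d,\Theta,f)-\min_{d',\Theta',f'}R(d',\Theta',f')=\mathbb{E}[(f(\Theta\mathbf{X})-F(\mathbf{X}))^2]$. Sparse matrices. $\mathcal{I}_d=\{I=I_1\times\dots\times I_d\neq\emptyset : I_1,\dots,I_d\subseteq\{1,\dots,p\}\}$ and $\Vert I\Vert=\sum_{i=1}^d|I_i|$. For $I\in\mathcal{I}_d$, $\mathcal{S}(I_i)=\{\vartheta\in\mathbb{R}^p:\Vert\vartheta\Vert_2=1,\ \vartheta_j=0\ \forall j\notin I_i\}$, $\mathcal{S}_d(I)$ is the set of matrices $\Theta=(\vartheta_1,\dots,\vartheta_d)^\top\in\mathbb{R}^{d\times p}$ with rows $\vartheta_i\in\mathcal{S}(I_i)$, and $\mathcal{S}_d=\bigcup_{I\in\mathcal{I}_d}\mathcal{S}_d(I)$. For $\Theta^\ast\in\mathcal{S}_{d^\ast}$, $\Vert\Theta^\ast\Vert_0=\Vert I^\ast\Vert$ for the minimal $I^\ast\in\mathcal{I}_{d^\ast}$ with respect to $\Vert\cdot\Vert$ such that $\Theta^\ast\in\mathcal{S}_{d^\ast}(I^\ast)$. Let $\mu_{d,I}$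 be the uniform distribution on $\mathcal{S}_d(I)$ (product of the uniform distributions on the spheres $\mathcal{S}(I_i)$), $\mathcal{I}_{d,i}=\{I\in\mathcal{I}_d:\Vert I\Vert=i\}$, and $$\mu_d=C_{\mu,d}\sum_{i=d}^{dp}10^{-i+d-1}\frac{1}{|\mathcal{I}_{d,i}|}\sum_{I\in\mathcal{I}_{d,i}}\mu_{d,I},\qquad C_{\mu,d}=9\big(1-10^{(1-p)d-1}\big)^{-1}.$$ Link functions. Let $\phi$ and $\psi$ be continuously differentiable, compactly supported (regular Daubechies) scaling and wavelet functions on $\mathbb{R}$; $\psi_0=\phi$, $\psi_1=\psi$. For $M,N$ let $$\mathcal{Z}^d_{M,N}=\{(0,l_2,0): l_2\in\mathbb{Z}^d,\Vert l_2\Vert_\infty\leq N\}\cup\{(l_1,l_2,l_3)\in\mathbb{N}_0\times\mathbb{Z}^d\times\{0,1\}^d: l_1\leq M,\ \Vert l_2\Vert_\infty\leq2^{l_1}N,\ l_3\neq0\},$$ and $\Psi_l(x)=2^{l_1d/2}\prod_{i=1}^d\psi_{l_{3,i}}(2^{l_1}x_i-l_{2,i})$ for $x\in\mathbb{R}^d$; $(\Psi_l)_{l\in\mathcal{Z}^d_{\infty,\infty}}$ is an orthonormal basis of $L^2(\mathbb{R}^d)$. Throughout, a sufficiently large constant $N\in\mathbb{N}_0$ is fixed and $\mathcal{Z}^d_M=\mathcal{Z}^d_{M,N}$. Let $L=\max(\Vert\psi\Vert_\infty,\Vert\phi\Vert_\infty,\Vert\psi'\Vert_\infty,\Vert\phi'\Vert_\infty)$,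 $\Vert\beta\Vert_{\mathcal{B}}=L^d\sum_{l\in\mathcal{Z}^d_M}2^{l_1(d/2+1)}|\beta_l|$ for $\beta\in\mathbb{R}^{\mathcal{Z}^d_M}$, $\mathcal{B}_{d,M}(\xi)=\{\beta\in\mathbb{R}^{\mathcal{Z}^d_M}:\Vert\beta\Vert_{\mathcal{B}}\leq\xi\}$, $\Phi_{d,M}(\beta)=\sum_{l\in\mathcal{Z}^d_M}\beta_l\Psi_l$, $\mathcal{F}_{d,M}(\xi)=\Phi_{d,M}(\mathcal{B}_{d,M}(\xi))$ and $\mathcal{F}_d=\bigcup_{M=0}^n\mathcal{F}_{d,M}(C+1)$. Let $\nu_{d,M}$ be the push-forward under $\Phi_{d,M}$ of the uniform distribution on $\mathcal{B}_{d,M}(C+1)$, and $$\nu_d=C_{\nu,d}\sum_{M=0}^n10^{-M}\nu_{d,M},\qquad C_{\nu,d}=\frac{9}{10-10^{-n}}.$$ Besov ellipsoid. For $\alpha>0$, integrability parameter $q$ and radius $\xi>0$, $$B^\alpha_{q,d^\ast}(\xi)=\Big\{f\in L^2(\mathbb{R}^{d^\ast}):\sum_{l\in\mathcal{Z}^{d^\ast}_{\infty,\infty}}2^{ql_1\alpha}|\langle f,\Psi_l\rangle|^q\leq\xi^q\Big\}.$$ Prior and posterior. With $\delta_d$ the Dirac measure in $d$, the prior on $\bigcup_{d=1}^p\{d\}\times\mathcal{S}_d\times\mathcal{F}_d$ is $$\pi=C_\pi\sum_{d=1}^p10^{-d}\,\delta_d\otimes\mu_d\otimes\nu_d,\qquad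 C_\pi=\frac{9}{1-10^{-p}}.$$ The Gibbs posterior $\hat\rho_\lambda$ is the (data-dependent) probability measure with $\pi$-density proportional to $\exp(-\lambda R_n(d,\Theta,f))$. The notation $\mathbb{P}\otimes\hat\rho_\lambda$ refers to the joint law of the data (under $\mathbb{P}$) and the draw $(\hat d_\lambda,\hat\Theta_\lambda,\hat f_\lambda)$ which, conditionally on the data, has law $\hat\rho_\lambda$. *)

theory Defs
  imports "HOL-Probability.Probability"
begin

text \<open>
  The dimensions \<open>p\<close> and \<open>d\<close> are quantified inside the theorem, so vectors in $\mathbb{R}^m$ are
  extensional functions on \<open>{..<m}\<close>, and real \<open>d \<times> p\<close> matrices are extensional functions on
  \<open>{..<d}\<close> whose values are the rows. Coordinates are indexed from 0.
\<close>

type_synonym rvec = "nat \<Rightarrow> real"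
type_synonym rmat = "nat \<Rightarrow> rvec"

definition vec_space :: "nat \<Rightarrow> rvec measure" where
  "vec_space m = (\<Pi>\<^sub>M i\<in>{..<m}. borel)"

definition leb :: "nat \<Rightarrow> rvec measure" where
  "leb m = (\<Pi>\<^sub>M i\<in>{..<m}. lborel)"

definition mat_space :: "nat \<Rightarrow> nat \<Rightarrow> rmat measure" where
  "mat_space d p = (\<Pi>\<^sub>M i\<in>{..<d}. vec_space p)"

definition mat_vec :: "nat \<Rightarrow> nat \<Rightarrow> rmat \<Rightarrow> rvec \<Rightarrow> rvec" where
  "mat_vec d p \<Theta> x = (\<lambda>i\<in>{..<d}. \<Sum>j<p. \<Theta> i j * x j)"


section \<open>Measure-theoretic preliminaries\<close>

definition uniform_on :: "'a measure \<Rightarrow> 'a set \<Rightarrow> 'a measure" where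
  "uniform_on M A = uniform_measure (restrict_space M A) A"

text \<open>The weighted sum $\sum_{j \in J} w_j\, m_j$ of measures on the measurable space of \<open>N\<close>.\<close>

definition mixture :: "'a measure \<Rightarrow> 'i set \<Rightarrow> ('i \<Rightarrow> real) \<Rightarrow> ('i \<Rightarrow> 'a measure) \<Rightarrow> 'a measure" where
  "mixture N J w m =
     measure_of (space N) (sets N) (\<lambda>A. \<Sum>j\<in>J. ennreal (w j) * emeasure (m j) A)"


section \<open>Risks\<close>

text \<open>
  \<open>P\<close> is the law of the pair of covariate vector and response. The risk is the Lebesgue integral with
  values in \<open>[0, \<infinity>]\<close>, so that a non-integrable loss has infinite risk.
\<close>

definition risk :: "(rvec \<times> real) measure \<Rightarrow> nat \<Rightarrow> nat \<Rightarrow> rmat \<Rightarrow> (rvec \<Rightarrow> real) \<Rightarrow> ennreal" where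
  "risk P p d \<Theta> f = (\<integral>\<^sup>+ (x, y). ennreal ((y - f (mat_vec d p \<Theta> x))\<^sup>2) \<partial>P)"

definition emp_risk ::
  "nat \<Rightarrow> nat \<Rightarrow> (nat \<Rightarrow> rvec \<times> real) \<Rightarrow> nat \<times> rmat \<times> (rvec \<Rightarrow> real) \<Rightarrow> real" where
  "emp_risk n p \<omega> = (\<lambda>(d, \<Theta>, f).
     1 / real n * (\<Sum>i<n. (snd (\<omega> i) - f (mat_vec d p \<Theta> (fst (\<omega> i))))\<^sup>2))"

definition excess_risk ::
  "(rvec \<times> real) measure \<Rightarrow> nat \<Rightarrow> nat \<times> rmat \<times> (rvec \<Rightarrow> real) \<Rightarrow> ennreal" where
  "excess_risk P p = (\<lambda>(d, \<Theta>, f). risk P p d \<Theta> f -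
     (INF (d', \<Theta>', f') \<in> (SIGMA d':{1..p}. space (mat_space d' p) \<times> borel_measurable (vec_space d')).
        risk P p d' \<Theta>' f'))"


section \<open>Sparse matrices and their prior\<close>

definition patterns :: "nat \<Rightarrow> nat \<Rightarrow> (nat \<Rightarrow> nat set) set" where
  "patterns d p = {I \<in> {..<d} \<rightarrow>\<^sub>E Pow {..<p}. PiE {..<d} I \<noteq> {}}"

definition pattern_size :: "nat \<Rightarrow> (nat \<Rightarrow> nat set) \<Rightarrow> nat" where
  "pattern_size d I = (\<Sum>i<d. card (I i))"

definition sparse_sphere :: "nat \<Rightarrow> nat set \<Rightarrow> rvec set" where
  "sparse_sphere p J = {v \<in> {..<p} \<rightarrow>\<^sub>E UNIV. L2_set v {..<p} = 1 \<and> (\<forall>j<p. j \<notin> J \<longrightarrow> v j = 0)}"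

definition sparse_mats_on :: "nat \<Rightarrow> nat \<Rightarrow> (nat \<Rightarrow> nat set) \<Rightarrow> rmat set" where
  "sparse_mats_on d p I = (\<Pi>\<^sub>E i\<in>{..<d}. sparse_sphere p (I i))"

definition sparse_mats :: "nat \<Rightarrow> nat \<Rightarrow> rmat set" where
  "sparse_mats d p = (\<Union>I\<in>patterns d p. sparse_mats_on d p I)"

definition sparsity :: "nat \<Rightarrow> nat \<Rightarrow> rmat \<Rightarrow> nat" where
  "sparsity d p \<Theta> = Min (pattern_size d ` {I \<in> patterns d p. \<Theta> \<in> sparse_mats_on d p I})"

text \<open>
  The uniform distribution (normalised surface measure) on a sphere, realised as the image of the
  uniform distribution on the punctured unit ball of $\mathbb{R}^J$ under \<open>u \<mapsto> u / \<parallel>u\<parallel>\<close>, extended by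
  zero outside \<open>J\<close>. For singleton \<open>J\<close> both points of the sphere get mass 1/2.
\<close>

definition sphere_unif :: "nat \<Rightarrow> nat set \<Rightarrow> rvec measure" where
  "sphere_unif p J =
     distr (uniform_on (\<Pi>\<^sub>M j\<in>J. lborel) {u \<in> J \<rightarrow>\<^sub>E UNIV. 0 < L2_set u J \<and> L2_set u J \<le> 1})
       (restrict_space (vec_space p) (sparse_sphere p J))
       (\<lambda>u. \<lambda>j\<in>{..<p}. if j \<in> J then u j / L2_set u J else 0)"

definition sparse_mat_space :: "nat \<Rightarrow> nat \<Rightarrow> rmat measure" where
  "sparse_mat_space d p = restrict_space (mat_space d p) (sparse_mats d p)"

definition mu_pattern :: "nat \<Rightarrow> nat \<Rightarrow> (nat \<Rightarrow> nat set) \<Rightarrow> rmat measure" where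
  "mu_pattern d p I =
     distr (\<Pi>\<^sub>M i\<in>{..<d}. sphere_unif p (I i)) (sparse_mat_space d p) (\<lambda>\<Theta>. \<Theta>)"

definition patterns_of_size :: "nat \<Rightarrow> nat \<Rightarrow> nat \<Rightarrow> (nat \<Rightarrow> nat set) set" where
  "patterns_of_size d p i = {I \<in> patterns d p. pattern_size d I = i}"

definition mu :: "nat \<Rightarrow> nat \<Rightarrow> rmat measure" where
  "mu d p = mixture (sparse_mat_space d p)
     (SIGMA i:{d..d * p}. patterns_of_size d p i)
     (\<lambda>(i, I). 9 / (1 - 10 powi ((1 - int p) * int d - 1))
        * 10 powi (- int i + int d - 1) / real (card (patterns_of_size d p i)))
     (\<lambda>(i, I). mu_pattern d p I)"


section \<open>Wavelets\<close>

text \<open>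
  Continuously differentiable, compactly supported orthonormal scaling function \<open>\<phi>\<close> and wavelet \<open>\<psi>\<close>
  of a multiresolution analysis, as constructed by Daubechies: \<open>\<phi>\<close> and \<open>\<psi>\<close> satisfy two-scale relations
  with finite filters \<open>h\<close> and \<open>g\<close>, and their integer translates are orthonormal. Sign and
  translation conventions for \<open>\<psi>\<close> are left open.
\<close>

definition wavelet_pair :: "(real \<Rightarrow> real) \<Rightarrow> (real \<Rightarrow> real) \<Rightarrow> bool" where
  "wavelet_pair \<phi> \<psi> \<longleftrightarrow>
     \<phi> C1_differentiable_on UNIV \<and> \<psi> C1_differentiable_on UNIV \<and>
     (\<exists>r. \<forall>x. \<bar>x\<bar> > r \<longrightarrow> \<phi> x = 0 \<and> \<psi> x = 0) \<and>
     (\<exists>(h :: int \<Rightarrow> real) (g :: int \<Rightarrow> real) m. \<forall>x.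
        \<phi> x = sqrt 2 * (\<Sum>k=-m..m. h k * \<phi> (2 * x - of_int k)) \<and>
        \<psi> x = sqrt 2 * (\<Sum>k=-m..m. g k * \<phi> (2 * x - of_int k))) \<and>
     (\<forall>k::int. (LBINT x. \<phi> x * \<phi> (x - of_int k)) = (if k = 0 then 1 else 0)) \<and>
     (\<forall>k::int. (LBINT x. \<psi> x * \<psi> (x - of_int k)) = (if k = 0 then 1 else 0)) \<and>
     (\<forall>k::int. (LBINT x. \<phi> x * \<psi> (x - of_int k)) = 0) \<and>
     (LBINT x. \<phi> x) = 1"

type_synonym windex = "nat \<times> (nat \<Rightarrow> int) \<times> (nat \<Rightarrow> nat)"

definition wavelet_index :: "nat \<Rightarrow> enat \<Rightarrow> enat \<Rightarrow> windex set" where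
  "wavelet_index d M N =
     {(l1, l2, l3). l1 = 0 \<and> l2 \<in> {..<d} \<rightarrow>\<^sub>E UNIV \<and> l3 = (\<lambda>i\<in>{..<d}. 0) \<and>
        (\<forall>i<d. enat (nat \<bar>l2 i\<bar>) \<le> N)} \<union>
     {(l1, l2, l3). enat l1 \<le> M \<and> l2 \<in> {..<d} \<rightarrow>\<^sub>E UNIV \<and> l3 \<in> {..<d} \<rightarrow>\<^sub>E {0, 1} \<and>
        (\<forall>i<d. enat (nat \<bar>l2 i\<bar>) \<le> 2 ^ l1 * N) \<and> l3 \<noteq> (\<lambda>i\<in>{..<d}. 0)}"

definition wavelet :: "(real \<Rightarrow> real) \<Rightarrow> (real \<Rightarrow> real) \<Rightarrow> nat \<Rightarrow> windex \<Rightarrow> rvec \<Rightarrow> real" where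
  "wavelet \<phi> \<psi> d = (\<lambda>(l1, l2, l3) x. 2 powr (real l1 * real d / 2) *
     (\<Prod>i<d. (if l3 i = 0 then \<phi> else \<psi>) (2 ^ l1 * x i - of_int (l2 i))))"

definition sup_norm :: "(real \<Rightarrow> real) \<Rightarrow> real" where
  "sup_norm f = (SUP x. \<bar>f x\<bar>)"

definition wavelet_bound :: "(real \<Rightarrow> real) \<Rightarrow> (real \<Rightarrow> real) \<Rightarrow> real" where
  "wavelet_bound \<phi> \<psi> = Max {sup_norm \<psi>, sup_norm \<phi>, sup_norm (deriv \<psi>), sup_norm (deriv \<phi>)}"

definition besov_ellipsoid ::
  "(real \<Rightarrow> real) \<Rightarrow> (real \<Rightarrow> real) \<Rightarrow> real \<Rightarrow> real \<Rightarrow> nat \<Rightarrow> real \<Rightarrow> (rvec \<Rightarrow> real) set" where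
  "besov_ellipsoid \<phi> \<psi> \<alpha> q d \<xi> =
     {f \<in> borel_measurable (leb d). integrable (leb d) (\<lambda>x. (f x)\<^sup>2) \<and>
        (let t = (\<lambda>l. 2 powr (q * real (fst l) * \<alpha>) *
                      \<bar>\<integral>x. f x * wavelet \<phi> \<psi> d l x \<partial>leb d\<bar> powr q)
         in t summable_on wavelet_index d \<infinity> \<infinity> \<and>
            (\<Sum>\<^sub>\<infinity>l\<in>wavelet_index d \<infinity> \<infinity>. t l) \<le> \<xi> powr q)}"


section \<open>Link functions and their prior\<close>

definition coeff_norm ::
  "(real \<Rightarrow> real) \<Rightarrow> (real \<Rightarrow> real) \<Rightarrow> nat \<Rightarrow> nat \<Rightarrow> nat \<Rightarrow> (windex \<Rightarrow> real) \<Rightarrow> real" where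
  "coeff_norm \<phi> \<psi> N d M \<beta> = wavelet_bound \<phi> \<psi> ^ d *
     (\<Sum>l\<in>wavelet_index d M N. 2 powr (real (fst l) * (real d / 2 + 1)) * \<bar>\<beta> l\<bar>)"

definition coeff_ball ::
  "(real \<Rightarrow> real) \<Rightarrow> (real \<Rightarrow> real) \<Rightarrow> nat \<Rightarrow> nat \<Rightarrow> nat \<Rightarrow> real \<Rightarrow> (windex \<Rightarrow> real) set" where
  "coeff_ball \<phi> \<psi> N d M \<xi> =
     {\<beta> \<in> wavelet_index d M N \<rightarrow>\<^sub>E UNIV. coeff_norm \<phi> \<psi> N d M \<beta> \<le> \<xi>}"

definition expansion ::
  "(real \<Rightarrow> real) \<Rightarrow> (real \<Rightarrow> real) \<Rightarrow> nat \<Rightarrow> nat \<Rightarrow> nat \<Rightarrow> (windex \<Rightarrow> real) \<Rightarrow> rvec \<Rightarrow> real" where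
  "expansion \<phi> \<psi> N d M \<beta> =
     (\<lambda>x\<in>space (vec_space d). \<Sum>l\<in>wavelet_index d M N. \<beta> l * wavelet \<phi> \<psi> d l x)"

definition links ::
  "(real \<Rightarrow> real) \<Rightarrow> (real \<Rightarrow> real) \<Rightarrow> nat \<Rightarrow> nat \<Rightarrow> real \<Rightarrow> nat \<Rightarrow> (rvec \<Rightarrow> real) set" where
  "links \<phi> \<psi> N n C d = (\<Union>M\<in>{0..n}. expansion \<phi> \<psi> N d M ` coeff_ball \<phi> \<psi> N d M (C + 1))"

text \<open>
  The \<open>\<sigma>\<close>-algebra on the link functions is generated by the point evaluations. Since the link
  functions are continuous and vanish outside a common compact set, it is the Borel
  \<open>\<sigma>\<close>-algebra of the supremum norm.
\<close>

definition link_space ::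
  "(real \<Rightarrow> real) \<Rightarrow> (real \<Rightarrow> real) \<Rightarrow> nat \<Rightarrow> nat \<Rightarrow> real \<Rightarrow> nat \<Rightarrow> (rvec \<Rightarrow> real) measure" where
  "link_space \<phi> \<psi> N n C d =
     restrict_space (\<Pi>\<^sub>M x\<in>space (vec_space d). borel) (links \<phi> \<psi> N n C d)"

definition nu_level ::
  "(real \<Rightarrow> real) \<Rightarrow> (real \<Rightarrow> real) \<Rightarrow> nat \<Rightarrow> nat \<Rightarrow> real \<Rightarrow> nat \<Rightarrow> nat \<Rightarrow> (rvec \<Rightarrow> real) measure" where
  "nu_level \<phi> \<psi> N n C d M =
     distr (uniform_on (\<Pi>\<^sub>M l\<in>wavelet_index d M N. lborel) (coeff_ball \<phi> \<psi> N d M (C + 1)))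
       (link_space \<phi> \<psi> N n C d) (expansion \<phi> \<psi> N d M)"

definition nu ::
  "(real \<Rightarrow> real) \<Rightarrow> (real \<Rightarrow> real) \<Rightarrow> nat \<Rightarrow> nat \<Rightarrow> real \<Rightarrow> nat \<Rightarrow> (rvec \<Rightarrow> real) measure" where
  "nu \<phi> \<psi> N n C d = mixture (link_space \<phi> \<psi> N n C d) {0..n}
     (\<lambda>M. 9 / (10 - 10 powi (- int n)) * 10 powi (- int M)) (nu_level \<phi> \<psi> N n C d)"


section \<open>Prior, Gibbs posterior and the joint law\<close>

text \<open>
  The parameter space is the disjoint union over \<open>d\<close> of products of a matrix space and a link
  function space, with the \<open>\<sigma>\<close>-algebra of the disjoint union; \<open>distr _ _ (Pair d)\<close> forms the
  product with the Dirac measure in \<open>d\<close>.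
\<close>

definition param_space ::
  "(real \<Rightarrow> real) \<Rightarrow> (real \<Rightarrow> real) \<Rightarrow> nat \<Rightarrow> nat \<Rightarrow> real \<Rightarrow> nat
     \<Rightarrow> (nat \<times> rmat \<times> (rvec \<Rightarrow> real)) measure" where
  "param_space \<phi> \<psi> N n C p =
     (let \<Omega> = (SIGMA d:{1..p}. sparse_mats d p \<times> links \<phi> \<psi> N n C d)
      in sigma \<Omega> {A. A \<subseteq> \<Omega> \<and>
           (\<forall>d\<in>{1..p}. Pair d -` A \<in> sets (sparse_mat_space d p \<Otimes>\<^sub>M link_space \<phi> \<psi> N n C d))})"

definition prior ::
  "(real \<Rightarrow> real) \<Rightarrow> (real \<Rightarrow> real) \<Rightarrow> nat \<Rightarrow> nat \<Rightarrow> real \<Rightarrow> nat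
     \<Rightarrow> (nat \<times> rmat \<times> (rvec \<Rightarrow> real)) measure" where
  "prior \<phi> \<psi> N n C p = mixture (param_space \<phi> \<psi> N n C p) {1..p}
     (\<lambda>d. 9 / (1 - 10 powi (- int p)) * 10 powi (- int d))
     (\<lambda>d. distr (mu d p \<Otimes>\<^sub>M nu \<phi> \<psi> N n C d) (param_space \<phi> \<psi> N n C p) (Pair d))"

definition gibbs ::
  "(nat \<times> rmat \<times> (rvec \<Rightarrow> real)) measure \<Rightarrow> real \<Rightarrow> nat \<Rightarrow> nat \<Rightarrow> (nat \<Rightarrow> rvec \<times> real)
     \<Rightarrow> (nat \<times> rmat \<times> (rvec \<Rightarrow> real)) measure" where
  "gibbs \<pi> lam n p \<omega> = density \<pi> (\<lambda>\<theta>. ennreal (exp (- lam * emp_risk n p \<omega> \<theta>) /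
     (\<integral>\<theta>'. exp (- lam * emp_risk n p \<omega> \<theta>') \<partial>\<pi>)))"

text \<open>
  The law of \<open>n\<close> independent observations with law \<open>P\<close> together with a draw which, given the
  observations, follows the Gibbs posterior.
\<close>

definition sample_law :: "(rvec \<times> real) measure \<Rightarrow> nat \<Rightarrow> (nat \<Rightarrow> rvec \<times> real) measure" where
  "sample_law P n = (\<Pi>\<^sub>M i\<in>{..<n}. P)"

definition joint_law ::
  "(nat \<times> rmat \<times> (rvec \<Rightarrow> real)) measure \<Rightarrow> real \<Rightarrow> (rvec \<times> real) measure \<Rightarrow> nat \<Rightarrow> nat
     \<Rightarrow> ((nat \<Rightarrow> rvec \<times> real) \<times> (nat \<times> rmat \<times> (rvec \<Rightarrow> real))) measure" where
  "joint_law \<pi> lam P n p =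
     sample_law P n \<bind> (\<lambda>\<omega>. distr (gibbs \<pi> lam n p \<omega>) (sample_law P n \<Otimes>\<^sub>M \<pi>) (Pair \<omega>))"


section \<open>The multi-index regression model\<close>

definition covariate_algebra :: "(rvec \<times> real) measure \<Rightarrow> nat \<Rightarrow> (rvec \<times> real) measure" where
  "covariate_algebra P p = vimage_algebra (space P) fst (vec_space p)"

text \<open>
  \<open>F\<close> is a version of the conditional expectation of the response given the covariates.
\<close>

definition regression_model :: "(rvec \<times> real) measure \<Rightarrow> nat \<Rightarrow> (rvec \<Rightarrow> real) \<Rightarrow> bool" where
  "regression_model P p F \<longleftrightarrow>
     prob_space P \<and> sets P = sets (vec_space p \<Otimes>\<^sub>M borel) \<and> integrable P snd \<and>
     F \<in> borel_measurable (vec_space p) \<and>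
     (AE z in P. real_cond_exp P (covariate_algebra P p) snd z = F (fst z))"

text \<open>
  The conditional moments are taken in \<open>[0, \<infinity>]\<close>, so the bounds include their finiteness.
\<close>

definition bernstein_noise ::
  "(rvec \<times> real) measure \<Rightarrow> nat \<Rightarrow> (rvec \<Rightarrow> real) \<Rightarrow> real \<Rightarrow> real \<Rightarrow> bool" where
  "bernstein_noise P p F \<sigma> \<Gamma> \<longleftrightarrow>
     (\<forall>k\<ge>2. AE z in P.
        nn_cond_exp P (covariate_algebra P p) (\<lambda>(x, y). ennreal (\<bar>y - F x\<bar> ^ k)) z
          \<le> ennreal (fact k / 2 * \<sigma>\<^sup>2 * \<Gamma> ^ (k - 2)))"

end

theory Submission
  imports Defs "HOL-Real_Asymp.Real_Asymp"
begin

text \<open>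
  The argument compares the posterior with the prior on a small neighbourhood of an approximate
  truth. Let \<open>E \<theta>\<close> be the mean squared distance between \<open>F\<close> and the regression function given by the
  parameter \<open>\<theta>\<close>, and \<open>G \<theta>\<close> the difference between the empirical risks of \<open>\<theta>\<close> and of \<open>F\<close>. Bernstein's
  moment condition and the size of \<open>lam\<close> give, for every fixed \<open>\<theta>\<close>, the two bounds
  \<open>exp (- lam G) \<le> exp (- lam E / 2)\<close> and \<open>exp (lam G) \<le> exp (2 lam E)\<close>, both for expectations on the left
  (\<open>loss_gap_exponential_moments\<close>).

  With the random normaliser \<open>D = \<integral> exp (- lam G) d\<pi>\<close>, Fubini turns the first bound into
  \<open>\<integral> exp (lam E / 2) D \<le> 1\<close> for the joint law of sample and draw. Restricting the integral in \<open>D\<close> to a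
  set \<open>A\<close> on which \<open>E \<le> t\<close> and using that the reciprocal is convex, the second bound gives
  \<open>\<integral> 1 / D \<le> exp (2 lam t) / \<pi> A\<close>. The geometric mean of the two integrands is \<open>exp (lam E / 4)\<close>, so
  Markov's inequality bounds \<open>E\<close>, with probability \<open>1 - \<delta>\<close>, by
  \<open>4 t + (2 log (1 / \<pi> A) + 4 log (1 / \<delta>)) / lam\<close> (\<open>pac_bayes\<close>). It remains to find \<open>A\<close> with small \<open>t\<close>
  and large prior mass.

  Take for \<open>A\<close> the parameters with \<open>E\<close> at most the value reached near \<open>(d, \<Theta>, f_M)\<close>, where \<open>f_M\<close> is the
  wavelet sum of \<open>f\<close> up to level \<open>M\<close>, truncated to translations reaching slightly beyond the support
  of the index. Its coefficients lie in the prior's coefficient ball: this is Cauchy-Schwarz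
  against the Besov norm, with \<open>\<alpha> > 2 + d\<close> making the dual series geometric (\<open>coeff_norm_le\<close>). The
  squared bias is at most \<open>B2 \<xi>\<^sup>2 2^(- 2 M \<alpha>)\<close> (\<open>trunc_error\<close>). The prior charges the neighbourhood by
  at least a product of ratios of box volumes: inside each Euclidean or weighted \<open>l1\<close>-ball, a
  box around the target is compared with a box around the ball (\<open>uniform_on_box\<close>, \<open>mu_cap\<close>,
  \<open>prior_near\<close>). The cost is of order \<open>\<parallel>\<Theta>\<parallel>\<^sub>0 log (p n)\<close> for the matrix and \<open>2^(M d) log n\<close> for the coefficients; balancing the
  latter divided by \<open>n\<close> against the bias fixes \<open>M\<close> (\<open>resolution_level\<close>, \<open>rate_bound\<close>).

  The bias bound presupposes that \<open>f\<close> equals its wavelet series on the box carrying the index, that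
  is, completeness of the wavelets. It follows from the two-scale equations. The functions
  \<open>sqrt 2 \<phi>(2 x - k)\<close> lie in the span of the integer translates of \<open>\<phi>\<close> and \<open>\<psi>\<close>, since their squared
  distances to it are nonnegative and add up to zero over two consecutive \<open>k\<close> (\<open>synthesis\<close>). Hence the
  residual of the series is orthogonal to all fine-scale translates of \<open>\<phi>\<close> near the box. Sums of
  these converge to indicators of boxes because the translates of \<open>\<phi>\<close> add up to one
  (\<open>partition_of_unity\<close>), so the residual vanishes almost everywhere on the box (\<open>link_eq_limit\<close>).

  The threshold \<open>N0\<close> dominates the bound on the index plus the support radius of the wavelets, so
  that no relevant translation is cut off, and \<open>1 / wavelet_bound\<close>, so that the constant in the rate
  can be expressed through \<open>N\<close>.
\<close>

section \<open>Two-scale equations in one dimension\<close>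

lemma continuous_compact_support_integrable:
  fixes u :: "real \<Rightarrow> real"
  assumes "continuous_on UNIV u" "\<And>x. \<bar>x\<bar> > r \<Longrightarrow> u x = 0"
  shows "integrable lborel u"
proof -
  have "integrable lborel (\<lambda>x. indicator {-r..r} x *\<^sub>R u x)"
    by (rule borel_integrable_compact) (auto intro: continuous_on_subset[OF assms(1)])
  also have "(\<lambda>x. indicator {-r..r} x *\<^sub>R u x) = u"
    by (intro ext) (use assms(2) in \<open>force simp: indicator_def\<close>)
  finally show ?thesis .
qed

text \<open>
  Bessel's identity; it measures the distance of \<open>v\<close> to the span of the \<open>b i\<close>.
\<close>

lemma integral_sum_orthonormal:
  fixes v :: "'a \<Rightarrow> real" and b :: "'i \<Rightarrow> 'a \<Rightarrow> real"
  assumes S: "finite S"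
    and v: "integrable M (\<lambda>x. v x * v x)" "\<And>i. i \<in> S \<Longrightarrow> integrable M (\<lambda>x. v x * b i x)"
    and b: "\<And>i j. i \<in> S \<Longrightarrow> j \<in> S \<Longrightarrow> integrable M (\<lambda>x. b i x * b j x)"
    and orth: "\<And>i j. i \<in> S \<Longrightarrow> j \<in> S \<Longrightarrow> (\<integral>x. b i x * b j x \<partial>M) = (if i = j then 1 else 0)"
    and c: "\<And>i. i \<in> S \<Longrightarrow> (\<integral>x. v x * b i x \<partial>M) = c i"
  shows "(\<integral>x. (v x - (\<Sum>i\<in>S. c i * b i x))\<^sup>2 \<partial>M) = (\<integral>x. v x * v x \<partial>M) - (\<Sum>i\<in>S. (c i)\<^sup>2)"
proof -
  have eq: "(v x - (\<Sum>i\<in>S. c i * b i x))\<^sup>2 = v x * v x - 2 * (\<Sum>i\<in>S. c i * (v x * b i x))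
      + (\<Sum>i\<in>S. \<Sum>j\<in>S. c i * c j * (b i x * b j x))" for x
    by (simp add: power2_eq_square algebra_simps sum_distrib_left sum_distrib_right)
  have "(\<integral>x. (v x - (\<Sum>i\<in>S. c i * b i x))\<^sup>2 \<partial>M) = (\<integral>x. v x * v x \<partial>M)
      - 2 * (\<Sum>i\<in>S. c i * (\<integral>x. v x * b i x \<partial>M))
      + (\<Sum>i\<in>S. \<Sum>j\<in>S. c i * c j * (\<integral>x. b i x * b j x \<partial>M))"
    unfolding eq using v b
    by (subst Bochner_Integration.integral_add Bochner_Integration.integral_diff
        Bochner_Integration.integral_sum; auto intro!: Bochner_Integration.integrable_sum
        Bochner_Integration.integrable_diff sum.cong simp: Bochner_Integration.integral_sum)+
  also have "(\<Sum>i\<in>S. c i * (\<integral>x. v x * b i x \<partial>M)) = (\<Sum>i\<in>S. (c i)\<^sup>2)"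
    by (intro sum.cong) (auto simp: c power2_eq_square)
  also have "(\<Sum>i\<in>S. \<Sum>j\<in>S. c i * c j * (\<integral>x. b i x * b j x \<partial>M)) = (\<Sum>i\<in>S. (c i)\<^sup>2)"
    using S by (intro sum.cong) (auto simp: orth power2_eq_square sum.If_cases if_distrib cong: if_cong)
  finally show ?thesis by simp
qed

text \<open>
  A point where \<open>u\<close> does not vanish would have a neighbourhood of positive measure, so for continuous
  functions distance zero in mean square gives equality at every point.
\<close>

lemma continuous_square_integral_0:
  fixes u :: "real \<Rightarrow> real"
  assumes u: "continuous_on UNIV u" "integrable lborel (\<lambda>x. (u x)\<^sup>2)" "(LBINT x. (u x)\<^sup>2) = 0"
  shows "u x = 0"
proof -
  have "AE x in lborel. (u x)\<^sup>2 = 0"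
    using integral_nonneg_eq_0_iff_AE[OF u(2)] u(3) by auto
  then have ae: "AE x in lborel. x \<in> u -` {0}" by auto
  have "closed (u -` {0})"
    using continuous_closed_vimage[of "{0}" u] u(1) by (auto simp: continuous_on_eq_continuous_at)
  then have "u -` {0} = UNIV"
    using mem_closed_if_AE_lebesgue[OF _ AE_completion[OF ae]] by blast
  then show ?thesis by auto
qed

text \<open>
  One integer \<open>m\<close> bounds both the supports of \<open>\<phi>\<close> and \<open>\<psi>\<close> and the lengths of the filters, so that a single
  parameter controls how far translations spread when a level is refined.
\<close>

locale two_scale_pair =
  fixes \<phi> \<psi> :: "real \<Rightarrow> real" and h g :: "int \<Rightarrow> real" and m :: int
  assumes C1: "\<phi> C1_differentiable_on UNIV" "\<psi> C1_differentiable_on UNIV"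
    and supp: "\<And>x. \<bar>x\<bar> > of_int m \<Longrightarrow> \<phi> x = 0" "\<And>x. \<bar>x\<bar> > of_int m \<Longrightarrow> \<psi> x = 0"
    and taps: "\<And>k. \<bar>k\<bar> > m \<Longrightarrow> h k = 0" "\<And>k. \<bar>k\<bar> > m \<Longrightarrow> g k = 0"
    and m_pos: "m \<ge> 1"
    and two_scale: "\<And>x. \<phi> x = sqrt 2 * (\<Sum>k=-m..m. h k * \<phi> (2 * x - of_int k))"
       "\<And>x. \<psi> x = sqrt 2 * (\<Sum>k=-m..m. g k * \<phi> (2 * x - of_int k))"
    and orth: "\<And>k::int. (LBINT x. \<phi> x * \<phi> (x - of_int k)) = (if k = 0 then 1 else 0)"
       "\<And>k::int. (LBINT x. \<psi> x * \<psi> (x - of_int k)) = (if k = 0 then 1 else 0)"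
       "\<And>k::int. (LBINT x. \<phi> x * \<psi> (x - of_int k)) = 0"
    and int_phi: "(LBINT x. \<phi> x) = 1"

lemma wavelet_pair_two_scale:
  assumes "wavelet_pair \<phi> \<psi>"
  obtains h g m where "two_scale_pair \<phi> \<psi> h g m"
proof -
  obtain r h g m where r: "\<And>x. \<bar>x\<bar> > r \<Longrightarrow> \<phi> x = 0 \<and> \<psi> x = 0"
    and ts: "\<And>x. \<phi> x = sqrt 2 * (\<Sum>k=-m..m. h k * \<phi> (2 * x - of_int k))"
            "\<And>x. \<psi> x = sqrt 2 * (\<Sum>k=-m..m. g k * \<phi> (2 * x - of_int k))"
    using assms unfolding wavelet_pair_def by blast
  define m' where "m' = max 1 (max m \<lceil>r\<rceil>)"
  define h' where "h' k = (if \<bar>k\<bar> \<le> m then h k else 0)" for k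
  define g' where "g' k = (if \<bar>k\<bar> \<le> m then g k else 0)" for k
  have eq: "(\<Sum>k=-m'..m'. (if \<bar>k\<bar> \<le> m then h k else 0) * \<phi> (2 * x - of_int k))
      = (\<Sum>k=-m..m. h k * \<phi> (2 * x - of_int k))" for h x
    by (rule sum.mono_neutral_cong_right) (auto simp: m'_def)
  have m'r: "r \<le> of_int m'" unfolding m'_def
    by (metis (no_types, opaque_lifting) ceiling_le_iff max.cobounded2 max.coboundedI2)
  have "two_scale_pair \<phi> \<psi> h' g' m'"
  proof
    fix x show "\<phi> x = sqrt 2 * (\<Sum>k=-m'..m'. h' k * \<phi> (2 * x - of_int k))"
      "\<psi> x = sqrt 2 * (\<Sum>k=-m'..m'. g' k * \<phi> (2 * x - of_int k))"
      unfolding h'_def g'_def eq by (rule ts)+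
    show "\<phi> x = 0" if "\<bar>x\<bar> > of_int m'" using r[of x] that m'r by simp
    show "\<psi> x = 0" if "\<bar>x\<bar> > of_int m'" using r[of x] that m'r by simp
  qed (use assms in \<open>auto simp: wavelet_pair_def h'_def g'_def m'_def\<close>)
  then show ?thesis by (rule that)
qed

context two_scale_pair begin

text \<open>
  The binary digit \<open>t\<close> selects the scaling function or the wavelet, as the entries of the third component of a
  wavelet index do; any nonzero \<open>t\<close> stands for the wavelet.
\<close>

definition gen :: "nat \<Rightarrow> real \<Rightarrow> real" where "gen t = (if t = 0 then \<phi> else \<psi>)"
definition tap :: "nat \<Rightarrow> int \<Rightarrow> real" where "tap t = (if t = 0 then h else g)"

lemma gen_simps: "gen 0 = \<phi>" "gen (Suc 0) = \<psi>" by (auto simp: gen_def)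

lemma gen_supp: "\<bar>x\<bar> > of_int m \<Longrightarrow> gen t x = 0"
  by (auto simp: gen_def supp)

lemma tap_supp: "\<bar>k\<bar> > m \<Longrightarrow> tap t k = 0"
  by (auto simp: tap_def taps)

lemma gen_two_scale: "gen t x = sqrt 2 * (\<Sum>k=-m..m. tap t k * \<phi> (2 * x - of_int k))"
  by (cases "t = 0", simp_all only: gen_def tap_def if_True if_False simp_thms) (rule two_scale)+

lemma gen_cont: "continuous_on UNIV (gen t)"
  using C1 by (auto simp: gen_def intro: C1_differentiable_imp_continuous_on)

lemma gen_continuous_intro [continuous_intros]:
  "continuous_on A u \<Longrightarrow> continuous_on A (\<lambda>x. gen t (u x))"
  by (rule continuous_on_compose2[OF gen_cont]) auto

lemma phi_continuous_intro [continuous_intros]: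
  "continuous_on A u \<Longrightarrow> continuous_on A (\<lambda>x. \<phi> (u x))"
  using gen_continuous_intro[of A u 0] by (simp add: gen_simps)

lemma gen_measurable [measurable]: "gen t \<in> borel_measurable borel"
  by (rule borel_measurable_continuous_onI[OF gen_cont])

lemma gen_affine_integrable:
  assumes "c \<noteq> 0" and "continuous_on UNIV u"
  shows "integrable lborel (\<lambda>x. gen t (c * x - b) * u x)"
proof (rule continuous_compact_support_integrable[where r = "(of_int m + \<bar>b\<bar>) / \<bar>c\<bar>"])
  fix x assume "(of_int m + \<bar>b\<bar>) / \<bar>c\<bar> < \<bar>x\<bar>"
  then have "of_int m + \<bar>b\<bar> < \<bar>c * x\<bar>" using assms by (simp add: field_simps abs_mult)
  then show "gen t (c * x - b) * u x = 0" by (subst gen_supp) auto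
qed (intro continuous_intros assms)

lemma gen_orth:
  assumes "s \<in> {0,1}" "t \<in> {0,1}"
  shows "(LBINT x. gen s (x - of_int a) * gen t (x - of_int b)) = (if s = t \<and> a = b then 1 else 0)"
proof -
  have *: "(LBINT x. u (x - of_int a) * v (x - of_int b)) = (LBINT x. u x * v (x - of_int (b - a)))"
    for u v :: "real \<Rightarrow> real" and a b :: int
    by (subst lborel_integral_real_affine[where c = 1 and t = "of_int a"]) (auto simp: algebra_simps)
  have "(LBINT x. \<psi> (x - of_int a) * \<phi> (x - of_int b)) = (LBINT x. \<phi> (x - of_int b) * \<psi> (x - of_int a))"
    by (simp add: mult.commute)
  then show ?thesis using assms orth[of "b - a"] orth[of "a - b"]
    by (auto simp: * gen_def)
qed

lemma dilated_phi_orth: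
  "(LBINT x. (sqrt 2 * \<phi> (2 * x - of_int a)) * (sqrt 2 * \<phi> (2 * x - of_int b))) = (if a = b then 1 else 0)"
proof -
  have "(if a = b then 1 else 0) = (LBINT x. \<phi> (x - of_int a) * \<phi> (x - of_int b))"
    using gen_orth[of 0 0 a b] by (simp add: gen_simps)
  also have "\<dots> = (LBINT x. 2 * (\<phi> (2 * x - of_int a) * \<phi> (2 * x - of_int b)))"
    by (subst lborel_integral_real_affine[where c = 2 and t = 0]) auto
  also have "\<dots> = (LBINT x. (sqrt 2 * \<phi> (2 * x - of_int a)) * (sqrt 2 * \<phi> (2 * x - of_int b)))"
    by (intro arg_cong[where f = "integral\<^sup>L lborel"] ext) simp
  finally show ?thesis by simp
qed

text \<open>
  Expanding \<open>gen t\<close> by its two-scale equation leaves one orthonormal term, so the filter consists of the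
  inner products with the next finer level.
\<close>

lemma phi_gen_inner:
  "(LBINT x. (sqrt 2 * \<phi> (2 * x - of_int k)) * gen t (x - of_int n)) = tap t (k - 2 * n)"
proof -
  have "(LBINT x. (sqrt 2 * \<phi> (2 * x - of_int k)) * gen t (x - of_int n)) =
      (LBINT x. (\<Sum>j=-m..m. tap t j * ((sqrt 2 * \<phi> (2 * x - of_int k)) * (sqrt 2 * \<phi> (2 * x - of_int (2 * n + j))))))"
  proof (intro arg_cong[where f = "integral\<^sup>L lborel"] ext)
    fix x :: real
    have arg: "2 * (x - of_int n) - of_int j = 2 * x - of_int (2 * n + j)" for j by simp
    show "(sqrt 2 * \<phi> (2 * x - of_int k)) * gen t (x - of_int n) =
      (\<Sum>j=-m..m. tap t j * ((sqrt 2 * \<phi> (2 * x - of_int k)) * (sqrt 2 * \<phi> (2 * x - of_int (2 * n + j)))))"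
      unfolding gen_two_scale[of t "x - of_int n"] sum_distrib_left arg
      by (intro sum.cong refl) (simp only: mult_ac)
  qed
  also have "\<dots> = (\<Sum>j=-m..m. tap t j * (if k = 2 * n + j then 1 else 0))"
  proof (subst Bochner_Integration.integral_sum)
    fix j
    have "integrable lborel (\<lambda>x. gen 0 (2 * x - of_int k) * (2 * \<phi> (2 * x - of_int (2 * n + j))))"
      by (rule gen_affine_integrable) (auto intro!: continuous_intros)
    then have "integrable lborel (\<lambda>x. ((sqrt 2 * \<phi> (2 * x - of_int k)) * (sqrt 2 * \<phi> (2 * x - of_int (2 * n + j)))))"
      by (rule Bochner_Integration.integrable_cong[THEN iffD1, rotated -1]) (auto simp: gen_simps algebra_simps)
    then show "integrable lborel (\<lambda>x. tap t j * ((sqrt 2 * \<phi> (2 * x - of_int k)) * (sqrt 2 * \<phi> (2 * x - of_int (2 * n + j)))))"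
      by (rule integrable_mult_right)
  next
    show "(\<Sum>j=-m..m. LBINT x. tap t j * (sqrt 2 * \<phi> (2 * x - of_int k) * (sqrt 2 * \<phi> (2 * x - of_int (2 * n + j))))) =
     (\<Sum>j=-m..m. tap t j * (if k = 2 * n + j then 1 else 0))"
      by (simp only: integral_mult_right_zero dilated_phi_orth)
  qed
  also have "\<dots> = (\<Sum>j=-m..m. if j = k - 2 * n then tap t j else 0)"
    by (intro sum.cong) auto
  also have "\<dots> = tap t (k - 2 * n)"
    using tap_supp[of "k - 2 * n" t] by auto
  finally show ?thesis .
qed

lemma tap_square_sum:
  assumes "t \<in> {0,1}" shows "(\<Sum>j=-m..m. (tap t j)\<^sup>2) = 1"
proof -
  have "1 = (LBINT x. gen t x * gen t x)"
    using gen_orth[of t t 0 0] assms by simp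
  also have "\<dots> = (LBINT x. (\<Sum>j=-m..m. tap t j * ((sqrt 2 * \<phi> (2 * x - of_int j)) * gen t x)))"
  proof (intro arg_cong[where f = "integral\<^sup>L lborel"] ext)
    fix x
    show "gen t x * gen t x = (\<Sum>j=-m..m. tap t j * ((sqrt 2 * \<phi> (2 * x - of_int j)) * gen t x))"
      using arg_cong[OF gen_two_scale[of t x], of "\<lambda>y. y * gen t x"]
      unfolding sum_distrib_left sum_distrib_right by (simp only: mult_ac)
  qed
  also have "\<dots> = (\<Sum>j=-m..m. (tap t j)\<^sup>2)"
  proof (subst Bochner_Integration.integral_sum)
    fix j
    have "integrable lborel (\<lambda>x. gen 0 (2 * x - of_int j) * (tap t j * sqrt 2 * gen t x))"
      by (rule gen_affine_integrable) (auto intro!: continuous_intros gen_cont)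
    then show "integrable lborel (\<lambda>x. tap t j * ((sqrt 2 * \<phi> (2 * x - of_int j)) * gen t x))"
      by (rule Bochner_Integration.integrable_cong[THEN iffD1, rotated -1]) (auto simp: gen_simps algebra_simps)
  next
    have "(LBINT x. sqrt 2 * \<phi> (2 * x - of_int j) * gen t x) = tap t j" for j
      using phi_gen_inner[of j t 0] by simp
    then show "(\<Sum>j=-m..m. LBINT x. tap t j * (sqrt 2 * \<phi> (2 * x - of_int j) * gen t x)) = (\<Sum>j=-m..m. (tap t j)\<^sup>2)"
      by (simp only: integral_mult_right_zero power2_eq_square)
  qed
  finally show ?thesis by simp
qed

text \<open>
  The translations \<open>n\<close> on the coarse level for which \<open>tap t (k - 2 * n)\<close> can be nonzero.
\<close>

definition parents :: "int \<Rightarrow> int set" where "parents k = {n. \<bar>k - 2 * n\<bar> \<le> m}"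

lemma finite_parents [simp, intro]: "finite (parents k)"
proof (rule finite_subset)
  show "parents k \<subseteq> (\<lambda>j. (k - j) div 2) ` {-m..m}"
  proof
    fix n assume "n \<in> parents k"
    then have "k - 2 * n \<in> {-m..m}" by (simp add: parents_def abs_le_iff)
    moreover have "n = (k - (k - 2 * n)) div 2" by simp
    ultimately show "n \<in> (\<lambda>j. (k - j) div 2) ` {-m..m}" by (rule rev_image_eqI)
  qed
qed simp

text \<open>
  The refinement step runs backwards: a fine scaling function is a combination of coarse scaling
  functions and wavelets. By Bessel's identity the squared distance \<open>q k\<close> to the span of the coarse
  functions is one minus a sum of squared taps. The taps reached from \<open>k\<close> and those reached from \<open>k + 1\<close>
  have opposite parity and together form both filters, each of norm one. Hence \<open>q k + q (k + 1) = 2 - 2\<close>,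
  and both distances vanish.
\<close>

lemma synthesis:
  "sqrt 2 * \<phi> (2 * x - of_int k) = (\<Sum>t\<in>{0,1}. \<Sum>n\<in>parents k. tap t (k - 2 * n) * gen t (x - of_int n))"
proof -
  define D where "D k x = sqrt 2 * \<phi> (2 * x - of_int k)
      - (\<Sum>(t,n)\<in>{0,1::nat}\<times>parents k. tap t (k - 2 * n) * gen t (x - of_int n))" for k x
  define q where "q k = (LBINT x. (D k x)\<^sup>2)" for k
  have D_cont: "continuous_on UNIV (\<lambda>x. D k x)" for k
    unfolding D_def case_prod_beta by (intro continuous_on_diff continuous_on_mult continuous_on_const
      continuous_on_sum gen_continuous_intro phi_continuous_intro continuous_on_id)
  have D_int: "integrable lborel (\<lambda>x. (D k x)\<^sup>2)" for k
  proof (rule continuous_compact_support_integrable[where r = "2 * of_int m + of_int \<bar>k\<bar>"])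
    fix x :: real assume x: "2 * of_int m + of_int \<bar>k\<bar> < \<bar>x\<bar>"
    have "gen t (x - of_int n) = 0" if "n \<in> parents k" for t n
    proof (rule gen_supp)
      have "\<bar>k - 2 * n\<bar> \<le> m" using that by (simp add: parents_def)
      then have "\<bar>2 * n\<bar> \<le> \<bar>k\<bar> + m" by linarith
      then have "2 * \<bar>n\<bar> \<le> \<bar>k\<bar> + m" by linarith
      then have "2 * of_int \<bar>n\<bar> \<le> (of_int \<bar>k\<bar> + of_int m :: real)" by linarith
      then have "2 * \<bar>of_int n :: real\<bar> \<le> of_int \<bar>k\<bar> + of_int m" by simp
      moreover have "(of_int m :: real) \<ge> 1" using m_pos by simp
      ultimately show "of_int m < \<bar>x - of_int n\<bar>" using x by linarith
    qed
    moreover have "\<phi> (2 * x - of_int k) = 0"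
    proof (rule supp)
      have "(of_int m :: real) \<ge> 1" using m_pos by simp
      then show "of_int m < \<bar>2 * x - of_int k\<bar>" using x by (simp only: of_int_abs)
    qed
    ultimately show "(D k x)\<^sup>2 = 0" unfolding D_def by (auto intro!: sum.neutral)
  qed (intro continuous_on_power D_cont)
  have q_eq: "q k = 1 - (\<Sum>t\<in>{0,1}. \<Sum>n\<in>parents k. (tap t (k - 2 * n))\<^sup>2)" for k
  proof -
    have "(LBINT x. (sqrt 2 * \<phi> (2 * x - of_int k) - (\<Sum>i\<in>{0,1::nat}\<times>parents k.
          tap (fst i) (k - 2 * snd i) * gen (fst i) (x - of_int (snd i))))\<^sup>2) =
        (LBINT x. (sqrt 2 * \<phi> (2 * x - of_int k)) * (sqrt 2 * \<phi> (2 * x - of_int k)))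
        - (\<Sum>i\<in>{0,1::nat}\<times>parents k. (tap (fst i) (k - 2 * snd i))\<^sup>2)"
    proof (rule integral_sum_orthonormal)
      have "integrable lborel (\<lambda>x. gen 0 (2 * x - of_int k) * (2 * gen 0 (2 * x - of_int k)))"
        by (rule gen_affine_integrable) (auto intro!: continuous_intros)
      then show "integrable lborel (\<lambda>x. sqrt 2 * \<phi> (2 * x - of_int k) * (sqrt 2 * \<phi> (2 * x - of_int k)))"
        by (rule Bochner_Integration.integrable_cong[THEN iffD1, rotated -1]) (auto simp: gen_simps algebra_simps)
      show "integrable lborel (\<lambda>x. sqrt 2 * \<phi> (2 * x - of_int k) * gen (fst i) (x - of_int (snd i)))"
        if "i \<in> {0,1::nat}\<times>parents k" for i
      proof -
        have "integrable lborel (\<lambda>x. gen 0 (2 * x - of_int k) * (sqrt 2 * gen (fst i) (x - of_int (snd i))))"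
          by (rule gen_affine_integrable) (auto intro!: continuous_intros)
        then show ?thesis
          by (rule Bochner_Integration.integrable_cong[THEN iffD1, rotated -1]) (auto simp: gen_simps algebra_simps)
      qed
      show "integrable lborel (\<lambda>x. gen (fst i) (x - of_int (snd i)) * gen (fst j) (x - of_int (snd j)))" for i j :: "nat \<times> int"
      proof -
        have "integrable lborel (\<lambda>x. gen (fst i) (1 * x - of_int (snd i)) * gen (fst j) (x - of_int (snd j)))"
          by (rule gen_affine_integrable) (auto intro!: continuous_intros)
        then show ?thesis by simp
      qed
      show "(LBINT x. gen (fst i) (x - of_int (snd i)) * gen (fst j) (x - of_int (snd j))) = (if i = j then 1 else 0)"
        if "i \<in> {0,1::nat}\<times>parents k" "j \<in> {0,1::nat}\<times>parents k" for i j
        using that by (subst gen_orth) (auto simp: prod_eq_iff)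
    qed (auto simp: phi_gen_inner)
    then show ?thesis unfolding q_def D_def case_prod_beta dilated_phi_orth sum.cartesian_product by simp
  qed
  \<comment> \<open>Each tap is met exactly once, from \<open>k\<close> or from \<open>k + 1\<close> according to its parity.\<close>
  have split: "(\<Sum>n\<in>parents k. (tap t (k - 2 * n))\<^sup>2) + (\<Sum>n\<in>parents (k+1). (tap t (k + 1 - 2 * n))\<^sup>2) = 1"
    if "t \<in> {0,1}" for t k
  proof -
    have p: "(\<Sum>n\<in>parents k. (tap t (k - 2 * n))\<^sup>2) = (\<Sum>j | j \<in> {-m..m} \<and> even (k - j). (tap t j)\<^sup>2)" for k
    proof (rule sum.reindex_bij_witness[where i = "\<lambda>j. (k - j) div 2" and j = "\<lambda>n. k - 2 * n"])
      fix j assume j: "j \<in> {j. j \<in> {-m..m} \<and> even (k - j)}"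
      then show eq: "k - 2 * ((k - j) div 2) = j" by simp
      show "(k - j) div 2 \<in> parents k" unfolding parents_def mem_Collect_eq eq using j by auto
    qed (auto simp: parents_def abs_le_iff)
    have "(\<Sum>n\<in>parents k. (tap t (k - 2 * n))\<^sup>2) + (\<Sum>n\<in>parents (k+1). (tap t (k + 1 - 2 * n))\<^sup>2)
        = (\<Sum>j\<in>{j. j \<in> {-m..m} \<and> even (k - j)} \<union> {j. j \<in> {-m..m} \<and> even (k + 1 - j)}. (tap t j)\<^sup>2)"
      unfolding p by (rule sum.union_disjoint[symmetric]) (auto intro: finite_subset[of _ "{-m..m}"])
    also have "{j. j \<in> {-m..m} \<and> even (k - j)} \<union> {j. j \<in> {-m..m} \<and> even (k + 1 - j)} = {-m..m}"
      by auto
    finally show ?thesis using tap_square_sum[OF that] by simp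
  qed
  have "q k + q (k + 1) = 2 - (\<Sum>t\<in>{0,1}. (\<Sum>n\<in>parents k. (tap t (k - 2 * n))\<^sup>2) + (\<Sum>n\<in>parents (k+1). (tap t (k + 1 - 2 * n))\<^sup>2))"
    by (simp add: q_eq)
  also have "\<dots> = 0"
    using split[of 0 k] split[of 1 k] by simp
  moreover have "q k \<ge> 0" for k unfolding q_def by simp
  ultimately have "q k = 0" by (metis add_nonneg_eq_0_iff)
  then have "D k x = 0"
    using continuous_square_integral_0[OF D_cont D_int] unfolding q_def by blast
  then show ?thesis unfolding D_def sum.cartesian_product by simp
qed

end

text \<open>
  Outside the support the derivative vanishes as well, so both suprema are taken over a compact interval.
\<close>

lemma C1_compact_support_bounded:
  fixes u :: "real \<Rightarrow> real"
  assumes u: "u C1_differentiable_on UNIV" and 0: "\<And>x. \<bar>x\<bar> > r \<Longrightarrow> u x = 0"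
  shows "bdd_above (range (\<lambda>x. \<bar>u x\<bar>))" "bdd_above (range (\<lambda>x. \<bar>deriv u x\<bar>))"
    "(u has_field_derivative deriv u x) (at x)"
proof -
  obtain D where D: "\<And>x. (u has_vector_derivative D x) (at x)" and Dc: "continuous_on UNIV D"
    using u unfolding C1_differentiable_on_def by auto
  have D': "(u has_field_derivative D x) (at x)" for x
    using D by (simp add: has_real_derivative_iff_has_vector_derivative)
  have eq: "deriv u = D" using D' by (auto intro: DERIV_imp_deriv)
  show "(u has_field_derivative deriv u x) (at x)" unfolding eq by (rule D')
  have Dz: "D x = 0" if "\<bar>x\<bar> > r" for x
  proof -
    have "open {x::real. \<bar>x\<bar> > r}" by (intro open_Collect_less continuous_intros)
    then have "((\<lambda>_. 0) has_field_derivative D x) (at x)"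
      using has_field_derivative_transform_within_open[OF D'[of x], of "{x. \<bar>x\<bar> > r}" "\<lambda>_. 0"] that 0 by auto
    then show ?thesis using DERIV_unique[OF _ DERIV_const[of 0]] by blast
  qed
  have *: "bdd_above (range (\<lambda>x. \<bar>v x\<bar>))" if vc: "continuous_on UNIV v" and v0: "\<And>x. \<bar>x\<bar> > r \<Longrightarrow> v x = 0"
    for v :: "real \<Rightarrow> real"
  proof -
    have "compact (v ` {-r..r})"
      by (intro compact_continuous_image continuous_on_subset[OF vc]) auto
    then obtain B where B: "\<And>y. y \<in> v ` {-r..r} \<Longrightarrow> \<bar>y\<bar> \<le> B"
      using compact_imp_bounded bounded_iff real_norm_def by metis
    have "\<bar>v x\<bar> \<le> max B 0" for x
    proof (cases "\<bar>x\<bar> \<le> r")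
      case True
      then have "v x \<in> v ` {-r..r}" by (auto simp: abs_le_iff)
      from B[OF this] show ?thesis by simp
    qed (use v0[of x] in auto)
    then show ?thesis by (intro bdd_aboveI2)
  qed
  show "bdd_above (range (\<lambda>x. \<bar>u x\<bar>))"
    by (rule *) (auto simp: 0 u C1_differentiable_imp_continuous_on)
  show "bdd_above (range (\<lambda>x. \<bar>deriv u x\<bar>))"
    unfolding eq by (rule *) (auto simp: Dz Dc)
qed

context two_scale_pair begin

abbreviation L :: real where "L \<equiv> wavelet_bound \<phi> \<psi>"

lemma gen_bounded:
  "\<bar>gen t x\<bar> \<le> L" "\<bar>deriv (gen t) x\<bar> \<le> L" "(gen t has_field_derivative deriv (gen t) x) (at x)"
proof -
  note b = C1_compact_support_bounded[OF C1(1) supp(1)] C1_compact_support_bounded[OF C1(2) supp(2)]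
  show "(gen t has_field_derivative deriv (gen t) x) (at x)"
    using b(3,6) unfolding gen_def by (cases "t = 0") auto
  have s: "\<bar>\<phi> x\<bar> \<le> sup_norm \<phi>" "\<bar>deriv \<phi> x\<bar> \<le> sup_norm (deriv \<phi>)" "\<bar>\<psi> x\<bar> \<le> sup_norm \<psi>" "\<bar>deriv \<psi> x\<bar> \<le> sup_norm (deriv \<psi>)"
    unfolding sup_norm_def using b by (auto intro!: cSUP_upper)
  show "\<bar>gen t x\<bar> \<le> L" "\<bar>deriv (gen t) x\<bar> \<le> L"
    using s unfolding wavelet_bound_def gen_def by (auto simp: Max_ge_iff)
qed

lemma L_pos: "L > 0"
proof (rule ccontr)
  assume "\<not> L > 0"
  then have "\<phi> x = 0" for x using gen_bounded(1)[of 0 x] by (simp add: gen_simps)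
  then show False using int_phi by simp
qed

lemma gen_lipschitz: "\<bar>gen t x - gen t y\<bar> \<le> L * \<bar>x - y\<bar>"
  using field_differentiable_bound[of UNIV "gen t" "deriv (gen t)" L x y] gen_bounded
  by (auto simp: real_norm_def norm_minus_commute)

text \<open>
  Integrating the synthesis formula gives \<open>1 / sqrt 2 = S 0 k + w * S 1 k\<close>, where \<open>w\<close> is the integral of
  \<open>\<psi>\<close> and \<open>S t k\<close> sums the taps of one parity. The two-scale equations give the full sums of the taps in
  terms of \<open>w\<close>; comparison forces \<open>w = 0\<close>, so the even and the odd taps of \<open>h\<close> have equal sums.
\<close>

lemma tap_sum: "(\<Sum>n\<in>parents k. h (k - 2 * n)) = 1 / sqrt 2"
proof -
  define w where "w = (LBINT x. \<psi> x)"
  define S where "S t k = (\<Sum>n\<in>parents k. tap t (k - 2 * n))" for t k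
  have tr: "(LBINT x. gen t (x - of_int n)) = (LBINT x. gen t x)" for t n
    by (subst lborel_integral_real_affine[where c = 1 and t = "of_int n"]) auto
  have half: "(LBINT x. \<phi> (2 * x - b)) = 1 / 2" for b
    using lborel_integral_real_affine[of 2 \<phi> "-b"] int_phi by (simp add: algebra_simps)
  have int_tr: "integrable lborel (\<lambda>x. gen t (x - of_int n))" for t n
    using gen_affine_integrable[of 1 "\<lambda>_. 1" t "of_int n"] by (simp add: continuous_intros)
  have one: "1 / sqrt 2 = S 0 k + w * S 1 k" for k
  proof -
    have "1 / sqrt 2 = sqrt 2 * (1 / 2)" by (simp add: real_div_sqrt field_simps)
    also have "\<dots> = (LBINT x. sqrt 2 * \<phi> (2 * x - of_int k))" by (simp add: half)
    also have "\<dots> = (LBINT x. (\<Sum>t\<in>{0,1}. \<Sum>n\<in>parents k. tap t (k - 2 * n) * gen t (x - of_int n)))"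
      by (simp only: synthesis)
    also have "\<dots> = (\<Sum>t\<in>{0,1}. \<Sum>n\<in>parents k. tap t (k - 2 * n) * (LBINT x. gen t x))"
      by (simp add: Bochner_Integration.integral_sum int_tr tr Bochner_Integration.integral_add
          Bochner_Integration.integrable_sum)
    also have "\<dots> = S 0 k + w * S 1 k"
      using int_phi unfolding S_def w_def
      by (simp add: gen_simps sum_distrib_right[symmetric] mult.commute[of "integral\<^sup>L lborel \<psi>"])
    finally show ?thesis .
  qed
  have p: "S t k = (\<Sum>j | j \<in> {-m..m} \<and> even (k - j). tap t j)" for t k
    unfolding S_def
  proof (rule sum.reindex_bij_witness[where i = "\<lambda>j. (k - j) div 2" and j = "\<lambda>n. k - 2 * n"])
    fix j assume j: "j \<in> {j. j \<in> {-m..m} \<and> even (k - j)}"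
    then show eq: "k - 2 * ((k - j) div 2) = j" by simp
    show "(k - j) div 2 \<in> parents k" unfolding parents_def mem_Collect_eq eq using j by auto
  qed (auto simp: parents_def abs_le_iff)
  have split: "S t k + S t (k + 1) = (\<Sum>j=-m..m. tap t j)" for t k
  proof -
    have "S t k + S t (k + 1) = (\<Sum>j\<in>{j. j \<in> {-m..m} \<and> even (k - j)} \<union> {j. j \<in> {-m..m} \<and> even (k + 1 - j)}. tap t j)"
      unfolding p by (rule sum.union_disjoint[symmetric]) (auto intro: finite_subset[of _ "{-m..m}"])
    also have "{j. j \<in> {-m..m} \<and> even (k - j)} \<union> {j. j \<in> {-m..m} \<and> even (k + 1 - j)} = {-m..m}" by auto
    finally show ?thesis .
  qed
  have total: "(LBINT x. gen t x) = (\<Sum>j=-m..m. tap t j) / sqrt 2" for t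
  proof -
    have "(LBINT x. gen t x) = (LBINT x. (\<Sum>j=-m..m. sqrt 2 * tap t j * \<phi> (2 * x - of_int j)))"
      by (intro arg_cong[where f = "integral\<^sup>L lborel"] ext)
         (use gen_two_scale[of t] in \<open>simp only: sum_distrib_left mult.assoc\<close>)
    also have "\<dots> = (\<Sum>j=-m..m. sqrt 2 * tap t j * (1 / 2))"
    proof (subst Bochner_Integration.integral_sum)
      show "integrable lborel (\<lambda>x. sqrt 2 * tap t j * \<phi> (2 * x - of_int j))" for j
        using gen_affine_integrable[of 2 "\<lambda>_. 1" 0 "of_int j"] by (simp add: gen_simps continuous_intros)
    qed (simp add: half)
    also have "\<dots> = (\<Sum>j=-m..m. tap t j) * (sqrt 2 * (1/2))"
      by (subst sum_distrib_right) (simp only: mult_ac)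
    also have "sqrt 2 * (1/2) = 1 / sqrt 2" by (simp add: real_div_sqrt field_simps)
    finally show ?thesis by simp
  qed
  \<comment> \<open>The identities for \<open>k = 0\<close> and \<open>k = 1\<close> cover all taps of each filter; their sum leaves \<open>sqrt 2 * w\<^sup>2 = 0\<close>.\<close>
  have s2: "(\<Sum>j=-m..m. tap 0 j) = sqrt 2" using total[of 0] int_phi by (simp add: gen_simps)
  have w: "(\<Sum>j=-m..m. tap 1 j) = sqrt 2 * w" using total[of 1] by (simp add: gen_simps w_def)
  have "2 * (1 / sqrt 2) = (S 0 0 + S 0 1) + w * (S 1 0 + S 1 1)"
    using one[of 0] one[of 1] by (simp add: algebra_simps)
  also have "\<dots> = sqrt 2 + w * (sqrt 2 * w)" using split[of 0 0] split[of 1 0] s2 w by simp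
  finally have "sqrt 2 * w\<^sup>2 = 0" by (simp add: real_div_sqrt power2_eq_square)
  then have w0: "w = 0" by simp
  show "(\<Sum>n\<in>parents k. h (k - 2 * n)) = 1 / sqrt 2"
    using one[of k] w0 by (simp add: S_def tap_def)
qed

lemma translate_sum_indep:
  assumes "\<bar>x\<bar> + of_int m \<le> of_int T" "\<bar>x\<bar> + of_int m \<le> of_int T'"
  shows "(\<Sum>k=-T..T. \<phi> (x - of_int k)) = (\<Sum>k=-T'..T'. \<phi> (x - of_int k))"
proof -
  have *: "(\<Sum>k=-T..T. \<phi> (x - of_int k)) = (\<Sum>k | \<bar>x - of_int k\<bar> \<le> of_int m. \<phi> (x - of_int k))"
    if "\<bar>x\<bar> + of_int m \<le> of_int T" for T
  proof (rule sum.mono_neutral_right)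
    show "{k. \<bar>x - of_int k\<bar> \<le> of_int m} \<subseteq> {- T..T}"
    proof
      fix k assume "k \<in> {k. \<bar>x - of_int k\<bar> \<le> of_int m}"
      then have "\<bar>of_int k\<bar> \<le> (of_int T :: real)" using that by (simp only: mem_Collect_eq)
      then have "of_int \<bar>k\<bar> \<le> (of_int T :: real)" by simp
      then show "k \<in> {-T..T}" by (simp only: of_int_le_iff) auto
    qed
    show "\<forall>k\<in>{- T..T} - {k. \<bar>x - of_int k\<bar> \<le> of_int m}. \<phi> (x - of_int k) = 0"
      using supp(1) by (auto simp: not_le)
  qed simp
  show ?thesis using *[OF assms(1)] *[OF assms(2)] by simp
qed

text \<open>
  Write \<open>s x\<close> for the sum. Summing the two-scale equation over the translates and using \<open>tap_sum\<close> gives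
  \<open>s x = s (2 * x)\<close>. By continuity at \<open>0\<close> the function \<open>s\<close> is constant, and integrating \<open>\<phi> * s\<close> against the
  orthonormality relations identifies the constant.
\<close>

lemma partition_of_unity:
  assumes "\<bar>x\<bar> + of_int m \<le> of_int T"
  shows "(\<Sum>k=-T..T. \<phi> (x - of_int k)) = 1"
proof -
  define s where "s x = (\<Sum>k=-(\<lceil>\<bar>x\<bar>\<rceil>+m)..\<lceil>\<bar>x\<bar>\<rceil>+m. \<phi> (x - of_int k))" for x
  have s: "(\<Sum>k=-T..T. \<phi> (x - of_int k)) = s x" if "\<bar>x\<bar> + of_int m \<le> of_int T" for x T
    unfolding s_def by (rule translate_sum_indep) (use that le_of_int_ceiling[of "\<bar>x\<bar>"] in \<open>simp_all\<close>)
  have double: "s x = s (2 * x)" for x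
  proof -
    define T where "T = \<lceil>\<bar>x\<bar>\<rceil> + m"
    have T: "\<bar>x\<bar> + of_int m \<le> of_int T" using le_of_int_ceiling[of "\<bar>x\<bar>"] by (simp add: T_def)
    have "s x = (\<Sum>k=-T..T. \<phi> (x - of_int k))" using s[OF T] by simp
    also have "\<dots> = (\<Sum>k=-T..T. sqrt 2 * (\<Sum>n=-(2*T+m)..2*T+m. h (n - 2 * k) * \<phi> (2 * x - of_int n)))"
    proof (intro sum.cong refl)
      fix k assume k: "k \<in> {-T..T}"
      have "(\<Sum>j=-m..m. h j * \<phi> (2 * (x - of_int k) - of_int j)) =
          (\<Sum>n=2*k-m..2*k+m. h (n - 2 * k) * \<phi> (2 * x - of_int n))"
        by (rule sum.reindex_bij_witness[where j = "\<lambda>j. j + 2 * k" and i = "\<lambda>n. n - 2 * k"])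
           (auto simp: algebra_simps)
      also have "\<dots> = (\<Sum>n=-(2*T+m)..2*T+m. h (n - 2 * k) * \<phi> (2 * x - of_int n))"
        by (rule sum.mono_neutral_left) (use k in \<open>auto intro!: taps\<close>)
      finally show "\<phi> (x - of_int k) = sqrt 2 * (\<Sum>n=-(2*T+m)..2*T+m. h (n - 2 * k) * \<phi> (2 * x - of_int n))"
        using two_scale(1)[of "x - of_int k"] by simp
    qed
    also have "\<dots> = (\<Sum>n=-(2*T+m)..2*T+m. sqrt 2 * (\<Sum>k=-T..T. h (n - 2 * k)) * \<phi> (2 * x - of_int n))"
      unfolding sum_distrib_left sum_distrib_right by (subst sum.swap) (simp only: mult_ac)
    also have "\<dots> = (\<Sum>n=-(2*T+m)..2*T+m. \<phi> (2 * x - of_int n))"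
    proof (intro sum.cong refl)
      fix n assume "n \<in> {-(2*T+m)..2*T+m}"
      show "sqrt 2 * (\<Sum>k=-T..T. h (n - 2 * k)) * \<phi> (2 * x - of_int n) = \<phi> (2 * x - of_int n)"
      proof (cases "\<bar>2 * x - of_int n\<bar> > of_int m")
        case False
        then have "\<bar>of_int n\<bar> \<le> 2 * \<bar>x\<bar> + of_int m" by linarith
        then have "\<bar>of_int n\<bar> \<le> (2 * of_int T - of_int m :: real)" using T by linarith
        then have n: "\<bar>n\<bar> \<le> 2 * T - m" by linarith
        have "(\<Sum>k=-T..T. h (n - 2 * k)) = (\<Sum>k\<in>parents n. h (n - 2 * k))"
        proof (rule sum.mono_neutral_right)
          show "parents n \<subseteq> {-T..T}"
          proof
            fix k assume "k \<in> parents n"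
            then have "\<bar>n - 2 * k\<bar> \<le> m" by (simp add: parents_def)
            then show "k \<in> {-T..T}" using n unfolding atLeastAtMost_iff by linarith
          qed
        qed (auto simp: parents_def intro!: taps)
        then show ?thesis using tap_sum[of n] by simp
      qed (simp add: supp)
    qed
    also have "\<dots> = s (2 * x)"
    proof (rule s)
      show "\<bar>2 * x\<bar> + of_int m \<le> of_int (2 * T + m)" using T m_pos by (simp add: abs_mult)
    qed
    finally show ?thesis .
  qed
  have const: "s x = s 0" for x
  proof -
    have pow: "s (x / 2 ^ i) = s x" for i
    proof (induction i)
      case (Suc i)
      have "s (x / 2 ^ Suc i) = s (2 * (x / 2 ^ Suc i))" by (rule double)
      then show ?case using Suc by simp
    qed simp
    define T where "T = \<lceil>\<bar>x\<bar>\<rceil> + m"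
    have T: "\<bar>x\<bar> + of_int m \<le> of_int T" using le_of_int_ceiling[of "\<bar>x\<bar>"] by (simp add: T_def)
    have "(\<lambda>i. x / 2 ^ i) \<longlonglongrightarrow> 0" by real_asymp
    then have "(\<lambda>i. \<Sum>k=-T..T. \<phi> (x / 2 ^ i - of_int k)) \<longlonglongrightarrow> (\<Sum>k=-T..T. \<phi> (0 - of_int k))"
      by (intro tendsto_sum isCont_tendsto_compose[of _ \<phi>] tendsto_intros)
         (use gen_cont[of 0] in \<open>auto simp: gen_simps continuous_on_eq_continuous_at\<close>)
    moreover have "(\<Sum>k=-T..T. \<phi> (x / 2 ^ i - of_int k)) = s x" for i
    proof -
      have "\<bar>x\<bar> / 2 ^ i \<le> \<bar>x\<bar> / 1" by (rule divide_left_mono) auto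
      then have "\<bar>x / 2 ^ i\<bar> \<le> \<bar>x\<bar>" by simp
      then show ?thesis using T by (subst s) (auto simp: pow)
    qed
    moreover have "(\<Sum>k=-T..T. \<phi> (0 - of_int k)) = s 0" by (rule s) (use T in linarith)
    ultimately have "(\<lambda>i::nat. s x) \<longlonglongrightarrow> s 0" by simp
    then show ?thesis by (rule LIMSEQ_unique[OF tendsto_const])
  qed
  have "s 0 = (LBINT y. \<phi> y * s 0)" by (simp add: int_phi)
  also have "\<dots> = (LBINT y. (\<Sum>k=-(2*m)..2*m. \<phi> y * \<phi> (y - of_int k)))"
  proof (intro arg_cong[where f = "integral\<^sup>L lborel"] ext)
    fix y
    show "\<phi> y * s 0 = (\<Sum>k=-(2*m)..2*m. \<phi> y * \<phi> (y - of_int k))"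
    proof (cases "\<bar>y\<bar> > of_int m")
      case False
      then have "(\<Sum>k=-(2*m)..2*m. \<phi> (y - of_int k)) = s 0" unfolding const[of y, symmetric] by (intro s) auto
      then show ?thesis by (simp add: sum_distrib_left[symmetric])
    qed (simp add: supp)
  qed
  also have "\<dots> = (\<Sum>k=-(2*m)..2*m. (if k = 0 then 1 else 0))"
  proof (subst Bochner_Integration.integral_sum)
    show "integrable lborel (\<lambda>y. \<phi> y * \<phi> (y - of_int k))" for k
      using gen_affine_integrable[of 1 "\<lambda>y. \<phi> (y - of_int k)" 0 0] by (simp add: gen_simps continuous_intros)
  qed (simp add: orth)
  also have "\<dots> = 1" using m_pos by simp
  finally show ?thesis using s[OF assms] const[of x] by simp
qed

text \<open>
  Iterating the two-scale equation puts a coarse function into the span of the scaling functions of any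
  finer level.
\<close>

lemma coarse_expansion:
  obtains S a where "finite S" "\<And>x. gen t (2 ^ J * x - of_int n) = (\<Sum>k\<in>S. a k * \<phi> (2 ^ (J + Suc i) * x - of_int k))"
proof -
  have "\<exists>S a. finite S \<and> (\<forall>y. gen t (y - of_int n) = (\<Sum>k\<in>S. a k * \<phi> (2 ^ (Suc i) * y - of_int k)))"
  proof (induction i)
    case 0
    have base: "gen t (y - of_int n) = (\<Sum>k\<in>{2*n-m..2*n+m}. (sqrt 2 * tap t (k - 2 * n)) * \<phi> (2 ^ (Suc 0) * y - of_int k))" for y
    proof -
      have "(\<Sum>j=-m..m. tap t j * \<phi> (2 * (y - of_int n) - of_int j)) =
          (\<Sum>k=2*n-m..2*n+m. tap t (k - 2 * n) * \<phi> (2 * y - of_int k))"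
        by (rule sum.reindex_bij_witness[where j = "\<lambda>j. j + 2 * n" and i = "\<lambda>k. k - 2 * n"])
           (auto simp: algebra_simps)
      then show ?thesis
        unfolding gen_two_scale[of t "y - of_int n"] power_Suc0_right by (simp only: sum_distrib_left mult.assoc)
    qed
    show ?case by (rule exI, rule exI, rule conjI[OF _ allI[OF base]]) simp
  next
    case (Suc i)
    then obtain S a where S: "finite S"
      and e: "\<And>y. gen t (y - of_int n) = (\<Sum>k\<in>S. a k * \<phi> (2 ^ (Suc i) * y - of_int k))" by blast
    have step: "gen t (y - of_int n) = (\<Sum>k'\<in>(\<Union>k\<in>S. {2*k-m..2*k+m}). (\<Sum>k\<in>S. a k * (sqrt 2 * h (k' - 2 * k))) * \<phi> (2 ^ (Suc (Suc i)) * y - of_int k'))" for y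
    proof -
      have "\<phi> (2 ^ (Suc i) * y - of_int k) = (\<Sum>k'\<in>(\<Union>k\<in>S. {2*k-m..2*k+m}). sqrt 2 * h (k' - 2 * k) * \<phi> (2 ^ (Suc (Suc i)) * y - of_int k'))"
        if k: "k \<in> S" for k
      proof -
        have "(\<Sum>j=-m..m. h j * \<phi> (2 * (2 ^ (Suc i) * y - of_int k) - of_int j)) =
          (\<Sum>k'=2*k-m..2*k+m. h (k' - 2 * k) * \<phi> (2 ^ (Suc (Suc i)) * y - of_int k'))"
          by (rule sum.reindex_bij_witness[where j = "\<lambda>j. j + 2 * k" and i = "\<lambda>k'. k' - 2 * k"])
             (auto simp: algebra_simps)
        also have "\<dots> = (\<Sum>k'\<in>(\<Union>k\<in>S. {2*k-m..2*k+m}). h (k' - 2 * k) * \<phi> (2 ^ (Suc (Suc i)) * y - of_int k'))"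
          by (rule sum.mono_neutral_left) (use S k in \<open>auto intro!: taps\<close>)
        finally show ?thesis using two_scale(1)[of "2 ^ (Suc i) * y - of_int k"] by (simp add: sum_distrib_left mult.assoc)
      qed
      then have "gen t (y - of_int n) = (\<Sum>k\<in>S. a k * (\<Sum>k'\<in>(\<Union>k\<in>S. {2*k-m..2*k+m}). sqrt 2 * h (k' - 2 * k) * \<phi> (2 ^ (Suc (Suc i)) * y - of_int k')))"
        unfolding e by (intro sum.cong) auto
      also have "\<dots> = (\<Sum>k'\<in>(\<Union>k\<in>S. {2*k-m..2*k+m}). (\<Sum>k\<in>S. a k * (sqrt 2 * h (k' - 2 * k))) * \<phi> (2 ^ (Suc (Suc i)) * y - of_int k'))"
        unfolding sum_distrib_left sum_distrib_right by (subst sum.swap) (simp only: mult_ac)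
      finally show ?thesis .
    qed
    show ?case by (rule exI, rule exI, rule conjI[OF _ allI[OF step]]) (use S in auto)
  qed
  then obtain S a where S: "finite S" "\<And>y. gen t (y - of_int n) = (\<Sum>k\<in>S. a k * \<phi> (2 ^ (Suc i) * y - of_int k))" by blast
  have "2 ^ Suc i * (2 ^ J * x) = 2 ^ (J + Suc i) * x" for x :: real
    by (simp add: power_add)
  then have "gen t (2 ^ J * x - of_int n) = (\<Sum>k\<in>S. a k * \<phi> (2 ^ (J + Suc i) * x - of_int k))" for x
    using S(2)[of "2 ^ J * x"] by (simp only:)
  then show ?thesis by (rule that[OF S(1)])
qed

lemma scaled_orth:
  assumes "s \<in> {0,1}" "t \<in> {0,1}"
  shows "(LBINT x. gen s (2 ^ J * x - of_int a) * gen t (2 ^ J * x - of_int b)) = (if s = t \<and> a = b then 1 / 2 ^ J else 0)"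
proof -
  have "(if s = t \<and> a = b then 1 else 0) = (LBINT x. gen s (x - of_int a) * gen t (x - of_int b))"
    using gen_orth[OF assms] by simp
  also have "\<dots> = 2 ^ J * (LBINT x. gen s (2 ^ J * x - of_int a) * gen t (2 ^ J * x - of_int b))"
    by (subst lborel_integral_real_affine[where c = "2 ^ J" and t = 0]) auto
  finally show ?thesis by (auto simp: field_simps split: if_splits)
qed

lemma scaled_integrable: "integrable lborel (\<lambda>x. gen s (2 ^ J * x - of_int a) * gen t (2 ^ I * x - of_int b))"
  using gen_affine_integrable[of "2 ^ J" "\<lambda>x. gen t (2 ^ I * x - of_int b)" s "of_int a"]
  by (simp add: continuous_intros)

text \<open>
  On the finer level the coarse factor is a combination of scaling functions, all of them orthogonal to the
  wavelet \<open>\<psi>\<close> of that level.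
\<close>

lemma cross_level_orth:
  assumes "I < J"
  shows "(LBINT x. gen t (2 ^ I * x - of_int a) * \<psi> (2 ^ J * x - of_int b)) = 0"
proof -
  obtain i where J: "J = I + Suc i" using assms less_iff_Suc_add by auto
  obtain S c where S: "finite S" "\<And>x. gen t (2 ^ I * x - of_int a) = (\<Sum>k\<in>S. c k * \<phi> (2 ^ J * x - of_int k))"
    using coarse_expansion[of t I a i] unfolding J by metis
  have "(LBINT x. gen t (2 ^ I * x - of_int a) * \<psi> (2 ^ J * x - of_int b)) =
     (LBINT x. (\<Sum>k\<in>S. c k * (gen 0 (2 ^ J * x - of_int k) * gen 1 (2 ^ J * x - of_int b))))"
    unfolding S(2) by (simp add: gen_simps sum_distrib_right mult.assoc)
  also have "\<dots> = (\<Sum>k\<in>S. c k * (LBINT x. gen 0 (2 ^ J * x - of_int k) * gen 1 (2 ^ J * x - of_int b)))"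
    by (simp add: Bochner_Integration.integral_sum scaled_integrable del: One_nat_def)
  also have "\<dots> = 0" by (simp add: scaled_orth del: One_nat_def)
  finally show ?thesis .
qed

end

section \<open>Lebesgue measure on coordinate space and wavelet indices\<close>

interpretation lborel_prod: product_sigma_finite "\<lambda>_::'i. lborel :: real measure" ..

lemma space_leb [simp]: "space (leb d) = {..<d} \<rightarrow>\<^sub>E UNIV"
  by (simp add: leb_def space_PiM)

lemma space_vec_space [simp]: "space (vec_space d) = {..<d} \<rightarrow>\<^sub>E UNIV"
  by (simp add: vec_space_def space_PiM)

lemma sets_leb [measurable_cong]: "sets (leb d) = sets (vec_space d)"
  unfolding leb_def vec_space_def by (intro sets_PiM_cong) auto

lemma vec_component_measurable [measurable]:
  "i < d \<Longrightarrow> (\<lambda>x. x i) \<in> borel_measurable (vec_space d)"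
  unfolding vec_space_def by measurable

lemma sigma_finite_leb: "sigma_finite_measure (leb d)"
  unfolding leb_def by (rule lborel_prod.sigma_finite) simp

lemma sets_leb_orthants:
  "sets (leb d) = sigma_sets ({..<d} \<rightarrow>\<^sub>E UNIV) (range (\<lambda>c :: nat \<Rightarrow> real. PiE {..<d} (\<lambda>i. {..c i})))"
proof -
  have "sets (leb d) = sets (\<Pi>\<^sub>M i\<in>{..<d}. sigma UNIV (range (\<lambda>c::real. {..c})))"
    unfolding sets_leb vec_space_def by (simp add: borel_eq_atMost)
  also have "\<dots> = sets (sigma (\<Pi>\<^sub>E i\<in>{..<d}. UNIV)
      {{f\<in>(\<Pi>\<^sub>E i\<in>{..<d}. UNIV). \<forall>i\<in>j. f i \<in> B i} | B j. j \<in> {{..<d}} \<and> B \<in> Pi j (\<lambda>_. range (\<lambda>c::real. {..c}))})"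
  proof (rule sets_PiM_sigma)
    show "\<exists>S\<subseteq>range (\<lambda>c::real. {..c}). countable S \<and> UNIV = \<Union>S" for i
      by (rule exI[of _ "range (\<lambda>n::nat. {..real n})"]) (auto intro: real_arch_simple)
  qed auto
  also have "{{f\<in>(\<Pi>\<^sub>E i\<in>{..<d}. UNIV). \<forall>i\<in>j. f i \<in> B i} | B j. j \<in> {{..<d}} \<and> B \<in> Pi j (\<lambda>_. range (\<lambda>c::real. {..c}))}
      = range (\<lambda>c :: nat \<Rightarrow> real. PiE {..<d} (\<lambda>i. {..c i}))" (is "?A = ?B")
  proof (intro equalityI subsetI)
    fix X assume "X \<in> ?A"
    then obtain B where B: "B \<in> Pi {..<d} (\<lambda>_. range (\<lambda>c::real. {..c}))"
      and X: "X = {f\<in>(\<Pi>\<^sub>E i\<in>{..<d}. UNIV). \<forall>i\<in>{..<d}. f i \<in> B i}" by auto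
    have "\<forall>i\<in>{..<d}. \<exists>c. B i = {..c}" using B by (auto simp: Pi_iff)
    then obtain c where "\<forall>i\<in>{..<d}. B i = {..c i}" by metis
    then have "X = PiE {..<d} (\<lambda>i. {..c i})" unfolding X by (auto simp: PiE_iff extensional_def)
    then show "X \<in> ?B" by (intro range_eqI[where x = c])
  next
    fix X assume "X \<in> ?B"
    then obtain c where "X = PiE {..<d} (\<lambda>i. {..c i::real})" by auto
    then have "X = {f\<in>(\<Pi>\<^sub>E i\<in>{..<d}. UNIV). \<forall>i\<in>{..<d}. f i \<in> {..c i}}"
      by (simp add: set_eq_iff PiE_iff conj_commute)
    then have "X = {f\<in>(\<Pi>\<^sub>E i\<in>{..<d}. UNIV). \<forall>i\<in>{..<d}. f i \<in> {..c i}} \<and> {..<d} \<in> {{..<d}}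
        \<and> (\<lambda>i. {..c i}) \<in> Pi {..<d} (\<lambda>_. range (\<lambda>c::real. {..c}))" by simp
    then show "X \<in> ?A" unfolding mem_Collect_eq
      by (rule_tac x = "\<lambda>i. {..c i}" in exI, rule_tac x = "{..<d}" in exI)
  qed
  finally show ?thesis by (subst (asm) sets_measure_of) auto
qed

text \<open>
  The orthants are stable under intersection and generate the \<open>\<sigma>\<close>-algebra, so the signed measure with
  density \<open>v\<close> vanishes.
\<close>

lemma AE_0_if_integral_orthants_0:
  fixes v :: "rvec \<Rightarrow> real"
  assumes v: "integrable (leb d) v" and tot: "(\<integral>x. v x \<partial>leb d) = 0"
    and orthant: "\<And>c. (\<integral>x. indicator (PiE {..<d} (\<lambda>i. {..c i})) x * v x \<partial>leb d) = 0"
  shows "AE x in leb d. v x = 0"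
proof (rule sigma_finite_measure.density_zero[OF sigma_finite_leb v])
  fix A assume "A \<in> sets (leb d)"
  then have A: "A \<in> sigma_sets ({..<d} \<rightarrow>\<^sub>E UNIV) (range (\<lambda>c :: nat \<Rightarrow> real. PiE {..<d} (\<lambda>i. {..c i})))"
    by (simp add: sets_leb_orthants)
  have "Int_stable (range (\<lambda>c :: nat \<Rightarrow> real. PiE {..<d} (\<lambda>i. {..c i})))"
  proof (rule Int_stableI)
    fix a b assume "a \<in> range (\<lambda>c :: nat \<Rightarrow> real. PiE {..<d} (\<lambda>i. {..c i}))" "b \<in> range (\<lambda>c :: nat \<Rightarrow> real. PiE {..<d} (\<lambda>i. {..c i}))"
    then obtain c c' where "a = PiE {..<d} (\<lambda>i. {..c i::real})" "b = PiE {..<d} (\<lambda>i. {..c' i::real})" by auto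
    then have "a \<inter> b = PiE {..<d} (\<lambda>i. {..min (c i) (c' i)})" by (simp add: PiE_Int)
    then show "a \<inter> b \<in> range (\<lambda>c :: nat \<Rightarrow> real. PiE {..<d} (\<lambda>i. {..c i}))"
      by (intro range_eqI[where x = "\<lambda>i. min (c i) (c' i)"])
  qed
  moreover have "range (\<lambda>c :: nat \<Rightarrow> real. PiE {..<d} (\<lambda>i. {..c i})) \<subseteq> Pow ({..<d} \<rightarrow>\<^sub>E UNIV)"
    by auto
  ultimately show "set_lebesgue_integral (leb d) A v = 0" using A
  proof (induction rule: sigma_sets_induct_disjoint)
    case (basic X)
    then show ?case using orthant by (auto simp: set_lebesgue_integral_def)
  next
    case empty show ?case by (simp add: set_lebesgue_integral_def)
  next
    case (compl X)
    have X: "X \<in> sets (leb d)" using compl(1) by (simp add: sets_leb_orthants)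
    have "set_lebesgue_integral (leb d) (space (leb d) - X) v = (\<integral>x. v x - indicator X x *\<^sub>R v x \<partial>leb d)"
      unfolding set_lebesgue_integral_def by (intro Bochner_Integration.integral_cong) (auto split: split_indicator)
    also have "\<dots> = 0" using compl(2) v tot integrable_mult_indicator[OF X v]
      by (subst Bochner_Integration.integral_diff) (auto simp: set_lebesgue_integral_def)
    finally show ?case by simp
  next
    case (union X)
    have X: "X i \<in> sets (leb d)" for i using union(2) by (auto simp: sets_leb_orthants)
    have "set_lebesgue_integral (leb d) (\<Union>i. X i) v = (\<Sum>i. set_lebesgue_integral (leb d) (X i) v)"
    proof (rule lebesgue_integral_countable_add)
      show "set_integrable (leb d) (\<Union> (range X)) v"
        unfolding set_integrable_def using X v by (intro integrable_mult_indicator) auto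
    qed (use X union(1) in \<open>auto simp: disjoint_family_on_def\<close>)
    then show ?case using union(3) by simp
  qed
qed

lemma wavelet_index_finite_iff:
  "(l1, l2, l3) \<in> wavelet_index d (enat M) (enat N) \<longleftrightarrow>
     l1 \<le> M \<and> l2 \<in> {..<d} \<rightarrow>\<^sub>E UNIV \<and> l3 \<in> {..<d} \<rightarrow>\<^sub>E {0,1} \<and> (\<forall>i<d. \<bar>l2 i\<bar> \<le> 2 ^ l1 * int N)
       \<and> (l3 = (\<lambda>i\<in>{..<d}. 0) \<longrightarrow> l1 = 0)"
proof -
  have e: "enat (nat \<bar>k\<bar>) \<le> 2 ^ l1 * enat N \<longleftrightarrow> \<bar>k\<bar> \<le> 2 ^ l1 * int N" for k
  proof -
    have "(2::enat) ^ l1 = enat (2 ^ l1)" by (induction l1) (auto simp: numeral_eq_enat one_enat_def)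
    then have "enat (nat \<bar>k\<bar>) \<le> 2 ^ l1 * enat N \<longleftrightarrow> nat \<bar>k\<bar> \<le> 2 ^ l1 * N" by simp
    also have "\<dots> \<longleftrightarrow> \<bar>k\<bar> \<le> 2 ^ l1 * int N" by (simp add: nat_le_iff)
    finally show ?thesis .
  qed
  have e0: "enat (nat \<bar>k\<bar>) \<le> enat N \<longleftrightarrow> \<bar>k\<bar> \<le> int N" for k by (simp add: nat_le_iff)
  show ?thesis unfolding wavelet_index_def
    by (auto simp: e e0 PiE_iff restrict_def extensional_def fun_eq_iff)
qed

lemma wavelet_index_mono: "M \<le> M' \<Longrightarrow> wavelet_index d (enat M) (enat N) \<subseteq> wavelet_index d (enat M') (enat N)"
  by (auto simp: wavelet_index_finite_iff)

lemma wavelet_index_infinite: "wavelet_index d M N \<subseteq> wavelet_index d \<infinity> \<infinity>"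
proof -
  have *: "(2::enat) ^ l * \<infinity> = \<infinity>" for l
  proof -
    have "(2::enat) ^ l = enat (2 ^ l)" by (induction l) (auto simp: numeral_eq_enat one_enat_def)
    then show ?thesis by simp
  qed
  show ?thesis unfolding wavelet_index_def by (auto simp: *)
qed

lemma wavelet_index_level_subset:
  assumes "l \<in> wavelet_index d (enat M) (enat N)"
  shows "l \<in> {fst l} \<times> ({..<d} \<rightarrow>\<^sub>E {-(2 ^ fst l * int N)..2 ^ fst l * int N}) \<times> ({..<d} \<rightarrow>\<^sub>E {0,1})"
proof -
  obtain l1 l2 l3 where l: "l = (l1, l2, l3)" by (cases l)
  show ?thesis using assms unfolding l wavelet_index_finite_iff by (auto simp: PiE_iff abs_le_iff)
qed

text \<open>
  At most \<open>2 * 2 ^ j * N + 1\<close> translations, hence at most \<open>3 * N * 2 ^ j\<close>, and two types per coordinate.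
\<close>

lemma wavelet_level_card:
  assumes "N \<ge> 1"
  shows "card {l \<in> wavelet_index d (enat M) (enat N). fst l = j} \<le> (6 * N * 2 ^ j) ^ d"
proof -
  let ?S = "{j} \<times> ({..<d} \<rightarrow>\<^sub>E {-(2 ^ j * int N)..2 ^ j * int N}) \<times> ({..<d} \<rightarrow>\<^sub>E {0,1::nat})"
  have sub: "{l \<in> wavelet_index d (enat M) (enat N). fst l = j} \<subseteq> ?S"
    using wavelet_index_level_subset by blast
  have fin: "finite ?S" by (intro finite_cartesian_product finite_PiE) auto
  have "card {l \<in> wavelet_index d (enat M) (enat N). fst l = j} \<le> card ?S"
    by (rule card_mono[OF fin sub])
  also have "\<dots> = (nat (2 * (2 ^ j * int N) + 1)) ^ d * 2 ^ d"
    by (simp add: card_cartesian_product card_PiE algebra_simps, simp add: numeral_2_eq_2)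
  also have "\<dots> \<le> (3 * N * 2 ^ j) ^ d * 2 ^ d"
  proof (intro mult_right_mono power_mono)
    have "1 \<le> N * 2 ^ j" using assms by simp
    moreover have "nat (2 * (2 ^ j * int N) + 1) = 2 * (2 ^ j * N) + 1"
      by (simp add: nat_add_distrib nat_mult_distrib nat_power_eq)
    ultimately show "nat (2 * (2 ^ j * int N) + 1) \<le> 3 * N * 2 ^ j" by (simp add: mult.commute)
  qed auto
  also have "\<dots> = ((3 * N * 2 ^ j) * 2) ^ d" by (simp only: power_mult_distrib)
  also have "(3 * N * 2 ^ j) * 2 = 6 * N * 2 ^ j" by simp
  finally show "card {l \<in> wavelet_index d (enat M) (enat N). fst l = j} \<le> (6 * N * 2 ^ j) ^ d" .
qed

lemma finite_wavelet_index [simp, intro]: "finite (wavelet_index d (enat M) (enat N))"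
proof (rule finite_subset)
  show "wavelet_index d (enat M) (enat N) \<subseteq>
    (SIGMA j:{..M}. ({..<d} \<rightarrow>\<^sub>E {-(2 ^ j * int N)..2 ^ j * int N}) \<times> ({..<d} \<rightarrow>\<^sub>E {0,1}))"
  proof
    fix l assume l: "l \<in> wavelet_index d (enat M) (enat N)"
    obtain l1 l2 l3 where e: "l = (l1, l2, l3)" by (cases l)
    show "l \<in> (SIGMA j:{..M}. ({..<d} \<rightarrow>\<^sub>E {-(2 ^ j * int N)..2 ^ j * int N}) \<times> ({..<d} \<rightarrow>\<^sub>E {0,1}))"
      using wavelet_index_level_subset[OF l] l unfolding e by (auto simp: wavelet_index_finite_iff)
  qed
qed (intro finite_SigmaI finite_cartesian_product finite_PiE; simp)

lemma sum_wavelet_levels: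
  "(\<Sum>l\<in>wavelet_index d (enat M) (enat N). u l)
     = (\<Sum>j\<le>M. \<Sum>l | l \<in> wavelet_index d (enat M) (enat N) \<and> fst l = j. u l)"
  by (rule sum.group[symmetric]) (auto simp: wavelet_index_finite_iff)

lemma wavelet_level_indep:
  "j \<le> M \<Longrightarrow> {l. l \<in> wavelet_index d (enat M) (enat N) \<and> fst l = j} = {l. l \<in> wavelet_index d (enat j) (enat N) \<and> fst l = j}"
  by (auto simp: wavelet_index_finite_iff)

text \<open>
  A geometric sum over the levels: the dimension of the coefficient space is of the order of its finest level.
\<close>

lemma card_wavelet_index:
  assumes "N \<ge> 1" "d \<ge> 1"
  shows "real (card (wavelet_index d (enat M) (enat N))) \<le> 2 * (6 * real N) ^ d * 2 ^ (M * d)"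
proof -
  have "card (wavelet_index d (enat M) (enat N)) = (\<Sum>j\<le>M. card {l \<in> wavelet_index d (enat M) (enat N). fst l = j})"
    using sum_wavelet_levels[of "\<lambda>_. 1::nat" d M N] by (simp only: card_eq_sum)
  also have "\<dots> \<le> (\<Sum>j\<le>M. (6 * N * 2 ^ j) ^ d)"
    by (intro sum_mono wavelet_level_card assms)
  finally have "real (card (wavelet_index d (enat M) (enat N))) \<le> real (\<Sum>j\<le>M. (6 * N * 2 ^ j) ^ d)"
    by (simp only: of_nat_le_iff)
  also have "\<dots> = (6 * real N) ^ d * (\<Sum>j\<le>M. 2 ^ (j * d))"
    by (simp add: power_mult_distrib power_mult sum_distrib_left)
  also have "\<dots> \<le> (6 * real N) ^ d * (2 * 2 ^ (M * d))"
  proof (rule mult_left_mono, induction M)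
    case (Suc M)
    have "(2::real) * 2 ^ (M * d) \<le> 2 ^ (Suc M * d)"
      using assms(2) by (simp flip: power_Suc)
    then show ?case using Suc by simp
  qed simp_all
  finally show ?thesis by (simp add: mult_ac)
qed

section \<open>Tensor wavelets and links in a Besov ellipsoid\<close>

lemma wavelet_index_infinite_D:
  assumes "(J, k, e) \<in> wavelet_index d \<infinity> \<infinity>"
  shows "k \<in> {..<d} \<rightarrow>\<^sub>E UNIV" "e \<in> {..<d} \<rightarrow>\<^sub>E {0,1}" "e = (\<lambda>i\<in>{..<d}. 0) \<Longrightarrow> J = 0"
proof -
  have "(J = 0 \<and> k \<in> {..<d} \<rightarrow>\<^sub>E UNIV \<and> e = (\<lambda>i\<in>{..<d}. 0)) \<or>
      (k \<in> {..<d} \<rightarrow>\<^sub>E UNIV \<and> e \<in> {..<d} \<rightarrow>\<^sub>E {0,1} \<and> e \<noteq> (\<lambda>i\<in>{..<d}. 0))"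
    using assms unfolding wavelet_index_def by blast
  then show "k \<in> {..<d} \<rightarrow>\<^sub>E UNIV" "e \<in> {..<d} \<rightarrow>\<^sub>E {0,1}" "e = (\<lambda>i\<in>{..<d}. 0) \<Longrightarrow> J = 0"
    by (elim disjE; simp)+
qed

context two_scale_pair begin

definition tensor :: "nat \<Rightarrow> nat \<Rightarrow> (nat \<Rightarrow> int) \<Rightarrow> (nat \<Rightarrow> nat) \<Rightarrow> rvec \<Rightarrow> real" where
  "tensor d J k e x = (\<Prod>i<d. gen (e i) (2 ^ J * x i - of_int (k i)))"

lemma wavelet_tensor: "wavelet \<phi> \<psi> d (J, k, e) x = 2 powr (real J * real d / 2) * tensor d J k e x"
  by (simp add: wavelet_def tensor_def gen_def)

lemma tensor_cong: "(\<And>i. i < d \<Longrightarrow> k i = k' i \<and> e i = e' i) \<Longrightarrow> tensor d J k e = tensor d J k' e'"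
  unfolding tensor_def by (intro ext prod.cong) auto

lemma tensor_measurable [measurable]: "tensor d J k e \<in> borel_measurable (vec_space d)"
  unfolding tensor_def by (rule borel_measurable_prod) measurable

lemma wavelet_measurable [measurable]: "wavelet \<phi> \<psi> d l \<in> borel_measurable (vec_space d)"
proof -
  obtain J k e where l: "l = (J, k, e)" by (cases l)
  have "wavelet \<phi> \<psi> d l = (\<lambda>x. 2 powr (real J * real d / 2) * tensor d J k e x)"
    unfolding l by (intro ext wavelet_tensor)
  then show ?thesis by simp
qed

lemma tensor_bound: "\<bar>tensor d J k e x\<bar> \<le> L ^ d"
proof -
  have "\<bar>tensor d J k e x\<bar> \<le> (\<Prod>i<d. L)"
    unfolding tensor_def abs_prod by (intro prod_mono) (auto simp: gen_bounded)
  then show ?thesis by simp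
qed

lemma wavelet_abs_le: "\<bar>wavelet \<phi> \<psi> d l x\<bar> \<le> 2 powr (real (fst l) * real d / 2) * L ^ d"
  by (cases l) (auto simp: wavelet_tensor abs_mult intro!: mult_left_mono tensor_bound)

lemma tensor_lipschitz: "\<bar>tensor d J k e x - tensor d J k e y\<bar> \<le> L ^ d * 2 ^ J * (\<Sum>i<d. \<bar>x i - y i\<bar>)"
proof -
  define z where "z x i = gen (e i) (2 ^ J * x i - of_int (k i)) / L" for x i
  have zb: "norm (z x i) \<le> 1" for x i
    using gen_bounded(1) L_pos by (simp add: z_def)
  have t: "tensor d J k e x = L ^ d * (\<Prod>i<d. z x i)" for x
    using L_pos by (simp add: tensor_def z_def prod_dividef)
  have "\<bar>(\<Prod>i<d. z x i) - (\<Prod>i<d. z y i)\<bar> \<le> (\<Sum>i<d. \<bar>z x i - z y i\<bar>)"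
    using norm_prod_diff[of "{..<d}" "z x" "z y"] zb by simp
  also have "\<dots> \<le> (\<Sum>i<d. 2 ^ J * \<bar>x i - y i\<bar>)"
  proof (rule sum_mono)
    fix i
    have "\<bar>z x i - z y i\<bar> = \<bar>gen (e i) (2 ^ J * x i - of_int (k i)) - gen (e i) (2 ^ J * y i - of_int (k i))\<bar> / L"
      using L_pos by (simp add: z_def diff_divide_distrib[symmetric])
    also have "\<dots> \<le> (L * \<bar>(2 ^ J * x i - of_int (k i)) - (2 ^ J * y i - of_int (k i))\<bar>) / L"
      using L_pos by (intro divide_right_mono gen_lipschitz) simp
    also have "\<dots> = 2 ^ J * \<bar>x i - y i\<bar>"
      using L_pos by (simp add: abs_mult flip: right_diff_distrib)
    finally show "\<bar>z x i - z y i\<bar> \<le> 2 ^ J * \<bar>x i - y i\<bar>" .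
  qed
  finally have "L ^ d * \<bar>(\<Prod>i<d. z x i) - (\<Prod>i<d. z y i)\<bar> \<le> L ^ d * (2 ^ J * (\<Sum>i<d. \<bar>x i - y i\<bar>))"
    using L_pos by (intro mult_left_mono) (auto simp: sum_distrib_left)
  then show ?thesis using L_pos unfolding t by (simp add: abs_mult mult.assoc flip: right_diff_distrib)
qed

lemma gen_dilate_integrable: "integrable lborel (\<lambda>x. gen s (2 ^ J * x - of_int a))"
  using gen_affine_integrable[of "2 ^ J" "\<lambda>_. 1" s "of_int a"] by (simp add: continuous_intros)

lemma tensor_integrable: "integrable (leb d) (tensor d J k e)"
  unfolding leb_def tensor_def[abs_def]
  by (rule lborel_prod.product_integrable_prod) (auto intro: gen_dilate_integrable)

lemma tensor_mult: "tensor d J k e x * tensor d I l e' x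
    = (\<Prod>i<d. gen (e i) (2 ^ J * x i - of_int (k i)) * gen (e' i) (2 ^ I * x i - of_int (l i)))"
  by (simp add: tensor_def prod.distrib)

lemma tensor_mult_integrable: "integrable (leb d) (\<lambda>x. tensor d J k e x * tensor d I l e' x)"
  unfolding leb_def tensor_mult
  by (rule lborel_prod.product_integrable_prod) (auto intro: scaled_integrable)

lemma tensor_inner: "(\<integral>x. tensor d J k e x * tensor d I l e' x \<partial>leb d)
    = (\<Prod>i<d. LBINT y. gen (e i) (2 ^ J * y - of_int (k i)) * gen (e' i) (2 ^ I * y - of_int (l i)))"
  unfolding leb_def tensor_mult
  by (rule lborel_prod.product_integral_prod) (auto intro: scaled_integrable)

lemma wavelet_integrable: "integrable (leb d) (wavelet \<phi> \<psi> d l)"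
proof -
  obtain J k e where l: "l = (J, k, e)" by (cases l)
  have "wavelet \<phi> \<psi> d l = (\<lambda>x. 2 powr (real J * real d / 2) * tensor d J k e x)"
    unfolding l by (intro ext wavelet_tensor)
  then show ?thesis by (simp add: tensor_integrable)
qed

lemma wavelet_mult_integrable: "integrable (leb d) (\<lambda>x. wavelet \<phi> \<psi> d l x * wavelet \<phi> \<psi> d l' x)"
proof -
  obtain J k e I k' e' where l: "l = (J, k, e)" "l' = (I, k', e')" by (cases l, cases l') blast
  have "integrable (leb d) (\<lambda>x. (2 powr (real J * real d / 2) * 2 powr (real I * real d / 2)) * (tensor d J k e x * tensor d I k' e' x))"
    by (intro integrable_mult_right tensor_mult_integrable)
  then show ?thesis unfolding l wavelet_tensor by (simp only: mult_ac)
qed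

text \<open>
  On one level the product of one-dimensional inner products vanishes at any coordinate where the indices
  differ. On different levels the finer index has a coordinate of wavelet type, since pure scaling products occur
  only on level \<open>0\<close>, and there \<open>cross_level_orth\<close> applies.
\<close>

lemma wavelet_orthonormal:
  assumes "l \<in> wavelet_index d \<infinity> \<infinity>" "l' \<in> wavelet_index d \<infinity> \<infinity>"
  shows "(\<integral>x. wavelet \<phi> \<psi> d l x * wavelet \<phi> \<psi> d l' x \<partial>leb d) = (if l = l' then 1 else 0)"
proof -
  obtain J k e I k' e' where l: "l = (J, k, e)" "l' = (I, k', e')" by (cases l, cases l') blast
  note D = wavelet_index_infinite_D[OF assms(1)[unfolded l]] wavelet_index_infinite_D[OF assms(2)[unfolded l]]
  have e01: "e i \<in> {0,1}" "e' i \<in> {0,1}" if "i < d" for i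
    using D(2,5) that by (auto simp: PiE_iff)
  have nz: "\<exists>i<d. e i = 1" if "J \<noteq> 0"
  proof (rule ccontr)
    assume "\<not> (\<exists>i<d. e i = 1)"
    then have "e = (\<lambda>i\<in>{..<d}. 0)" using D(2) by (intro PiE_ext[OF D(2)]) (auto simp: PiE_iff)
    then show False using D(3) that by simp
  qed
  have nz': "\<exists>i<d. e' i = 1" if "I \<noteq> 0"
  proof (rule ccontr)
    assume "\<not> (\<exists>i<d. e' i = 1)"
    then have "e' = (\<lambda>i\<in>{..<d}. 0)" using D(5) by (intro PiE_ext[OF D(5)]) (auto simp: PiE_iff)
    then show False using D(6) that by simp
  qed
  have "(\<integral>x. wavelet \<phi> \<psi> d l x * wavelet \<phi> \<psi> d l' x \<partial>leb d) =
    (\<integral>x. (2 powr (real J * real d / 2) * 2 powr (real I * real d / 2)) * (tensor d J k e x * tensor d I k' e' x) \<partial>leb d)"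
    unfolding l wavelet_tensor by (simp only: mult_ac)
  also have "\<dots> = (2 powr (real J * real d / 2) * 2 powr (real I * real d / 2)) *
     (\<Prod>i<d. LBINT y. gen (e i) (2 ^ J * y - of_int (k i)) * gen (e' i) (2 ^ I * y - of_int (k' i)))"
    by (simp add: tensor_inner)
  also have "\<dots> = (if l = l' then 1 else 0)"
  proof (cases "J = I")
    case True
    have "(\<Prod>i<d. LBINT y. gen (e i) (2 ^ J * y - of_int (k i)) * gen (e' i) (2 ^ I * y - of_int (k' i)))
       = (\<Prod>i<d. if e i = e' i \<and> k i = k' i then 1 / 2 ^ J else 0)"
      using e01 True by (intro prod.cong refl) (simp add: scaled_orth)
    also have "\<dots> = (if l = l' then (1 / 2 ^ J) ^ d else 0)"
    proof (cases "l = l'")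
      case False
      then have "k \<noteq> k' \<or> e \<noteq> e'" using True l by auto
      then have "\<exists>i<d. \<not> (e i = e' i \<and> k i = k' i)"
        using PiE_ext[OF D(1,4)] PiE_ext[OF D(2,5)] by (metis lessThan_iff)
      then have "(\<Prod>i<d. if e i = e' i \<and> k i = k' i then 1 / 2 ^ J else 0 :: real) = 0"
        by (intro prod_zero) auto
      then show ?thesis using False by simp
    qed (use l in simp)
    moreover have "2 powr (real J * real d / 2) * 2 powr (real J * real d / 2) * (1 / 2 ^ J) ^ d = (1::real)"
    proof -
      have "2 powr (real J * real d / 2) * 2 powr (real J * real d / 2) = (2::real) powr (real (J * d))"
        by (simp flip: powr_add)
      also have "\<dots> = 2 ^ (J * d)" by (rule powr_realpow) simp
      finally show ?thesis by (simp add: power_mult power_divide)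
    qed
    ultimately show ?thesis using True by simp
  next
    case False
    have "(\<Prod>i<d. LBINT y. gen (e i) (2 ^ J * y - of_int (k i)) * gen (e' i) (2 ^ I * y - of_int (k' i))) = 0"
    proof (cases "J < I")
      case True
      then obtain i where i: "i < d" "e' i = 1" using nz' by auto
      then have "(LBINT y. gen (e i) (2 ^ J * y - of_int (k i)) * gen (e' i) (2 ^ I * y - of_int (k' i))) = 0"
        using cross_level_orth[OF True] by (simp add: gen_simps)
      then show ?thesis using i by (intro prod_zero bexI[of _ i]) simp_all
    next
      case F: False
      then have lt: "I < J" using False by simp
      then obtain i where i: "i < d" "e i = 1" using nz by auto
      then have "(LBINT y. gen (e i) (2 ^ J * y - of_int (k i)) * gen (e' i) (2 ^ I * y - of_int (k' i))) = 0"
        using cross_level_orth[OF lt] by (simp add: gen_simps mult.commute)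
      then show ?thesis using i by (intro prod_zero bexI[of _ i]) simp_all
    qed
    then show ?thesis using False l by auto
  qed
  finally show ?thesis .
qed

end

text \<open>
  The box \<open>(- A, A]\<close> in every coordinate is the region where \<open>f\<close> has to be reproduced by its wavelet
  series. The inequality \<open>A + m \<le> N\<close> makes the prior use every wavelet that meets this box.
\<close>

locale besov_link = two_scale_pair +
  fixes d N :: nat and A :: int and \<alpha> \<xi> C :: real and f :: "rvec \<Rightarrow> real"
  assumes A: "A \<ge> 0" and N: "int N \<ge> A + m"
    and C: "C > 0"
    and \<alpha>: "\<alpha> > 2 + real d"
    and f: "f \<in> besov_ellipsoid \<phi> \<psi> \<alpha> 2 d \<xi>"
    and \<xi>: "\<xi> = C / (wavelet_bound \<phi> \<psi> ^ d * 2 * real N powr (real d / 2) * 8 powr (real d / 2))"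
begin

definition \<beta> :: "windex \<Rightarrow> real" where "\<beta> l = (\<integral>x. f x * wavelet \<phi> \<psi> d l x \<partial>leb d)"

abbreviation Z :: "nat \<Rightarrow> windex set" where "Z M \<equiv> wavelet_index d (enat M) (enat N)"

definition trunc :: "nat \<Rightarrow> rvec \<Rightarrow> real" where
  "trunc M x = (\<Sum>l\<in>Z M. \<beta> l * wavelet \<phi> \<psi> d l x)"

lemma N_pos: "N \<ge> 1" using N A m_pos by linarith

lemma f_measurable [measurable]: "f \<in> borel_measurable (vec_space d)"
  using f unfolding besov_ellipsoid_def by (simp cong: measurable_cong_sets add: sets_leb)

lemma f_square_integrable: "integrable (leb d) (\<lambda>x. (f x)\<^sup>2)"
  using f unfolding besov_ellipsoid_def by simp

lemma \<xi>_pos: "\<xi> > 0"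
  using \<xi> C L_pos N_pos by simp

lemma energy_le:
  assumes "finite S" "S \<subseteq> wavelet_index d \<infinity> \<infinity>"
  shows "(\<Sum>l\<in>S. 2 powr (2 * real (fst l) * \<alpha>) * (\<beta> l)\<^sup>2) \<le> \<xi>\<^sup>2"
proof -
  define t where "t l = 2 powr (2 * real (fst l) * \<alpha>) * \<bar>\<beta> l\<bar> powr 2" for l
  have "t summable_on wavelet_index d \<infinity> \<infinity>" "(\<Sum>\<^sub>\<infinity>l\<in>wavelet_index d \<infinity> \<infinity>. t l) \<le> \<xi> powr 2"
    using f unfolding besov_ellipsoid_def t_def \<beta>_def Let_def by auto
  moreover have "sum t S \<le> (\<Sum>\<^sub>\<infinity>l\<in>wavelet_index d \<infinity> \<infinity>. t l)"
    by (rule finite_sum_le_infsum) (use assms calculation in \<open>auto simp: t_def\<close>)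
  moreover have "t l = 2 powr (2 * real (fst l) * \<alpha>) * (\<beta> l)\<^sup>2" for l
    by (simp add: t_def powr_numeral[of "\<bar>_\<bar>"])
  ultimately show ?thesis using \<xi>_pos by (simp add: powr_numeral)
qed

text \<open>
  Cauchy-Schwarz with weights \<open>2 powr (l1 * \<alpha>)\<close>. Level \<open>j\<close> has at most \<open>(6 * N * 2 ^ j) ^ d\<close> indices, so
  the dual sum has terms \<open>2 powr (j * (2 * d + 2 - 2 * \<alpha>))\<close> up to a constant. For \<open>\<alpha> > 2 + d\<close> they are at most
  \<open>(1 / 4) ^ j\<close>; the radius \<open>\<xi>\<close> absorbs the resulting constant \<open>2 * (8 * N) powr (d / 2)\<close>.
\<close>

lemma coeff_norm_le: "coeff_norm \<phi> \<psi> N d M \<beta> \<le> C"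
proof -
  define a where "a l = 2 powr (real (fst l) * \<alpha>) * \<bar>\<beta> l\<bar>" for l :: windex
  define b where "b l = 2 powr (real (fst l) * (real d / 2 + 1 - \<alpha>))" for l :: windex
  define S where "S = (\<Sum>l\<in>Z M. 2 powr (real (fst l) * (real d / 2 + 1)) * \<bar>\<beta> l\<bar>)"
  have ab: "a l * b l = 2 powr (real (fst l) * (real d / 2 + 1)) * \<bar>\<beta> l\<bar>" for l
    unfolding a_def b_def by (simp add: algebra_simps flip: powr_add)
  have "(\<Sum>l\<in>Z M. (a l)\<^sup>2) = (\<Sum>l\<in>Z M. 2 powr (2 * real (fst l) * \<alpha>) * (\<beta> l)\<^sup>2)"
    by (intro sum.cong refl) (simp add: a_def power_mult_distrib powr_power mult_ac)
  also have "\<dots> \<le> \<xi>\<^sup>2" by (rule energy_le) (use wavelet_index_infinite in auto)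
  finally have a2: "(\<Sum>l\<in>Z M. (a l)\<^sup>2) \<le> \<xi>\<^sup>2" .
  have geo: "(\<Sum>j\<le>M. (1 / 4) ^ j) \<le> (2 - (1/4) ^ M :: real)" for M
  proof (induction M)
    case (Suc M)
    moreover have "0 \<le> (1 / 4 :: real) ^ M" by simp
    ultimately show ?case unfolding sum.atMost_Suc power_Suc by linarith
  qed simp
  have "(\<Sum>l\<in>Z M. (b l)\<^sup>2) = (\<Sum>j\<le>M. \<Sum>l | l \<in> Z M \<and> fst l = j. (b l)\<^sup>2)"
    by (rule sum_wavelet_levels)
  also have "\<dots> \<le> (\<Sum>j\<le>M. (6 * real N) ^ d * (1 / 4) ^ j)"
  proof (rule sum_mono)
    fix j
    have "(\<Sum>l | l \<in> Z M \<and> fst l = j. (b l)\<^sup>2)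
        = real (card {l. l \<in> Z M \<and> fst l = j}) * 2 powr (real j * (real d + 2 - 2 * \<alpha>))"
      by (simp add: b_def powr_power algebra_simps)
    also have "\<dots> \<le> (6 * real N * 2 ^ j) ^ d * 2 powr (real j * (real d + 2 - 2 * \<alpha>))"
    proof (rule mult_right_mono)
      have "real (card {l. l \<in> Z M \<and> fst l = j}) \<le> real ((6 * N * 2 ^ j) ^ d)"
        using wavelet_level_card[OF N_pos, of d M j] by (simp only: of_nat_le_iff)
      then show "real (card {l. l \<in> Z M \<and> fst l = j}) \<le> (6 * real N * 2 ^ j) ^ d" by simp
    qed simp
    also have "\<dots> = (6 * real N) ^ d * (2 powr (real (j * d)) * 2 powr (real j * (real d + 2 - 2 * \<alpha>)))"
      by (simp add: power_mult_distrib powr_realpow power_mult del: of_nat_mult)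
    also have "\<dots> = (6 * real N) ^ d * 2 powr (real j * (2 * real d + 2 - 2 * \<alpha>))"
      by (simp add: algebra_simps flip: powr_add)
    also have "\<dots> \<le> (6 * real N) ^ d * 2 powr (real j * (- 2))"
      using \<alpha> by (intro mult_left_mono powr_mono mult_left_mono) auto
    also have "2 powr (real j * (- 2)) = (1 / 4 :: real) ^ j"
    proof -
      have "2 powr (real j * (- 2)) = (2 powr (- 2) :: real) ^ j" by (simp add: powr_power mult.commute)
      also have "2 powr (- 2) = (1 / 4 :: real)" by (simp add: powr_minus powr_numeral)
      finally show ?thesis .
    qed
    finally show "(\<Sum>l | l \<in> Z M \<and> fst l = j. (b l)\<^sup>2) \<le> (6 * real N) ^ d * (1 / 4) ^ j" .
  qed
  also have "\<dots> \<le> (6 * real N) ^ d * 2"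
    unfolding sum_distrib_left[symmetric]
  proof (rule mult_left_mono)
    have "0 \<le> (1 / 4 :: real) ^ M" by simp
    then show "(\<Sum>j\<le>M. (1 / 4) ^ j) \<le> (2::real)" using geo[of M] by linarith
  qed simp
  also have "\<dots> \<le> (8 * real N) ^ d * 4"
    by (intro mult_mono power_mono) auto
  finally have b2: "(\<Sum>l\<in>Z M. (b l)\<^sup>2) \<le> 4 * (8 * real N) ^ d" by simp
  have "S\<^sup>2 \<le> (\<Sum>l\<in>Z M. (a l)\<^sup>2) * (\<Sum>l\<in>Z M. (b l)\<^sup>2)"
    using Cauchy_Schwarz_ineq_sum[of a b "Z M"] unfolding S_def ab .
  also have "\<dots> \<le> \<xi>\<^sup>2 * (4 * (8 * real N) ^ d)"
    by (intro mult_mono a2 b2) (auto intro: sum_nonneg)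
  also have "\<dots> = (\<xi> * 2 * (real N powr (real d / 2) * 8 powr (real d / 2)))\<^sup>2"
  proof -
    have "(real N powr (real d / 2) * 8 powr (real d / 2))\<^sup>2 = (8 * real N) ^ d"
      using N_pos by (simp add: power_mult_distrib powr_power powr_realpow mult.commute)
    then show ?thesis by (simp add: power_mult_distrib)
  qed
  finally have "S \<le> \<xi> * 2 * (real N powr (real d / 2) * 8 powr (real d / 2))"
    by (rule power2_le_imp_le) (use \<xi>_pos in simp)
  then have "L ^ d * S \<le> L ^ d * (\<xi> * 2 * (real N powr (real d / 2) * 8 powr (real d / 2)))"
    using L_pos by (intro mult_left_mono) auto
  also have "\<dots> = C"
    using L_pos N_pos unfolding \<xi> by simp
  finally show ?thesis unfolding coeff_norm_def S_def .
qed

text \<open>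
  The coefficient norm dominates the supremum norm, which makes the wavelet series converge absolutely
  everywhere.
\<close>

lemma series_abs_le: "(\<Sum>l\<in>Z M. \<bar>\<beta> l * wavelet \<phi> \<psi> d l x\<bar>) \<le> C"
proof -
  have "(\<Sum>l\<in>Z M. \<bar>\<beta> l * wavelet \<phi> \<psi> d l x\<bar>)
      \<le> (\<Sum>l\<in>Z M. L ^ d * (2 powr (real (fst l) * (real d / 2 + 1)) * \<bar>\<beta> l\<bar>))"
  proof (rule sum_mono)
    fix l
    have "\<bar>wavelet \<phi> \<psi> d l x\<bar> \<le> 2 powr (real (fst l) * real d / 2) * L ^ d" by (rule wavelet_abs_le)
    also have "\<dots> \<le> 2 powr (real (fst l) * (real d / 2 + 1)) * L ^ d"
      using L_pos by (intro mult_right_mono powr_mono) (auto simp: algebra_simps)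
    finally have w: "\<bar>wavelet \<phi> \<psi> d l x\<bar> \<le> 2 powr (real (fst l) * (real d / 2 + 1)) * L ^ d" .
    show "\<bar>\<beta> l * wavelet \<phi> \<psi> d l x\<bar> \<le> L ^ d * (2 powr (real (fst l) * (real d / 2 + 1)) * \<bar>\<beta> l\<bar>)"
      using mult_right_mono[OF w abs_ge_zero[of "\<beta> l"]] by (simp add: abs_mult mult_ac)
  qed
  also have "\<dots> = coeff_norm \<phi> \<psi> N d M \<beta>" by (simp add: coeff_norm_def sum_distrib_left)
  finally show ?thesis using coeff_norm_le[of M] by simp
qed

definition level :: "nat \<Rightarrow> rvec \<Rightarrow> real" where
  "level j x = (\<Sum>l | l \<in> Z j \<and> fst l = j. \<beta> l * wavelet \<phi> \<psi> d l x)"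

definition lim_link :: "rvec \<Rightarrow> real" where "lim_link x = (\<Sum>j. level j x)"

lemma trunc_levels: "trunc M x = (\<Sum>j\<le>M. level j x)"
  unfolding trunc_def sum_wavelet_levels level_def
  by (intro sum.cong refl arg_cong2[where f = sum] wavelet_level_indep) auto

lemma level_summable: "summable (\<lambda>j. \<bar>level j x\<bar>)"
proof (rule bounded_imp_summable)
  fix M
  have "(\<Sum>j\<le>M. \<bar>level j x\<bar>) \<le> (\<Sum>j\<le>M. \<Sum>l | l \<in> Z M \<and> fst l = j. \<bar>\<beta> l * wavelet \<phi> \<psi> d l x\<bar>)"
  proof (rule sum_mono)
    fix j assume "j \<in> {..M}"
    then show "\<bar>level j x\<bar> \<le> (\<Sum>l | l \<in> Z M \<and> fst l = j. \<bar>\<beta> l * wavelet \<phi> \<psi> d l x\<bar>)"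
      using wavelet_level_indep[of j M d N] unfolding level_def by (simp add: sum_abs)
  qed
  also have "\<dots> = (\<Sum>l\<in>Z M. \<bar>\<beta> l * wavelet \<phi> \<psi> d l x\<bar>)" by (rule sum_wavelet_levels[symmetric])
  also have "\<dots> \<le> C" by (rule series_abs_le)
  finally show "(\<Sum>j\<le>M. \<bar>level j x\<bar>) \<le> C" .
qed simp

lemma trunc_lim: "(\<lambda>M. trunc M x) \<longlonglongrightarrow> lim_link x"
  unfolding trunc_levels lim_link_def
  using summable_LIMSEQ'[OF summable_rabs_cancel[OF level_summable]] by simp

lemma trunc_bound: "\<bar>trunc M x\<bar> \<le> C"
  unfolding trunc_def by (rule order_trans[OF sum_abs series_abs_le])

lemma lim_link_bound: "\<bar>lim_link x\<bar> \<le> C"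
  by (rule LIMSEQ_le_const2[OF tendsto_rabs[OF trunc_lim]]) (use trunc_bound in auto)

lemma trunc_measurable [measurable]: "trunc M \<in> borel_measurable (vec_space d)"
  unfolding trunc_def by measurable

lemma lim_link_measurable [measurable]: "lim_link \<in> borel_measurable (vec_space d)"
  by (rule borel_measurable_LIMSEQ_real[OF trunc_lim]) measurable

end

section \<open>Completeness of the wavelets on a box\<close>

context besov_link begin

definition resid :: "rvec \<Rightarrow> real" where "resid x = f x - lim_link x"

lemma resid_measurable [measurable]: "resid \<in> borel_measurable (vec_space d)"
  unfolding resid_def by measurable

lemma f_wavelet_integrable: "integrable (leb d) (\<lambda>x. f x * wavelet \<phi> \<psi> d l x)"
proof (rule Bochner_Integration.integrable_bound)
  show "integrable (leb d) (\<lambda>x. (f x)\<^sup>2 + wavelet \<phi> \<psi> d l x * wavelet \<phi> \<psi> d l x)"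
    by (intro Bochner_Integration.integrable_add f_square_integrable wavelet_mult_integrable)
  show "AE x in leb d. norm (f x * wavelet \<phi> \<psi> d l x) \<le> norm ((f x)\<^sup>2 + wavelet \<phi> \<psi> d l x * wavelet \<phi> \<psi> d l x)"
  proof (rule AE_I2)
    fix x
    have "2 * (f x * wavelet \<phi> \<psi> d l x) \<le> (f x)\<^sup>2 + (wavelet \<phi> \<psi> d l x)\<^sup>2"
      using sum_squares_bound[of "f x" "wavelet \<phi> \<psi> d l x"] by simp
    moreover have "- (2 * (f x * wavelet \<phi> \<psi> d l x)) \<le> (f x)\<^sup>2 + (wavelet \<phi> \<psi> d l x)\<^sup>2"
      using sum_squares_bound[of "- f x" "wavelet \<phi> \<psi> d l x"] by simp
    moreover have "0 \<le> (f x)\<^sup>2 + (wavelet \<phi> \<psi> d l x)\<^sup>2" by simp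
    ultimately show "norm (f x * wavelet \<phi> \<psi> d l x) \<le> norm ((f x)\<^sup>2 + wavelet \<phi> \<psi> d l x * wavelet \<phi> \<psi> d l x)"
      unfolding real_norm_def power2_eq_square by linarith
  qed
qed measurable

lemma lim_link_mult_integrable:
  assumes "integrable (leb d) u" shows "integrable (leb d) (\<lambda>x. lim_link x * u x)"
proof (rule Bochner_Integration.integrable_bound)
  show "integrable (leb d) (\<lambda>x. C * u x)" using assms by simp
  have [measurable]: "u \<in> borel_measurable (vec_space d)"
    using borel_measurable_integrable[OF assms] by (simp cong: measurable_cong_sets add: sets_leb)
  show "(\<lambda>x. lim_link x * u x) \<in> borel_measurable (leb d)" by measurable
  show "AE x in leb d. norm (lim_link x * u x) \<le> norm (C * u x)"
    using lim_link_bound C by (auto simp: abs_mult intro!: mult_right_mono)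
qed

text \<open>
  Dominated convergence, with the constant \<open>C\<close> times the integrable wavelet as the dominating function.
\<close>

lemma lim_link_coeff:
  assumes l: "l \<in> Z M0"
  shows "(\<integral>x. lim_link x * wavelet \<phi> \<psi> d l x \<partial>leb d) = \<beta> l"
proof -
  have trunc_coeff: "(\<integral>x. trunc M x * wavelet \<phi> \<psi> d l x \<partial>leb d) = \<beta> l" if M: "M \<ge> M0" for M
  proof -
    have lM: "l \<in> Z M" using l wavelet_index_mono[OF M] by auto
    have "(\<integral>x. trunc M x * wavelet \<phi> \<psi> d l x \<partial>leb d)
        = (\<integral>x. (\<Sum>l'\<in>Z M. \<beta> l' * (wavelet \<phi> \<psi> d l' x * wavelet \<phi> \<psi> d l x)) \<partial>leb d)"
      by (simp only: trunc_def sum_distrib_right mult.assoc)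
    also have "\<dots> = (\<Sum>l'\<in>Z M. \<beta> l' * (\<integral>x. wavelet \<phi> \<psi> d l' x * wavelet \<phi> \<psi> d l x \<partial>leb d))"
      by (simp add: Bochner_Integration.integral_sum wavelet_mult_integrable)
    also have "\<dots> = (\<Sum>l'\<in>Z M. if l' = l then \<beta> l else 0)"
      by (intro sum.cong refl, subst wavelet_orthonormal)
         (use lM wavelet_index_infinite in auto)
    also have "\<dots> = \<beta> l" using lM by simp
    finally show ?thesis .
  qed
  have "(\<lambda>M. \<integral>x. trunc M x * wavelet \<phi> \<psi> d l x \<partial>leb d) \<longlonglongrightarrow> (\<integral>x. lim_link x * wavelet \<phi> \<psi> d l x \<partial>leb d)"
  proof (rule integral_dominated_convergence)
    show "integrable (leb d) (\<lambda>x. C * \<bar>wavelet \<phi> \<psi> d l x\<bar>)"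
      by (intro integrable_mult_right integrable_abs wavelet_integrable)
    show "AE x in leb d. (\<lambda>M. trunc M x * wavelet \<phi> \<psi> d l x) \<longlonglongrightarrow> lim_link x * wavelet \<phi> \<psi> d l x"
      by (intro AE_I2 tendsto_mult trunc_lim tendsto_const)
    show "AE x in leb d. norm (trunc M x * wavelet \<phi> \<psi> d l x) \<le> C * \<bar>wavelet \<phi> \<psi> d l x\<bar>" for M
      using trunc_bound by (auto simp: abs_mult intro!: mult_right_mono)
  qed measurable
  moreover have "(\<lambda>M. \<integral>x. trunc M x * wavelet \<phi> \<psi> d l x \<partial>leb d) \<longlonglongrightarrow> \<beta> l"
    by (rule tendsto_eventually) (use trunc_coeff in \<open>auto simp: eventually_sequentially\<close>)
  ultimately show ?thesis by (rule LIMSEQ_unique)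
qed

lemma tensor_wavelet: "tensor d J k e x = 2 powr (- (real J * real d / 2)) * wavelet \<phi> \<psi> d (J, k, e) x"
  by (simp add: wavelet_tensor powr_minus field_simps)

lemma resid_tensor_integrable: "integrable (leb d) (\<lambda>x. resid x * tensor d J k e x)"
proof -
  have "integrable (leb d) (\<lambda>x. 2 powr (- (real J * real d / 2)) * (f x * wavelet \<phi> \<psi> d (J, k, e) x)
      - lim_link x * tensor d J k e x)"
    by (intro Bochner_Integration.integrable_diff integrable_mult_right f_wavelet_integrable
        lim_link_mult_integrable tensor_integrable)
  then show ?thesis unfolding resid_def tensor_wavelet by (simp add: algebra_simps)
qed

text \<open>
  The function \<open>f\<close> and the limit of its series have the same coefficients for the indices used by the series.
\<close>

lemma resid_wavelet_0:
  assumes "(J, k, e) \<in> Z M"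
  shows "(\<integral>x. resid x * tensor d J k e x \<partial>leb d) = 0"
proof -
  have "(\<integral>x. resid x * tensor d J k e x \<partial>leb d) = (\<integral>x. 2 powr (- (real J * real d / 2)) *
      (f x * wavelet \<phi> \<psi> d (J, k, e) x - lim_link x * wavelet \<phi> \<psi> d (J, k, e) x) \<partial>leb d)"
    unfolding resid_def tensor_wavelet by (intro Bochner_Integration.integral_cong refl) (simp add: algebra_simps)
  also have "\<dots> = 2 powr (- (real J * real d / 2)) *
     ((\<integral>x. f x * wavelet \<phi> \<psi> d (J, k, e) x \<partial>leb d) - (\<integral>x. lim_link x * wavelet \<phi> \<psi> d (J, k, e) x \<partial>leb d))"
    by (simp add: Bochner_Integration.integral_diff f_wavelet_integrable lim_link_mult_integrable wavelet_integrable)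
  also have "\<dots> = 0" using lim_link_coeff[OF assms] by (simp add: \<beta>_def)
  finally show ?thesis .
qed

text \<open>
  Induction on the level. Synthesis in each coordinate writes a scaling product on level \<open>J + 1\<close> through
  scaling products on level \<open>J\<close>, covered by the induction hypothesis, and wavelets on level \<open>J\<close>. The parents
  of a translation of size at most \<open>2 ^ (J + 1) * A + m\<close> have size at most \<open>2 ^ J * A + m\<close>, so the range of
  translations is preserved; it stays within \<open>2 ^ J * N\<close>, where the wavelets belong to the series.
\<close>

lemma resid_scaling_0:
  assumes "\<forall>i<d. \<bar>k i\<bar> \<le> 2 ^ J * A + m"
  shows "(\<integral>x. resid x * tensor d J k (\<lambda>_. 0) x \<partial>leb d) = 0"
  using assms
proof (induction J arbitrary: k)
  case 0
  let ?k = "\<lambda>i\<in>{..<d}. k i" and ?e = "\<lambda>i\<in>{..<d}. 0::nat"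
  have "(0, ?k, ?e) \<in> Z 0"
    using 0 N by (auto simp: wavelet_index_finite_iff)
  from resid_wavelet_0[OF this] show ?case
    by (subst (asm) tensor_cong[where k' = k and e' = "\<lambda>_. 0"]) auto
next
  case (Suc J)
  define B where "B i = {0,1::nat} \<times> parents (k i)" for i
  define a where "a i y = tap (fst y) (k i - 2 * snd y) / sqrt 2" for i and y :: "nat \<times> int"
  have exp: "\<phi> (2 ^ Suc J * z - of_int (k i)) = (\<Sum>y\<in>B i. a i y * gen (fst y) (2 ^ J * z - of_int (snd y)))" for i z
  proof -
    have "\<phi> (2 * (2 ^ J * z) - of_int (k i)) =
       (\<Sum>t\<in>{0,1}. \<Sum>n\<in>parents (k i). tap t (k i - 2 * n) * gen t (2 ^ J * z - of_int n)) / sqrt 2"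
      using synthesis[of "2 ^ J * z" "k i"] by (simp add: field_simps)
    also have "\<dots> = (\<Sum>y\<in>B i. a i y * gen (fst y) (2 ^ J * z - of_int (snd y)))"
      unfolding B_def a_def sum.cartesian_product sum_divide_distrib by (simp add: case_prod_beta)
    finally show ?thesis by (simp add: mult.assoc)
  qed
  have tens: "tensor d (Suc J) k (\<lambda>_. 0) x =
      (\<Sum>q\<in>PiE {..<d} B. (\<Prod>i<d. a i (q i)) * tensor d J (\<lambda>i. snd (q i)) (\<lambda>i. fst (q i)) x)" for x
  proof -
    have "tensor d (Suc J) k (\<lambda>_. 0) x = (\<Prod>i<d. \<Sum>y\<in>B i. a i y * gen (fst y) (2 ^ J * x i - of_int (snd y)))"
      unfolding tensor_def gen_simps exp ..
    also have "\<dots> = (\<Sum>q\<in>PiE {..<d} B. \<Prod>i<d. a i (q i) * gen (fst (q i)) (2 ^ J * x i - of_int (snd (q i))))"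
      by (rule prod_sum_PiE) (auto simp: B_def)
    finally show ?thesis by (simp add: tensor_def prod.distrib)
  qed
  have zero: "(\<integral>x. resid x * tensor d J (\<lambda>i. snd (q i)) (\<lambda>i. fst (q i)) x \<partial>leb d) = 0" if q: "q \<in> PiE {..<d} B" for q
  proof -
    have qB: "fst (q i) \<in> {0,1}" "\<bar>k i - 2 * snd (q i)\<bar> \<le> m" if "i < d" for i
      using q that by (auto simp: B_def parents_def PiE_iff mem_Times_iff)
    have bd: "\<bar>snd (q i)\<bar> \<le> 2 ^ J * A + m" if i: "i < d" for i
    proof -
      have "\<bar>k i\<bar> \<le> 2 * (2 ^ J * A) + m" using Suc.prems i by (simp add: mult.assoc)
      then show ?thesis using qB(2)[OF i] by linarith
    qed
    show ?thesis
    proof (cases "\<forall>i<d. fst (q i) = 0")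
      case True
      then show ?thesis using Suc.IH[of "\<lambda>i. snd (q i)"] bd
        by (subst tensor_cong[where k' = "\<lambda>i. snd (q i)" and e' = "\<lambda>_. 0"]) auto
    next
      case False
      let ?k = "\<lambda>i\<in>{..<d}. snd (q i)" and ?e = "\<lambda>i\<in>{..<d}. fst (q i)"
      have le: "2 ^ J * A + m \<le> 2 ^ J * int N"
      proof -
        have "2 ^ J * (A + m) \<le> 2 ^ J * int N" using N by (intro mult_left_mono) auto
        moreover have "1 * m \<le> 2 ^ J * m" using m_pos by (intro mult_right_mono) auto
        ultimately show ?thesis by (simp add: algebra_simps)
      qed
      have "?e \<noteq> (\<lambda>i\<in>{..<d}. 0)" using False by (auto simp: fun_eq_iff restrict_def)
      moreover have "?e \<in> {..<d} \<rightarrow>\<^sub>E {0,1}" using qB(1) by (intro restrict_PiE_iff[THEN iffD2]) auto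
      moreover have "\<forall>i<d. \<bar>?k i\<bar> \<le> 2 ^ J * int N" using bd le by (auto intro: order_trans)
      ultimately have "(J, ?k, ?e) \<in> Z J"
        by (simp add: wavelet_index_finite_iff)
      from resid_wavelet_0[OF this] show ?thesis
        by (subst (asm) tensor_cong[where k' = "\<lambda>i. snd (q i)" and e' = "\<lambda>i. fst (q i)"]) auto
    qed
  qed
  have "(\<integral>x. resid x * tensor d (Suc J) k (\<lambda>_. 0) x \<partial>leb d) =
      (\<integral>x. (\<Sum>q\<in>PiE {..<d} B. (\<Prod>i<d. a i (q i)) * (resid x * tensor d J (\<lambda>i. snd (q i)) (\<lambda>i. fst (q i)) x)) \<partial>leb d)"
    unfolding tens sum_distrib_left by (simp only: mult.left_commute)
  also have "\<dots> = (\<Sum>q\<in>PiE {..<d} B. (\<Prod>i<d. a i (q i)) * (\<integral>x. resid x * tensor d J (\<lambda>i. snd (q i)) (\<lambda>i. fst (q i)) x \<partial>leb d))"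
    by (simp add: Bochner_Integration.integral_sum resid_tensor_integrable)
  also have "\<dots> = 0" using zero by simp
  finally show ?case .
qed

definition cells :: "nat \<Rightarrow> real \<Rightarrow> int set" where
  "cells J c = {k. - (2 ^ J * of_int A) < (of_int k :: real) \<and> of_int k \<le> 2 ^ J * c}"

text \<open>
  A partial sum of the partition of unity, close to the indicator of \<open>(- A, c]\<close> on fine levels.
\<close>

definition plateau :: "nat \<Rightarrow> real \<Rightarrow> real \<Rightarrow> real" where
  "plateau J c y = (\<Sum>k\<in>cells J c. \<phi> (2 ^ J * y - of_int k))"

lemma cells_bound:
  assumes "c \<le> of_int A" "k \<in> cells J c" shows "\<bar>k\<bar> \<le> 2 ^ J * A"
proof -
  have "2 ^ J * c \<le> 2 ^ J * of_int A" using assms(1) by (intro mult_left_mono) auto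
  moreover have "of_int k \<le> 2 ^ J * c" "- (2 ^ J * of_int A) \<le> (of_int k :: real)"
    using assms(2) by (auto simp: cells_def)
  ultimately have "of_int k \<le> (2 ^ J * of_int A :: real)" "- (2 ^ J * of_int A) \<le> (of_int k :: real)"
    by linarith+
  then have "(of_int k :: real) \<le> of_int (2 ^ J * A)" "of_int (- (2 ^ J * A)) \<le> (of_int k :: real)" by auto
  then show ?thesis unfolding of_int_le_iff by linarith
qed

lemma finite_cells: "c \<le> of_int A \<Longrightarrow> finite (cells J c)"
  by (rule finite_subset[of _ "{-(2 ^ J * A)..2 ^ J * A}"]) (auto dest!: cells_bound simp: abs_le_iff)

text \<open>
  The translates that can be nonzero at \<open>y\<close>; there are at most \<open>2 * m + 1\<close> of them.
\<close>

definition near :: "nat \<Rightarrow> real \<Rightarrow> int set" where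
  "near J y = {k. \<bar>2 ^ J * y - of_int k\<bar> \<le> of_int m}"

lemma near_finite: "finite (near J y)" and near_card: "card (near J y) \<le> nat (2 * m + 1)"
proof -
  have sub: "near J y \<subseteq> {\<lceil>2 ^ J * y\<rceil> - m..\<lfloor>2 ^ J * y\<rfloor> + m}"
  proof
    fix k assume "k \<in> near J y"
    then have "2 ^ J * y \<le> of_int (k + m)" "of_int (k - m) \<le> 2 ^ J * y"
      by (auto simp: near_def abs_le_iff)
    then have "\<lceil>2 ^ J * y\<rceil> \<le> k + m" "k - m \<le> \<lfloor>2 ^ J * y\<rfloor>"
      by (simp_all only: ceiling_le_iff le_floor_iff)
    then show "k \<in> {\<lceil>2 ^ J * y\<rceil> - m..\<lfloor>2 ^ J * y\<rfloor> + m}" by simp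
  qed
  then show "finite (near J y)" by (rule finite_subset) simp
  have "card (near J y) \<le> card {\<lceil>2 ^ J * y\<rceil> - m..\<lfloor>2 ^ J * y\<rfloor> + m}"
    by (rule card_mono[OF _ sub]) simp
  also have "\<dots> \<le> nat (2 * m + 1)"
    using floor_le_ceiling[of "2 ^ J * y"] by (simp del: floor_le_ceiling)
  finally show "card (near J y) \<le> nat (2 * m + 1)" .
qed

lemma plateau_near:
  assumes "c \<le> of_int A"
  shows "plateau J c y = (\<Sum>k\<in>cells J c \<inter> near J y. \<phi> (2 ^ J * y - of_int k))"
  unfolding plateau_def
  by (rule sum.mono_neutral_right) (use finite_cells[OF assms] supp(1) in \<open>auto simp: near_def not_le\<close>)

lemma plateau_bound:
  assumes "c \<le> of_int A"
  shows "\<bar>plateau J c y\<bar> \<le> (2 * of_int m + 1) * L"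
proof -
  have "\<bar>plateau J c y\<bar> \<le> (\<Sum>k\<in>cells J c \<inter> near J y. \<bar>\<phi> (2 ^ J * y - of_int k)\<bar>)"
    unfolding plateau_near[OF assms] by (rule sum_abs)
  also have "\<dots> \<le> (\<Sum>k\<in>cells J c \<inter> near J y. L)"
    using gen_bounded(1)[of 0] by (intro sum_mono) (simp add: gen_simps)
  also have "\<dots> = real (card (cells J c \<inter> near J y)) * L" by simp
  also have "\<dots> \<le> (2 * of_int m + 1) * L"
  proof (rule mult_right_mono)
    have "card (cells J c \<inter> near J y) \<le> nat (2 * m + 1)"
      using card_mono[OF near_finite, of "cells J c \<inter> near J y" J y] near_card[of J y] by auto
    then have "real (card (cells J c \<inter> near J y)) \<le> real (nat (2 * m + 1))" by (simp only: of_nat_le_iff)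
    also have "\<dots> = 2 * of_int m + 1" using m_pos by (subst of_nat_nat) auto
    finally show "real (card (cells J c \<inter> near J y)) \<le> 2 * of_int m + 1" .
  qed (use L_pos in simp)
  finally show ?thesis .
qed

lemma plateau_support:
  assumes "c \<le> of_int A" "\<bar>y\<bar> > of_int (A + m)" shows "plateau J c y = 0"
proof -
  have "cells J c \<inter> near J y = {}"
  proof (rule ccontr)
    assume "cells J c \<inter> near J y \<noteq> {}"
    then obtain k where k: "k \<in> cells J c" "k \<in> near J y" by auto
    have "of_int \<bar>k\<bar> \<le> (of_int (2 ^ J * A) :: real)" using cells_bound[OF assms(1) k(1)] by (simp only: of_int_le_iff)
    then have "\<bar>2 ^ J * y\<bar> \<le> 2 ^ J * of_int A + of_int m" using k(2) unfolding near_def by simp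
    also have "\<dots> \<le> 2 ^ J * of_int A + 2 ^ J * of_int m"
      using m_pos mult_right_mono[of 1 "2 ^ J" "of_int m :: real"] by simp
    finally have "2 ^ J * \<bar>y\<bar> \<le> 2 ^ J * of_int (A + m)" by (simp add: abs_mult algebra_simps)
    then show False using assms(2) by simp
  qed
  then show ?thesis unfolding plateau_near[OF assms(1)] by simp
qed

text \<open>
  Away from the two end points, eventually either all translates that meet \<open>y\<close> are selected, and they
  sum to one, or none of them is.
\<close>

lemma plateau_lim:
  assumes c: "c \<le> of_int A" and y: "y \<noteq> - of_int A" "y \<noteq> c"
  shows "(\<lambda>J. plateau J c y) \<longlonglongrightarrow> indicator {- of_int A<..c} y"
proof -
  have big: "\<forall>\<^sub>F J in sequentially. 2 ^ J * e > of_int m" if "e > 0" for e :: real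
    using that m_pos by real_asymp
  have ev: "\<forall>\<^sub>F J in sequentially. plateau J c y = indicator {- of_int A<..c} y"
  proof (cases "- of_int A < y \<and> y < c")
    case True
    then have "y + of_int A > 0" "c - y > 0" by auto
    from eventually_conj[OF big[OF this(1)] big[OF this(2)]] show ?thesis
    proof eventually_elim
      case (elim J)
      have sub: "near J y \<subseteq> cells J c"
        using elim unfolding near_def cells_def by (auto simp: algebra_simps abs_le_iff)
      obtain T where T: "\<bar>2 ^ J * y\<bar> + of_int m \<le> of_int T" using ex_le_of_int by blast
      have "plateau J c y = (\<Sum>k\<in>near J y. \<phi> (2 ^ J * y - of_int k))"
        unfolding plateau_near[OF c] using sub by (simp add: Int_absorb1)
      also have "\<dots> = (\<Sum>k=-T..T. \<phi> (2 ^ J * y - of_int k))"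
      proof (rule sum.mono_neutral_left)
        show "near J y \<subseteq> {-T..T}"
        proof
          fix k assume "k \<in> near J y"
          then have "\<bar>of_int k\<bar> \<le> (of_int T :: real)" using T unfolding near_def by simp
          then have "of_int \<bar>k\<bar> \<le> (of_int T :: real)" by simp
          then show "k \<in> {-T..T}" by (simp only: of_int_le_iff) auto
        qed
      qed (use supp(1) in \<open>auto simp: near_def not_le\<close>)
      also have "\<dots> = 1" by (rule partition_of_unity[OF T])
      finally show ?case using True by simp
    qed
  next
    case False
    then have "- of_int A - y > 0 \<or> y - c > 0" using y by linarith
    then have "\<forall>\<^sub>F J in sequentially. cells J c \<inter> near J y = {}"
    proof
      assume "- of_int A - y > 0"
      from big[OF this] show ?thesis
        by eventually_elim (auto simp: near_def cells_def algebra_simps abs_le_iff)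
    next
      assume "y - c > 0"
      from big[OF this] show ?thesis
        by eventually_elim (auto simp: near_def cells_def algebra_simps abs_le_iff)
    qed
    moreover have "indicator {- of_int A<..c} y = (0::real)" using False y by auto
    ultimately show ?thesis by (auto simp: plateau_near[OF c] elim!: eventually_mono)
  qed
  then show ?thesis by (rule tendsto_eventually)
qed

end

lemma integral_square_sum_orthonormal:
  fixes b :: "'i \<Rightarrow> 'a \<Rightarrow> real"
  assumes S: "finite S" and b: "\<And>i j. i \<in> S \<Longrightarrow> j \<in> S \<Longrightarrow> integrable M (\<lambda>x. b i x * b j x)"
    and orth: "\<And>i j. i \<in> S \<Longrightarrow> j \<in> S \<Longrightarrow> (\<integral>x. b i x * b j x \<partial>M) = (if i = j then 1 else 0)"
  shows "integrable M (\<lambda>x. (\<Sum>i\<in>S. c i * b i x)\<^sup>2)"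
    and "(\<integral>x. (\<Sum>i\<in>S. c i * b i x)\<^sup>2 \<partial>M) = (\<Sum>i\<in>S. (c i)\<^sup>2)"
proof -
  have eq: "(\<Sum>i\<in>S. c i * b i x)\<^sup>2 = (\<Sum>i\<in>S. \<Sum>j\<in>S. (c i * c j) * (b i x * b j x))" for x
    unfolding power2_eq_square sum_product by (intro sum.cong refl) (simp only: mult_ac)
  show "integrable M (\<lambda>x. (\<Sum>i\<in>S. c i * b i x)\<^sup>2)"
    unfolding eq by (intro Bochner_Integration.integrable_sum integrable_mult_right b)
  have "(\<integral>x. (\<Sum>i\<in>S. c i * b i x)\<^sup>2 \<partial>M) = (\<Sum>i\<in>S. \<Sum>j\<in>S. c i * c j * (\<integral>x. b i x * b j x \<partial>M))"
    unfolding eq using b by (simp add: Bochner_Integration.integral_sum Bochner_Integration.integrable_sum)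
  also have "\<dots> = (\<Sum>i\<in>S. \<Sum>j\<in>S. if j = i then (c i)\<^sup>2 else 0)"
    by (intro sum.cong refl) (simp add: orth power2_eq_square)
  also have "\<dots> = (\<Sum>i\<in>S. (c i)\<^sup>2)" using S by simp
  finally show "(\<integral>x. (\<Sum>i\<in>S. c i * b i x)\<^sup>2 \<partial>M) = (\<Sum>i\<in>S. (c i)\<^sup>2)" .
qed

lemma emeasure_leb_box:
  assumes "\<And>i. i < d \<Longrightarrow> B i \<in> sets borel"
  shows "emeasure (leb d) (PiE {..<d} B) = (\<Prod>i<d. emeasure lborel (B i))"
  unfolding leb_def by (rule lborel_prod.emeasure_PiM) (use assms in auto)

lemma AE_leb_component_neq:
  assumes "i < d" shows "AE x in leb d. x i \<noteq> c"
proof (rule AE_I)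
  let ?B = "PiE {..<d} (\<lambda>j. if j = i then {c} else UNIV)"
  show "{x \<in> space (leb d). \<not> x i \<noteq> c} \<subseteq> ?B" by (auto simp: PiE_iff extensional_def)
  show "?B \<in> sets (leb d)" unfolding leb_def by (rule sets_PiM_I_finite) auto
  show "emeasure (leb d) ?B = 0"
    using assms by (subst emeasure_leb_box) (auto intro!: prod_zero bexI[of _ i])
qed

lemma indicator_PiE:
  assumes "x \<in> {..<d::nat} \<rightarrow>\<^sub>E UNIV"
  shows "indicator (PiE {..<d} B) x = (\<Prod>i<d. indicator (B i) (x i) :: real)"
proof (cases "x \<in> PiE {..<d} B")
  case True
  then show ?thesis by (auto simp: PiE_iff intro!: prod.neutral[symmetric])
next
  case False
  then obtain i where "i < d" "x i \<notin> B i" using assms by (auto simp: PiE_iff)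
  then have "(\<Prod>i<d. indicator (B i) (x i) :: real) = 0"
    by (intro prod_zero bexI[of _ i]) simp_all
  then show ?thesis using False by simp
qed

context besov_link begin

lemma resid_box_integrable:
  "integrable (leb d) (\<lambda>x. resid x * indicator (PiE {..<d} (\<lambda>_. {a..b::real})) x)"
proof -
  let ?B = "PiE {..<d} (\<lambda>_. {a..b::real})"
  have B [measurable]: "?B \<in> sets (leb d)" unfolding leb_def by (rule sets_PiM_I_finite) auto
  then have [measurable]: "?B \<in> sets (vec_space d)" by (simp add: sets_leb)
  have "emeasure (leb d) ?B < \<infinity>"
    by (subst emeasure_leb_box) (auto simp: less_top[symmetric] power_eq_top_ennreal emeasure_lborel_Icc_eq)
  then have ind: "integrable (leb d) (indicator ?B :: _ \<Rightarrow> real)"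
    using B by (intro integrable_real_indicator) auto
  have "integrable (leb d) (\<lambda>x. f x * indicator ?B x)"
  proof (rule Bochner_Integration.integrable_bound)
    show "integrable (leb d) (\<lambda>x. (f x)\<^sup>2 + indicator ?B x)"
      by (intro Bochner_Integration.integrable_add f_square_integrable ind)
    show "AE x in leb d. norm (f x * indicator ?B x) \<le> norm ((f x)\<^sup>2 + indicator ?B x)"
    proof (rule AE_I2)
      fix x
      have "\<bar>f x\<bar> \<le> (f x)\<^sup>2 + 1"
        using zero_le_power2[of "\<bar>f x\<bar> - 1 / 2"] by (simp add: power2_diff) (simp add: field_simps power2_eq_square)
      then show "norm (f x * indicator ?B x) \<le> norm ((f x)\<^sup>2 + indicator ?B x)"
        by (auto split: split_indicator)
    qed
  qed measurable
  then have "integrable (leb d) (\<lambda>x. f x * indicator ?B x - lim_link x * indicator ?B x)"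
    by (intro Bochner_Integration.integrable_diff lim_link_mult_integrable ind)
  then show ?thesis unfolding resid_def by (simp add: left_diff_distrib)
qed

text \<open>
  A product of plateaus is a sum of scaling products, each orthogonal to the residual.
\<close>

lemma resid_plateau_0:
  assumes c: "\<And>i. i < d \<Longrightarrow> c i \<le> of_int A"
  shows "(\<integral>x. resid x * (\<Prod>i<d. plateau J (c i) (x i)) \<partial>leb d) = 0"
proof -
  have e: "(\<Prod>i<d. plateau J (c i) (x i)) = (\<Sum>q\<in>PiE {..<d} (\<lambda>i. cells J (c i)). tensor d J q (\<lambda>_. 0) x)" for x
    unfolding plateau_def tensor_def gen_simps
    by (rule prod_sum_PiE) (use c finite_cells in auto)
  have "(\<integral>x. resid x * (\<Prod>i<d. plateau J (c i) (x i)) \<partial>leb d)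
    = (\<Sum>q\<in>PiE {..<d} (\<lambda>i. cells J (c i)). (\<integral>x. resid x * tensor d J q (\<lambda>_. 0) x \<partial>leb d))"
    unfolding e sum_distrib_left by (simp add: Bochner_Integration.integral_sum resid_tensor_integrable)
  also have "\<dots> = 0"
  proof (intro sum.neutral ballI resid_scaling_0 allI impI)
    fix q i assume "q \<in> PiE {..<d} (\<lambda>i. cells J (c i))" "i < d"
    then have "\<bar>q i\<bar> \<le> 2 ^ J * A" using c by (intro cells_bound[of "c i"]) auto
    then show "\<bar>q i\<bar> \<le> 2 ^ J * A + m" using m_pos by simp
  qed
  finally show ?thesis .
qed

text \<open>
  Products of plateaus converge to the indicator of the box outside finitely many hyperplanes. They are
  bounded and supported in a common box, on which the residual is integrable.
\<close>

lemma resid_cell_0: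
  assumes c: "\<And>i. i < d \<Longrightarrow> c i \<le> of_int A"
  shows "(\<integral>x. resid x * (\<Prod>i<d. indicator {- of_int A<..c i} (x i)) \<partial>leb d) = 0"
proof -
  let ?B = "PiE {..<d} (\<lambda>_. {- of_int (A + m)..of_int (A + m)::real})"
  have [measurable]: "plateau J r \<in> borel_measurable borel" for J r
    unfolding plateau_def using gen_measurable[of 0] unfolding gen_simps by measurable
  have "(\<lambda>J. \<integral>x. resid x * (\<Prod>i<d. plateau J (c i) (x i)) \<partial>leb d) \<longlonglongrightarrow>
      (\<integral>x. resid x * (\<Prod>i<d. indicator {- of_int A<..c i} (x i)) \<partial>leb d)"
  proof (rule integral_dominated_convergence)
    show "integrable (leb d) (\<lambda>x. ((2 * of_int m + 1) * L) ^ d * \<bar>resid x * indicator ?B x\<bar>)"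
      by (intro integrable_mult_right integrable_abs resid_box_integrable)
    have "AE x in leb d. \<forall>i\<in>{..<d}. x i \<noteq> - of_int A"
      by (rule AE_ball_countable') (auto intro: AE_leb_component_neq)
    moreover have "AE x in leb d. \<forall>i\<in>{..<d}. x i \<noteq> c i"
      by (rule AE_ball_countable') (auto intro: AE_leb_component_neq)
    ultimately show "AE x in leb d. (\<lambda>J. resid x * (\<Prod>i<d. plateau J (c i) (x i))) \<longlonglongrightarrow>
        resid x * (\<Prod>i<d. indicator {- of_int A<..c i} (x i))"
      by eventually_elim (intro tendsto_mult tendsto_const tendsto_prod plateau_lim c; auto)
    show "AE x in leb d. norm (resid x * (\<Prod>i<d. plateau J (c i) (x i)))
        \<le> ((2 * of_int m + 1) * L) ^ d * \<bar>resid x * indicator ?B x\<bar>" for J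
    proof (rule AE_I2)
      fix x assume x: "x \<in> space (leb d)"
      have "\<bar>\<Prod>i<d. plateau J (c i) (x i)\<bar> \<le> ((2 * of_int m + 1) * L) ^ d * indicator ?B x"
      proof (cases "x \<in> ?B")
        case True
        have "(\<Prod>i<d. \<bar>plateau J (c i) (x i)\<bar>) \<le> (\<Prod>i<d. (2 * of_int m + 1) * L)"
          using c by (intro prod_mono) (auto intro: plateau_bound)
        then show ?thesis using True by (simp add: abs_prod)
      next
        case False
        then obtain i where "i < d" "\<bar>x i\<bar> > of_int (A + m)"
          using x by (auto simp: PiE_iff abs_le_iff not_le)
        then have "(\<Prod>i<d. plateau J (c i) (x i)) = 0"
          by (intro prod_zero bexI[of _ i] plateau_support c) auto
        then show ?thesis using False by simp
      qed
      then show "norm (resid x * (\<Prod>i<d. plateau J (c i) (x i)))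
        \<le> ((2 * of_int m + 1) * L) ^ d * \<bar>resid x * indicator ?B x\<bar>"
        using mult_left_mono[OF _ abs_ge_zero[of "resid x"]] by (fastforce simp: abs_mult mult_ac)
    qed
  qed measurable
  then have "(\<lambda>J::nat. 0) \<longlonglongrightarrow> (\<integral>x. resid x * (\<Prod>i<d. indicator {- of_int A<..c i} (x i)) \<partial>leb d)"
    by (simp only: resid_plateau_0[OF c])
  then show ?thesis by (rule LIMSEQ_unique[OF _ tendsto_const])
qed

definition box :: "rvec set" where "box = PiE {..<d} (\<lambda>_. {- of_int A<..of_int A::real})"

lemma box_measurable [measurable]: "box \<in> sets (leb d)" "box \<in> sets (vec_space d)"
proof -
  show "box \<in> sets (leb d)" unfolding box_def leb_def by (rule sets_PiM_I_finite) auto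
  then show "box \<in> sets (vec_space d)" by (simp add: sets_leb)
qed

text \<open>
  The sets in \<open>resid_cell_0\<close> are the intersections of the box with orthants.
\<close>

lemma link_eq_limit: "AE x in leb d. x \<in> box \<longrightarrow> f x = lim_link x"
proof -
  let ?v = "\<lambda>x. resid x * indicator box x"
  have eq: "(\<integral>x. indicator (PiE {..<d} (\<lambda>i. {..c i})) x * ?v x \<partial>leb d) = 0" for c
  proof -
    have "(\<integral>x. indicator (PiE {..<d} (\<lambda>i. {..c i})) x * ?v x \<partial>leb d) =
        (\<integral>x. resid x * (\<Prod>i<d. indicator {- of_int A<..min (c i) (of_int A)} (x i)) \<partial>leb d)"
    proof (rule Bochner_Integration.integral_cong[OF refl])
      fix x assume x: "x \<in> space (leb d)"
      have "indicator (PiE {..<d} (\<lambda>i. {..c i})) x * indicator box x = (\<Prod>i<d. indicator {..c i} (x i) * indicator {- of_int A<..of_int A} (x i) :: real)"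
        using x unfolding box_def by (simp add: indicator_PiE prod.distrib)
      also have "\<dots> = (\<Prod>i<d. indicator {- of_int A<..min (c i) (of_int A)} (x i))"
        by (intro prod.cong refl) (auto split: split_indicator)
      finally show "indicator (PiE {..<d} (\<lambda>i. {..c i})) x * ?v x = resid x * (\<Prod>i<d. indicator {- of_int A<..min (c i) (of_int A)} (x i))"
        by simp
    qed
    also have "\<dots> = 0" by (rule resid_cell_0) simp
    finally show ?thesis .
  qed
  have tot: "(\<integral>x. ?v x \<partial>leb d) = 0"
  proof -
    have "(\<integral>x. ?v x \<partial>leb d) = (\<integral>x. resid x * (\<Prod>i<d. indicator {- of_int A<..of_int A} (x i)) \<partial>leb d)"
      by (rule Bochner_Integration.integral_cong[OF refl]) (simp add: box_def indicator_PiE)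
    then show ?thesis using resid_cell_0[of "\<lambda>_. of_int A"] by simp
  qed
  have "integrable (leb d) (\<lambda>x. indicator box x *\<^sub>R (resid x * indicator (PiE {..<d} (\<lambda>_. {- of_int A..of_int A::real})) x))"
    by (intro integrable_mult_indicator resid_box_integrable) measurable
  also have "(\<lambda>x. indicator box x *\<^sub>R (resid x * indicator (PiE {..<d} (\<lambda>_. {- of_int A..of_int A::real})) x)) = ?v"
  proof
    fix x
    have "x \<in> box \<Longrightarrow> x \<in> PiE {..<d} (\<lambda>_. {- of_int A..of_int A::real})"
      by (auto simp: box_def PiE_iff intro: less_imp_le)
    then show "indicator box x *\<^sub>R (resid x * indicator (PiE {..<d} (\<lambda>_. {- of_int A..of_int A::real})) x) = ?v x"
      by (auto split: split_indicator)
  qed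
  finally have "AE x in leb d. ?v x = 0" by (rule AE_0_if_integral_orthants_0[OF _ tot eq])
  then show ?thesis by eventually_elim (auto simp: resid_def)
qed

text \<open>
  By orthonormality the squared distance of two truncations is the energy of the coefficients in between,
  and these carry a factor of at least \<open>2 powr (2 * M * \<alpha>)\<close> in the Besov norm. Fatou's lemma passes to the limit of the
  series, which is \<open>f\<close> on the box.
\<close>

theorem trunc_error:
  "(\<integral>\<^sup>+x. ennreal ((f x - trunc M x)\<^sup>2) * indicator box x \<partial>leb d) \<le> ennreal (2 powr (- 2 * real M * \<alpha>) * \<xi>\<^sup>2)"
proof -
  have step: "(\<integral>\<^sup>+x. ennreal ((trunc M' x - trunc M x)\<^sup>2) \<partial>leb d) \<le> ennreal (2 powr (- 2 * real M * \<alpha>) * \<xi>\<^sup>2)"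
    if M': "M \<le> M'" for M'
  proof -
    let ?D = "Z M' - Z M"
    have D: "finite ?D" "?D \<subseteq> wavelet_index d \<infinity> \<infinity>" using wavelet_index_infinite by auto
    have diff: "trunc M' x - trunc M x = (\<Sum>l\<in>?D. \<beta> l * wavelet \<phi> \<psi> d l x)" for x
      unfolding trunc_def using sum.subset_diff[OF wavelet_index_mono[OF M'], of d N "\<lambda>l. \<beta> l * wavelet \<phi> \<psi> d l x"] by simp
    have orth: "(\<integral>x. wavelet \<phi> \<psi> d i x * wavelet \<phi> \<psi> d j x \<partial>leb d) = (if i = j then 1 else 0)"
      if "i \<in> ?D" "j \<in> ?D" for i j
      using that D(2) by (intro wavelet_orthonormal) auto
    have "(\<integral>\<^sup>+x. ennreal ((trunc M' x - trunc M x)\<^sup>2) \<partial>leb d) = ennreal (\<integral>x. (\<Sum>l\<in>?D. \<beta> l * wavelet \<phi> \<psi> d l x)\<^sup>2 \<partial>leb d)"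
      unfolding diff
      by (intro nn_integral_eq_integral integral_square_sum_orthonormal(1) D wavelet_mult_integrable orth) auto
    also have "(\<integral>x. (\<Sum>l\<in>?D. \<beta> l * wavelet \<phi> \<psi> d l x)\<^sup>2 \<partial>leb d) = (\<Sum>l\<in>?D. (\<beta> l)\<^sup>2)"
      by (intro integral_square_sum_orthonormal(2) D wavelet_mult_integrable orth) auto
    also have "(\<Sum>l\<in>?D. (\<beta> l)\<^sup>2) \<le> (\<Sum>l\<in>?D. 2 powr (- 2 * real M * \<alpha>) * (2 powr (2 * real (fst l) * \<alpha>) * (\<beta> l)\<^sup>2))"
    proof (rule sum_mono)
      fix l assume l: "l \<in> ?D"
      obtain l1 l2 l3 where l123: "l = (l1, l2, l3)" by (cases l)
      have "M \<le> fst l"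
      proof (rule ccontr)
        assume "\<not> M \<le> fst l"
        then have "l1 \<le> M" by (simp add: l123)
        then have "l \<in> Z M" using l unfolding l123 Diff_iff wavelet_index_finite_iff by blast
        then show False using l by blast
      qed
      then have "real M * \<alpha> \<le> real (fst l) * \<alpha>"
        using \<alpha> by (intro mult_right_mono) auto
      then have "0 \<le> - 2 * real M * \<alpha> + 2 * real (fst l) * \<alpha>" by simp
      then have "1 \<le> 2 powr (- 2 * real M * \<alpha>) * (2 powr (2 * real (fst l) * \<alpha>) :: real)"
        unfolding powr_add[symmetric] by (rule ge_one_powr_ge_zero[rotated]) simp
      from mult_right_mono[OF this zero_le_power2[of "\<beta> l"]]
      show "(\<beta> l)\<^sup>2 \<le> 2 powr (- 2 * real M * \<alpha>) * (2 powr (2 * real (fst l) * \<alpha>) * (\<beta> l)\<^sup>2)"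
        by (simp add: mult.assoc)
    qed
    also have "\<dots> \<le> 2 powr (- 2 * real M * \<alpha>) * \<xi>\<^sup>2"
      unfolding sum_distrib_left[symmetric] by (intro mult_left_mono energy_le D) simp
    finally show ?thesis by (simp add: ennreal_leI)
  qed
  have "(\<integral>\<^sup>+x. ennreal ((f x - trunc M x)\<^sup>2) * indicator box x \<partial>leb d)
      \<le> (\<integral>\<^sup>+x. liminf (\<lambda>M'. ennreal ((trunc M' x - trunc M x)\<^sup>2)) \<partial>leb d)"
  proof (rule nn_integral_mono_AE)
    show "AE x in leb d. ennreal ((f x - trunc M x)\<^sup>2) * indicator box x \<le> liminf (\<lambda>M'. ennreal ((trunc M' x - trunc M x)\<^sup>2))"
      using link_eq_limit
    proof eventually_elim
      case (elim x)
      have "(\<lambda>M'. ennreal ((trunc M' x - trunc M x)\<^sup>2)) \<longlonglongrightarrow> ennreal ((lim_link x - trunc M x)\<^sup>2)"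
        by (intro tendsto_ennrealI tendsto_power tendsto_diff trunc_lim tendsto_const)
      then have "liminf (\<lambda>M'. ennreal ((trunc M' x - trunc M x)\<^sup>2)) = ennreal ((lim_link x - trunc M x)\<^sup>2)"
        by (intro lim_imp_Liminf) auto
      then show ?case using elim by (auto split: split_indicator)
    qed
  qed
  also have "\<dots> \<le> liminf (\<lambda>M'. \<integral>\<^sup>+x. ennreal ((trunc M' x - trunc M x)\<^sup>2) \<partial>leb d)"
    by (rule nn_integral_liminf) measurable
  also have "\<dots> \<le> liminf (\<lambda>M'::nat. ennreal (2 powr (- 2 * real M * \<alpha>) * \<xi>\<^sup>2))"
    by (rule Liminf_mono) (use step in \<open>auto simp: eventually_sequentially\<close>)
  also have "\<dots> = ennreal (2 powr (- 2 * real M * \<alpha>) * \<xi>\<^sup>2)" by (intro Liminf_const) simp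
  finally show ?thesis .
qed

end

section \<open>An oracle inequality for Gibbs posteriors\<close>

definition predictor :: "nat \<Rightarrow> nat \<times> rmat \<times> (rvec \<Rightarrow> real) \<Rightarrow> rvec \<Rightarrow> real" where
  "predictor p = (\<lambda>(d, \<Theta>, f) x. f (mat_vec d p \<Theta> x))"

definition loss :: "nat \<Rightarrow> nat \<times> rmat \<times> (rvec \<Rightarrow> real) \<Rightarrow> rvec \<times> real \<Rightarrow> real" where
  "loss p \<theta> z = (snd z - predictor p \<theta> (fst z))\<^sup>2"

lemma emp_risk_eq: "emp_risk n p \<omega> \<theta> = 1 / real n * (\<Sum>i<n. loss p \<theta> (\<omega> i))"
  by (cases \<theta>) (simp add: emp_risk_def loss_def predictor_def)

text \<open>
  Jensen's inequality for the reciprocal on the conditional law given \<open>A\<close>. It follows from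
  \<open>2 \<le> c * exp (- y) + exp y / c\<close>, integrated over \<open>A\<close>, with \<open>c\<close> chosen to balance the first term.
\<close>

lemma (in prob_space) nn_integral_exp_reciprocal:
  assumes g [measurable]: "g \<in> borel_measurable M" and A [measurable]: "A \<in> sets M" and pos: "prob A > 0"
    and int: "integrable M (\<lambda>x. exp (- g x))"
  shows "ennreal (1 / (\<integral>x. exp (- g x) \<partial>M)) \<le> ennreal (1 / (prob A)\<^sup>2) * (\<integral>\<^sup>+x. ennreal (exp (g x)) * indicator A x \<partial>M)"
proof -
  define D where "D = (\<integral>x. exp (- g x) * indicator A x \<partial>M)"
  define E where "E = (\<integral>\<^sup>+x. ennreal (exp (g x)) * indicator A x \<partial>M)"
  have intA: "integrable M (\<lambda>x. exp (- g x) * indicator A x)"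
    using integrable_mult_indicator[OF A int] by (simp add: mult.commute)
  have D_pos: "D > 0"
  proof -
    have "D \<noteq> 0"
    proof
      assume "D = 0"
      then have "AE x in M. exp (- g x) * indicator A x = 0"
        unfolding D_def using integral_nonneg_eq_0_iff_AE[OF intA] by auto
      then have "AE x in M. x \<notin> A" by eventually_elim (auto split: split_indicator_asm)
      moreover have "{x \<in> space M. \<not> x \<notin> A} = A" using sets.sets_into_space[OF A] by auto
      ultimately have "emeasure M A = 0" using AE_iff_measurable[OF A, of "\<lambda>x. x \<notin> A"] by simp
      then have "prob A = 0" by (simp add: measure_def)
      then show False using pos by simp
    qed
    moreover have "D \<ge> 0" unfolding D_def by simp
    ultimately show ?thesis by simp
  qed
  have D_le: "D \<le> (\<integral>x. exp (- g x) \<partial>M)"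
    unfolding D_def by (intro integral_mono intA int) (auto split: split_indicator)
  have D_nn: "(\<integral>\<^sup>+x. ennreal (exp (- g x) * indicator A x) \<partial>M) = ennreal D"
    unfolding D_def by (rule nn_integral_eq_integral[OF intA]) auto
  define c where "c = prob A / D"
  have c: "c > 0" using pos D_pos by (simp add: c_def)
  have amgm: "2 \<le> c * exp (- y) + exp y / c" for y
  proof -
    define u v where "u = sqrt (c * exp (- y))" and "v = sqrt (exp y / c)"
    have "u * v = sqrt ((c * exp (- y)) * (exp y / c))" unfolding u_def v_def by (rule real_sqrt_mult[symmetric])
    also have "(c * exp (- y)) * (exp y / c) = 1" using c by (simp add: exp_minus)
    finally have "u * v = 1" by simp
    moreover have "u\<^sup>2 = c * exp (- y)" "v\<^sup>2 = exp y / c" using c by (auto simp: u_def v_def)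
    moreover have "0 \<le> (u - v)\<^sup>2" by simp
    ultimately show ?thesis by (simp add: power2_diff)
  qed
  have "ennreal (2 * prob A) = (\<integral>\<^sup>+x. 2 * indicator A x \<partial>M)"
    by (simp add: nn_integral_cmult_indicator emeasure_eq_measure ennreal_mult)
  also have "\<dots> \<le> (\<integral>\<^sup>+x. ennreal c * ennreal (exp (- g x) * indicator A x) + ennreal (1 / c) * (ennreal (exp (g x)) * indicator A x) \<partial>M)"
  proof (rule nn_integral_mono)
    fix x
    have "ennreal 2 \<le> ennreal (c * exp (- g x) + exp (g x) / c)" by (intro ennreal_leI amgm)
    also have "\<dots> = ennreal c * ennreal (exp (- g x)) + ennreal (1 / c) * ennreal (exp (g x))"
      using c by (simp add: ennreal_plus[symmetric] ennreal_mult[symmetric] del: ennreal_plus)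
    finally show "2 * indicator A x \<le> ennreal c * ennreal (exp (- g x) * indicator A x) + ennreal (1 / c) * (ennreal (exp (g x)) * indicator A x)"
      by (auto split: split_indicator)
  qed
  also have "\<dots> = ennreal c * ennreal D + ennreal (1 / c) * E"
    unfolding E_def D_nn[symmetric] by (subst nn_integral_add) (auto simp: nn_integral_cmult)
  also have "ennreal c * ennreal D = ennreal (prob A)"
    using D_pos by (simp add: c_def ennreal_mult[symmetric])
  finally have main: "ennreal (2 * prob A) \<le> ennreal (prob A) + ennreal (1 / c) * E" .
  have "ennreal (1 / D) \<le> ennreal (1 / (prob A)\<^sup>2) * E"
  proof (cases E)
    case (real r)
    then have "ennreal (2 * prob A) \<le> ennreal (prob A + 1 / c * r)"
      using main pos c by (simp add: ennreal_mult[symmetric] ennreal_plus[symmetric] del: ennreal_plus)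
    then have "2 * prob A \<le> prob A + 1 / c * r"
      using pos c real by (subst (asm) ennreal_le_iff) auto
    then have "1 / D \<le> 1 / (prob A)\<^sup>2 * r"
      using pos D_pos by (simp add: c_def field_simps power2_eq_square)
    then show ?thesis using real by (simp add: ennreal_mult[symmetric] ennreal_leI)
  next
    case top
    then show ?thesis using pos by (simp add: ennreal_mult_top)
  qed
  moreover have "ennreal (1 / (\<integral>x. exp (- g x) \<partial>M)) \<le> ennreal (1 / D)"
    using D_pos D_le by (intro ennreal_leI divide_left_mono) auto
  ultimately show ?thesis unfolding E_def by (rule order_trans[rotated])
qed

text \<open>
  Here \<open>r0\<close> is a reference loss, \<open>e\<close> the excess of the mean loss, and \<open>s\<close> the inverse temperature per
  observation. The assumptions \<open>lower\<close> and \<open>upper\<close> are one-observation exponential moment bounds; independence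
  raises them to the power \<open>n\<close>.
\<close>

locale gibbs_model = P: prob_space P + prior: prob_space "\<pi>"
  for P :: "(rvec \<times> real) measure" and \<pi> :: "(nat \<times> rmat \<times> (rvec \<Rightarrow> real)) measure" +
  fixes n p :: nat and s lam :: real and r0 :: "rvec \<times> real \<Rightarrow> real"
    and e :: "nat \<times> rmat \<times> (rvec \<Rightarrow> real) \<Rightarrow> real"
  assumes loss_measurable: "(\<lambda>(\<theta>, z). loss p \<theta> z) \<in> borel_measurable (\<pi> \<Otimes>\<^sub>M P)"
    and r0_measurable [measurable]: "r0 \<in> borel_measurable P"
    and e_measurable [measurable]: "e \<in> borel_measurable \<pi>"
    and n_pos: "n > 0" and s_pos: "s > 0" and lam: "lam = s * real n"
    and e_nonneg: "\<And>\<theta>. \<theta> \<in> space \<pi> \<Longrightarrow> e \<theta> \<ge> 0"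
    and lower: "\<And>\<theta>. \<theta> \<in> space \<pi> \<Longrightarrow> (\<integral>\<^sup>+z. ennreal (exp (- s * (loss p \<theta> z - r0 z))) \<partial>P) \<le> ennreal (exp (- s * e \<theta> / 2))"
    and upper: "\<And>\<theta>. \<theta> \<in> space \<pi> \<Longrightarrow> (\<integral>\<^sup>+z. ennreal (exp (s * (loss p \<theta> z - r0 z))) \<partial>P) \<le> ennreal (exp (2 * s * e \<theta>))"
begin

abbreviation S where "S \<equiv> sample_law P n"

sublocale S: prob_space S
  unfolding sample_law_def by (rule prob_space_PiM) (rule P.prob_space_axioms)

lemma lam_pos: "lam > 0" using lam n_pos s_pos by simp

lemma coord_measurable [measurable]: "i < n \<Longrightarrow> (\<lambda>\<omega>. \<omega> i) \<in> measurable S P"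
  unfolding sample_law_def by (rule measurable_component_singleton) simp

lemma loss_sample_measurable [measurable]:
  "i < n \<Longrightarrow> (\<lambda>x. loss p (snd x) (fst x i)) \<in> borel_measurable (S \<Otimes>\<^sub>M \<pi>)"
  using measurable_compose[OF _ loss_measurable, of "\<lambda>x. (snd x, fst x i)" "S \<Otimes>\<^sub>M \<pi>"]
  by (auto simp: measurable_Pair)

lemma emp_risk_measurable [measurable]: "(\<lambda>x. emp_risk n p (fst x) (snd x)) \<in> borel_measurable (S \<Otimes>\<^sub>M \<pi>)"
  unfolding emp_risk_eq by (intro borel_measurable_times borel_measurable_const borel_measurable_sum) auto

lemma emp_risk_sample_measurable [measurable]: "\<omega> \<in> space S \<Longrightarrow> emp_risk n p \<omega> \<in> borel_measurable \<pi>"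
  using measurable_compose[OF measurable_Pair1' emp_risk_measurable, of \<omega>] by simp

lemma emp_risk_nonneg: "emp_risk n p \<omega> \<theta> \<ge> 0"
  unfolding emp_risk_eq by (auto simp: loss_def intro!: sum_nonneg divide_nonneg_nonneg)

definition partition :: "(nat \<Rightarrow> rvec \<times> real) \<Rightarrow> real" where
  "partition \<omega> = (\<integral>\<theta>. exp (- lam * emp_risk n p \<omega> \<theta>) \<partial>\<pi>)"

lemma gibbs_weight_integrable:
  assumes "\<omega> \<in> space S" shows "integrable \<pi> (\<lambda>\<theta>. exp (- lam * emp_risk n p \<omega> \<theta>))"
proof (rule prior.integrable_const_bound[where B = 1])
  show "AE \<theta> in \<pi>. norm (exp (- lam * emp_risk n p \<omega> \<theta>)) \<le> 1"
    using emp_risk_nonneg lam_pos by auto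
qed (use assms in measurable)

lemma partition_pos:
  assumes "\<omega> \<in> space S" shows "partition \<omega> > 0"
  unfolding partition_def
proof (subst prior.integral_less_AE_space[of "\<lambda>_. 0", simplified])
qed (use gibbs_weight_integrable[OF assms] prior.emeasure_space_1 in auto)

lemma partition_measurable [measurable]: "partition \<in> borel_measurable S"
proof -
  have "(\<lambda>x. exp (- lam * emp_risk n p (fst x) (snd x))) \<in> borel_measurable (S \<Otimes>\<^sub>M \<pi>)" by measurable
  then show ?thesis unfolding partition_def[abs_def]
    by (intro prior.borel_measurable_lebesgue_integral) (simp only: case_prod_beta')
qed

abbreviation weight :: "(nat \<Rightarrow> rvec \<times> real) \<Rightarrow> (nat \<times> rmat \<times> (rvec \<Rightarrow> real)) \<Rightarrow> ennreal" where
  "weight \<omega> \<theta> \<equiv> ennreal (exp (- lam * emp_risk n p \<omega> \<theta>) / partition \<omega>)"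

lemma weight_total: "\<omega> \<in> space S \<Longrightarrow> (\<integral>\<^sup>+\<theta>. weight \<omega> \<theta> \<partial>\<pi>) = 1"
  using gibbs_weight_integrable[of \<omega>] partition_pos[of \<omega>]
  by (subst nn_integral_eq_integral) (auto simp: partition_def)

definition kernel where "kernel \<omega> = distr (gibbs \<pi> lam n p \<omega>) (S \<Otimes>\<^sub>M \<pi>) (Pair \<omega>)"

lemma gibbs_eq: "gibbs \<pi> lam n p \<omega> = density \<pi> (weight \<omega>)"
  by (simp add: gibbs_def partition_def)

lemma nn_integral_kernel:
  assumes w: "\<omega> \<in> space S" and G [measurable]: "G \<in> borel_measurable (S \<Otimes>\<^sub>M \<pi>)"
  shows "(\<integral>\<^sup>+x. G x \<partial>kernel \<omega>) = (\<integral>\<^sup>+\<theta>. weight \<omega> \<theta> * G (\<omega>, \<theta>) \<partial>\<pi>)"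
proof -
  have P [measurable]: "Pair \<omega> \<in> measurable \<pi> (S \<Otimes>\<^sub>M \<pi>)" by (rule measurable_Pair1'[OF w])
  have W: "weight \<omega> \<in> borel_measurable \<pi>" using w by measurable
  have "(\<integral>\<^sup>+x. G x \<partial>kernel \<omega>) = (\<integral>\<^sup>+\<theta>. G (\<omega>, \<theta>) \<partial>density \<pi> (weight \<omega>))"
    unfolding kernel_def gibbs_eq by (subst nn_integral_distr) auto
  also have "\<dots> = (\<integral>\<^sup>+\<theta>. weight \<omega> \<theta> * G (\<omega>, \<theta>) \<partial>\<pi>)"
    by (rule nn_integral_density[OF W measurable_compose[OF P G]])
  finally show ?thesis .
qed

lemma prob_kernel: "\<omega> \<in> space S \<Longrightarrow> prob_space (kernel \<omega>)"
  using nn_integral_kernel[of \<omega> "\<lambda>_. 1"] weight_total[of \<omega>]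
  by (intro prob_spaceI) simp

lemma kernel_measurable [measurable]: "kernel \<in> measurable S (subprob_algebra (S \<Otimes>\<^sub>M \<pi>))"
proof (rule measurable_subprob_algebra)
  show "subprob_space (kernel \<omega>)" if "\<omega> \<in> space S" for \<omega>
    using prob_kernel[OF that] by (rule prob_space_imp_subprob_space)
  show "sets (kernel \<omega>) = sets (S \<Otimes>\<^sub>M \<pi>)" for \<omega> by (simp add: kernel_def)
  fix A assume A [measurable]: "A \<in> sets (S \<Otimes>\<^sub>M \<pi>)"
  have eq: "emeasure (kernel \<omega>) A = (\<integral>\<^sup>+\<theta>. weight \<omega> \<theta> * indicator A (\<omega>, \<theta>) \<partial>\<pi>)" if "\<omega> \<in> space S" for \<omega>
    using nn_integral_kernel[OF that, of "indicator A"] A by (simp add: kernel_def)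
  have "(\<lambda>\<omega>. \<integral>\<^sup>+\<theta>. weight \<omega> \<theta> * indicator A (\<omega>, \<theta>) \<partial>\<pi>) \<in> borel_measurable S"
    by (rule prior.borel_measurable_nn_integral) (simp add: case_prod_beta')
  then show "(\<lambda>\<omega>. emeasure (kernel \<omega>) A) \<in> borel_measurable S"
    by (simp only: measurable_cong[OF eq])
qed

abbreviation J where "J \<equiv> joint_law \<pi> lam P n p"

lemma J_eq: "J = S \<bind> kernel"
  unfolding joint_law_def kernel_def ..

lemma sets_J [measurable_cong]: "sets J = sets (S \<Otimes>\<^sub>M \<pi>)"
  unfolding J_eq by (rule sets_bind) (auto simp: kernel_def S.not_empty)

lemma nn_integral_J:
  assumes [measurable]: "G \<in> borel_measurable (S \<Otimes>\<^sub>M \<pi>)"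
  shows "(\<integral>\<^sup>+x. G x \<partial>J) = (\<integral>\<^sup>+\<omega>. \<integral>\<^sup>+\<theta>. weight \<omega> \<theta> * G (\<omega>, \<theta>) \<partial>\<pi> \<partial>S)"
  unfolding J_eq by (subst nn_integral_bind[OF _ kernel_measurable]) (auto intro!: nn_integral_cong simp: nn_integral_kernel)

lemma prob_J: "prob_space J"
  unfolding J_eq
  by (rule S.prob_space_bind[OF _ kernel_measurable]) (auto intro: prob_kernel)

text \<open>
  The sum of the loss differences. It differs from the empirical risk by a factor and by a term free of \<open>\<theta>\<close>,
  which cancels in the Gibbs density.
\<close>

definition gap :: "(nat \<Rightarrow> rvec \<times> real) \<Rightarrow> (nat \<times> rmat \<times> (rvec \<Rightarrow> real)) \<Rightarrow> real" where
  "gap \<omega> \<theta> = (\<Sum>i<n. loss p \<theta> (\<omega> i) - r0 (\<omega> i))"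

lemma gap_measurable [measurable]: "(\<lambda>x. gap (fst x) (snd x)) \<in> borel_measurable (S \<Otimes>\<^sub>M \<pi>)"
  unfolding gap_def by (intro borel_measurable_sum borel_measurable_diff) (auto intro: measurable_compose)

lemma gap_sample_measurable [measurable]: "\<omega> \<in> space S \<Longrightarrow> gap \<omega> \<in> borel_measurable \<pi>"
  using measurable_compose[OF measurable_Pair1' gap_measurable, of \<omega>] by simp

lemma gap_eq: "s * gap \<omega> \<theta> = lam * emp_risk n p \<omega> \<theta> - s * (\<Sum>i<n. r0 (\<omega> i))"
  using n_pos by (simp add: gap_def emp_risk_eq lam sum_subtractf algebra_simps)

lemma nn_integral_exp_gap:
  assumes \<theta>: "\<theta> \<in> space \<pi>" and bd: "(\<integral>\<^sup>+z. ennreal (exp (c * (loss p \<theta> z - r0 z))) \<partial>P) \<le> ennreal (exp b)"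
  shows "(\<integral>\<^sup>+\<omega>. ennreal (exp (c * gap \<omega> \<theta>)) \<partial>S) \<le> ennreal (exp (real n * b))"
proof -
  interpret product_sigma_finite "\<lambda>_::nat. P" ..
  have [measurable]: "loss p \<theta> \<in> borel_measurable P"
    using measurable_compose[OF measurable_Pair1'[OF \<theta>] loss_measurable] by simp
  have "(\<integral>\<^sup>+\<omega>. ennreal (exp (c * gap \<omega> \<theta>)) \<partial>S) = (\<integral>\<^sup>+\<omega>. (\<Prod>i<n. ennreal (exp (c * (loss p \<theta> (\<omega> i) - r0 (\<omega> i))))) \<partial>S)"
    by (simp add: gap_def sum_distrib_left exp_sum prod_ennreal)
  also have "\<dots> = (\<Prod>i<n. \<integral>\<^sup>+z. ennreal (exp (c * (loss p \<theta> z - r0 z))) \<partial>P)"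
    unfolding sample_law_def by (rule product_nn_integral_prod) auto
  also have "\<dots> \<le> (\<Prod>i<n. ennreal (exp b))"
    using bd by (simp only: prod_constant) (rule power_mono, simp_all)
  also have "\<dots> = ennreal (exp (real n * b))" by (simp add: ennreal_power exp_of_nat_mult)
  finally show ?thesis .
qed

text \<open>
  With the normaliser \<open>D\<close> of the centred Gibbs density, \<open>exp (lam * e / 2) * D\<close> has joint integral at most \<open>1\<close>
  by Fubini and \<open>lower\<close>, and \<open>1 / D\<close> has integral at most
  \<open>B = exp (2 * lam * t) / measure \<pi> A\<close> by Jensen and \<open>upper\<close>. The inequality of
  arithmetic and geometric means, weighted by \<open>sqrt B\<close>, bounds the integral of \<open>exp (lam * e / 4)\<close> by
  \<open>sqrt B\<close>, and Markov's inequality concludes.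
\<close>

theorem pac_bayes:
  assumes A [measurable]: "A \<in> sets \<pi>" and A_pos: "measure \<pi> A > 0"
    and t: "\<And>\<theta>. \<theta> \<in> A \<Longrightarrow> e \<theta> \<le> t" and \<delta>: "\<delta> > 0"
  shows "measure J {x \<in> space J. e (snd x) \<le> 2 / lam * ln (1 / measure \<pi> A) + 4 * t + 4 / lam * ln (1 / \<delta>)} \<ge> 1 - \<delta>"
proof -
  interpret J: prob_space J by (rule prob_J)
  interpret SP: pair_sigma_finite S \<pi> ..
  have spJ: "space J = space S \<times> space \<pi>"
    using sets_eq_imp_space_eq[OF sets_J] by (simp add: space_pair_measure)
  define D where "D \<omega> = (\<integral>\<theta>. exp (- (s * gap \<omega> \<theta>)) \<partial>\<pi>)" for \<omega>
  have D_eq: "D \<omega> = exp (s * (\<Sum>i<n. r0 (\<omega> i))) * partition \<omega>" for \<omega>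
  proof -
    have "exp (- (s * gap \<omega> \<theta>)) = exp (s * (\<Sum>i<n. r0 (\<omega> i))) * exp (- lam * emp_risk n p \<omega> \<theta>)" for \<theta>
      unfolding gap_eq by (simp flip: exp_add)
    then show ?thesis by (simp add: D_def partition_def)
  qed
  have D_pos: "D \<omega> > 0" if "\<omega> \<in> space S" for \<omega>
    using partition_pos[OF that] by (simp add: D_eq)
  have [measurable]: "D \<in> borel_measurable S" unfolding D_eq[abs_def] by measurable
  define B where "B = exp (2 * lam * t) / measure \<pi> A"
  have B: "B > 0" using A_pos by (simp add: B_def)
  have intD: "integrable \<pi> (\<lambda>\<theta>. exp (- (s * gap \<omega> \<theta>)))" if "\<omega> \<in> space S" for \<omega>
  proof -
    have "exp (- (s * gap \<omega> \<theta>)) = exp (s * (\<Sum>i<n. r0 (\<omega> i))) * exp (- lam * emp_risk n p \<omega> \<theta>)" for \<theta>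
      unfolding gap_eq by (simp flip: exp_add)
    then show ?thesis using gibbs_weight_integrable[OF that] by simp
  qed
  have "(\<integral>\<^sup>+x. ennreal (exp (lam * e (snd x) / 2) * D (fst x)) \<partial>J) = (\<integral>\<^sup>+\<omega>. \<integral>\<^sup>+\<theta>. ennreal (exp (lam * e \<theta> / 2)) * ennreal (exp (- s * gap \<omega> \<theta>)) \<partial>\<pi> \<partial>S)"
  proof (subst nn_integral_J, measurable, intro nn_integral_cong, goal_cases)
    case (1 \<omega> \<theta>)
    have "exp (- lam * emp_risk n p \<omega> \<theta>) / partition \<omega> * (exp (lam * e \<theta> / 2) * D \<omega>) = exp (lam * e \<theta> / 2) * exp (- (s * gap \<omega> \<theta>))"
      using partition_pos[OF 1(1)] unfolding D_eq gap_eq by (simp add: mult_ac flip: exp_add)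
    then show ?case using partition_pos[OF 1(1)] D_pos[OF 1(1)] by (simp add: ennreal_mult[symmetric])
  qed
  also have "\<dots> = (\<integral>\<^sup>+\<theta>. \<integral>\<^sup>+\<omega>. ennreal (exp (lam * e \<theta> / 2)) * ennreal (exp (- s * gap \<omega> \<theta>)) \<partial>S \<partial>\<pi>)"
    by (rule SP.Fubini'[symmetric]) (simp add: case_prod_beta')
  also have "\<dots> \<le> (\<integral>\<^sup>+\<theta>. 1 \<partial>\<pi>)"
  proof (rule nn_integral_mono)
    fix \<theta> assume \<theta>: "\<theta> \<in> space \<pi>"
    have [measurable]: "(\<lambda>\<omega>. gap \<omega> \<theta>) \<in> borel_measurable S"
      using measurable_compose[OF measurable_Pair2'[OF \<theta>] gap_measurable] by simp
    have "(\<integral>\<^sup>+\<omega>. ennreal (exp (lam * e \<theta> / 2)) * ennreal (exp (- s * gap \<omega> \<theta>)) \<partial>S)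
        = ennreal (exp (lam * e \<theta> / 2)) * (\<integral>\<^sup>+\<omega>. ennreal (exp (- s * gap \<omega> \<theta>)) \<partial>S)"
      by (rule nn_integral_cmult) measurable
    also have "\<dots> \<le> ennreal (exp (lam * e \<theta> / 2)) * ennreal (exp (real n * (- s * e \<theta> / 2)))"
      by (intro mult_left_mono nn_integral_exp_gap \<theta> lower) auto
    also have "\<dots> = 1" by (simp add: ennreal_mult[symmetric] lam flip: exp_add)
    finally show "(\<integral>\<^sup>+\<omega>. ennreal (exp (lam * e \<theta> / 2)) * ennreal (exp (- s * gap \<omega> \<theta>)) \<partial>S) \<le> 1" .
  qed
  also have "\<dots> = 1" by (simp add: prior.emeasure_space_1)
  finally have first: "(\<integral>\<^sup>+x. ennreal (exp (lam * e (snd x) / 2) * D (fst x)) \<partial>J) \<le> 1" .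
  have "(\<integral>\<^sup>+x. ennreal (1 / D (fst x)) \<partial>J) = (\<integral>\<^sup>+\<omega>. ennreal (1 / D \<omega>) \<partial>S)"
  proof (subst nn_integral_J, measurable, intro nn_integral_cong, goal_cases)
    case (1 \<omega>)
    have [measurable]: "weight \<omega> \<in> borel_measurable \<pi>" using 1 by measurable
    have "(\<integral>\<^sup>+\<theta>. weight \<omega> \<theta> * ennreal (1 / D \<omega>) \<partial>\<pi>) = (\<integral>\<^sup>+\<theta>. weight \<omega> \<theta> \<partial>\<pi>) * ennreal (1 / D \<omega>)"
      by (rule nn_integral_multc) measurable
    then show ?case using weight_total[OF 1] by (simp only: fst_conv mult_1)
  qed
  also have "\<dots> \<le> (\<integral>\<^sup>+\<omega>. ennreal (1 / (measure \<pi> A)\<^sup>2) * (\<integral>\<^sup>+\<theta>. ennreal (exp (s * gap \<omega> \<theta>)) * indicator A \<theta> \<partial>\<pi>) \<partial>S)"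
    unfolding D_def by (intro nn_integral_mono prior.nn_integral_exp_reciprocal A_pos A) (auto intro: intD)
  also have "\<dots> = ennreal (1 / (measure \<pi> A)\<^sup>2) * (\<integral>\<^sup>+\<omega>. \<integral>\<^sup>+\<theta>. ennreal (exp (s * gap \<omega> \<theta>)) * indicator A \<theta> \<partial>\<pi> \<partial>S)"
    by (rule nn_integral_cmult) (rule prior.borel_measurable_nn_integral, simp add: case_prod_beta')
  also have "(\<integral>\<^sup>+\<omega>. \<integral>\<^sup>+\<theta>. ennreal (exp (s * gap \<omega> \<theta>)) * indicator A \<theta> \<partial>\<pi> \<partial>S)
     = (\<integral>\<^sup>+\<theta>. \<integral>\<^sup>+\<omega>. ennreal (exp (s * gap \<omega> \<theta>)) * indicator A \<theta> \<partial>S \<partial>\<pi>)"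
    by (rule SP.Fubini'[symmetric]) (simp add: case_prod_beta')
  also have "\<dots> \<le> (\<integral>\<^sup>+\<theta>. ennreal (exp (2 * lam * t)) * indicator A \<theta> \<partial>\<pi>)"
  proof (rule nn_integral_mono)
    fix \<theta> assume \<theta>: "\<theta> \<in> space \<pi>"
    show "(\<integral>\<^sup>+\<omega>. ennreal (exp (s * gap \<omega> \<theta>)) * indicator A \<theta> \<partial>S) \<le> ennreal (exp (2 * lam * t)) * indicator A \<theta>"
    proof (cases "\<theta> \<in> A")
      case True
      have "(\<integral>\<^sup>+\<omega>. ennreal (exp (s * gap \<omega> \<theta>)) \<partial>S) \<le> ennreal (exp (real n * (2 * s * e \<theta>)))"
        by (intro nn_integral_exp_gap \<theta> upper)
      also have "\<dots> \<le> ennreal (exp (2 * lam * t))"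
        using mult_left_mono[OF t[OF True], of "2 * s * real n"] s_pos n_pos by (intro ennreal_leI) (simp add: lam mult_ac)
      finally show ?thesis using True by simp
    qed simp
  qed
  also have "\<dots> = ennreal (exp (2 * lam * t)) * ennreal (measure \<pi> A)"
    by (simp add: nn_integral_cmult_indicator prior.emeasure_eq_measure)
  also have "ennreal (1 / (measure \<pi> A)\<^sup>2) * (ennreal (exp (2 * lam * t)) * ennreal (measure \<pi> A)) = ennreal B"
    using A_pos by (simp add: ennreal_mult[symmetric] B_def power2_eq_square)
  finally have second: "(\<integral>\<^sup>+x. ennreal (1 / D (fst x)) \<partial>J) \<le> ennreal B"
    by (simp add: mult_left_mono)
  have "(\<integral>\<^sup>+x. ennreal (exp (lam * e (snd x) / 4)) \<partial>J)
     \<le> (\<integral>\<^sup>+x. ennreal (sqrt B / 2) * ennreal (exp (lam * e (snd x) / 2) * D (fst x)) + ennreal (1 / (2 * sqrt B)) * ennreal (1 / D (fst x)) \<partial>J)"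
  proof (rule nn_integral_mono)
    fix x assume "x \<in> space J"
    then have x: "fst x \<in> space S" by (auto simp: spJ)
    define a where "a = sqrt B * (exp (lam * e (snd x) / 2) * D (fst x))"
    define b where "b = 1 / (sqrt B * D (fst x))"
    have ab: "a \<ge> 0" "b \<ge> 0" using B D_pos[OF x] by (auto simp: a_def b_def)
    have "a * b = exp (lam * e (snd x) / 4) ^ 2"
      using B D_pos[OF x] by (simp add: a_def b_def flip: exp_double)
    then have "exp (lam * e (snd x) / 4) = sqrt (a * b)" by (metis abs_exp_cancel real_sqrt_abs)
    also have "\<dots> \<le> (a + b) / 2" by (rule arith_geo_mean_sqrt) (use ab in auto)
    also have "\<dots> = sqrt B / 2 * (exp (lam * e (snd x) / 2) * D (fst x)) + 1 / (2 * sqrt B) * (1 / D (fst x))"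
      by (simp add: a_def b_def add_divide_distrib)
    finally have "ennreal (exp (lam * e (snd x) / 4)) \<le> ennreal (sqrt B / 2 * (exp (lam * e (snd x) / 2) * D (fst x)) + 1 / (2 * sqrt B) * (1 / D (fst x)))"
      by (rule ennreal_leI)
    also have "\<dots> = ennreal (sqrt B / 2) * ennreal (exp (lam * e (snd x) / 2) * D (fst x)) + ennreal (1 / (2 * sqrt B)) * ennreal (1 / D (fst x))"
    proof -
      have split: "ennreal (u * X + v * Y) = ennreal u * ennreal X + ennreal v * ennreal Y"
        if "u \<ge> 0" "X \<ge> 0" "v \<ge> 0" "Y \<ge> 0" for u v X Y using that by (simp add: ennreal_mult)
      show ?thesis by (rule split) (use B D_pos[OF x] in auto)
    qed
    finally show "ennreal (exp (lam * e (snd x) / 4)) \<le> \<dots>" .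
  qed
  also have "\<dots> = ennreal (sqrt B / 2) * (\<integral>\<^sup>+x. ennreal (exp (lam * e (snd x) / 2) * D (fst x)) \<partial>J) + ennreal (1 / (2 * sqrt B)) * (\<integral>\<^sup>+x. ennreal (1 / D (fst x)) \<partial>J)"
    by (subst nn_integral_add) (auto simp: nn_integral_cmult)
  also have "\<dots> \<le> ennreal (sqrt B / 2) * 1 + ennreal (1 / (2 * sqrt B)) * ennreal B"
    by (intro add_mono mult_left_mono first second) auto
  also have "\<dots> = ennreal (sqrt B)"
  proof -
    have "sqrt B / 2 + 1 / (2 * sqrt B) * B = sqrt B" using B by (simp add: real_div_sqrt field_simps)
    then show ?thesis using B by (simp add: ennreal_mult[symmetric] ennreal_plus[symmetric] del: ennreal_plus)
  qed
  finally have third: "(\<integral>\<^sup>+x. ennreal (exp (lam * e (snd x) / 4)) \<partial>J) \<le> ennreal (sqrt B)" .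
  let ?thr = "2 / lam * ln (1 / measure \<pi> A) + 4 * t + 4 / lam * ln (1 / \<delta>)"
  have thr: "lam * ?thr / 4 = ln (sqrt B / \<delta>)"
    using lam_pos A_pos \<delta> B by (simp add: B_def ln_div ln_sqrt ln_mult field_simps)
  let ?bad = "{x \<in> space J. \<not> e (snd x) \<le> ?thr}"
  have bad_sets: "?bad \<in> sets J" by measurable
  have "emeasure J ?bad \<le> emeasure J {x \<in> space J. 1 \<le> ennreal (\<delta> / sqrt B) * ennreal (exp (lam * e (snd x) / 4))}"
  proof (rule emeasure_mono)
    show "?bad \<subseteq> {x \<in> space J. 1 \<le> ennreal (\<delta> / sqrt B) * ennreal (exp (lam * e (snd x) / 4))}"
    proof safe
      fix a b assume "\<not> e (snd (a, b)) \<le> ?thr"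
      then have "lam * ?thr / 4 \<le> lam * e b / 4" using lam_pos by (intro divide_right_mono mult_left_mono) auto
      then have "exp (lam * ?thr / 4) \<le> exp (lam * e b / 4)" by simp
      then have "sqrt B / \<delta> \<le> exp (lam * e b / 4)" unfolding thr using B \<delta> by simp
      then have "1 \<le> \<delta> / sqrt B * exp (lam * e b / 4)" using B \<delta> by (simp add: field_simps)
      then show "1 \<le> ennreal (\<delta> / sqrt B) * ennreal (exp (lam * e (snd (a, b)) / 4))"
        using B \<delta> by (simp add: ennreal_mult[symmetric] del: ennreal_1 flip: ennreal_1)
    qed
  qed measurable
  also have "\<dots> \<le> ennreal (\<delta> / sqrt B) * (\<integral>\<^sup>+x. ennreal (exp (lam * e (snd x) / 4)) * indicator (space J) x \<partial>J)"
    by (rule nn_integral_Markov_inequality) measurable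
  also have "(\<integral>\<^sup>+x. ennreal (exp (lam * e (snd x) / 4)) * indicator (space J) x \<partial>J) = (\<integral>\<^sup>+x. ennreal (exp (lam * e (snd x) / 4)) \<partial>J)"
    by (intro nn_integral_cong) auto
  also have "ennreal (\<delta> / sqrt B) * (\<integral>\<^sup>+x. ennreal (exp (lam * e (snd x) / 4)) \<partial>J) \<le> ennreal (\<delta> / sqrt B) * ennreal (sqrt B)"
    by (intro mult_left_mono third) auto
  also have "\<dots> = ennreal \<delta>" using B \<delta> by (simp add: ennreal_mult[symmetric])
  finally have "measure J ?bad \<le> \<delta>"
    using \<delta> by (simp add: J.emeasure_eq_measure)
  moreover have "{x \<in> space J. e (snd x) \<le> ?thr} = space J - ?bad" by auto
  ultimately show ?thesis using J.prob_compl[OF bad_sets] by simp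
qed

end

section \<open>Bernstein noise and the excess risk\<close>

lemma exp_le_quadratic:
  fixes x :: real assumes "x \<ge> 0" shows "exp (- x) \<le> 1 - x + x\<^sup>2"
proof -
  have "1 + x \<le> exp x" by simp
  then have "exp (- x) \<le> 1 / (1 + x)"
    using assms by (simp add: exp_minus inverse_eq_divide frac_le)
  also have "\<dots> \<le> 1 - x + x\<^sup>2"
  proof -
    have "1 \<le> (1 - x + x\<^sup>2) * (1 + x)" using assms by (simp add: algebra_simps power2_eq_square power3_eq_cube[symmetric])
    then show ?thesis using assms by (simp add: divide_le_eq)
  qed
  finally show ?thesis .
qed

lemma exp_remainder_sums: "(\<lambda>k. y ^ (k + 2) / fact (k + 2)) sums (exp y - 1 - y :: real)"
proof -
  have "(\<lambda>k. y ^ k / fact k) sums exp y"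
    using exp_converges[of y] by (simp add: scaleR_conv_of_real divide_inverse mult.commute)
  from sums_split_initial_segment[OF this, of 2] show ?thesis
    by (simp add: numeral_2_eq_2 algebra_simps)
qed

lemma exp_remainder_nonneg: "0 \<le> exp y - 1 - (y::real)"
  using exp_ge_add_one_self[of y] by linarith

text \<open>
  The power series with absolute values, so that moments can be inserted term by term.
\<close>

lemma exp_remainder_le:
  "ennreal (exp y - 1 - y) \<le> (\<Sum>k. ennreal (\<bar>y\<bar> ^ (k + 2) / fact (k + 2)))"
proof -
  have "exp y - 1 - y \<le> exp \<bar>y\<bar> - 1 - \<bar>y\<bar>"
  proof (rule sums_le[OF _ exp_remainder_sums[of y] exp_remainder_sums[of "\<bar>y\<bar>"]])
    show "y ^ (k + 2) / fact (k + 2) \<le> \<bar>y\<bar> ^ (k + 2) / fact (k + 2)" for k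
      unfolding power_abs[symmetric] by (intro divide_right_mono abs_ge_self) simp
  qed
  then have "ennreal (exp y - 1 - y) \<le> ennreal (exp \<bar>y\<bar> - 1 - \<bar>y\<bar>)" by (rule ennreal_leI)
  also have "\<dots> = (\<Sum>k. ennreal (\<bar>y\<bar> ^ (k + 2) / fact (k + 2)))"
    using exp_remainder_sums[of "\<bar>y\<bar>"] by (subst suminf_ennreal2) (auto simp: sums_iff)
  finally show ?thesis .
qed

locale regression =
  fixes P :: "(rvec \<times> real) measure" and p :: nat and F :: "rvec \<Rightarrow> real" and \<sigma> \<Gamma> :: real
  assumes model: "regression_model P p F" and noise: "bernstein_noise P p F \<sigma> \<Gamma>"
    and \<sigma>: "\<sigma> > 0" and \<Gamma>: "\<Gamma> > 0"
begin

sublocale prob_space P using model by (simp add: regression_model_def)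

abbreviation X where "X \<equiv> covariate_algebra P p"

lemma sets_P [measurable_cong]: "sets P = sets (vec_space p \<Otimes>\<^sub>M borel)"
  using model by (simp add: regression_model_def)

lemma F_measurable [measurable]: "F \<in> borel_measurable (vec_space p)"
  using model by (simp add: regression_model_def)

lemma fst_measurable [measurable]: "fst \<in> measurable P (vec_space p)"
  and snd_measurable [measurable]: "snd \<in> borel_measurable P"
  by measurable

lemma subalgebra_X: "subalgebra P X"
  unfolding subalgebra_def covariate_algebra_def
  using sets_image_in_sets[OF refl fst_measurable] by simp

sublocale X: finite_measure_subalgebra P X
  by unfold_locales (rule subalgebra_X)

lemma covariate_measurable:
  assumes "w \<in> measurable (vec_space p) N" shows "(\<lambda>z. w (fst z)) \<in> measurable X N"
proof -
  have "fst \<in> measurable X (vec_space p)"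
    unfolding covariate_algebra_def
    by (rule measurable_vimage_algebra1) (use measurable_space[OF fst_measurable] in auto)
  from measurable_compose[OF this assms] show ?thesis .
qed

definition noise :: "rvec \<times> real \<Rightarrow> real" where "noise z = snd z - F (fst z)"

lemma noise_measurable [measurable]: "noise \<in> borel_measurable P"
  unfolding noise_def by measurable

lemma F_integrable: "integrable P (\<lambda>z. F (fst z))"
proof -
  have i: "integrable P snd" using model by (simp add: regression_model_def)
  have "integrable P (real_cond_exp P X snd)" by (rule X.real_cond_exp_int(1)[OF i])
  moreover have "AE z in P. real_cond_exp P X snd z = F (fst z)"
    using model by (simp add: regression_model_def)
  ultimately show ?thesis by (subst (asm) integrable_cong_AE) auto
qed

lemma noise_integrable: "integrable P noise"
  unfolding noise_def[abs_def] using F_integrable model by (auto simp: regression_model_def)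

lemma noise_uncorrelated:
  assumes w [measurable]: "w \<in> borel_measurable (vec_space p)"
    and int: "integrable P (\<lambda>z. w (fst z) * noise z)"
  shows "(\<integral>z. w (fst z) * noise z \<partial>P) = 0"
proof -
  have "AE z in P. real_cond_exp P X noise z = real_cond_exp P X snd z - real_cond_exp P X (\<lambda>z. F (fst z)) z"
    unfolding noise_def[abs_def] using F_integrable model
    by (intro X.real_cond_exp_diff) (auto simp: regression_model_def)
  moreover have "AE z in P. real_cond_exp P X snd z = F (fst z)"
    using model by (simp add: regression_model_def)
  moreover have "AE z in P. real_cond_exp P X (\<lambda>z. F (fst z)) z = F (fst z)"
    by (rule X.real_cond_exp_F_meas[OF F_integrable covariate_measurable[OF F_measurable]])
  ultimately have z: "AE z in P. w (fst z) * real_cond_exp P X noise z = 0" by eventually_elim simp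
  have "(\<integral>z. w (fst z) * noise z \<partial>P) = (\<integral>z. w (fst z) * real_cond_exp P X noise z \<partial>P)"
    by (rule X.real_cond_exp_intg(2)[OF int covariate_measurable[OF w] noise_measurable, symmetric])
  also have "\<dots> = 0" using z by (subst integral_cong_AE[where g = "\<lambda>_. 0"]) auto
  finally show ?thesis .
qed

lemma noise_moment:
  assumes w [measurable]: "w \<in> borel_measurable (vec_space p)" and k: "k \<ge> 2"
  shows "(\<integral>\<^sup>+z. w (fst z) * ennreal (\<bar>noise z\<bar> ^ k) \<partial>P)
    \<le> (\<integral>\<^sup>+z. w (fst z) * ennreal (fact k / 2 * \<sigma>\<^sup>2 * \<Gamma> ^ (k - 2)) \<partial>P)"
proof -
  have "(\<integral>\<^sup>+z. w (fst z) * ennreal (\<bar>noise z\<bar> ^ k) \<partial>P)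
    = (\<integral>\<^sup>+z. w (fst z) * nn_cond_exp P X (\<lambda>z. ennreal (\<bar>noise z\<bar> ^ k)) z \<partial>P)"
    by (rule X.nn_cond_exp_intg[OF covariate_measurable[OF w], symmetric]) measurable
  also have "\<dots> \<le> (\<integral>\<^sup>+z. w (fst z) * ennreal (fact k / 2 * \<sigma>\<^sup>2 * \<Gamma> ^ (k - 2)) \<partial>P)"
  proof (rule nn_integral_mono_AE)
    have "AE z in P. nn_cond_exp P X (\<lambda>(x, y). ennreal (\<bar>y - F x\<bar> ^ k)) z \<le> ennreal (fact k / 2 * \<sigma>\<^sup>2 * \<Gamma> ^ (k - 2))"
      using noise k unfolding bernstein_noise_def by blast
    then show "AE z in P. w (fst z) * nn_cond_exp P X (\<lambda>z. ennreal (\<bar>noise z\<bar> ^ k)) z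
        \<le> w (fst z) * ennreal (fact k / 2 * \<sigma>\<^sup>2 * \<Gamma> ^ (k - 2))"
      unfolding noise_def by eventually_elim (auto intro!: mult_left_mono simp: case_prod_beta')
  qed
  finally show ?thesis .
qed

lemma noise_square_integrable: "integrable P (\<lambda>z. (noise z)\<^sup>2)"
proof (rule integrableI_nonneg)
  have "(\<integral>\<^sup>+z. ennreal ((noise z)\<^sup>2) \<partial>P) \<le> ennreal (fact 2 / 2 * \<sigma>\<^sup>2)"
    using noise_moment[of "\<lambda>_. 1" 2] by (simp add: emeasure_space_1)
  then show "(\<integral>\<^sup>+z. ennreal ((noise z)\<^sup>2) \<partial>P) < \<infinity>" by (rule le_less_trans) simp
qed auto

text \<open>
  The linear term of the exponential series integrates to zero, because the noise is centred given the
  covariates. By Bernstein's condition the terms of order \<open>k + 2\<close> are at most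
  \<open>\<sigma>\<^sup>2 * a\<^sup>2 / 2 * (\<bar>a\<bar> * \<Gamma>) ^ k\<close>, and the geometric series with ratio at most \<open>1 / 4\<close> has sum at most \<open>4 / 3\<close>.
\<close>

lemma noise_exponential_moment:
  assumes a [measurable]: "a \<in> borel_measurable (vec_space p)" and w [measurable]: "w \<in> borel_measurable (vec_space p)"
    and a_le: "\<And>x. \<bar>a x\<bar> * \<Gamma> \<le> 1 / 4" and w_bd: "\<And>x. 0 \<le> w x" "\<And>x. w x \<le> W"
  shows "(\<integral>\<^sup>+z. ennreal (w (fst z) * exp (a (fst z) * noise z)) \<partial>P)
    \<le> (\<integral>\<^sup>+z. ennreal (w (fst z) * (1 + 2 / 3 * \<sigma>\<^sup>2 * (a (fst z))\<^sup>2)) \<partial>P)"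
proof -
  define R where "R z = w (fst z) * (exp (a (fst z) * noise z) - 1 - a (fst z) * noise z)" for z
  have [measurable]: "R \<in> borel_measurable P" unfolding R_def by measurable
  have R_nonneg: "R z \<ge> 0" for z unfolding R_def by (intro mult_nonneg_nonneg w_bd exp_remainder_nonneg)
  have a_bd: "\<bar>a x\<bar> \<le> 1 / (4 * \<Gamma>)" for x using a_le[of x] \<Gamma> by (simp add: field_simps)
  have a2: "(a x)\<^sup>2 \<le> (1 / (4 * \<Gamma>))\<^sup>2" for x using a_bd[of x] \<Gamma> by (simp add: abs_le_square_iff[symmetric])
  have W0: "W \<ge> 0" using w_bd order_trans by blast
  have bint: "integrable P (\<lambda>z. u (fst z))" if "u \<in> borel_measurable (vec_space p)" "\<And>x. \<bar>u x\<bar> \<le> c" for u :: "rvec \<Rightarrow> real" and c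
    using that by (intro integrable_const_bound[where B = c]) auto
  have R_le: "(\<integral>\<^sup>+z. ennreal (R z) \<partial>P) \<le> (\<integral>\<^sup>+z. ennreal (w (fst z) * (2 / 3 * \<sigma>\<^sup>2 * (a (fst z))\<^sup>2)) \<partial>P)"
  proof -
    have "(\<integral>\<^sup>+z. ennreal (R z) \<partial>P) \<le> (\<integral>\<^sup>+z. (\<Sum>k. ennreal (w (fst z) * \<bar>a (fst z)\<bar> ^ (k + 2) / fact (k + 2)) * ennreal (\<bar>noise z\<bar> ^ (k + 2))) \<partial>P)"
    proof (rule nn_integral_mono)
      fix z
      have "ennreal (R z) = ennreal (w (fst z)) * ennreal (exp (a (fst z) * noise z) - 1 - a (fst z) * noise z)"
        unfolding R_def by (intro ennreal_mult w_bd exp_remainder_nonneg)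
      also have "\<dots> \<le> ennreal (w (fst z)) * (\<Sum>k. ennreal (\<bar>a (fst z) * noise z\<bar> ^ (k + 2) / fact (k + 2)))"
        by (intro mult_left_mono exp_remainder_le) auto
      also have "\<dots> = (\<Sum>k. ennreal (w (fst z)) * ennreal (\<bar>a (fst z) * noise z\<bar> ^ (k + 2) / fact (k + 2)))"
        by (rule ennreal_suminf_cmult[symmetric])
      also have "\<dots> = (\<Sum>k. ennreal (w (fst z) * \<bar>a (fst z)\<bar> ^ (k + 2) / fact (k + 2)) * ennreal (\<bar>noise z\<bar> ^ (k + 2)))"
        using w_bd(1)[of "fst z"]
        by (intro arg_cong[where f = suminf] ext)
           (simp add: ennreal_mult[symmetric] abs_mult power_mult_distrib mult_ac)
      finally show "ennreal (R z) \<le> \<dots>" .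
    qed
    also have "\<dots> = (\<Sum>k. \<integral>\<^sup>+z. ennreal (w (fst z) * \<bar>a (fst z)\<bar> ^ (k + 2) / fact (k + 2)) * ennreal (\<bar>noise z\<bar> ^ (k + 2)) \<partial>P)"
      by (rule nn_integral_suminf) measurable
    also have "\<dots> \<le> (\<Sum>k. \<integral>\<^sup>+z. ennreal (w (fst z) * \<bar>a (fst z)\<bar> ^ (k + 2) / fact (k + 2)) * ennreal (fact (k + 2) / 2 * \<sigma>\<^sup>2 * \<Gamma> ^ k) \<partial>P)"
    proof (intro suminf_le summableI)
      fix k
      show "(\<integral>\<^sup>+z. ennreal (w (fst z) * \<bar>a (fst z)\<bar> ^ (k + 2) / fact (k + 2)) * ennreal (\<bar>noise z\<bar> ^ (k + 2)) \<partial>P)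
        \<le> (\<integral>\<^sup>+z. ennreal (w (fst z) * \<bar>a (fst z)\<bar> ^ (k + 2) / fact (k + 2)) * ennreal (fact (k + 2) / 2 * \<sigma>\<^sup>2 * \<Gamma> ^ k) \<partial>P)"
        using noise_moment[of "\<lambda>x. ennreal (w x * \<bar>a x\<bar> ^ (k + 2) / fact (k + 2))" "k + 2"] by simp
    qed
    also have "\<dots> = (\<integral>\<^sup>+z. (\<Sum>k. ennreal (w (fst z) * \<bar>a (fst z)\<bar> ^ (k + 2) / fact (k + 2)) * ennreal (fact (k + 2) / 2 * \<sigma>\<^sup>2 * \<Gamma> ^ k)) \<partial>P)"
      by (rule nn_integral_suminf[symmetric]) measurable
    also have "\<dots> \<le> (\<integral>\<^sup>+z. ennreal (w (fst z) * (2 / 3 * \<sigma>\<^sup>2 * (a (fst z))\<^sup>2)) \<partial>P)"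
    proof (rule nn_integral_mono)
      fix z
      let ?a = "a (fst z)" and ?w = "w (fst z)"
      have eq: "ennreal (?w * \<bar>?a\<bar> ^ (k + 2) / fact (k + 2)) * ennreal (fact (k + 2) / 2 * \<sigma>\<^sup>2 * \<Gamma> ^ k)
          = ennreal (?w * \<sigma>\<^sup>2 * ?a\<^sup>2 / 2 * (\<bar>?a\<bar> * \<Gamma>) ^ k)" for k
      proof -
        have "?w * \<bar>?a\<bar> ^ (k + 2) / fact (k + 2) * (fact (k + 2) / 2 * \<sigma>\<^sup>2 * \<Gamma> ^ k) = ?w * \<sigma>\<^sup>2 * ?a\<^sup>2 / 2 * (\<bar>?a\<bar> * \<Gamma>) ^ k"
          by (simp add: power_mult_distrib power_add del: fact_Suc) (simp add: power2_eq_square mult_ac)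
        then show ?thesis using w_bd(1)[of "fst z"] \<Gamma> by (subst ennreal_mult[symmetric]) auto
      qed
      have r: "0 \<le> \<bar>?a\<bar> * \<Gamma>" "\<bar>?a\<bar> * \<Gamma> \<le> 1 / 4" using a_le[of "fst z"] \<Gamma> by auto
      have s: "(\<lambda>k. ?w * \<sigma>\<^sup>2 * ?a\<^sup>2 / 2 * (\<bar>?a\<bar> * \<Gamma>) ^ k) sums (?w * \<sigma>\<^sup>2 * ?a\<^sup>2 / 2 * (1 / (1 - \<bar>?a\<bar> * \<Gamma>)))"
        by (intro sums_mult geometric_sums) (use r in auto)
      have "(\<Sum>k. ennreal (?w * \<sigma>\<^sup>2 * ?a\<^sup>2 / 2 * (\<bar>?a\<bar> * \<Gamma>) ^ k)) = ennreal (?w * \<sigma>\<^sup>2 * ?a\<^sup>2 / 2 * (1 / (1 - \<bar>?a\<bar> * \<Gamma>)))"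
        using s w_bd(1)[of "fst z"] \<Gamma> by (subst suminf_ennreal2) (auto simp: sums_iff)
      also have "\<dots> \<le> ennreal (?w * \<sigma>\<^sup>2 * ?a\<^sup>2 / 2 * (4 / 3))"
        using r w_bd(1)[of "fst z"] by (intro ennreal_leI mult_left_mono) (auto simp: field_simps)
      also have "?w * \<sigma>\<^sup>2 * ?a\<^sup>2 / 2 * (4 / 3) = ?w * (2 / 3 * \<sigma>\<^sup>2 * ?a\<^sup>2)" by simp
      finally show "(\<Sum>k. ennreal (?w * \<bar>?a\<bar> ^ (k + 2) / fact (k + 2)) * ennreal (fact (k + 2) / 2 * \<sigma>\<^sup>2 * \<Gamma> ^ k))
        \<le> ennreal (?w * (2 / 3 * \<sigma>\<^sup>2 * ?a\<^sup>2))" unfolding eq .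
    qed
    finally show ?thesis .
  qed
  have quad_int: "integrable P (\<lambda>z. w (fst z) * (2 / 3 * \<sigma>\<^sup>2 * (a (fst z))\<^sup>2))"
    using w_bd a2 W0
    by (intro bint[of "\<lambda>x. w x * (2 / 3 * \<sigma>\<^sup>2 * (a x)\<^sup>2)" "W * (2 / 3 * \<sigma>\<^sup>2 * (1 / (4 * \<Gamma>))\<^sup>2)"])
       (auto simp: abs_mult intro!: mult_mono mult_nonneg_nonneg)
  have R_int: "integrable P R"
  proof (rule integrableI_nonneg)
    have "(\<integral>\<^sup>+z. ennreal (w (fst z) * (2 / 3 * \<sigma>\<^sup>2 * (a (fst z))\<^sup>2)) \<partial>P) < \<infinity>"
      using nn_integral_eq_integral[OF quad_int] w_bd by simp
    then show "(\<integral>\<^sup>+z. ennreal (R z) \<partial>P) < \<infinity>" by (rule le_less_trans[OF R_le])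
  qed (use R_nonneg in auto)
  have R_int_le: "(\<integral>z. R z \<partial>P) \<le> (\<integral>z. w (fst z) * (2 / 3 * \<sigma>\<^sup>2 * (a (fst z))\<^sup>2) \<partial>P)"
    using R_le w_bd R_nonneg
    by (subst (asm) nn_integral_eq_integral[OF R_int], simp, subst (asm) nn_integral_eq_integral[OF quad_int])
       (auto intro!: integral_nonneg)
  have w_int: "integrable P (\<lambda>z. w (fst z))"
    using w_bd by (intro bint[of w W]) auto
  have lin_int: "integrable P (\<lambda>z. (w (fst z) * a (fst z)) * noise z)"
  proof (rule Bochner_Integration.integrable_bound)
    show "integrable P (\<lambda>z. (W * (1 / (4 * \<Gamma>))) * noise z)" by (intro integrable_mult_right noise_integrable)
    show "AE z in P. norm ((w (fst z) * a (fst z)) * noise z) \<le> norm ((W * (1 / (4 * \<Gamma>))) * noise z)"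
    proof (rule AE_I2)
      fix z :: "rvec \<times> real"
      have "w (fst z) * \<bar>a (fst z)\<bar> \<le> W * (1 / (4 * \<Gamma>))"
        using w_bd a_bd W0 by (intro mult_mono) auto
      from mult_right_mono[OF this abs_ge_zero[of "noise z"]]
      show "norm ((w (fst z) * a (fst z)) * noise z) \<le> norm ((W * (1 / (4 * \<Gamma>))) * noise z)"
        using w_bd(1) W0 \<Gamma> by (simp add: abs_mult)
    qed
  qed measurable
  have eq: "w (fst z) * exp (a (fst z) * noise z) = R z + w (fst z) + (w (fst z) * a (fst z)) * noise z" for z
    by (simp add: R_def algebra_simps)
  have "(\<integral>\<^sup>+z. ennreal (w (fst z) * exp (a (fst z) * noise z)) \<partial>P) = ennreal (\<integral>z. w (fst z) * exp (a (fst z) * noise z) \<partial>P)"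
  proof (rule nn_integral_eq_integral)
    show "integrable P (\<lambda>z. w (fst z) * exp (a (fst z) * noise z))"
      unfolding eq by (intro Bochner_Integration.integrable_add R_int w_int lin_int)
  qed (use w_bd in simp)
  also have "(\<integral>z. w (fst z) * exp (a (fst z) * noise z) \<partial>P) = (\<integral>z. R z \<partial>P) + (\<integral>z. w (fst z) \<partial>P) + (\<integral>z. (w (fst z) * a (fst z)) * noise z \<partial>P)"
    unfolding eq using R_int w_int lin_int by simp
  also have "(\<integral>z. (w (fst z) * a (fst z)) * noise z \<partial>P) = 0"
    using lin_int by (intro noise_uncorrelated[where w = "\<lambda>x. w x * a x"]) auto
  also have "(\<integral>z. R z \<partial>P) + (\<integral>z. w (fst z) \<partial>P) + 0 \<le> (\<integral>z. w (fst z) * (1 + 2 / 3 * \<sigma>\<^sup>2 * (a (fst z))\<^sup>2) \<partial>P)"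
    using R_int_le quad_int w_int by (simp add: distrib_left)
  also have "ennreal \<dots> = (\<integral>\<^sup>+z. ennreal (w (fst z) * (1 + 2 / 3 * \<sigma>\<^sup>2 * (a (fst z))\<^sup>2)) \<partial>P)"
    using quad_int w_int w_bd by (subst nn_integral_eq_integral) (auto simp: distrib_left)
  finally show ?thesis by (simp add: ennreal_leI)
qed

text \<open>
  The loss difference is \<open>2 * b * noise + b\<^sup>2\<close> with \<open>b = F - g\<close>. The exponential moment of the noise costs a
  factor \<open>1 + 8 / 3 * (s * \<sigma> * b)\<^sup>2\<close>, which for \<open>8 * s * \<sigma>\<^sup>2 \<le> 1\<close> is at most \<open>1 + s * b\<^sup>2 / 3\<close>. As \<open>s * b\<^sup>2 \<le> 1 / 10\<close>,
  this leaves \<open>1 - s * b\<^sup>2 / 2\<close> and \<open>1 + 2 * s * b\<^sup>2\<close> under the integral.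
\<close>

lemma loss_gap_exponential_moments:
  assumes g [measurable]: "g \<in> borel_measurable (vec_space p)"
    and H: "AE z in P. \<bar>F (fst z) - g (fst z)\<bar> \<le> H" "H \<ge> 1"
    and s: "s > 0" "s * (10 * H\<^sup>2) \<le> 1" "s * (8 * H * \<Gamma>) \<le> 1" "s * (8 * \<sigma>\<^sup>2) \<le> 1"
  defines "e \<equiv> \<integral>z. (F (fst z) - g (fst z))\<^sup>2 \<partial>P"
  shows "(\<integral>\<^sup>+z. ennreal (exp (- s * ((snd z - g (fst z))\<^sup>2 - (noise z)\<^sup>2))) \<partial>P) \<le> ennreal (exp (- s * e / 2))"
    and "(\<integral>\<^sup>+z. ennreal (exp (s * ((snd z - g (fst z))\<^sup>2 - (noise z)\<^sup>2))) \<partial>P) \<le> ennreal (exp (2 * s * e))"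
proof -
  \<comment> \<open>Clipping makes the bound by \<open>H\<close> hold everywhere instead of almost everywhere.\<close>
  define b where "b x = max (- H) (min H (F x - g x))" for x
  have [measurable]: "b \<in> borel_measurable (vec_space p)" unfolding b_def by measurable
  have b_bd: "\<bar>b x\<bar> \<le> H" for x using H(2) by (auto simp: b_def)
  have b_eq: "AE z in P. b (fst z) = F (fst z) - g (fst z)"
    using H(1) by eventually_elim (auto simp: b_def)
  have b2: "(b x)\<^sup>2 \<le> H\<^sup>2" for x using b_bd[of x] H(2) by (simp add: abs_le_square_iff[symmetric])
  define y where "y x = s * (b x)\<^sup>2" for x
  have [measurable]: "y \<in> borel_measurable (vec_space p)" unfolding y_def by measurable
  have y: "0 \<le> y x" "y x \<le> 1 / 10" for x
  proof -
    have "s * (b x)\<^sup>2 \<le> s * H\<^sup>2" using s(1) by (intro mult_left_mono b2) auto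
    then show "y x \<le> 1 / 10" using s(2) by (simp add: y_def)
  qed (use s(1) in \<open>simp add: y_def\<close>)
  have y_int: "integrable P (\<lambda>z. y (fst z))"
    by (rule integrable_const_bound[where B = 1]) (use y in \<open>auto intro!: AE_I2 order_trans[OF y(2)]\<close>)
  have e_eq: "(\<integral>z. y (fst z) \<partial>P) = s * e"
  proof -
    have "(\<integral>z. y (fst z) \<partial>P) = (\<integral>z. s * (F (fst z) - g (fst z))\<^sup>2 \<partial>P)"
    proof (rule integral_cong_AE)
      show "AE z in P. y (fst z) = s * (F (fst z) - g (fst z))\<^sup>2"
        using b_eq by eventually_elim (simp add: y_def)
    qed measurable
    then show ?thesis by (simp add: e_def)
  qed
  have gap: "AE z in P. (snd z - g (fst z))\<^sup>2 - (noise z)\<^sup>2 = 2 * b (fst z) * noise z + (b (fst z))\<^sup>2"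
    using b_eq
  proof eventually_elim
    case (elim z)
    then have g_eq: "g (fst z) = F (fst z) - b (fst z)" by simp
    show ?case unfolding g_eq noise_def by (simp add: power2_eq_square algebra_simps)
  qed
  have a_le: "\<bar>2 * s * b x\<bar> * \<Gamma> \<le> 1 / 4" "\<bar>- 2 * s * b x\<bar> * \<Gamma> \<le> 1 / 4" for x
  proof -
    have "s * (\<bar>b x\<bar> * \<Gamma>) \<le> s * (H * \<Gamma>)" using b_bd[of x] s(1) \<Gamma> by (intro mult_right_mono mult_left_mono) auto
    moreover have "s * (8 * H * \<Gamma>) = 8 * (s * (H * \<Gamma>))" by simp
    moreover have "\<bar>2 * s * b x\<bar> * \<Gamma> = 2 * (s * (\<bar>b x\<bar> * \<Gamma>))" "\<bar>- 2 * s * b x\<bar> * \<Gamma> = 2 * (s * (\<bar>b x\<bar> * \<Gamma>))"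
      using s(1) by (simp_all add: abs_mult)
    ultimately show "\<bar>2 * s * b x\<bar> * \<Gamma> \<le> 1 / 4" "\<bar>- 2 * s * b x\<bar> * \<Gamma> \<le> 1 / 4" using s(3) by linarith+
  qed
  have quad: "2 / 3 * \<sigma>\<^sup>2 * (2 * s * b x)\<^sup>2 \<le> y x / 3" "2 / 3 * \<sigma>\<^sup>2 * (- 2 * s * b x)\<^sup>2 \<le> y x / 3" for x
  proof -
    have "2 / 3 * \<sigma>\<^sup>2 * (2 * s * b x)\<^sup>2 = (s * (8 * \<sigma>\<^sup>2)) * (y x / 3)"
      by (simp add: y_def power2_eq_square)
    also have "\<dots> \<le> 1 * (y x / 3)" using s(4) y(1) by (intro mult_right_mono) auto
    finally show "2 / 3 * \<sigma>\<^sup>2 * (2 * s * b x)\<^sup>2 \<le> y x / 3" by simp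
    then show "2 / 3 * \<sigma>\<^sup>2 * (- 2 * s * b x)\<^sup>2 \<le> y x / 3" by simp
  qed
  have "(\<integral>\<^sup>+z. ennreal (exp (- s * ((snd z - g (fst z))\<^sup>2 - (noise z)\<^sup>2))) \<partial>P)
    = (\<integral>\<^sup>+z. ennreal (exp (- y (fst z)) * exp ((- 2 * s * b (fst z)) * noise z)) \<partial>P)"
  proof (rule nn_integral_cong_AE)
    have *: "exp (- s * (2 * u * v + u\<^sup>2)) = exp (- (s * u\<^sup>2)) * exp ((- 2 * s * u) * v)" for u v
      unfolding exp_add[symmetric] by (simp add: algebra_simps)
    show "AE z in P. ennreal (exp (- s * ((snd z - g (fst z))\<^sup>2 - (noise z)\<^sup>2)))
        = ennreal (exp (- y (fst z)) * exp ((- 2 * s * b (fst z)) * noise z))"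
      using gap by eventually_elim (simp only: * y_def)
  qed
  also have "\<dots> \<le> (\<integral>\<^sup>+z. ennreal (exp (- y (fst z)) * (1 + 2 / 3 * \<sigma>\<^sup>2 * (- 2 * s * b (fst z))\<^sup>2)) \<partial>P)"
    by (rule noise_exponential_moment[where a = "\<lambda>x. - 2 * s * b x" and w = "\<lambda>x. exp (- y x)" and W = 1])
       (measurable, use a_le y in auto)
  also have "\<dots> \<le> (\<integral>\<^sup>+z. ennreal (1 - y (fst z) / 2) \<partial>P)"
  proof (intro nn_integral_mono ennreal_leI)
    fix z
    let ?y = "y (fst z)"
    have "exp (- ?y) * (1 + 2 / 3 * \<sigma>\<^sup>2 * (- 2 * s * b (fst z))\<^sup>2) \<le> exp (- ?y) * exp (?y / 3)"
      using quad(2)[of "fst z"] exp_ge_add_one_self[of "?y / 3"] by (intro mult_left_mono) (linarith, simp)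
    also have "\<dots> = exp (- (2 / 3 * ?y))" by (simp flip: exp_add)
    also have "\<dots> \<le> 1 - 2 / 3 * ?y + (2 / 3 * ?y)\<^sup>2" using y(1) by (intro exp_le_quadratic) simp
    also have "\<dots> \<le> 1 - ?y / 2"
    proof -
      have "?y * ?y \<le> ?y * (1 / 10)" using y by (intro mult_left_mono) auto
      then show ?thesis using y(1)[of "fst z"] by (simp add: power2_eq_square)
    qed
    finally show "exp (- ?y) * (1 + 2 / 3 * \<sigma>\<^sup>2 * (- 2 * s * b (fst z))\<^sup>2) \<le> 1 - ?y / 2" .
  qed
  also have "\<dots> = ennreal (\<integral>z. 1 - y (fst z) / 2 \<partial>P)"
  proof (rule nn_integral_eq_integral)
    show "AE z in P. 0 \<le> 1 - y (fst z) / 2"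
    proof (rule AE_I2)
      fix z show "0 \<le> 1 - y (fst z) / 2" using y(2)[of "fst z"] by simp
    qed
  qed (use y_int in simp)
  also have "(\<integral>z. 1 - y (fst z) / 2 \<partial>P) = 1 - s * e / 2"
    using y_int e_eq by (simp add: prob_space)
  also have "\<dots> \<le> exp (- s * e / 2)" using exp_ge_add_one_self[of "- s * e / 2"] by simp
  finally show "(\<integral>\<^sup>+z. ennreal (exp (- s * ((snd z - g (fst z))\<^sup>2 - (noise z)\<^sup>2))) \<partial>P) \<le> ennreal (exp (- s * e / 2))"
    by (simp add: ennreal_leI)
  have "(\<integral>\<^sup>+z. ennreal (exp (s * ((snd z - g (fst z))\<^sup>2 - (noise z)\<^sup>2))) \<partial>P)
    = (\<integral>\<^sup>+z. ennreal (exp (y (fst z)) * exp ((2 * s * b (fst z)) * noise z)) \<partial>P)"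
  proof (rule nn_integral_cong_AE)
    have *: "exp (s * (2 * u * v + u\<^sup>2)) = exp (s * u\<^sup>2) * exp ((2 * s * u) * v)" for u v
      unfolding exp_add[symmetric] by (simp add: algebra_simps)
    show "AE z in P. ennreal (exp (s * ((snd z - g (fst z))\<^sup>2 - (noise z)\<^sup>2)))
        = ennreal (exp (y (fst z)) * exp ((2 * s * b (fst z)) * noise z))"
      using gap by eventually_elim (simp only: * y_def)
  qed
  also have "\<dots> \<le> (\<integral>\<^sup>+z. ennreal (exp (y (fst z)) * (1 + 2 / 3 * \<sigma>\<^sup>2 * (2 * s * b (fst z))\<^sup>2)) \<partial>P)"
    by (rule noise_exponential_moment[where a = "\<lambda>x. 2 * s * b x" and w = "\<lambda>x. exp (y x)" and W = "exp (1 / 10)"])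
       (measurable, use a_le y in auto)
  also have "\<dots> \<le> (\<integral>\<^sup>+z. ennreal (1 + 2 * y (fst z)) \<partial>P)"
  proof (intro nn_integral_mono ennreal_leI)
    fix z
    let ?y = "y (fst z)"
    have "exp ?y * (1 + 2 / 3 * \<sigma>\<^sup>2 * (2 * s * b (fst z))\<^sup>2) \<le> exp ?y * exp (?y / 3)"
      using quad(1)[of "fst z"] exp_ge_add_one_self[of "?y / 3"] by (intro mult_left_mono) (linarith, simp)
    also have "\<dots> = exp (4 / 3 * ?y)" by (simp flip: exp_add)
    also have "\<dots> \<le> 1 + 4 / 3 * ?y + (4 / 3 * ?y)\<^sup>2" using y[of "fst z"] by (intro exp_bound) auto
    also have "\<dots> \<le> 1 + 2 * ?y"
    proof -
      have "?y * ?y \<le> ?y * (1 / 10)" using y by (intro mult_left_mono) auto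
      then show ?thesis using y(1)[of "fst z"] by (simp add: power2_eq_square)
    qed
    finally show "exp ?y * (1 + 2 / 3 * \<sigma>\<^sup>2 * (2 * s * b (fst z))\<^sup>2) \<le> 1 + 2 * ?y" .
  qed
  also have "\<dots> = ennreal (\<integral>z. 1 + 2 * y (fst z) \<partial>P)"
    by (rule nn_integral_eq_integral) (use y y_int in auto)
  also have "(\<integral>z. 1 + 2 * y (fst z) \<partial>P) = 1 + 2 * s * e"
    using y_int e_eq by (simp add: prob_space)
  also have "\<dots> \<le> exp (2 * s * e)" using exp_ge_add_one_self[of "2 * s * e"] by simp
  finally show "(\<integral>\<^sup>+z. ennreal (exp (s * ((snd z - g (fst z))\<^sup>2 - (noise z)\<^sup>2))) \<partial>P) \<le> ennreal (exp (2 * s * e))"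
    by (simp add: ennreal_leI)
qed

text \<open>
  The cross term vanishes because the noise is centred given the covariates. Finite risk makes the cross
  term integrable.
\<close>

lemma risk_decomposition:
  assumes g [measurable]: "g \<in> borel_measurable (vec_space p)"
    and fin: "(\<integral>\<^sup>+z. ennreal ((snd z - g (fst z))\<^sup>2) \<partial>P) < \<infinity>"
  shows "(\<integral>\<^sup>+z. ennreal ((snd z - g (fst z))\<^sup>2) \<partial>P)
    = (\<integral>\<^sup>+z. ennreal ((noise z)\<^sup>2) \<partial>P) + (\<integral>\<^sup>+z. ennreal ((F (fst z) - g (fst z))\<^sup>2) \<partial>P)"
proof -
  define b where "b x = F x - g x" for x
  have [measurable]: "b \<in> borel_measurable (vec_space p)" unfolding b_def by measurable
  have yb: "snd z - g (fst z) = noise z + b (fst z)" for z by (simp add: noise_def b_def)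
  have tot: "integrable P (\<lambda>z. (noise z + b (fst z))\<^sup>2)"
    using fin unfolding yb by (intro integrableI_nonneg) auto
  have sq: "integrable P (\<lambda>z. (b (fst z))\<^sup>2)"
  proof (rule Bochner_Integration.integrable_bound)
    show "integrable P (\<lambda>z. 2 * (noise z + b (fst z))\<^sup>2 + 2 * (noise z)\<^sup>2)"
      using tot noise_square_integrable by simp
    have "(v::real)\<^sup>2 \<le> 2 * (u + v)\<^sup>2 + 2 * u\<^sup>2" for u v
      using zero_le_power2[of "2 * u + v"] by (simp add: power2_eq_square algebra_simps)
    then show "AE z in P. norm ((b (fst z))\<^sup>2) \<le> norm (2 * (noise z + b (fst z))\<^sup>2 + 2 * (noise z)\<^sup>2)"
      by (auto intro!: AE_I2 simp: abs_of_nonneg)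
  qed measurable
  have cross: "integrable P (\<lambda>z. b (fst z) * noise z)"
  proof -
    have "(\<lambda>z. b (fst z) * noise z) = (\<lambda>z. ((noise z + b (fst z))\<^sup>2 - (noise z)\<^sup>2 - (b (fst z))\<^sup>2) / 2)"
      by (intro ext) (simp add: power2_eq_square algebra_simps)
    then show ?thesis using tot sq noise_square_integrable by simp
  qed
  have "(\<integral>z. (noise z + b (fst z))\<^sup>2 \<partial>P) = (\<integral>z. (noise z)\<^sup>2 + 2 * (b (fst z) * noise z) + (b (fst z))\<^sup>2 \<partial>P)"
    by (intro Bochner_Integration.integral_cong refl) (simp add: power2_eq_square algebra_simps)
  also have "\<dots> = (\<integral>z. (noise z)\<^sup>2 \<partial>P) + (\<integral>z. (b (fst z))\<^sup>2 \<partial>P)"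
    using noise_square_integrable cross sq noise_uncorrelated[OF _ cross] by simp
  finally show ?thesis
    unfolding yb b_def[symmetric] using tot sq noise_square_integrable
    by (simp add: nn_integral_eq_integral ennreal_plus[symmetric] del: ennreal_plus)
qed

lemma mat_vec_measurable:
  assumes "\<Theta> \<in> space (mat_space d p)" shows "mat_vec d p \<Theta> \<in> measurable (vec_space p) (vec_space d)"
  unfolding mat_vec_def vec_space_def by measurable

lemma risk_eq: "risk P p d \<Theta> f = (\<integral>\<^sup>+z. ennreal ((snd z - f (mat_vec d p \<Theta> (fst z)))\<^sup>2) \<partial>P)"
  by (simp add: risk_def case_prod_beta')

text \<open>
  Every competing risk is at least the noise variance, whose subtraction leaves the squared distance to \<open>F\<close>.
\<close>

lemma excess_risk_le:
  assumes f: "(\<lambda>x. f (mat_vec d p \<Theta> x)) \<in> borel_measurable (vec_space p)"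
  shows "excess_risk P p (d, \<Theta>, f) \<le> (\<integral>\<^sup>+z. ennreal ((F (fst z) - f (mat_vec d p \<Theta> (fst z)))\<^sup>2) \<partial>P)"
proof (cases "(\<integral>\<^sup>+z. ennreal ((F (fst z) - f (mat_vec d p \<Theta> (fst z)))\<^sup>2) \<partial>P) = \<infinity>")
  case False
  let ?v = "\<integral>\<^sup>+z. ennreal ((noise z)\<^sup>2) \<partial>P"
  have v_fin: "?v < \<infinity>"
    using noise_square_integrable by (simp add: nn_integral_eq_integral)
  note [measurable] = f
  have "(\<integral>\<^sup>+z. ennreal ((snd z - f (mat_vec d p \<Theta> (fst z)))\<^sup>2) \<partial>P)
    \<le> (\<integral>\<^sup>+z. 2 * ennreal ((noise z)\<^sup>2) + 2 * ennreal ((F (fst z) - f (mat_vec d p \<Theta> (fst z)))\<^sup>2) \<partial>P)"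
  proof (rule nn_integral_mono)
    fix z
    have *: "(u + v)\<^sup>2 \<le> 2 * u\<^sup>2 + 2 * v\<^sup>2" for u v :: real
      using zero_le_power2[of "u - v"] by (simp add: power2_eq_square algebra_simps)
    have "(snd z - f (mat_vec d p \<Theta> (fst z)))\<^sup>2 \<le> 2 * (noise z)\<^sup>2 + 2 * (F (fst z) - f (mat_vec d p \<Theta> (fst z)))\<^sup>2"
      using *[of "noise z" "F (fst z) - f (mat_vec d p \<Theta> (fst z))"] by (simp add: noise_def)
    from ennreal_leI[OF this]
    show "ennreal ((snd z - f (mat_vec d p \<Theta> (fst z)))\<^sup>2) \<le> 2 * ennreal ((noise z)\<^sup>2) + 2 * ennreal ((F (fst z) - f (mat_vec d p \<Theta> (fst z)))\<^sup>2)"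
      by (simp add: ennreal_plus ennreal_mult)
  qed
  also have "\<dots> = 2 * ?v + 2 * (\<integral>\<^sup>+z. ennreal ((F (fst z) - f (mat_vec d p \<Theta> (fst z)))\<^sup>2) \<partial>P)"
    by (subst nn_integral_add) (auto simp: nn_integral_cmult)
  also have "\<dots> < \<infinity>" using v_fin False by (auto simp: ennreal_mult_less_top less_top)
  finally have fin: "(\<integral>\<^sup>+z. ennreal ((snd z - f (mat_vec d p \<Theta> (fst z)))\<^sup>2) \<partial>P) < \<infinity>" .
  have inf: "?v \<le> (INF (d', \<Theta>', f') \<in> (SIGMA d':{1..p}. space (mat_space d' p) \<times> borel_measurable (vec_space d')).
        risk P p d' \<Theta>' f')"
  proof (intro INF_greatest, clarify)
    fix d' \<Theta>' and f' :: "rvec \<Rightarrow> real" assume \<Theta>': "\<Theta>' \<in> space (mat_space d' p)" and f': "f' \<in> borel_measurable (vec_space d')"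
    have m: "(\<lambda>x. f' (mat_vec d' p \<Theta>' x)) \<in> borel_measurable (vec_space p)"
      by (rule measurable_compose[OF mat_vec_measurable[OF \<Theta>'] f'])
    show "?v \<le> risk P p d' \<Theta>' f'"
    proof (cases "risk P p d' \<Theta>' f' = \<infinity>")
      case False
      then show ?thesis unfolding risk_eq by (subst risk_decomposition[OF m]) (auto simp: less_top)
    qed simp
  qed
  have "excess_risk P p (d, \<Theta>, f) \<le> risk P p d \<Theta> f - ?v"
    unfolding excess_risk_def prod.case by (intro ennreal_mono_minus inf)
  also have "\<dots> = (\<integral>\<^sup>+z. ennreal ((F (fst z) - f (mat_vec d p \<Theta> (fst z)))\<^sup>2) \<partial>P)"
    unfolding risk_eq risk_decomposition[OF f fin] using v_fin by (simp add: ennreal_add_diff_cancel_left less_top)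
  finally show ?thesis .
qed simp

end

section \<open>Mixtures, disjoint unions and evaluation of links\<close>

lemma
  shows sets_mixture [simp]: "sets (mixture N J w m) = sets N"
    and space_mixture [simp]: "space (mixture N J w m) = space N"
  by (simp_all add: mixture_def sets.space_closed sets.sigma_sets_eq)

lemma emeasure_mixture:
  assumes m: "\<And>j. j \<in> J \<Longrightarrow> sets (m j) = sets N" and A: "A \<in> sets N"
  shows "emeasure (mixture N J w m) A = (\<Sum>j\<in>J. ennreal (w j) * emeasure (m j) A)"
  unfolding mixture_def
proof (rule emeasure_measure_of_sigma[OF sets.sigma_algebra_axioms _ _ A])
  show "positive (sets N) (\<lambda>A. \<Sum>j\<in>J. ennreal (w j) * emeasure (m j) A)"
    by (simp add: positive_def)
  show "countably_additive (sets N) (\<lambda>A. \<Sum>j\<in>J. ennreal (w j) * emeasure (m j) A)"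
  proof (rule countably_additiveI)
    fix B :: "nat \<Rightarrow> _ set" assume B: "range B \<subseteq> sets N" "disjoint_family B"
    have "(\<Sum>i. \<Sum>j\<in>J. ennreal (w j) * emeasure (m j) (B i)) = (\<Sum>j\<in>J. \<Sum>i. ennreal (w j) * emeasure (m j) (B i))"
      by (rule suminf_sum) simp
    also have "\<dots> = (\<Sum>j\<in>J. ennreal (w j) * emeasure (m j) (\<Union>i. B i))"
      using B by (intro sum.cong refl) (simp add: m suminf_emeasure)
    finally show "(\<Sum>i. \<Sum>j\<in>J. ennreal (w j) * emeasure (m j) (B i)) = (\<Sum>j\<in>J. ennreal (w j) * emeasure (m j) (\<Union>i. B i))" .
  qed
qed

lemma mixture_ge:
  assumes "finite J" "j \<in> J" "\<And>j. j \<in> J \<Longrightarrow> sets (m j) = sets N" "A \<in> sets N"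
  shows "emeasure (mixture N J w m) A \<ge> ennreal (w j) * emeasure (m j) A"
  using assms member_le_sum[of j J "\<lambda>j. ennreal (w j) * emeasure (m j) A"] by (simp add: emeasure_mixture)

lemma prob_space_mixture:
  assumes "finite J" "\<And>j. j \<in> J \<Longrightarrow> sets (m j) = sets N" "\<And>j. j \<in> J \<Longrightarrow> prob_space (m j)"
    and "\<And>j. j \<in> J \<Longrightarrow> w j \<ge> 0" "(\<Sum>j\<in>J. w j) = 1"
  shows "prob_space (mixture N J w m)"
proof
  have one: "emeasure (m j) (space N) = 1" if "j \<in> J" for j
    using prob_space.emeasure_space_1[OF assms(3)[OF that]] sets_eq_imp_space_eq[OF assms(2)[OF that]] by simp
  have "emeasure (mixture N J w m) (space N) = (\<Sum>j\<in>J. ennreal (w j) * emeasure (m j) (space N))"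
    by (rule emeasure_mixture) (use assms in auto)
  also have "\<dots> = (\<Sum>j\<in>J. ennreal (w j))" by (intro sum.cong refl) (simp add: one)
  also have "\<dots> = 1" using assms by (simp add: sum_ennreal)
  finally show "emeasure (mixture N J w m) (space (mixture N J w m)) = 1" by simp
qed

text \<open>
  The disjoint union of measurable spaces, the form in which the parameter space collects the dimensions.
\<close>

definition coproduct :: "'i set \<Rightarrow> ('i \<Rightarrow> 'a measure) \<Rightarrow> ('i \<times> 'a) measure" where
  "coproduct I M = sigma (SIGMA i:I. space (M i))
     {A. A \<subseteq> (SIGMA i:I. space (M i)) \<and> (\<forall>i\<in>I. Pair i -` A \<in> sets (M i))}"

lemma space_coproduct [simp]: "space (coproduct I M) = (SIGMA i:I. space (M i))"
  unfolding coproduct_def by (rule space_measure_of) auto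

lemma sets_coproduct:
  "sets (coproduct I M) = {A. A \<subseteq> (SIGMA i:I. space (M i)) \<and> (\<forall>i\<in>I. Pair i -` A \<in> sets (M i))}"
    (is "_ = ?C")
proof -
  have "sigma_algebra (SIGMA i:I. space (M i)) ?C"
    unfolding sigma_algebra_iff2
  proof (intro conjI ballI allI impI)
    fix A assume A: "A \<in> ?C"
    have "Pair i -` ((SIGMA i:I. space (M i)) - A) = space (M i) - Pair i -` A" if "i \<in> I" for i
      using that by auto
    then show "(SIGMA i:I. space (M i)) - A \<in> ?C" using A by auto
  next
    fix A :: "nat \<Rightarrow> _" assume "range A \<subseteq> ?C"
    then show "(\<Union>i. A i) \<in> ?C" by (auto simp: vimage_UN)
  qed auto
  then show ?thesis unfolding coproduct_def by (rule sigma_algebra.sets_measure_of_eq)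
qed

lemma measurable_coproduct:
  assumes "\<And>i. i \<in> I \<Longrightarrow> (\<lambda>x. f (i, x)) \<in> measurable (M i) N"
  shows "f \<in> measurable (coproduct I M) N"
proof (rule measurableI)
  fix x assume "x \<in> space (coproduct I M)"
  then show "f x \<in> space N" using measurable_space[OF assms] by auto
next
  fix B assume B: "B \<in> sets N"
  have "Pair i -` (f -` B \<inter> (SIGMA i:I. space (M i))) = (\<lambda>x. f (i, x)) -` B \<inter> space (M i)" if "i \<in> I" for i
    using that by auto
  then show "f -` B \<inter> space (coproduct I M) \<in> sets (coproduct I M)"
    using measurable_sets[OF assms B] by (auto simp: sets_coproduct)
qed

lemma measurable_Pair_coproduct: "i \<in> I \<Longrightarrow> Pair i \<in> measurable (M i) (coproduct I M)"
  by (rule measurableI) (auto simp: sets_coproduct vimage_def intro!: sets.Int_space_eq1[THEN subst])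

text \<open>
  With finitely many summands the function is a sum of its restrictions. The projection to a summand is
  extended by an arbitrary default point, which is why the summands must be nonempty.
\<close>

lemma measurable_coproduct_pair:
  fixes f :: "('i \<times> 'a) \<times> 'b \<Rightarrow> real"
  assumes I: "finite I" and f: "\<And>i. i \<in> I \<Longrightarrow> (\<lambda>(x, y). f ((i, x), y)) \<in> borel_measurable (M i \<Otimes>\<^sub>M K)"
    and ne: "\<And>i. i \<in> I \<Longrightarrow> space (M i) \<noteq> {}"
  shows "f \<in> borel_measurable (coproduct I M \<Otimes>\<^sub>M K)"
proof -
  \<comment> \<open>The default value never enters the sum, whose terms are guarded by the summand.\<close>
  define dflt where "dflt i = (SOME x. x \<in> space (M i))" for i
  have dflt: "dflt i \<in> space (M i)" if "i \<in> I" for i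
    unfolding dflt_def using ne[OF that] by (simp add: some_in_eq)
  define g where "g i = (\<lambda>x. if fst x = i then snd x else dflt i)" for i
  have g: "g i \<in> measurable (coproduct I M) (M i)" if i: "i \<in> I" for i
  proof (rule measurable_coproduct)
    fix j assume "j \<in> I"
    then show "(\<lambda>x. g i (j, x)) \<in> measurable (M j) (M i)"
      using dflt[OF i] by (cases "j = i") (auto simp: g_def)
  qed
  have idx: "fst \<in> measurable (coproduct I M) (count_space UNIV)"
    by (rule measurable_coproduct) simp
  have comp: "(\<lambda>z. if fst (fst z) = i then f ((i, g i (fst z)), snd z) else 0) \<in> borel_measurable (coproduct I M \<Otimes>\<^sub>M K)"
    if i: "i \<in> I" for i
  proof (rule measurable_If)
    have "(\<lambda>z. (g i (fst z), snd z)) \<in> measurable (coproduct I M \<Otimes>\<^sub>M K) (M i \<Otimes>\<^sub>M K)"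
      by (rule measurable_Pair[OF measurable_compose[OF measurable_fst g[OF i]] measurable_snd])
    from measurable_compose[OF this f[OF i]]
    show "(\<lambda>z. f ((i, g i (fst z)), snd z)) \<in> borel_measurable (coproduct I M \<Otimes>\<^sub>M K)" by simp
    have "(\<lambda>z. fst (fst z)) \<in> measurable (coproduct I M \<Otimes>\<^sub>M K) (count_space UNIV)"
      by (rule measurable_compose[OF measurable_fst idx])
    from measurable_sets[OF this, of "{i}"]
    show "{z \<in> space (coproduct I M \<Otimes>\<^sub>M K). fst (fst z) = i} \<in> sets (coproduct I M \<Otimes>\<^sub>M K)"
      by (simp add: vimage_def Int_def conj_commute)
  qed simp
  have m: "(\<lambda>z. \<Sum>i\<in>I. if fst (fst z) = i then f ((i, g i (fst z)), snd z) else 0) \<in> borel_measurable (coproduct I M \<Otimes>\<^sub>M K)"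
    by (rule borel_measurable_sum) (rule comp)
  have eq: "(\<Sum>i\<in>I. if fst (fst z) = i then f ((i, g i (fst z)), snd z) else 0) = f z"
    if "z \<in> space (coproduct I M \<Otimes>\<^sub>M K)" for z
  proof -
    obtain i x y where z: "z = ((i, x), y)" by (metis prod.collapse)
    have i: "i \<in> I" using that by (auto simp: z space_pair_measure)
    show ?thesis using I i by (simp add: z g_def)
  qed
  show ?thesis by (rule measurable_cong[OF eq, THEN iffD1, OF _ m])
qed

lemma mat_space_entry_measurable:
  "i < d \<Longrightarrow> j < p \<Longrightarrow> (\<lambda>\<Theta>. \<Theta> i j) \<in> borel_measurable (mat_space d p)"
  unfolding mat_space_def
  by (rule measurable_compose[OF measurable_component_singleton[of i "{..<d}" "\<lambda>_. vec_space p"]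
      vec_component_measurable]) auto

lemma sparse_mats_space: "sparse_mats d p \<subseteq> space (mat_space d p)"
  unfolding sparse_mats_def sparse_mats_on_def sparse_sphere_def mat_space_def vec_space_def
  by (auto simp: space_PiM PiE_iff extensional_def)

lemma space_sparse_mat_space [simp]: "space (sparse_mat_space d p) = sparse_mats d p"
  using sparse_mats_space by (auto simp: sparse_mat_space_def space_restrict_space)

lemma mat_entry_measurable:
  "i < d \<Longrightarrow> j < p \<Longrightarrow> (\<lambda>\<Theta>. \<Theta> i j) \<in> borel_measurable (sparse_mat_space d p)"
  unfolding sparse_mat_space_def by (rule measurable_restrict_space1) (rule mat_space_entry_measurable)

lemma mat_vec_measurable_pair:
  "(\<lambda>z. mat_vec d p (fst z) (snd z)) \<in> measurable (sparse_mat_space d p \<Otimes>\<^sub>M vec_space p) (vec_space d)"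
  unfolding mat_vec_def vec_space_def[of d]
proof (rule measurable_restrict)
  fix i assume "i \<in> {..<d}"
  then have i: "i < d" by simp
  show "(\<lambda>z. \<Sum>j<p. fst z i j * snd z j) \<in> borel_measurable (sparse_mat_space d p \<Otimes>\<^sub>M vec_space p)"
  proof (rule borel_measurable_sum)
    fix j assume "j \<in> {..<p}"
    then have j: "j < p" by simp
    show "(\<lambda>z. fst z i j * snd z j) \<in> borel_measurable (sparse_mat_space d p \<Otimes>\<^sub>M vec_space p)"
      using measurable_compose[OF measurable_fst mat_entry_measurable[OF i j]]
        measurable_compose[OF measurable_snd vec_component_measurable[OF j]]
      by (rule borel_measurable_times)
  qed
qed

lemma links_subset: "links \<phi> \<psi> N n C d \<subseteq> space (\<Pi>\<^sub>M x\<in>space (vec_space d). borel)"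
  unfolding links_def expansion_def space_PiM
  by (intro UN_least image_subsetI) (simp only: restrict_PiE_iff, simp)

lemma space_link_space [simp]: "space (link_space \<phi> \<psi> N n C d) = links \<phi> \<psi> N n C d"
  unfolding link_space_def space_restrict_space using links_subset by blast

lemma link_eval_measurable:
  "x \<in> space (vec_space d) \<Longrightarrow> (\<lambda>f. f x) \<in> borel_measurable (link_space \<phi> \<psi> N n C d)"
  unfolding link_space_def by (rule measurable_restrict_space1) (rule measurable_component_singleton)

lemma param_space_coproduct:
  "param_space \<phi> \<psi> N n C p = coproduct {1..p} (\<lambda>d. sparse_mat_space d p \<Otimes>\<^sub>M link_space \<phi> \<psi> N n C d)"
  unfolding param_space_def coproduct_def by (simp add: space_pair_measure Let_def)

lemma space_param_space:
  "space (param_space \<phi> \<psi> N n C p) = (SIGMA d:{1..p}. sparse_mats d p \<times> links \<phi> \<psi> N n C d)"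
  unfolding param_space_coproduct by (simp add: space_pair_measure)

context two_scale_pair begin

text \<open>
  The factor is the weight of the index in the coefficient norm; this explains the exponent \<open>d / 2 + 1\<close> there.
\<close>

lemma wavelet_lipschitz:
  "\<bar>wavelet \<phi> \<psi> d l x - wavelet \<phi> \<psi> d l y\<bar> \<le> 2 powr (real (fst l) * (real d / 2 + 1)) * L ^ d * (\<Sum>i<d. \<bar>x i - y i\<bar>)"
proof -
  obtain J k e where l: "l = (J, k, e)" by (cases l)
  have "\<bar>wavelet \<phi> \<psi> d l x - wavelet \<phi> \<psi> d l y\<bar> = 2 powr (real J * real d / 2) * \<bar>tensor d J k e x - tensor d J k e y\<bar>"
    unfolding l wavelet_tensor by (simp add: abs_mult flip: right_diff_distrib)
  also have "\<dots> \<le> 2 powr (real J * real d / 2) * (L ^ d * 2 ^ J * (\<Sum>i<d. \<bar>x i - y i\<bar>))"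
    by (intro mult_left_mono tensor_lipschitz) simp
  also have "\<dots> = (2 powr (real J * real d / 2) * 2 powr real J) * L ^ d * (\<Sum>i<d. \<bar>x i - y i\<bar>)"
    by (simp add: powr_realpow)
  also have "2 powr (real J * real d / 2) * 2 powr real J = 2 powr (real (fst l) * (real d / 2 + 1))"
    unfolding powr_add[symmetric] by (simp add: l algebra_simps)
  finally show ?thesis .
qed

lemma expansion_lipschitz:
  assumes x: "x \<in> space (vec_space d)" "y \<in> space (vec_space d)"
  shows "\<bar>expansion \<phi> \<psi> N d M b x - expansion \<phi> \<psi> N d M b y\<bar> \<le> coeff_norm \<phi> \<psi> N d M b * (\<Sum>i<d. \<bar>x i - y i\<bar>)"
proof -
  have "expansion \<phi> \<psi> N d M b x - expansion \<phi> \<psi> N d M b y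
      = (\<Sum>l\<in>wavelet_index d M N. b l * (wavelet \<phi> \<psi> d l x - wavelet \<phi> \<psi> d l y))"
    using x by (simp add: expansion_def right_diff_distrib sum_subtractf)
  also have "\<bar>\<dots>\<bar> \<le> (\<Sum>l\<in>wavelet_index d M N. \<bar>b l * (wavelet \<phi> \<psi> d l x - wavelet \<phi> \<psi> d l y)\<bar>)"
    by (rule sum_abs)
  also have "\<dots> \<le> (\<Sum>l\<in>wavelet_index d M N. L ^ d * (2 powr (real (fst l) * (real d / 2 + 1)) * \<bar>b l\<bar>) * (\<Sum>i<d. \<bar>x i - y i\<bar>))"
  proof (rule sum_mono)
    fix l
    show "\<bar>b l * (wavelet \<phi> \<psi> d l x - wavelet \<phi> \<psi> d l y)\<bar> \<le> L ^ d * (2 powr (real (fst l) * (real d / 2 + 1)) * \<bar>b l\<bar>) * (\<Sum>i<d. \<bar>x i - y i\<bar>)"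
      using mult_left_mono[OF wavelet_lipschitz[of d l x y] abs_ge_zero[of "b l"]]
      by (simp only: abs_mult mult_ac)
  qed
  also have "\<dots> = coeff_norm \<phi> \<psi> N d M b * (\<Sum>i<d. \<bar>x i - y i\<bar>)"
    by (simp only: coeff_norm_def sum_distrib_left[of "L ^ d"] sum_distrib_right[symmetric])
  finally show ?thesis .
qed

lemma expansion_bound:
  "x \<in> space (vec_space d) \<Longrightarrow> \<bar>expansion \<phi> \<psi> N d M b x\<bar> \<le> coeff_norm \<phi> \<psi> N d M b"
proof -
  assume x: "x \<in> space (vec_space d)"
  have "\<bar>expansion \<phi> \<psi> N d M b x\<bar> \<le> (\<Sum>l\<in>wavelet_index d M N. \<bar>b l * wavelet \<phi> \<psi> d l x\<bar>)"
    using x by (simp add: expansion_def sum_abs)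
  also have "\<dots> \<le> (\<Sum>l\<in>wavelet_index d M N. L ^ d * (2 powr (real (fst l) * (real d / 2 + 1)) * \<bar>b l\<bar>))"
  proof (rule sum_mono)
    fix l
    have "\<bar>wavelet \<phi> \<psi> d l x\<bar> \<le> 2 powr (real (fst l) * real d / 2) * L ^ d" by (rule wavelet_abs_le)
    also have "\<dots> \<le> 2 powr (real (fst l) * (real d / 2 + 1)) * L ^ d"
      using L_pos by (intro mult_right_mono powr_mono) (auto simp: algebra_simps)
    finally have w: "\<bar>wavelet \<phi> \<psi> d l x\<bar> \<le> 2 powr (real (fst l) * (real d / 2 + 1)) * L ^ d" .
    show "\<bar>b l * wavelet \<phi> \<psi> d l x\<bar> \<le> L ^ d * (2 powr (real (fst l) * (real d / 2 + 1)) * \<bar>b l\<bar>)"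
      using mult_left_mono[OF w abs_ge_zero[of "b l"]] by (simp only: abs_mult mult_ac)
  qed
  also have "\<dots> = coeff_norm \<phi> \<psi> N d M b" by (simp add: coeff_norm_def sum_distrib_left)
  finally show ?thesis .
qed

lemma links_lipschitz:
  assumes f: "f \<in> links \<phi> \<psi> N n C d" and x: "x \<in> space (vec_space d)" "y \<in> space (vec_space d)"
  shows "\<bar>f x - f y\<bar> \<le> (C + 1) * (\<Sum>i<d. \<bar>x i - y i\<bar>)"
proof -
  obtain M b where b: "coeff_norm \<phi> \<psi> N d M b \<le> C + 1" "f = expansion \<phi> \<psi> N d M b"
    using f by (auto simp: links_def coeff_ball_def)
  have "\<bar>f x - f y\<bar> \<le> coeff_norm \<phi> \<psi> N d M b * (\<Sum>i<d. \<bar>x i - y i\<bar>)"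
    unfolding b by (rule expansion_lipschitz[OF x])
  also have "\<dots> \<le> (C + 1) * (\<Sum>i<d. \<bar>x i - y i\<bar>)"
    by (intro mult_right_mono b sum_nonneg) auto
  finally show ?thesis .
qed

lemma links_bound:
  assumes f: "f \<in> links \<phi> \<psi> N n C d" and x: "x \<in> space (vec_space d)"
  shows "\<bar>f x\<bar> \<le> C + 1"
proof -
  obtain M b where b: "coeff_norm \<phi> \<psi> N d M b \<le> C + 1" "f = expansion \<phi> \<psi> N d M b"
    using f by (auto simp: links_def coeff_ball_def)
  show ?thesis using expansion_bound[OF x, of N M b] b by simp
qed

text \<open>
  The \<open>\<sigma>\<close>-algebra on links only knows evaluations at fixed points. A link is uniformly Lipschitz, so its
  value at \<open>x\<close> is the limit of its values at the dyadic grid point below \<open>x\<close>, of which there are countably many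
  on each level.
\<close>

lemma eval_measurable:
  "(\<lambda>z. fst z (snd z)) \<in> borel_measurable (link_space \<phi> \<psi> N n C d \<Otimes>\<^sub>M vec_space d)"
proof (rule borel_measurable_LIMSEQ_real)
  let ?K = "link_space \<phi> \<psi> N n C d \<Otimes>\<^sub>M vec_space d"
  define grid where "grid k u = (\<lambda>i\<in>{..<d}. real_of_int (u i) / 2 ^ k)" for k and u :: "nat \<Rightarrow> int"
  define cell where "cell k x = (\<lambda>i\<in>{..<d}. \<lfloor>2 ^ k * x i\<rfloor>)" for k and x :: rvec
  have grid_space: "grid k u \<in> space (vec_space d)" for k u by (simp add: grid_def)
  show "(\<lambda>k. fst z (grid k (cell k (snd z)))) \<longlonglongrightarrow> fst z (snd z)" if z: "z \<in> space ?K" for z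
  proof (rule Lim_null_comparison[THEN LIM_zero_cancel])
    have zs: "fst z \<in> links \<phi> \<psi> N n C d" "snd z \<in> space (vec_space d)"
      using z by (simp_all add: space_pair_measure mem_Times_iff)
    have C1: "C + 1 \<ge> 0" using links_bound[OF zs] by linarith
    show "\<forall>\<^sub>F k in sequentially. norm (fst z (grid k (cell k (snd z))) - fst z (snd z)) \<le> (C + 1) * (real d * (1 / 2 ^ k))"
    proof (rule always_eventually, rule allI)
      fix k
      have "norm (fst z (grid k (cell k (snd z))) - fst z (snd z)) \<le> (C + 1) * (\<Sum>i<d. \<bar>grid k (cell k (snd z)) i - snd z i\<bar>)"
        unfolding real_norm_def by (rule links_lipschitz[OF zs(1) grid_space zs(2)])
      also have "\<dots> \<le> (C + 1) * (\<Sum>i<d. 1 / 2 ^ k)"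
      proof (intro mult_left_mono sum_mono C1)
        fix i assume "i \<in> {..<d}"
        then have "grid k (cell k (snd z)) i - snd z i = (of_int \<lfloor>2 ^ k * snd z i\<rfloor> - 2 ^ k * snd z i) / 2 ^ k"
          by (simp add: grid_def cell_def field_simps)
        moreover have "\<bar>of_int \<lfloor>2 ^ k * snd z i\<rfloor> - 2 ^ k * snd z i\<bar> \<le> 1" by linarith
        ultimately show "\<bar>grid k (cell k (snd z)) i - snd z i\<bar> \<le> 1 / 2 ^ k"
          by (simp add: divide_right_mono)
      qed
      finally show "norm (fst z (grid k (cell k (snd z))) - fst z (snd z)) \<le> (C + 1) * (real d * (1 / 2 ^ k))" by simp
    qed
    show "(\<lambda>k. (C + 1) * (real d * (1 / 2 ^ k))) \<longlonglongrightarrow> 0" by real_asymp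
  qed
  show "(\<lambda>z. fst z (grid k (cell k (snd z)))) \<in> borel_measurable ?K" for k
  proof (rule measurable_compose_countable'[where I = "{..<d} \<rightarrow>\<^sub>E (UNIV::int set)" and g = "\<lambda>z. cell k (snd z)"])
    show "(\<lambda>z. fst z (grid k u)) \<in> borel_measurable ?K" for u
      by (rule measurable_compose[OF measurable_fst link_eval_measurable[OF grid_space]])
    show cnt: "countable ({..<d} \<rightarrow>\<^sub>E (UNIV::int set))" by (intro countable_PiE) auto
    show "(\<lambda>z. cell k (snd z)) \<in> measurable ?K (count_space ({..<d} \<rightarrow>\<^sub>E UNIV))"
    proof (rule measurable_compose[OF measurable_snd], subst measurable_count_space_eq_countable[OF cnt], intro conjI ballI)
      show "cell k \<in> space (vec_space d) \<rightarrow> {..<d} \<rightarrow>\<^sub>E UNIV" by (auto simp: cell_def)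
      fix u :: "nat \<Rightarrow> int" assume u: "u \<in> {..<d} \<rightarrow>\<^sub>E UNIV"
      have "cell k -` {u} \<inter> space (vec_space d) = {x \<in> space (vec_space d). \<forall>i\<in>{..<d}. \<lfloor>2 ^ k * x i\<rfloor> = u i}"
      proof -
        have "cell k x = u \<longleftrightarrow> (\<forall>i\<in>{..<d}. \<lfloor>2 ^ k * x i\<rfloor> = u i)" for x
        proof
          assume "\<forall>i\<in>{..<d}. \<lfloor>2 ^ k * x i\<rfloor> = u i"
          then show "cell k x = u"
            by (intro extensionalityI[of _ "{..<d}"]) (use u in \<open>auto simp: cell_def PiE_iff\<close>)
        qed (auto simp: cell_def)
        then show ?thesis by (simp add: vimage_def Int_def conj_commute)
      qed
      also have "\<dots> \<in> sets (vec_space d)" by measurable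
      finally show "cell k -` {u} \<inter> space (vec_space d) \<in> sets (vec_space d)" .
    qed
  qed
qed

end

section \<open>Prior mass of caps on sparse spheres\<close>

\<comment> \<open>The spheres live on products over arbitrary index sets \<open>J\<close>, where this rule only lengthens the search.\<close>
declare vec_component_measurable [measurable del]

lemma emeasure_uniform_on:
  assumes U: "U \<in> sets M" and B: "B \<in> sets M"
  shows "emeasure (uniform_on M U) (B \<inter> U) = emeasure M (B \<inter> U) / emeasure M U"
proof -
  have sub: "U \<inter> space M \<in> sets M" using U by simp
  have "U \<in> sets (restrict_space M U)" "B \<inter> U \<in> sets (restrict_space M U)"
    using U B by (auto simp: sets_restrict_space_iff[OF sub])
  then have "emeasure (uniform_on M U) (B \<inter> U) = emeasure (restrict_space M U) (U \<inter> (B \<inter> U)) / emeasure (restrict_space M U) U"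
    unfolding uniform_on_def by (rule emeasure_uniform_measure)
  also have "U \<inter> (B \<inter> U) = B \<inter> U" by auto
  finally show ?thesis using U by (simp add: emeasure_restrict_space[OF sub])
qed

lemma sets_uniform_on: "sets (uniform_on M U) = sets (restrict_space M U)"
  by (simp add: uniform_on_def)

lemma space_uniform_on: "U \<in> sets M \<Longrightarrow> space (uniform_on M U) = U"
  using sets.sets_into_space[of U M] by (auto simp: uniform_on_def space_restrict_space)

text \<open>
  The uniform distribution on \<open>U\<close> gives a box inside \<open>U\<close> at least the ratio of its volume to that of any box
  around \<open>U\<close>. This stands in for
  the exact volumes of Euclidean balls and of weighted \<open>l1\<close>-balls.
\<close>

lemma uniform_on_box:
  fixes c r R :: "'i \<Rightarrow> real" and J :: "'i set"
  defines "M \<equiv> \<Pi>\<^sub>M j\<in>J. lborel"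
  assumes J: "finite J" and U: "U \<in> sets M"
    and inner: "PiE J (\<lambda>j. {c j - r j..c j + r j}) \<subseteq> U" and outer: "U \<subseteq> PiE J (\<lambda>j. {- R j..R j})"
    and r: "\<And>j. j \<in> J \<Longrightarrow> r j > 0" and R: "\<And>j. j \<in> J \<Longrightarrow> R j > 0"
  shows "prob_space (uniform_on M U)"
    and "\<And>B. B \<in> sets (uniform_on M U) \<Longrightarrow> PiE J (\<lambda>j. {c j - r j..c j + r j}) \<subseteq> B
      \<Longrightarrow> ennreal (\<Prod>j\<in>J. r j / R j) \<le> emeasure (uniform_on M U) B"
proof -
  let ?Q = "PiE J (\<lambda>j. {c j - r j..c j + r j})"
  have box: "emeasure M (PiE J (\<lambda>j. {a j..b j})) = ennreal (\<Prod>j\<in>J. b j - a j)" if "\<And>j. j \<in> J \<Longrightarrow> a j \<le> b j" for a b :: "'i \<Rightarrow> real"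
    unfolding M_def using J that by (subst lborel_prod.emeasure_PiM) (auto simp: prod_ennreal intro!: prod.cong)
  have Q_sets: "?Q \<in> sets M" unfolding M_def by (rule sets_PiM_I_finite[OF J]) auto
  have out_sets: "PiE J (\<lambda>j. {- R j..R j}) \<in> sets M" unfolding M_def by (rule sets_PiM_I_finite[OF J]) auto
  have Q: "emeasure M ?Q = ennreal (\<Prod>j\<in>J. 2 * r j)"
    using r by (subst box) (auto intro: less_imp_le simp: order_trans[of "- r _" 0])
  have out: "emeasure M U \<le> ennreal (\<Prod>j\<in>J. 2 * R j)"
    using emeasure_mono[OF outer out_sets] R by (subst (asm) box) (auto intro: less_imp_le simp: order_trans[of "- R _" 0])
  have Qpos: "(\<Prod>j\<in>J. 2 * r j) > 0" and Rpos: "(\<Prod>j\<in>J. 2 * R j) > 0" using r R by (auto intro!: prod_pos)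
  have U0: "emeasure M U \<noteq> 0" using emeasure_mono[OF inner U] Q Qpos by (auto simp: ennreal_eq_0_iff)
  have Ufin: "emeasure M U \<noteq> \<infinity>" using out by (auto simp: top_unique)
  have sub: "U \<inter> space M \<in> sets M" using U by simp
  have eU: "emeasure (restrict_space M U) U = emeasure M U" by (rule emeasure_restrict_space[OF sub]) simp
  show "prob_space (uniform_on M U)"
    unfolding uniform_on_def by (rule prob_space_uniform_measure) (use U0 Ufin eU in auto)
  fix B assume B: "B \<in> sets (uniform_on M U)" and QB: "?Q \<subseteq> B"
  have B': "B \<in> sets M" "B \<subseteq> U" using B by (auto simp: sets_uniform_on sets_restrict_space_iff[OF sub])
  obtain u where u: "emeasure M U = ennreal u" "u \<ge> 0" using Ufin by (cases "emeasure M U") auto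
  have upos: "u > 0" using U0 u by (cases "u = 0") auto
  have u_le: "u \<le> (\<Prod>j\<in>J. 2 * R j)" using out Rpos unfolding u by (subst (asm) ennreal_le_iff) auto
  have "ennreal (\<Prod>j\<in>J. r j / R j) = ennreal ((\<Prod>j\<in>J. 2 * r j) / (\<Prod>j\<in>J. 2 * R j))"
    by (simp add: prod_dividef prod.distrib)
  also have "\<dots> \<le> ennreal ((\<Prod>j\<in>J. 2 * r j) / u)"
    using upos u_le Qpos Rpos by (intro ennreal_leI divide_left_mono) auto
  also have "\<dots> = emeasure M ?Q / emeasure M U"
    unfolding Q u using Qpos upos by (simp add: divide_ennreal)
  also have "\<dots> \<le> emeasure M B / emeasure M U"
    by (intro divide_right_mono_ennreal emeasure_mono QB B')
  also have "\<dots> = emeasure (uniform_on M U) B"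
    using emeasure_uniform_on[OF U B'(1)] B'(2) by (simp add: Int_absorb2)
  finally show "ennreal (\<Prod>j\<in>J. r j / R j) \<le> emeasure (uniform_on M U) B" .
qed

lemma L2_set_abs_diff: "\<bar>L2_set u A - L2_set v A\<bar> \<le> (\<Sum>i\<in>A. \<bar>u i - v i\<bar>)"
proof -
  have *: "L2_set u A - L2_set v A \<le> (\<Sum>i\<in>A. \<bar>u i - v i\<bar>)" for u v
  proof -
    have "L2_set u A = L2_set (\<lambda>i. (u i - v i) + v i) A" by simp
    also have "\<dots> \<le> L2_set (\<lambda>i. u i - v i) A + L2_set v A" by (rule L2_set_triangle_ineq)
    also have "L2_set (\<lambda>i. u i - v i) A \<le> (\<Sum>i\<in>A. \<bar>u i - v i\<bar>)" by (rule L2_set_le_sum_abs)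
    finally show ?thesis by simp
  qed
  show ?thesis using *[of u v] *[of v u] by (simp add: abs_le_iff abs_minus_commute)
qed

lemma L2_set_abs: "L2_set (\<lambda>i. \<bar>f i\<bar>) A = L2_set f A"
  by (simp add: L2_set_def)

lemma L2_set_measurable [measurable]:
  "finite J \<Longrightarrow> (\<lambda>u. L2_set u J) \<in> borel_measurable (\<Pi>\<^sub>M j\<in>J. lborel)"
  unfolding L2_set_def by measurable

definition punctured_ball :: "nat set \<Rightarrow> rvec set" where
  "punctured_ball J = {u \<in> J \<rightarrow>\<^sub>E UNIV. 0 < L2_set u J \<and> L2_set u J \<le> 1}"

text \<open>
  The retraction onto the unit sphere of the coordinates in \<open>J\<close> that defines the spherical law.
\<close>

definition normalise :: "nat \<Rightarrow> nat set \<Rightarrow> rvec \<Rightarrow> rvec" where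
  "normalise p J u = (\<lambda>j\<in>{..<p}. if j \<in> J then u j / L2_set u J else 0)"

lemma sphere_unif_eq:
  "sphere_unif p J = distr (uniform_on (\<Pi>\<^sub>M j\<in>J. lborel) (punctured_ball J))
      (restrict_space (vec_space p) (sparse_sphere p J)) (normalise p J)"
  unfolding sphere_unif_def punctured_ball_def normalise_def ..

lemma sparse_sphere_space: "sparse_sphere p J \<subseteq> space (vec_space p)"
  by (auto simp: sparse_sphere_def)

lemma space_sphere_unif: "space (sphere_unif p J) = sparse_sphere p J"
  and sets_sphere_unif: "sets (sphere_unif p J) = sets (restrict_space (vec_space p) (sparse_sphere p J))"
  using sparse_sphere_space by (auto simp: sphere_unif_eq space_restrict_space)

lemma L2_set_restrict_support:
  assumes "J \<subseteq> {..<p::nat}" "\<And>j. j < p \<Longrightarrow> j \<notin> J \<Longrightarrow> v j = (0::real)"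
  shows "L2_set v {..<p} = L2_set v J"
  unfolding L2_set_def using assms by (intro arg_cong[where f = sqrt] sum.mono_neutral_right) auto

context
  fixes p :: nat and J :: "nat set"
  assumes J: "J \<subseteq> {..<p}" "J \<noteq> {}"
begin

lemma finite_J [simp]: "finite J" using J finite_subset by blast

lemma punctured_ball_sets: "punctured_ball J \<in> sets (\<Pi>\<^sub>M j\<in>J. lborel)"
proof -
  have "punctured_ball J = {u \<in> space (\<Pi>\<^sub>M j\<in>J. lborel). 0 < L2_set u J \<and> L2_set u J \<le> 1}"
    by (simp add: punctured_ball_def space_PiM)
  also have "\<dots> \<in> sets (\<Pi>\<^sub>M j\<in>J. lborel)" by measurable
  finally show ?thesis .
qed

lemma normalise_sphere:
  assumes "u \<in> punctured_ball J" shows "normalise p J u \<in> sparse_sphere p J"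
proof -
  have pos: "L2_set u J > 0" using assms by (simp add: punctured_ball_def)
  have "L2_set (normalise p J u) {..<p} = L2_set (normalise p J u) J"
    by (rule L2_set_restrict_support) (use J in \<open>auto simp: normalise_def\<close>)
  also have "\<dots> = L2_set (\<lambda>j. inverse (L2_set u J) * u j) J"
    by (rule L2_set_cong) (use J in \<open>auto simp: normalise_def field_simps\<close>)
  also have "\<dots> = 1" using pos by (simp add: L2_set_right_distrib[symmetric])
  finally show ?thesis by (auto simp: sparse_sphere_def normalise_def)
qed

lemma normalise_measurable:
  "normalise p J \<in> measurable (uniform_on (\<Pi>\<^sub>M j\<in>J. lborel) (punctured_ball J)) (restrict_space (vec_space p) (sparse_sphere p J))"
proof (rule measurable_restrict_space2)
  show "normalise p J \<in> space (uniform_on (\<Pi>\<^sub>M j\<in>J. lborel) (punctured_ball J)) \<rightarrow> sparse_sphere p J"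
    using normalise_sphere by (simp add: space_uniform_on[OF punctured_ball_sets])
  have "normalise p J \<in> measurable (\<Pi>\<^sub>M j\<in>J. lborel) (vec_space p)"
    unfolding normalise_def vec_space_def
  proof (rule measurable_restrict)
    fix j
    show "(\<lambda>u. if j \<in> J then u j / L2_set u J else 0) \<in> borel_measurable (\<Pi>\<^sub>M j\<in>J. lborel)"
      by (cases "j \<in> J") simp_all
  qed
  then have "normalise p J \<in> measurable (restrict_space (\<Pi>\<^sub>M j\<in>J. lborel) (punctured_ball J)) (vec_space p)"
    by (rule measurable_restrict_space1)
  then show "normalise p J \<in> measurable (uniform_on (\<Pi>\<^sub>M j\<in>J. lborel) (punctured_ball J)) (vec_space p)"
    by (simp cong: measurable_cong_sets add: sets_uniform_on)
qed

text \<open>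
  A cube of half side \<open>\<eta> / (4 * p)\<close> around \<open>\<zeta> / 2\<close> lies in the ball and is mapped into the cap by
  normalisation. Its centre sits at half the radius, away from both the origin and the boundary; scaling by
  \<open>1 / L2_set u J\<close>, close to \<open>2\<close>, moves it back to \<open>\<zeta>\<close>.
\<close>

lemma sphere_unif_cap:
  assumes \<zeta>: "\<zeta> \<in> sparse_sphere p J" and \<eta>: "0 < \<eta>" "\<eta> \<le> 1"
  shows "prob_space (sphere_unif p J)"
    and "ennreal ((\<eta> / (4 * real p)) ^ card J) \<le> emeasure (sphere_unif p J) {v \<in> sparse_sphere p J. \<forall>j<p. \<bar>v j - \<zeta> j\<bar> \<le> \<eta>}"
proof -
  let ?M = "\<Pi>\<^sub>M j\<in>J. lborel :: real measure"
  define \<tau> where "\<tau> = \<eta> / (4 * real p)"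
  have p: "p > 0" using J by auto
  have \<tau>: "\<tau> > 0" using \<eta> p by (simp add: \<tau>_def)
  have cardJ: "card J \<le> p" "card J \<ge> 1" using J card_mono[OF _ J(1)] by (auto simp: Suc_le_eq card_gt_0_iff)
  have m\<tau>: "real (card J) * \<tau> \<le> \<eta> / 4" "\<tau> \<le> \<eta> / 4"
  proof -
    have "real (card J) * \<tau> \<le> real p * \<tau>" using cardJ \<tau> by (intro mult_right_mono) auto
    also have "\<dots> = \<eta> / 4" using p by (simp add: \<tau>_def)
    finally show a: "real (card J) * \<tau> \<le> \<eta> / 4" .
    have "1 * \<tau> \<le> real (card J) * \<tau>" using cardJ \<tau> by (intro mult_right_mono) auto
    then show "\<tau> \<le> \<eta> / 4" using a by simp
  qed
  have \<zeta>1: "L2_set \<zeta> J = 1"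
    using \<zeta> L2_set_restrict_support[OF J(1), of \<zeta>] by (auto simp: sparse_sphere_def)
  have half: "L2_set (\<lambda>j. \<zeta> j / 2) J = 1 / 2"
    using \<zeta>1 L2_set_left_distrib[of "1/2" \<zeta> J] by simp
  let ?Q = "PiE J (\<lambda>j. {\<zeta> j / 2 - \<tau>..\<zeta> j / 2 + \<tau>})"
  have near: "\<bar>L2_set u J - 1 / 2\<bar> \<le> \<eta> / 4" if u: "u \<in> ?Q" for u
  proof -
    have "\<bar>L2_set u J - L2_set (\<lambda>j. \<zeta> j / 2) J\<bar> \<le> (\<Sum>j\<in>J. \<bar>u j - \<zeta> j / 2\<bar>)" by (rule L2_set_abs_diff)
    also have "\<dots> \<le> (\<Sum>j\<in>J. \<tau>)"
    proof (rule sum_mono)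
      fix j assume "j \<in> J"
      then have "\<zeta> j / 2 - \<tau> \<le> u j" "u j \<le> \<zeta> j / 2 + \<tau>" using u by (auto simp: PiE_iff)
      then show "\<bar>u j - \<zeta> j / 2\<bar> \<le> \<tau>" by linarith
    qed
    also have "\<dots> \<le> \<eta> / 4" using m\<tau> by simp
    finally show ?thesis using half by simp
  qed
  have inner: "?Q \<subseteq> punctured_ball J"
  proof
    fix u assume u: "u \<in> ?Q"
    have "0 < L2_set u J" "L2_set u J \<le> 1" using near[OF u] \<eta> by linarith+
    then show "u \<in> punctured_ball J" using u by (auto simp: punctured_ball_def PiE_iff)
  qed
  have outer: "punctured_ball J \<subseteq> PiE J (\<lambda>j. {- 1..1})"
  proof
    fix u assume u: "u \<in> punctured_ball J"
    have "\<bar>u j\<bar> \<le> 1" if "j \<in> J" for j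
      using member_le_L2_set[OF finite_J that, of "\<lambda>j. \<bar>u j\<bar>"] u by (simp add: punctured_ball_def L2_set_abs)
    then show "u \<in> PiE J (\<lambda>j. {- 1..1})" using u by (auto simp: punctured_ball_def PiE_iff abs_le_iff)
  qed
  note unif = uniform_on_box[OF finite_J punctured_ball_sets inner outer \<tau>, simplified]
  show "prob_space (sphere_unif p J)"
    unfolding sphere_unif_eq by (intro prob_space.prob_space_distr unif(1) normalise_measurable)
  let ?cap = "{v \<in> sparse_sphere p J. \<forall>j<p. \<bar>v j - \<zeta> j\<bar> \<le> \<eta>}"
  have cap_sets: "?cap \<in> sets (restrict_space (vec_space p) (sparse_sphere p J))"
  proof -
    note vec_component_measurable [measurable]
    have "{v \<in> space (vec_space p). \<forall>j\<in>{..<p}. \<bar>v j - \<zeta> j\<bar> \<le> \<eta>} \<in> sets (vec_space p)" by measurable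
    then have "sparse_sphere p J \<inter> {v \<in> space (vec_space p). \<forall>j\<in>{..<p}. \<bar>v j - \<zeta> j\<bar> \<le> \<eta>} \<in> sets (restrict_space (vec_space p) (sparse_sphere p J))"
      by (auto simp: sets_restrict_space)
    also have "sparse_sphere p J \<inter> {v \<in> space (vec_space p). \<forall>j\<in>{..<p}. \<bar>v j - \<zeta> j\<bar> \<le> \<eta>} = ?cap"
      using sparse_sphere_space by auto
    finally show ?thesis .
  qed
  let ?B = "normalise p J -` ?cap \<inter> space (uniform_on ?M (punctured_ball J))"
  have "?Q \<subseteq> ?B"
  proof
    fix u assume u: "u \<in> ?Q"
    then have ub: "u \<in> punctured_ball J" using inner by auto
    have nrm: "L2_set u J > 0" "L2_set u J \<le> 1" using ub by (auto simp: punctured_ball_def)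
    have "\<bar>normalise p J u j - \<zeta> j\<bar> \<le> \<eta>" if j: "j < p" for j
    proof (cases "j \<in> J")
      case True
      have uj: "\<bar>u j\<bar> \<le> L2_set u J"
        using member_le_L2_set[OF finite_J True, of "\<lambda>j. \<bar>u j\<bar>"] by (simp add: L2_set_abs)
      \<comment> \<open>The first term is the error of the norm, the second the position in the cube.\<close>
      have "normalise p J u j - \<zeta> j = u j / L2_set u J * (1 - 2 * L2_set u J) + 2 * (u j - \<zeta> j / 2)"
        using True j nrm by (simp add: normalise_def field_simps)
      also have "\<bar>\<dots>\<bar> \<le> \<bar>u j / L2_set u J\<bar> * \<bar>1 - 2 * L2_set u J\<bar> + 2 * \<bar>u j - \<zeta> j / 2\<bar>"
        using abs_triangle_ineq[of "u j / L2_set u J * (1 - 2 * L2_set u J)" "2 * (u j - \<zeta> j / 2)"] by (simp only: abs_mult abs_numeral)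
      also have "\<dots> \<le> 1 * \<bar>1 - 2 * L2_set u J\<bar> + 2 * \<tau>"
      proof (intro add_mono mult_right_mono)
        show "\<bar>u j / L2_set u J\<bar> \<le> 1" using uj nrm by simp
        have "\<zeta> j / 2 - \<tau> \<le> u j" "u j \<le> \<zeta> j / 2 + \<tau>" using u True by (auto simp: PiE_iff)
        then have "\<bar>u j - \<zeta> j / 2\<bar> \<le> \<tau>" by linarith
        then show "2 * \<bar>u j - \<zeta> j / 2\<bar> \<le> 2 * \<tau>" by simp
      qed simp
      also have "\<dots> \<le> \<eta>"
      proof -
        have "\<bar>1 - 2 * L2_set u J\<bar> \<le> \<eta> / 2"
        proof -
          have "1 - 2 * L2_set u J = - 2 * (L2_set u J - 1 / 2)" by simp
          then have "\<bar>1 - 2 * L2_set u J\<bar> = 2 * \<bar>L2_set u J - 1 / 2\<bar>"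
            by (simp only: abs_mult abs_neg_numeral)
          then show ?thesis using near[OF u] by simp
        qed
        then show ?thesis using m\<tau> by simp
      qed
      finally show ?thesis .
    next
      case False
      then have "\<zeta> j = 0" using \<zeta> j by (simp add: sparse_sphere_def)
      then show ?thesis using False j \<eta> by (simp add: normalise_def)
    qed
    then show "u \<in> ?B" using ub normalise_sphere[OF ub] by (simp add: space_uniform_on[OF punctured_ball_sets])
  qed
  then have "ennreal (\<Prod>j\<in>J. \<tau> / 1) \<le> emeasure (uniform_on ?M (punctured_ball J)) ?B"
    using unif(2)[OF measurable_sets[OF normalise_measurable cap_sets]] by simp
  also have "\<dots> = emeasure (sphere_unif p J) ?cap"
    unfolding sphere_unif_eq by (rule emeasure_distr[OF normalise_measurable cap_sets, symmetric])
  finally show "ennreal ((\<eta> / (4 * real p)) ^ card J) \<le> emeasure (sphere_unif p J) ?cap"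
    by (simp add: \<tau>_def)
qed

lemma sparse_sphere_nonempty: "sparse_sphere p J \<noteq> {}"
proof -
  obtain j where j: "j \<in> J" using J by blast
  have "L2_set (\<lambda>i\<in>{..<p}. if i = j then 1 else 0) {..<p} = L2_set (\<lambda>i. if i = j then 1 else 0 :: real) {..<p}"
    by (rule L2_set_cong) auto
  also have "\<dots> = 1" using j J by (auto simp: L2_set_def if_distrib[of "\<lambda>x. x\<^sup>2"] cong: if_cong)
  finally have "(\<lambda>i\<in>{..<p}. if i = j then 1 else 0) \<in> sparse_sphere p J"
    using j J by (auto simp: sparse_sphere_def)
  then show ?thesis by blast
qed

lemma prob_sphere_unif: "prob_space (sphere_unif p J)"
  using sparse_sphere_nonempty sphere_unif_cap(1)[of _ 1] by auto

end

section \<open>Prior mass near a sparse matrix\<close>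

lemma pattern_component:
  assumes "I \<in> patterns d p" "i < d" shows "I i \<subseteq> {..<p}" "I i \<noteq> {}"
  using assms by (auto simp: patterns_def PiE_iff PiE_eq_empty_iff)

lemma finite_patterns [simp]: "finite (patterns d p)"
  unfolding patterns_def by (rule finite_subset[of _ "{..<d} \<rightarrow>\<^sub>E Pow {..<p}"]) (auto intro: finite_PiE)

lemma pattern_card:
  assumes "I \<in> patterns d p" "i < d" shows "1 \<le> card (I i)" "card (I i) \<le> p"
proof -
  note c = pattern_component[OF assms]
  have "finite (I i)" using c(1) finite_subset by blast
  then show "1 \<le> card (I i)" using c(2) by (simp add: Suc_le_eq card_gt_0_iff)
  show "card (I i) \<le> p" using card_mono[OF _ c(1)] by simp
qed

lemma pattern_size_bounds:
  assumes "I \<in> patterns d p" shows "d \<le> pattern_size d I" "pattern_size d I \<le> d * p"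
proof -
  have "(\<Sum>i<d. 1) \<le> pattern_size d I"
    unfolding pattern_size_def by (intro sum_mono) (use pattern_card(1)[OF assms] in auto)
  then show "d \<le> pattern_size d I" by simp
  have "pattern_size d I \<le> (\<Sum>i<d. p)"
    unfolding pattern_size_def by (intro sum_mono) (use pattern_card(2)[OF assms] in auto)
  then show "pattern_size d I \<le> d * p" by simp
qed

lemma sparsity_pattern:
  assumes "\<Theta> \<in> sparse_mats d p"
  obtains I where "I \<in> patterns d p" "\<Theta> \<in> sparse_mats_on d p I" "pattern_size d I = sparsity d p \<Theta>"
proof -
  have "sparsity d p \<Theta> \<in> pattern_size d ` {I \<in> patterns d p. \<Theta> \<in> sparse_mats_on d p I}"
    unfolding sparsity_def using assms by (intro Min_in) (auto simp: sparse_mats_def)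
  then show ?thesis using that by auto
qed

lemma sizes_exist:
  assumes "d \<le> i" "i \<le> d * p" "p \<ge> 1"
  shows "\<exists>s :: nat \<Rightarrow> nat. (\<forall>k<d. 1 \<le> s k \<and> s k \<le> p) \<and> (\<Sum>k<d. s k) = i"
  using assms(1,2)
proof (induction d arbitrary: i)
  case 0 then show ?case by simp
next
  case (Suc d)
  \<comment> \<open>The last row takes as many entries as possible while leaving one for each of the others.\<close>
  define a where "a = min p (i - d)"
  have a: "1 \<le> a" "a \<le> p" using Suc.prems assms(3) by (auto simp: a_def)
  have "d \<le> i - a" "i - a \<le> d * p"
  proof -
    show "d \<le> i - a" using Suc.prems by (auto simp: a_def min_def)
    show "i - a \<le> d * p"
    proof (cases "p \<le> i - d")
      case True then show ?thesis using Suc.prems by (simp add: a_def)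
    next
      case False
      then have "i - a = d" using Suc.prems by (simp add: a_def)
      then show ?thesis using assms(3) by simp
    qed
  qed
  from Suc.IH[OF this] obtain s where s: "\<forall>k<d. 1 \<le> s k \<and> s k \<le> p" "(\<Sum>k<d. s k) = i - a" by blast
  have "(\<Sum>k<Suc d. (s(d := a)) k) = i"
    using s(2) Suc.prems by (simp add: a_def)
  moreover have "\<forall>k<Suc d. 1 \<le> (s(d := a)) k \<and> (s(d := a)) k \<le> p" using s(1) a by (auto simp: less_Suc_eq)
  ultimately show ?case by blast
qed

text \<open>
  Every size from \<open>d\<close> to \<open>d * p\<close> occurs, so each stage of the mixture keeps its full weight and the weights
  add up to one.
\<close>

lemma patterns_of_size_nonempty:
  assumes "d \<le> i" "i \<le> d * p" "p \<ge> 1" shows "patterns_of_size d p i \<noteq> {}"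
proof -
  obtain s where s: "\<forall>k<d. 1 \<le> s k \<and> s k \<le> p" "(\<Sum>k<d. s k) = i" using sizes_exist[OF assms] by blast
  let ?I = "\<lambda>k\<in>{..<d}. {..<s k}"
  have "?I \<in> patterns d p"
    using s(1) by (auto simp: patterns_def PiE_eq_empty_iff lessThan_empty_iff)
  moreover have "pattern_size d ?I = i" using s(2) by (simp add: pattern_size_def)
  ultimately show ?thesis by (auto simp: patterns_of_size_def)
qed

lemma finite_patterns_of_size [simp]: "finite (patterns_of_size d p i)"
  by (simp add: patterns_of_size_def)

text \<open>
  A pattern is a set of \<open>i\<close> of the \<open>d * p\<close> entries of the matrix.
\<close>

lemma card_patterns_of_size: "card (patterns_of_size d p i) \<le> (d * p) ^ i"
proof -
  let ?S = "{B. B \<subseteq> {..<d} \<times> {..<p} \<and> card B = i}"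
  have "inj_on (\<lambda>I. Sigma {..<d} I) (patterns_of_size d p i)"
  proof (rule inj_onI)
    fix I I' assume I: "I \<in> patterns_of_size d p i" "I' \<in> patterns_of_size d p i" and eq: "Sigma {..<d} I = Sigma {..<d} I'"
    have IP: "I \<in> {..<d} \<rightarrow>\<^sub>E Pow {..<p}" "I' \<in> {..<d} \<rightarrow>\<^sub>E Pow {..<p}"
      using I by (simp_all only: patterns_of_size_def patterns_def mem_Collect_eq)
    show "I = I'"
    proof (rule PiE_ext[OF IP], rule set_eqI)
      fix k x assume "k \<in> {..<d}"
      moreover have "(k, x) \<in> Sigma {..<d} I \<longleftrightarrow> (k, x) \<in> Sigma {..<d} I'" by (simp only: eq)
      ultimately show "x \<in> I k \<longleftrightarrow> x \<in> I' k" by simp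
    qed
  qed
  moreover have "(\<lambda>I. Sigma {..<d} I) ` patterns_of_size d p i \<subseteq> ?S"
  proof (intro image_subsetI CollectI conjI)
    fix I assume "I \<in> patterns_of_size d p i"
    then have I: "I \<in> patterns d p" "pattern_size d I = i" by (auto simp: patterns_of_size_def)
    show "Sigma {..<d} I \<subseteq> {..<d} \<times> {..<p}" using pattern_component(1)[OF I(1)] by blast
    have "finite (I k)" if "k \<in> {..<d}" for k
      using pattern_component(1)[OF I(1), of k] that finite_subset by blast
    then show "card (Sigma {..<d} I) = i" using I(2) by (simp add: pattern_size_def)
  qed
  moreover have "finite ?S" by (rule finite_subset[of _ "Pow ({..<d} \<times> {..<p})"]) auto
  ultimately have "card (patterns_of_size d p i) \<le> card ?S" by (rule card_inj_on_le)
  also have "card ?S = (d * p) choose i" by (subst n_subsets) auto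
  also have "\<dots> \<le> (d * p) ^ i"
  proof (cases "i \<le> d * p")
    case True then show ?thesis by (rule binomial_le_pow)
  next
    case False then show ?thesis by (simp add: binomial_eq_0)
  qed
  finally show ?thesis .
qed

lemma sets_mu_pattern [simp]: "sets (mu_pattern d p I) = sets (sparse_mat_space d p)"
  by (simp add: mu_pattern_def)

lemma sparse_cap_sets:
  "{\<Theta>' \<in> sparse_mats d p. \<forall>i<d. \<forall>j<p. \<bar>\<Theta>' i j - \<Theta> i j\<bar> \<le> \<eta>} \<in> sets (sparse_mat_space d p)"
proof -
  have entry: "{\<Theta>' \<in> space (sparse_mat_space d p). \<bar>\<Theta>' i j - \<Theta> i j\<bar> \<le> \<eta>} \<in> sets (sparse_mat_space d p)"
    if "i < d" "j < p" for i j
    by (rule borel_measurable_le[OF borel_measurable_abs[OF borel_measurable_diff[OF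
        mat_entry_measurable[OF that] borel_measurable_const]] borel_measurable_const])
  have row: "{\<Theta>' \<in> space (sparse_mat_space d p). \<forall>j\<in>{..<p}. \<bar>\<Theta>' i j - \<Theta> i j\<bar> \<le> \<eta>} \<in> sets (sparse_mat_space d p)"
    if "i < d" for i
    by (rule sets.sets_Collect_finite_All) (simp_all add: entry[OF that] del: space_sparse_mat_space)
  have "{\<Theta>' \<in> space (sparse_mat_space d p). \<forall>i\<in>{..<d}. \<forall>j\<in>{..<p}. \<bar>\<Theta>' i j - \<Theta> i j\<bar> \<le> \<eta>} \<in> sets (sparse_mat_space d p)"
    by (rule sets.sets_Collect_finite_All) (simp_all only: row finite_lessThan lessThan_iff)
  then show ?thesis by (simp only: space_sparse_mat_space Ball_def lessThan_iff)
qed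

text \<open>
  The rows are independent, so the caps of the spheres multiply.
\<close>

lemma mu_pattern_cap:
  assumes I: "I \<in> patterns d p" and p: "p \<ge> 1"
  shows "prob_space (mu_pattern d p I)"
    and "\<And>\<Theta> \<eta>. \<Theta> \<in> sparse_mats_on d p I \<Longrightarrow> 0 < \<eta> \<Longrightarrow> \<eta> \<le> 1 \<Longrightarrow>
      ennreal ((\<eta> / (4 * real p)) ^ pattern_size d I)
        \<le> emeasure (mu_pattern d p I) {\<Theta>' \<in> sparse_mats d p. \<forall>i<d. \<forall>j<p. \<bar>\<Theta>' i j - \<Theta> i j\<bar> \<le> \<eta>}"
proof -
  define M where "M i = sphere_unif p (if i < d then I i else {0})" for i
  have supp: "(if i < d then I i else {0}) \<subseteq> {..<p}" "(if i < d then I i else {0}) \<noteq> {}" for i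
    using pattern_component[OF I] p by auto
  have prob: "prob_space (M i)" for i
    unfolding M_def by (rule prob_sphere_unif[OF supp])
  interpret M: product_sigma_finite M
    by (simp add: product_sigma_finite_def prob_space_imp_sigma_finite prob)
  have PiM_eq: "(\<Pi>\<^sub>M i\<in>{..<d}. sphere_unif p (I i)) = PiM {..<d} M"
    by (rule PiM_cong) (auto simp: M_def)
  have spM: "space (M i) = sparse_sphere p (I i)" if "i < d" for i
    using that by (simp add: M_def space_sphere_unif)
  have setM: "sets (M i) = sets (restrict_space (vec_space p) (sparse_sphere p (I i)))" if "i < d" for i
    using that by (simp add: M_def sets_sphere_unif)
  have spPi: "space (PiM {..<d} M) = sparse_mats_on d p I"
    unfolding space_PiM sparse_mats_on_def by (rule PiE_cong) (simp add: spM)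
  have on_sub: "sparse_mats_on d p I \<subseteq> sparse_mats d p"
    unfolding sparse_mats_def using I by blast
  have id_meas: "(\<lambda>\<Theta>. \<Theta>) \<in> measurable (PiM {..<d} M) (sparse_mat_space d p)"
    unfolding sparse_mat_space_def
  proof (rule measurable_restrict_space2)
    show "(\<lambda>\<Theta>. \<Theta>) \<in> space (PiM {..<d} M) \<rightarrow> sparse_mats d p"
      unfolding spPi using on_sub by blast
    have m: "(\<lambda>\<Theta>. \<lambda>i\<in>{..<d}. \<Theta> i) \<in> measurable (PiM {..<d} M) (mat_space d p)"
      unfolding mat_space_def
    proof (rule measurable_restrict)
      fix i assume i: "i \<in> {..<d}"
      then have i': "i < d" by simp
      have "(\<lambda>\<Theta>. \<Theta> i) \<in> measurable (PiM {..<d} M) (M i)"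
        by (rule measurable_component_singleton[OF i])
      then have "(\<lambda>\<Theta>. \<Theta> i) \<in> measurable (PiM {..<d} M) (restrict_space (vec_space p) (sparse_sphere p (I i)))"
        by (simp only: measurable_cong_sets[OF refl setM[OF i']])
      then show "(\<lambda>\<Theta>. \<Theta> i) \<in> measurable (PiM {..<d} M) (vec_space p)"
        by (simp only: measurable_restrict_space2_iff)
    qed
    have eq: "(\<lambda>i\<in>{..<d}. \<Theta> i) = \<Theta>" if "\<Theta> \<in> space (PiM {..<d} M)" for \<Theta>
      using that unfolding space_PiM by (rule PiE_restrict)
    show "(\<lambda>\<Theta>. \<Theta>) \<in> measurable (PiM {..<d} M) (mat_space d p)"
      by (rule measurable_cong[OF eq, THEN iffD1, OF _ m])
  qed
  have mu_eq: "mu_pattern d p I = distr (PiM {..<d} M) (sparse_mat_space d p) (\<lambda>\<Theta>. \<Theta>)"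
    unfolding mu_pattern_def PiM_eq ..
  show "prob_space (mu_pattern d p I)"
    unfolding mu_eq by (rule prob_space.prob_space_distr[OF prob_space_PiM[OF prob] id_meas])
  fix \<Theta> and \<eta> :: real assume \<Theta>: "\<Theta> \<in> sparse_mats_on d p I" and \<eta>: "0 < \<eta>" "\<eta> \<le> 1"
  let ?B = "{\<Theta>' \<in> sparse_mats d p. \<forall>i<d. \<forall>j<p. \<bar>\<Theta>' i j - \<Theta> i j\<bar> \<le> \<eta>}"
  let ?cap = "\<lambda>i. {v \<in> sparse_sphere p (I i). \<forall>j<p. \<bar>v j - \<Theta> i j\<bar> \<le> \<eta>}"
  have B_sets: "?B \<in> sets (sparse_mat_space d p)" by (rule sparse_cap_sets)
  have cap_sets: "?cap i \<in> sets (M i)" if i: "i < d" for i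
  proof -
    have entry: "{v \<in> space (vec_space p). \<bar>v j - \<Theta> i j\<bar> \<le> \<eta>} \<in> sets (vec_space p)" if "j < p" for j
      by (rule borel_measurable_le[OF borel_measurable_abs[OF borel_measurable_diff[OF
          vec_component_measurable[OF that] borel_measurable_const]] borel_measurable_const])
    have "{v \<in> space (vec_space p). \<forall>j\<in>{..<p}. \<bar>v j - \<Theta> i j\<bar> \<le> \<eta>} \<in> sets (vec_space p)"
      by (rule sets.sets_Collect_finite_All) (simp_all only: entry finite_lessThan lessThan_iff)
    then have "sparse_sphere p (I i) \<inter> {v \<in> space (vec_space p). \<forall>j\<in>{..<p}. \<bar>v j - \<Theta> i j\<bar> \<le> \<eta>} \<in> sets (M i)"
      unfolding setM[OF i] sets_restrict_space by (rule imageI)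
    also have "sparse_sphere p (I i) \<inter> {v \<in> space (vec_space p). \<forall>j\<in>{..<p}. \<bar>v j - \<Theta> i j\<bar> \<le> \<eta>} = ?cap i"
      using sparse_sphere_space by auto
    finally show ?thesis .
  qed
  have pre: "(\<lambda>\<Theta>. \<Theta>) -` ?B \<inter> space (PiM {..<d} M) = PiE {..<d} ?cap"
  proof -
    have cap: "\<Theta>' \<in> PiE {..<d} ?cap \<longleftrightarrow> \<Theta>' \<in> sparse_mats_on d p I \<and> (\<forall>i<d. \<forall>j<p. \<bar>\<Theta>' i j - \<Theta> i j\<bar> \<le> \<eta>)" for \<Theta>'
      unfolding sparse_mats_on_def PiE_iff Ball_def lessThan_iff mem_Collect_eq by (rule iffI; simp)
    show ?thesis
      by (rule set_eqI) (use subsetD[OF on_sub] in \<open>simp only: cap spPi vimage_def Int_iff mem_Collect_eq, blast\<close>)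
  qed
  have "ennreal ((\<eta> / (4 * real p)) ^ pattern_size d I) = (\<Prod>i<d. ennreal ((\<eta> / (4 * real p)) ^ card (I i)))"
    unfolding pattern_size_def power_sum by (rule prod_ennreal[symmetric]) (use \<eta> in simp)
  also have "\<dots> \<le> (\<Prod>i<d. emeasure (M i) (?cap i))"
  proof (rule prod_mono_ennreal)
    fix i assume "i \<in> {..<d}"
    then have i: "i < d" by simp
    then have "\<Theta> i \<in> sparse_sphere p (I i)" using \<Theta> by (auto simp: sparse_mats_on_def)
    from sphere_unif_cap(2)[OF pattern_component[OF I i] this \<eta>]
    show "ennreal ((\<eta> / (4 * real p)) ^ card (I i)) \<le> emeasure (M i) (?cap i)" using i by (simp add: M_def)
  qed
  also have "\<dots> = emeasure (PiM {..<d} M) (PiE {..<d} ?cap)"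
    by (rule M.emeasure_PiM[OF finite_lessThan cap_sets, symmetric]) simp
  also have "\<dots> = emeasure (mu_pattern d p I) ?B"
    unfolding mu_eq emeasure_distr[OF id_meas B_sets] pre ..
  finally show "ennreal ((\<eta> / (4 * real p)) ^ pattern_size d I) \<le> emeasure (mu_pattern d p I) ?B" .
qed

lemma sets_mu [simp]: "sets (mu d p) = sets (sparse_mat_space d p)"
  by (simp add: mu_def)

lemma space_mu [simp]: "space (mu d p) = sparse_mats d p"
  by (simp add: mu_def)

lemma geometric_sum_tenth: "(\<Sum>k\<le>n. (1 / 10 :: real) ^ k) = (10 - (1 / 10) ^ n) / 9"
proof (induction n)
  case (Suc n)
  obtain x where x: "(1 / 10 :: real) ^ n = x" by simp
  show ?case using Suc unfolding sum.atMost_Suc power_Suc x by simp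
qed simp

lemma sum_shift_to_0: "d \<le> q \<Longrightarrow> (\<Sum>i=d..q. f (i - d)) = (\<Sum>k\<le>q - d. f k)" for d q :: nat
  by (rule sum.reindex_bij_witness[where j = "\<lambda>i. i - d" and i = "\<lambda>k. k + d"]) auto

lemma ten_powi_minus: "10 powi (- int k) = (1 / 10 :: real) ^ k"
  by (simp add: power_int_minus power_divide inverse_eq_divide)

lemma mu_weight:
  assumes "d \<ge> 1" "p \<ge> 1"
  shows "(\<Sum>i=d..d * p. 9 / (1 - 10 powi ((1 - int p) * int d - 1)) * 10 powi (- int i + int d - 1)) = (1::real)"
    and "d \<le> i \<Longrightarrow> 9 / (1 - 10 powi ((1 - int p) * int d - 1)) * 10 powi (- int i + int d - 1) \<ge> (1 / 10 :: real) ^ i"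
    and "9 / (1 - 10 powi ((1 - int p) * int d - 1)) \<ge> (9::real)"
proof -
  define K where "K = d * p - d"
  have dp: "d \<le> d * p" using assms by simp
  have e: "(1 - int p) * int d - 1 = - int (K + 1)"
    using dp by (simp add: K_def of_nat_diff algebra_simps)
  define c where "c = 9 / (1 - (1 / 10 :: real) ^ (K + 1))"
  have c_eq: "9 / (1 - 10 powi ((1 - int p) * int d - 1)) = c"
    unfolding e ten_powi_minus c_def ..
  have "(1 / 10 :: real) ^ (K + 1) \<le> (1 / 10) ^ 1" by (rule power_decreasing) auto
  then have lt: "(1 / 10 :: real) ^ (K + 1) < 1" by simp
  have pos: "1 - (1 / 10 :: real) ^ (K + 1) > 0" using lt by simp
  have "c \<ge> 9 / 1" unfolding c_def using pos by (intro divide_left_mono) auto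
  then show c9: "9 / (1 - 10 powi ((1 - int p) * int d - 1)) \<ge> (9::real)" unfolding c_eq by simp
  have pw: "10 powi (- int i + int d - 1) = (1 / 10 :: real) ^ (i - d + 1)" if "d \<le> i" for i
  proof -
    have "- int i + int d - 1 = - int (i - d + 1)" using that by simp
    then show ?thesis by (simp only: ten_powi_minus)
  qed
  have "(\<Sum>i=d..d * p. 9 / (1 - 10 powi ((1 - int p) * int d - 1)) * 10 powi (- int i + int d - 1))
     = (\<Sum>i=d..d * p. c * (1 / 10) ^ (i - d + 1))"
    unfolding c_eq by (intro sum.cong refl) (simp only: pw atLeastAtMost_iff)
  also have "\<dots> = (\<Sum>k\<le>K. c * (1 / 10) ^ (k + 1))"
    unfolding K_def by (rule sum_shift_to_0[OF dp, of "\<lambda>k. c * (1 / 10) ^ (k + 1)"])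
  also have "\<dots> = c / 10 * (\<Sum>k\<le>K. (1 / 10) ^ k)" by (simp add: sum_distrib_left)
  also have "\<dots> = 1" unfolding geometric_sum_tenth c_def using pos by (simp add: field_simps)
  finally show "(\<Sum>i=d..d * p. 9 / (1 - 10 powi ((1 - int p) * int d - 1)) * 10 powi (- int i + int d - 1)) = (1::real)" .
  show "9 / (1 - 10 powi ((1 - int p) * int d - 1)) * 10 powi (- int i + int d - 1) \<ge> (1 / 10 :: real) ^ i" if "d \<le> i"
  proof -
    have "(1 / 10 :: real) ^ i = 1 * (1 / 10) ^ i" by simp
    also have "\<dots> \<le> 9 * (1 / 10 :: real) ^ (i - d + 1)"
    proof -
      have "(1 / 10 :: real) ^ i \<le> (1 / 10) ^ (i - d + 1)"
        by (rule power_decreasing) (use that assms in auto)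
      moreover have "0 \<le> (1 / 10 :: real) ^ (i - d + 1)" by simp
      ultimately show ?thesis by linarith
    qed
    also have "\<dots> \<le> c * (1 / 10 :: real) ^ (i - d + 1)" using c9 unfolding c_eq by (intro mult_right_mono) auto
    finally show ?thesis unfolding c_eq pw[OF that] .
  qed
qed

lemma prob_mu:
  assumes "d \<ge> 1" "p \<ge> 1" shows "prob_space (mu d p)"
  unfolding mu_def
proof (rule prob_space_mixture)
  let ?J = "SIGMA i:{d..d * p}. patterns_of_size d p i"
  show "finite ?J" by (intro finite_SigmaI) auto
  show "prob_space (case j of (i, I) \<Rightarrow> mu_pattern d p I)" if "j \<in> ?J" for j
    using that mu_pattern_cap(1)[OF _ assms(2)] by (auto simp: patterns_of_size_def)
  let ?c = "9 / (1 - 10 powi ((1 - int p) * int d - 1)) :: real"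
  have c: "?c \<ge> 0" using mu_weight(3)[OF assms] by linarith
  show "0 \<le> (case j of (i, I) \<Rightarrow> ?c * 10 powi (- int i + int d - 1) / real (card (patterns_of_size d p i)))" if "j \<in> ?J" for j
    using c by (auto intro!: divide_nonneg_nonneg mult_nonneg_nonneg split: prod.split)
  have "(\<Sum>j\<in>?J. (case j of (i, I) \<Rightarrow> ?c * 10 powi (- int i + int d - 1) / real (card (patterns_of_size d p i))))
      = (\<Sum>i=d..d * p. \<Sum>I\<in>patterns_of_size d p i. ?c * 10 powi (- int i + int d - 1) / real (card (patterns_of_size d p i)))"
    by (subst sum.Sigma) auto
  also have "\<dots> = (\<Sum>i=d..d * p. ?c * 10 powi (- int i + int d - 1))"
  proof (intro sum.cong refl)
    fix i assume "i \<in> {d..d * p}"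
    then have "card (patterns_of_size d p i) \<noteq> 0" using patterns_of_size_nonempty[of d i p] assms by simp
    then show "(\<Sum>I\<in>patterns_of_size d p i. ?c * 10 powi (- int i + int d - 1) / real (card (patterns_of_size d p i))) = ?c * 10 powi (- int i + int d - 1)"
      by simp
  qed
  also have "\<dots> = 1" by (rule mu_weight(1)[OF assms])
  finally show "(\<Sum>j\<in>?J. (case j of (i, I) \<Rightarrow> ?c * 10 powi (- int i + int d - 1) / real (card (patterns_of_size d p i)))) = 1" .
qed auto

text \<open>
  Choose a pattern of minimal size \<open>k\<close>. The mixture gives it a weight of at least \<open>10 ^ (- k)\<close> divided by the
  number of patterns, at most \<open>(d * p) ^ k\<close>, and the cap has conditional mass at least \<open>(\<eta> / (4 * p)) ^ k\<close>.
\<close>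

lemma mu_cap:
  assumes \<Theta>: "\<Theta> \<in> sparse_mats d p" and dp: "d \<ge> 1" "p \<ge> 1" and \<eta>: "0 < \<eta>" "\<eta> \<le> 1"
  shows "ennreal ((\<eta> / (40 * real d * (real p)\<^sup>2)) ^ sparsity d p \<Theta>)
    \<le> emeasure (mu d p) {\<Theta>' \<in> sparse_mats d p. \<forall>i<d. \<forall>j<p. \<bar>\<Theta>' i j - \<Theta> i j\<bar> \<le> \<eta>}"
proof -
  let ?B = "{\<Theta>' \<in> sparse_mats d p. \<forall>i<d. \<forall>j<p. \<bar>\<Theta>' i j - \<Theta> i j\<bar> \<le> \<eta>}"
  obtain I where I: "I \<in> patterns d p" "\<Theta> \<in> sparse_mats_on d p I" "pattern_size d I = sparsity d p \<Theta>"
    using sparsity_pattern[OF \<Theta>] .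
  define k where "k = sparsity d p \<Theta>"
  have k: "d \<le> k" "k \<le> d * p" using pattern_size_bounds[OF I(1)] I(3) by (auto simp: k_def)
  have Ik: "I \<in> patterns_of_size d p k" using I by (simp add: patterns_of_size_def k_def)
  define w where "w = 9 / (1 - 10 powi ((1 - int p) * int d - 1)) * 10 powi (- int k + int d - 1) / real (card (patterns_of_size d p k))"
  have card_pos: "real (card (patterns_of_size d p k)) > 0" using Ik by (auto simp: card_gt_0_iff)
  have "real (card (patterns_of_size d p k)) \<le> real ((d * p) ^ k)"
    using card_patterns_of_size[of d p k] by (simp only: of_nat_le_iff)
  then have "(1 / 10) ^ k / real ((d * p) ^ k) \<le> w"
    unfolding w_def
    by (intro frac_le mu_weight(2)[OF dp k(1)] card_pos order_trans[OF _ mu_weight(2)[OF dp k(1)]]) simp_all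
  moreover have "(1 / (10 * real d * real p)) ^ k = (1 / 10) ^ k / real ((d * p) ^ k)"
  proof -
    have "1 / (10 * real d * real p) = (1 / 10) / real (d * p)" by simp
    then show ?thesis by (simp only: power_divide of_nat_power)
  qed
  ultimately have w: "(1 / (10 * real d * real p)) ^ k \<le> w" by (simp only:)
  have B_sets: "?B \<in> sets (sparse_mat_space d p)" by (rule sparse_cap_sets)
  have "(\<eta> / (40 * real d * (real p)\<^sup>2)) ^ k = (1 / (10 * real d * real p)) ^ k * (\<eta> / (4 * real p)) ^ k"
  proof -
    have "\<eta> / (40 * real d * (real p)\<^sup>2) = 1 / (10 * real d * real p) * (\<eta> / (4 * real p))"
      by (simp add: power2_eq_square)
    then show ?thesis by (simp only: power_mult_distrib)
  qed
  also have "\<dots> \<le> w * (\<eta> / (4 * real p)) ^ k"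
    by (rule mult_right_mono[OF w]) (use \<eta> in simp)
  finally have "ennreal ((\<eta> / (40 * real d * (real p)\<^sup>2)) ^ k) \<le> ennreal (w * (\<eta> / (4 * real p)) ^ k)"
    by (rule ennreal_leI)
  also have "\<dots> = ennreal w * ennreal ((\<eta> / (4 * real p)) ^ k)"
    by (rule ennreal_mult'') (use \<eta> in simp)
  also have "\<dots> \<le> ennreal w * emeasure (mu_pattern d p I) ?B"
    using mu_pattern_cap(2)[OF I(1) dp(2) I(2) \<eta>] unfolding I(3) k_def by (rule mult_left_mono) simp
  also have "\<dots> \<le> emeasure (mu d p) ?B"
  proof -
    let ?J = "SIGMA i:{d..d * p}. patterns_of_size d p i"
    let ?w = "\<lambda>(i, I). 9 / (1 - 10 powi ((1 - int p) * int d - 1))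
        * 10 powi (- int i + int d - 1) / real (card (patterns_of_size d p i))"
    have "ennreal (?w (k, I)) * emeasure ((\<lambda>(i, I). mu_pattern d p I) (k, I)) ?B \<le> emeasure (mu d p) ?B"
      unfolding mu_def
    proof (rule mixture_ge[where j = "(k, I)" and w = ?w and m = "\<lambda>(i, I). mu_pattern d p I"])
      show "finite ?J" by (intro finite_SigmaI) simp_all
      show "(k, I) \<in> ?J" using k Ik by simp
      show "sets ((\<lambda>(i, I). mu_pattern d p I) j) = sets (sparse_mat_space d p)" for j
        by (cases j) simp
      show "?B \<in> sets (sparse_mat_space d p)" by (rule B_sets)
    qed
    then show ?thesis by (simp only: prod.case w_def)
  qed
  finally show ?thesis by (simp add: k_def)
qed

section \<open>Prior mass near a wavelet expansion\<close>

lemma nu_weight: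
  "(\<Sum>M\<in>{0..n}. 9 / (10 - 10 powi (- int n)) * 10 powi (- int M)) = (1::real)"
  "9 / (10 - 10 powi (- int n)) * 10 powi (- int M) \<ge> (1 / 10 :: real) ^ (M + 1)"
proof -
  obtain y where y: "(1 / 10 :: real) ^ n = y" by simp
  have y1: "y \<le> 1" "y > 0" unfolding y[symmetric] by (auto simp: power_le_one)
  have "(\<Sum>M\<in>{0..n}. 9 / (10 - 10 powi (- int n)) * 10 powi (- int M)) = 9 / (10 - y) * (\<Sum>M\<le>n. (1 / 10 :: real) ^ M)"
    unfolding ten_powi_minus y by (simp only: sum_distrib_left atLeast0AtMost)
  also have "\<dots> = 1" unfolding geometric_sum_tenth y using y1 by simp
  finally show "(\<Sum>M\<in>{0..n}. 9 / (10 - 10 powi (- int n)) * 10 powi (- int M)) = (1::real)" .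
  have "1 / 10 \<le> 9 / (10 - y)" using y1 by (simp add: field_simps)
  then have "1 / 10 * (1 / 10 :: real) ^ M \<le> 9 / (10 - y) * (1 / 10) ^ M" by (rule mult_right_mono) simp
  then show "9 / (10 - 10 powi (- int n)) * 10 powi (- int M) \<ge> (1 / 10 :: real) ^ (M + 1)"
    unfolding ten_powi_minus y by simp
qed

lemma prior_weight:
  assumes "p \<ge> 1"
  shows "(\<Sum>d\<in>{1..p}. 9 / (1 - 10 powi (- int p)) * 10 powi (- int d)) = (1::real)"
    "9 / (1 - 10 powi (- int p)) * 10 powi (- int d) \<ge> (1 / 10 :: real) ^ d"
proof -
  obtain y where y: "(1 / 10 :: real) ^ p = y" by simp
  have "(1 / 10 :: real) ^ p \<le> (1 / 10) ^ 1" by (rule power_decreasing) (use assms in auto)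
  then have y1: "y \<le> 1 / 10" "y > 0" unfolding y[symmetric] by auto
  have "(\<Sum>d\<in>{1..p}. (1 / 10 :: real) ^ d) = (\<Sum>d\<le>p. (1 / 10) ^ d) - 1"
    by (simp add: atMost_atLeast0 sum.atLeast_Suc_atMost)
  also have "\<dots> = (1 - y) / 9" unfolding geometric_sum_tenth y by simp
  finally have s: "(\<Sum>d\<in>{1..p}. (1 / 10 :: real) ^ d) = (1 - y) / 9" .
  show "(\<Sum>d\<in>{1..p}. 9 / (1 - 10 powi (- int p)) * 10 powi (- int d)) = (1::real)"
    unfolding ten_powi_minus y sum_distrib_left[symmetric] s using y1 by simp
  have "1 \<le> 9 / (1 - y)" using y1 by (simp add: field_simps)
  then have "1 * (1 / 10 :: real) ^ d \<le> 9 / (1 - y) * (1 / 10) ^ d" by (rule mult_right_mono) simp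
  then show "9 / (1 - 10 powi (- int p)) * 10 powi (- int d) \<ge> (1 / 10 :: real) ^ d"
    unfolding ten_powi_minus y by simp
qed

locale link_prior = two_scale_pair +
  fixes N n p :: nat and C :: real
  assumes C: "C \<ge> 1" and p: "p \<ge> 1"
begin

abbreviation coeffs :: "nat \<Rightarrow> nat \<Rightarrow> (windex \<Rightarrow> real) measure" where
  "coeffs d M \<equiv> \<Pi>\<^sub>M l\<in>wavelet_index d (enat M) (enat N). lborel"

abbreviation ball :: "nat \<Rightarrow> nat \<Rightarrow> (windex \<Rightarrow> real) set" where
  "ball d M \<equiv> coeff_ball \<phi> \<psi> N d M (C + 1)"

definition scale :: "nat \<Rightarrow> windex \<Rightarrow> real" where
  "scale d l = L ^ d * 2 powr (real (fst l) * (real d / 2 + 1))"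

lemma scale_pos: "scale d l > 0" using L_pos by (simp add: scale_def)

lemma coeff_norm_scale: "coeff_norm \<phi> \<psi> N d M b = (\<Sum>l\<in>wavelet_index d (enat M) (enat N). scale d l * \<bar>b l\<bar>)"
  by (simp only: coeff_norm_def scale_def sum_distrib_left mult.assoc)

lemma ball_sets: "ball d M \<in> sets (coeffs d M)"
proof -
  have "ball d M = {b \<in> space (coeffs d M). coeff_norm \<phi> \<psi> N d M b \<le> C + 1}"
    by (simp add: coeff_ball_def space_PiM)
  also have "\<dots> \<in> sets (coeffs d M)" unfolding coeff_norm_def by measurable
  finally show ?thesis .
qed

lemma zero_index: "(0, (\<lambda>i\<in>{..<d}. 0), (\<lambda>i\<in>{..<d}. 0)) \<in> wavelet_index d (enat M) (enat N)"
  by (simp add: wavelet_index_finite_iff)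

lemma card_index_pos: "card (wavelet_index d (enat M) (enat N)) \<ge> 1"
  using zero_index[of d M] by (auto simp: Suc_le_eq card_gt_0_iff)

lemma expansion_measurable:
  assumes M: "M \<le> n"
  shows "expansion \<phi> \<psi> N d M \<in> measurable (uniform_on (coeffs d M) (ball d M)) (link_space \<phi> \<psi> N n C d)"
  unfolding link_space_def
proof (rule measurable_restrict_space2)
  show "expansion \<phi> \<psi> N d M \<in> space (uniform_on (coeffs d M) (ball d M)) \<rightarrow> links \<phi> \<psi> N n C d"
    unfolding space_uniform_on[OF ball_sets] links_def using M by auto
  have "expansion \<phi> \<psi> N d M \<in> measurable (coeffs d M) (\<Pi>\<^sub>M x\<in>space (vec_space d). borel)"
    unfolding expansion_def by (rule measurable_restrict) measurable
  then have "expansion \<phi> \<psi> N d M \<in> measurable (restrict_space (coeffs d M) (ball d M)) (\<Pi>\<^sub>M x\<in>space (vec_space d). borel)"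
    by (rule measurable_restrict_space1)
  then show "expansion \<phi> \<psi> N d M \<in> measurable (uniform_on (coeffs d M) (ball d M)) (\<Pi>\<^sub>M x\<in>space (vec_space d). borel)"
    by (simp only: measurable_cong_sets[OF sets_uniform_on refl])
qed

lemma sets_nu_level: "sets (nu_level \<phi> \<psi> N n C d M) = sets (link_space \<phi> \<psi> N n C d)"
  by (simp add: nu_level_def)

text \<open>
  The box with half sides inversely proportional to the weights has coefficient norm at most \<open>\<eta>\<close> around \<open>b\<close>
  and fits into the ball of radius \<open>C + 1\<close>. That ball lies in a box whose half sides have the same proportions,
  so all \<open>D\<close> coordinates contribute the same ratio \<open>\<eta> / ((C + 1) * D)\<close>.
\<close>

lemma nu_level_near:
  assumes b: "coeff_norm \<phi> \<psi> N d M b \<le> C" and \<eta>: "0 < \<eta>" "\<eta> \<le> 1" and M: "M \<le> n"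
  defines "D \<equiv> card (wavelet_index d (enat M) (enat N))"
  shows "prob_space (nu_level \<phi> \<psi> N n C d M)"
    and "\<And>B. B \<in> sets (link_space \<phi> \<psi> N n C d) \<Longrightarrow>
      (\<And>b'. b' \<in> ball d M \<Longrightarrow> coeff_norm \<phi> \<psi> N d M (\<lambda>l. b' l - b l) \<le> \<eta> \<Longrightarrow> expansion \<phi> \<psi> N d M b' \<in> B) \<Longrightarrow>
      ennreal ((\<eta> / ((C + 1) * real D)) ^ D) \<le> emeasure (nu_level \<phi> \<psi> N n C d M) B"
proof -
  let ?Z = "wavelet_index d (enat M) (enat N)"
  have D1: "D \<ge> 1" unfolding D_def by (rule card_index_pos)
  define r where "r l = \<eta> / (scale d l * real D)" for l
  define R where "R l = (C + 1) / scale d l" for l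
  have rpos: "r l > 0" and Rpos: "R l > 0" for l
    using \<eta> C D1 scale_pos[of d l] by (auto simp: r_def R_def)
  let ?Q = "PiE ?Z (\<lambda>l. {b l - r l..b l + r l})"
  have near: "coeff_norm \<phi> \<psi> N d M (\<lambda>l. b' l - b l) \<le> \<eta>" if "b' \<in> ?Q" for b'
  proof -
    have "coeff_norm \<phi> \<psi> N d M (\<lambda>l. b' l - b l) \<le> (\<Sum>l\<in>?Z. \<eta> / real D)"
      unfolding coeff_norm_scale
    proof (rule sum_mono)
      fix l assume l: "l \<in> ?Z"
      have "b l - r l \<le> b' l" "b' l \<le> b l + r l" using that l by (auto simp: PiE_iff)
      then have "\<bar>b' l - b l\<bar> \<le> r l" by linarith
      then have "scale d l * \<bar>b' l - b l\<bar> \<le> scale d l * r l"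
        using scale_pos[of d l] by (intro mult_left_mono) auto
      also have "\<dots> = \<eta> / real D" using scale_pos[of d l] by (simp add: r_def)
      finally show "scale d l * \<bar>b' l - b l\<bar> \<le> \<eta> / real D" .
    qed
    also have "\<dots> = \<eta>" unfolding sum_constant D_def[symmetric] using D1 by simp
    finally show ?thesis .
  qed
  have inner: "?Q \<subseteq> ball d M"
  proof
    fix b' assume b': "b' \<in> ?Q"
    have "coeff_norm \<phi> \<psi> N d M b' \<le> coeff_norm \<phi> \<psi> N d M b + coeff_norm \<phi> \<psi> N d M (\<lambda>l. b' l - b l)"
      unfolding coeff_norm_scale sum.distrib[symmetric]
    proof (rule sum_mono)
      fix l
      have "\<bar>b' l\<bar> \<le> \<bar>b l\<bar> + \<bar>b' l - b l\<bar>" by linarith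
      from mult_left_mono[OF this, of "scale d l"] scale_pos[of d l]
      show "scale d l * \<bar>b' l\<bar> \<le> scale d l * \<bar>b l\<bar> + scale d l * \<bar>b' l - b l\<bar>" by (simp add: distrib_left)
    qed
    also have "\<dots> \<le> C + 1" using b near[OF b'] \<eta> by simp
    finally show "b' \<in> ball d M" using b' unfolding coeff_ball_def by (simp add: PiE_iff)
  qed
  have outer: "ball d M \<subseteq> PiE ?Z (\<lambda>l. {- R l..R l})"
  proof
    fix b' assume b': "b' \<in> ball d M"
    have "\<bar>b' l\<bar> \<le> R l" if l: "l \<in> ?Z" for l
    proof -
      have "scale d l * \<bar>b' l\<bar> \<le> coeff_norm \<phi> \<psi> N d M b'"
        unfolding coeff_norm_scale
        by (rule member_le_sum[OF l, of "\<lambda>l. scale d l * \<bar>b' l\<bar>"]) (auto intro!: mult_nonneg_nonneg less_imp_le[OF scale_pos])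
      also have "\<dots> \<le> C + 1" using b' by (simp add: coeff_ball_def)
      finally show ?thesis using scale_pos[of d l] by (simp add: R_def pos_le_divide_eq mult.commute)
    qed
    then show "b' \<in> PiE ?Z (\<lambda>l. {- R l..R l})"
      using b' unfolding coeff_ball_def by (simp add: PiE_iff abs_le_iff minus_le_iff)
  qed
  note unif = uniform_on_box[OF finite_wavelet_index ball_sets inner outer rpos Rpos]
  have nu: "nu_level \<phi> \<psi> N n C d M = distr (uniform_on (coeffs d M) (ball d M)) (link_space \<phi> \<psi> N n C d) (expansion \<phi> \<psi> N d M)"
    by (simp add: nu_level_def)
  show "prob_space (nu_level \<phi> \<psi> N n C d M)"
    unfolding nu by (rule prob_space.prob_space_distr[OF unif(1) expansion_measurable[OF M]])
  fix B assume B: "B \<in> sets (link_space \<phi> \<psi> N n C d)"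
    and BQ: "\<And>b'. b' \<in> ball d M \<Longrightarrow> coeff_norm \<phi> \<psi> N d M (\<lambda>l. b' l - b l) \<le> \<eta> \<Longrightarrow> expansion \<phi> \<psi> N d M b' \<in> B"
  let ?P = "expansion \<phi> \<psi> N d M -` B \<inter> space (uniform_on (coeffs d M) (ball d M))"
  have QP: "?Q \<subseteq> ?P"
    unfolding space_uniform_on[OF ball_sets] using inner near BQ by blast
  have "(\<eta> / ((C + 1) * real D)) ^ D = (\<Prod>l\<in>?Z. r l / R l)"
  proof -
    have "r l / R l = \<eta> / ((C + 1) * real D)" for l
      using scale_pos[of d l] by (simp add: r_def R_def)
    then show ?thesis by (simp only: prod_constant D_def)
  qed
  then have "ennreal ((\<eta> / ((C + 1) * real D)) ^ D) \<le> emeasure (uniform_on (coeffs d M) (ball d M)) ?P"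
    using unif(2)[OF measurable_sets[OF expansion_measurable[OF M] B] QP] by (simp only:)
  also have "\<dots> = emeasure (nu_level \<phi> \<psi> N n C d M) B"
    unfolding nu by (rule emeasure_distr[OF expansion_measurable[OF M] B, symmetric])
  finally show "ennreal ((\<eta> / ((C + 1) * real D)) ^ D) \<le> emeasure (nu_level \<phi> \<psi> N n C d M) B" .
qed

lemma coeff_norm_zero: "coeff_norm \<phi> \<psi> N d M (\<lambda>_. 0) \<le> C"
  using C by (simp add: coeff_norm_def)

lemma prob_nu_level: "M \<le> n \<Longrightarrow> prob_space (nu_level \<phi> \<psi> N n C d M)"
  by (rule nu_level_near(1)[OF coeff_norm_zero, of 1]) simp_all

abbreviation link_law :: "nat \<Rightarrow> (rvec \<Rightarrow> real) measure" where "link_law d \<equiv> nu \<phi> \<psi> N n C d"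

lemma sets_link_law: "sets (link_law d) = sets (link_space \<phi> \<psi> N n C d)"
  by (simp add: nu_def)

lemma prob_link_law: "prob_space (link_law d)"
  unfolding nu_def
proof (rule prob_space_mixture)
  fix M assume "M \<in> {0..n}"
  then show "prob_space (nu_level \<phi> \<psi> N n C d M)" using prob_nu_level by simp
  show "(0::real) \<le> 9 / (10 - 10 powi (- int n)) * 10 powi (- int M)"
    by (rule order_trans[OF _ nu_weight(2)]) simp
qed (simp_all only: finite_atLeastAtMost sets_nu_level nu_weight(1))

lemma link_law_near:
  assumes b: "coeff_norm \<phi> \<psi> N d M b \<le> C" and \<eta>: "0 < \<eta>" "\<eta> \<le> 1" and M: "M \<le> n"
    and B: "B \<in> sets (link_space \<phi> \<psi> N n C d)"
    and BQ: "\<And>b'. b' \<in> ball d M \<Longrightarrow> coeff_norm \<phi> \<psi> N d M (\<lambda>l. b' l - b l) \<le> \<eta> \<Longrightarrow> expansion \<phi> \<psi> N d M b' \<in> B"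
  defines "D \<equiv> card (wavelet_index d (enat M) (enat N))"
  shows "ennreal ((1 / 10) ^ (M + 1) * (\<eta> / ((C + 1) * real D)) ^ D) \<le> emeasure (link_law d) B"
proof -
  let ?w = "9 / (10 - 10 powi (- int n)) * 10 powi (- int M) :: real"
  have nn: "0 \<le> (\<eta> / ((C + 1) * real D)) ^ D" using \<eta> C by simp
  have "(1 / 10) ^ (M + 1) * (\<eta> / ((C + 1) * real D)) ^ D \<le> ?w * (\<eta> / ((C + 1) * real D)) ^ D"
    by (rule mult_right_mono[OF nu_weight(2) nn])
  then have "ennreal ((1 / 10) ^ (M + 1) * (\<eta> / ((C + 1) * real D)) ^ D) \<le> ennreal (?w * (\<eta> / ((C + 1) * real D)) ^ D)"
    by (rule ennreal_leI)
  also have "\<dots> = ennreal ?w * ennreal ((\<eta> / ((C + 1) * real D)) ^ D)"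
    by (rule ennreal_mult''[OF nn])
  also have "\<dots> \<le> ennreal ?w * emeasure (nu_level \<phi> \<psi> N n C d M) B"
    unfolding D_def by (rule mult_left_mono[OF nu_level_near(2)[OF b \<eta> M B BQ]]) simp_all
  also have "\<dots> \<le> emeasure (link_law d) B"
    unfolding nu_def
    by (rule mixture_ge[where j = M and w = "\<lambda>M. 9 / (10 - 10 powi (- int n)) * 10 powi (- int M)" and m = "nu_level \<phi> \<psi> N n C d"])
       (simp_all add: M B sets_nu_level del: atLeast0AtMost)
  finally show ?thesis .
qed

abbreviation prior0 where "prior0 \<equiv> prior \<phi> \<psi> N n C p"
abbreviation params where "params \<equiv> param_space \<phi> \<psi> N n C p"

abbreviation slice where "slice d \<equiv> sparse_mat_space d p \<Otimes>\<^sub>M link_space \<phi> \<psi> N n C d"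

lemma sets_slice: "sets (mu d p \<Otimes>\<^sub>M link_law d) = sets (slice d)"
  by (rule sets_pair_measure_cong[OF sets_mu sets_link_law])

lemma Pair_params:
  assumes "d \<in> {1..p}" shows "Pair d \<in> measurable (mu d p \<Otimes>\<^sub>M link_law d) params"
  unfolding param_space_coproduct measurable_cong_sets[OF sets_slice refl]
  by (rule measurable_Pair_coproduct[OF assms])

lemma sets_prior [simp]: "sets prior0 = sets params"
  by (simp add: prior_def)

lemma prob_prior: "prob_space prior0"
  unfolding prior_def
proof (rule prob_space_mixture)
  fix d assume d: "d \<in> {1..p}"
  interpret a: prob_space "mu d p" by (rule prob_mu) (use d p in auto)
  interpret b: prob_space "link_law d" by (rule prob_link_law)
  interpret ab: pair_prob_space "mu d p" "link_law d" ..
  show "prob_space (distr (mu d p \<Otimes>\<^sub>M link_law d) params (Pair d))"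
    by (rule ab.prob_space_distr[OF Pair_params[OF d]])
  show "(0::real) \<le> 9 / (1 - 10 powi (- int p)) * 10 powi (- int d)"
    by (rule order_trans[OF _ prior_weight(2)[OF p]]) simp
qed (simp_all only: finite_atLeastAtMost sets_distr prior_weight(1)[OF p])

text \<open>
  The three factors are the weight of the dimension, the mass of the matrices and that of the links, which
  are independent given the dimension.
\<close>

lemma prior_near:
  assumes d: "d \<in> {1..p}" and \<Theta>: "\<Theta> \<in> sparse_mats d p" and \<tau>: "0 < \<tau>" "\<tau> \<le> 1"
    and b: "coeff_norm \<phi> \<psi> N d M b \<le> C" and \<eta>: "0 < \<eta>" "\<eta> \<le> 1" and M: "M \<le> n"
    and A: "A \<in> sets params"
    and near: "\<And>\<Theta>' b'. \<Theta>' \<in> sparse_mats d p \<Longrightarrow> (\<forall>i<d. \<forall>j<p. \<bar>\<Theta>' i j - \<Theta> i j\<bar> \<le> \<tau>) \<Longrightarrow> b' \<in> ball d M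
      \<Longrightarrow> coeff_norm \<phi> \<psi> N d M (\<lambda>l. b' l - b l) \<le> \<eta> \<Longrightarrow> (d, \<Theta>', expansion \<phi> \<psi> N d M b') \<in> A"
  defines "D \<equiv> card (wavelet_index d (enat M) (enat N))"
  shows "(1 / 10) ^ d * ((\<tau> / (40 * real d * (real p)\<^sup>2)) ^ sparsity d p \<Theta>
      * ((1 / 10) ^ (M + 1) * (\<eta> / ((C + 1) * real D)) ^ D)) \<le> measure prior0 A"
proof -
  interpret a: prob_space "mu d p" by (rule prob_mu) (use d p in auto)
  interpret b: prob_space "link_law d" by (rule prob_link_law)
  interpret prior: prob_space prior0 by (rule prob_prior)
  define u where "u = (\<tau> / (40 * real d * (real p)\<^sup>2)) ^ sparsity d p \<Theta>"
  define v where "v = (1 / 10) ^ (M + 1) * (\<eta> / ((C + 1) * real D)) ^ D"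
  have u: "u \<ge> 0" and v: "v \<ge> 0" using \<tau> \<eta> C by (auto simp: u_def v_def)
  let ?cap = "{\<Theta>' \<in> sparse_mats d p. \<forall>i<d. \<forall>j<p. \<bar>\<Theta>' i j - \<Theta> i j\<bar> \<le> \<tau>}"
  let ?P = "Pair d -` A \<inter> space (mu d p \<Otimes>\<^sub>M link_law d)"
  have P: "?P \<in> sets (mu d p \<Otimes>\<^sub>M link_law d)" by (rule measurable_sets[OF Pair_params[OF d] A])
  have spP: "space (mu d p \<Otimes>\<^sub>M link_law d) = sparse_mats d p \<times> links \<phi> \<psi> N n C d"
    using sets_eq_imp_space_eq[OF sets_slice] by (simp add: space_pair_measure)
  have slice_mass: "ennreal v \<le> emeasure (link_law d) (Pair \<Theta>' -` ?P)" if \<Theta>': "\<Theta>' \<in> ?cap" for \<Theta>'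
    unfolding v_def D_def
  proof (rule link_law_near[OF b \<eta> M])
    show "Pair \<Theta>' -` ?P \<in> sets (link_space \<phi> \<psi> N n C d)"
      using sets_Pair1[OF P, of \<Theta>'] by (simp only: sets_link_law)
    fix b' assume b': "b' \<in> ball d M" "coeff_norm \<phi> \<psi> N d M (\<lambda>l. b' l - b l) \<le> \<eta>"
    have "expansion \<phi> \<psi> N d M b' \<in> links \<phi> \<psi> N n C d" using b'(1) M unfolding links_def by auto
    then show "expansion \<phi> \<psi> N d M b' \<in> Pair \<Theta>' -` ?P"
      using near[of \<Theta>' b'] \<Theta>' b' unfolding spP by simp
  qed
  have cap_sets: "?cap \<in> sets (mu d p)" unfolding sets_mu by (rule sparse_cap_sets)
  have "ennreal (u * v) = ennreal v * ennreal u" using u v by (simp only: ennreal_mult mult.commute)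
  also have "\<dots> \<le> ennreal v * emeasure (mu d p) ?cap"
    unfolding u_def by (intro mult_left_mono mu_cap \<Theta> \<tau> p) (use d in auto)
  also have "\<dots> = (\<integral>\<^sup>+\<Theta>'. ennreal v * indicator ?cap \<Theta>' \<partial>mu d p)"
    by (rule nn_integral_cmult_indicator[OF cap_sets, symmetric])
  also have "\<dots> \<le> (\<integral>\<^sup>+\<Theta>'. emeasure (link_law d) (Pair \<Theta>' -` ?P) \<partial>mu d p)"
    using slice_mass by (intro nn_integral_mono) (auto split: split_indicator simp del: mem_Collect_eq)
  also have "\<dots> = emeasure (mu d p \<Otimes>\<^sub>M link_law d) ?P"
    by (rule b.emeasure_pair_measure_alt[OF P, symmetric])
  also have "\<dots> = emeasure (distr (mu d p \<Otimes>\<^sub>M link_law d) params (Pair d)) A"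
    by (rule emeasure_distr[OF Pair_params[OF d] A, symmetric])
  finally have uv: "ennreal (u * v) \<le> emeasure (distr (mu d p \<Otimes>\<^sub>M link_law d) params (Pair d)) A" .
  let ?w = "9 / (1 - 10 powi (- int p)) * 10 powi (- int d) :: real"
  have "(1 / 10) ^ d * (u * v) \<le> ?w * (u * v)"
    using prior_weight(2)[OF p, of d] u v by (intro mult_right_mono) auto
  then have "ennreal ((1 / 10) ^ d * (u * v)) \<le> ennreal (?w * (u * v))" by (rule ennreal_leI)
  also have "\<dots> = ennreal ?w * ennreal (u * v)" by (rule ennreal_mult'') (use u v in simp)
  also have "\<dots> \<le> ennreal ?w * emeasure (distr (mu d p \<Otimes>\<^sub>M link_law d) params (Pair d)) A"
    by (rule mult_left_mono[OF uv]) simp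
  also have "\<dots> \<le> emeasure prior0 A"
    unfolding prior_def
    by (rule mixture_ge[where j = d and w = "\<lambda>d. 9 / (1 - 10 powi (- int p)) * 10 powi (- int d)"
        and m = "\<lambda>d. distr (mu d p \<Otimes>\<^sub>M link_law d) params (Pair d)"]) (use d A in simp_all)
  finally have "(1 / 10) ^ d * (u * v) \<le> measure prior0 A"
    by (simp add: prior.emeasure_eq_measure)
  then show ?thesis by (simp only: u_def v_def)
qed

lemma param_nonempty:
  assumes "d \<in> {1..p}" shows "space (slice d) \<noteq> {}"
proof -
  interpret a: prob_space "mu d p" by (rule prob_mu) (use assms p in auto)
  interpret b: prob_space "link_law d" by (rule prob_link_law)
  show ?thesis
    using a.not_empty b.not_empty sets_eq_imp_space_eq[OF sets_mu, of d p] sets_eq_imp_space_eq[OF sets_link_law, of d]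
    by (auto simp: space_pair_measure)
qed

lemma predictor_measurable:
  "(\<lambda>z. predictor p (fst z) (snd z)) \<in> borel_measurable (params \<Otimes>\<^sub>M vec_space p)"
  unfolding param_space_coproduct
proof (rule measurable_coproduct_pair)
  fix d assume d: "d \<in> {1..p}"
  show "space (slice d) \<noteq> {}" by (rule param_nonempty[OF d])
  let ?K = "slice d \<Otimes>\<^sub>M vec_space p"
  have m: "(\<lambda>z. mat_vec d p (fst (fst z)) (snd z)) \<in> measurable ?K (vec_space d)"
  proof -
    have "(\<lambda>z. (fst (fst z), snd z)) \<in> measurable ?K (sparse_mat_space d p \<Otimes>\<^sub>M vec_space p)"
      by (intro measurable_Pair measurable_compose[OF measurable_fst measurable_fst] measurable_snd)
    from measurable_compose[OF this mat_vec_measurable_pair] show ?thesis by (simp only: fst_conv snd_conv)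
  qed
  have "(\<lambda>z. (snd (fst z), mat_vec d p (fst (fst z)) (snd z))) \<in> measurable ?K (link_space \<phi> \<psi> N n C d \<Otimes>\<^sub>M vec_space d)"
    by (intro measurable_Pair measurable_compose[OF measurable_fst measurable_snd] m)
  from measurable_compose[OF this eval_measurable]
  show "(\<lambda>(x, y). predictor p (fst ((d, x), y)) (snd ((d, x), y))) \<in> borel_measurable ?K"
    by (simp add: predictor_def case_prod_beta')
qed simp

end

section \<open>Choice of the resolution and the resulting rate\<close>

text \<open>
  Equating the bias \<open>2 powr (- 2 * M * \<alpha>)\<close> and the cost \<open>2 ^ (M * d) * x\<close> of the coefficients gives
  \<open>2 powr M = x powr (- 1 / (2 * \<alpha> + d))\<close>. Rounding up costs a factor of \<open>2 ^ d\<close>. For \<open>x \<ge> 1\<close> this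
  asks for a nonpositive level and level \<open>0\<close> is used; then \<open>x \<le> ln C + 1\<close> pays for the difference.
\<close>

lemma resolution_level:
  fixes C \<alpha> :: real and n d :: nat
  assumes C: "C \<ge> 1" and n: "n \<ge> 1" and ln: "ln (C * real n) \<ge> 1" and d: "d \<ge> 1" and \<alpha>: "\<alpha> > 0"
  defines "x \<equiv> ln (C * real n) / real n" and "\<theta> \<equiv> 2 * \<alpha> / (2 * \<alpha> + real d)"
  obtains M :: nat where "2 powr (- 2 * real M * \<alpha>) \<le> x powr \<theta>" "M \<le> n"
    "2 ^ (M * d) * x \<le> 2 ^ d * (ln C + 1) * x powr \<theta>" "2 ^ (M * d) \<le> 2 ^ d * real n"
proof -
  define \<kappa> where "\<kappa> = 2 * \<alpha> + real d"
  have \<kappa>: "\<kappa> \<ge> 1" using d \<alpha> by (simp add: \<kappa>_def)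
  have \<theta>: "\<theta> = 2 * \<alpha> / \<kappa>" "0 \<le> \<theta>" "1 - \<theta> = real d / \<kappa>" "real d / \<kappa> \<le> 1"
    using \<alpha> \<kappa> by (auto simp: \<theta>_def \<kappa>_def field_simps)
  have x: "x > 0" using ln n by (simp add: x_def)
  have inv: "1 / x \<le> real n"
  proof -
    have "1 / x = real n / ln (C * real n)" by (simp add: x_def)
    also have "\<dots> \<le> real n / 1" using ln by (intro divide_left_mono) auto
    finally show ?thesis by simp
  qed
  have x_le: "x \<le> ln C + 1"
  proof -
    have "x = ln C / real n + ln (real n) / real n" using C n by (simp add: x_def ln_mult add_divide_distrib)
    moreover have "ln C / real n \<le> ln C / 1" using C n by (intro divide_left_mono) auto
    moreover have "ln (real n) / real n \<le> 1" using n ln_le_minus_one[of "real n"] by (simp add: divide_le_eq)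
    ultimately show ?thesis by simp
  qed
  define r where "r = - log 2 x / \<kappa>"
  \<comment> \<open>The exponent \<open>r\<close> solves \<open>x = 2 powr (- (2 * \<alpha> + d) * r)\<close>, which balances bias and cost.\<close>
  define M where "M = nat \<lceil>r\<rceil>"
  have Mr: "r \<le> real M" unfolding M_def by (simp add: real_nat_ceiling_ge)
  have x_pow: "x = 2 powr (- \<kappa> * r)" using x \<kappa> by (simp add: r_def)
  have approx: "2 powr (- 2 * real M * \<alpha>) \<le> x powr \<theta>"
  proof -
    have "2 powr (- 2 * real M * \<alpha>) \<le> 2 powr ((- \<kappa> * r) * \<theta>)"
    proof (rule powr_mono)
      have eq: "(- \<kappa> * r) * \<theta> = - 2 * (\<alpha> * r)" using \<kappa> by (simp add: \<theta>(1))
      have "\<alpha> * r \<le> \<alpha> * real M" using Mr \<alpha> by (intro mult_left_mono) auto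
      then show "- 2 * real M * \<alpha> \<le> (- \<kappa> * r) * \<theta>" unfolding eq by (simp add: mult.commute)
    qed simp
    also have "\<dots> = x powr \<theta>" by (subst x_pow) (rule powr_powr[symmetric])
    finally show ?thesis .
  qed
  show ?thesis
  proof (cases "x \<ge> 1")
    case True
    have "log 2 x \<ge> 0" using True by simp
    then have "r \<le> 0" using \<kappa> by (simp add: r_def divide_nonneg_nonneg)
    then have M0: "M = 0" by (simp add: M_def)
    have "x = x powr \<theta> * x powr (1 - \<theta>)" using x by (simp flip: powr_add)
    also have "\<dots> \<le> x powr \<theta> * (ln C + 1)"
    proof (rule mult_left_mono)
      have "x powr (1 - \<theta>) \<le> x powr 1" using True \<theta> by (intro powr_mono) auto
      then show "x powr (1 - \<theta>) \<le> ln C + 1" using x x_le by simp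
    qed simp
    also have "\<dots> \<le> 2 ^ d * ((ln C + 1) * x powr \<theta>)"
    proof -
      have "1 * ((ln C + 1) * x powr \<theta>) \<le> 2 ^ d * ((ln C + 1) * x powr \<theta>)"
        using C by (intro mult_right_mono) auto
      then show ?thesis by (simp add: mult.commute)
    qed
    finally have "2 ^ (M * d) * x \<le> 2 ^ d * (ln C + 1) * x powr \<theta>" unfolding M0 by (simp add: mult.assoc)
    moreover have "2 ^ (M * d) \<le> 2 ^ d * real n"
      using n mult_mono[of 1 "2 ^ d" 1 "real n"] unfolding M0 by simp
    ultimately show ?thesis using that[OF approx] M0 by simp
  next
    case False
    have lx: "log 2 x \<le> 0" using False x by simp
    then have r0: "r \<ge> 0" using \<kappa> by (simp add: r_def divide_le_0_iff)
    have M_lt: "real M \<le> r + 1"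
      unfolding M_def using r0 by (simp add: of_nat_nat)
    have pow: "2 ^ (M * d) \<le> 2 ^ d * x powr (- (real d / \<kappa>))"
    proof -
      have "(2::real) ^ (M * d) = 2 powr (real M * real d)" by (simp flip: powr_realpow)
      also have "\<dots> \<le> 2 powr ((r + 1) * real d)" using M_lt by (intro powr_mono mult_right_mono) auto
      also have "\<dots> = 2 powr real d * 2 powr ((- \<kappa> * r) * (- (real d / \<kappa>)))"
      proof -
        have eq: "(- \<kappa> * r) * (- (real d / \<kappa>)) = r * real d" using \<kappa> by simp
        show ?thesis unfolding eq powr_add[symmetric] by (simp add: algebra_simps)
      qed
      also have "2 powr ((- \<kappa> * r) * (- (real d / \<kappa>))) = x powr (- (real d / \<kappa>))"
        by (subst x_pow) (rule powr_powr[symmetric])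
      finally show ?thesis by (simp add: powr_realpow)
    qed
    have "2 ^ (M * d) * x \<le> 2 ^ d * x powr (- (real d / \<kappa>)) * x" using pow x by (intro mult_right_mono) auto
    also have "x powr (- (real d / \<kappa>)) * x = x powr \<theta>"
    proof -
      have "x powr (- (real d / \<kappa>)) * x powr 1 = x powr \<theta>"
        unfolding powr_add[symmetric] using \<theta>(3) by (intro arg_cong[where f = "\<lambda>y. x powr y"]) simp
      then show ?thesis using x by simp
    qed
    then have "2 ^ d * x powr (- (real d / \<kappa>)) * x = 2 ^ d * 1 * x powr \<theta>" by (simp add: mult.assoc)
    also have "\<dots> \<le> 2 ^ d * (ln C + 1) * x powr \<theta>"
      using C by (intro mult_right_mono mult_left_mono) auto
    finally have b: "2 ^ (M * d) * x \<le> 2 ^ d * (ln C + 1) * x powr \<theta>" .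
    have "2 ^ d * x powr (- (real d / \<kappa>)) \<le> 2 ^ d * real n"
    proof (rule mult_left_mono)
      have "x powr (- (real d / \<kappa>)) = (1 / x) powr (real d / \<kappa>)"
        using x by (simp add: powr_minus_divide powr_divide)
      also have "\<dots> \<le> (1 / x) powr 1"
        using False x \<theta> by (intro powr_mono) (auto simp: le_divide_eq)
      also have "\<dots> \<le> real n" using x inv by simp
      finally show "x powr (- (real d / \<kappa>)) \<le> real n" .
    qed simp
    with pow have c: "2 ^ (M * d) \<le> 2 ^ d * real n" by linarith
    have "M \<le> n"
    proof -
      have "r \<le> - log 2 x / 1" unfolding r_def using lx \<kappa> by (intro divide_left_mono) auto
      also have "- log 2 x / 1 = log 2 (1 / x)" using x by (simp add: log_divide)
      also have "\<dots> \<le> log 2 (real n)" using inv x n by (subst log_le_cancel_iff) auto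
      also have "\<dots> < real n"
      proof -
        have "real n < 2 ^ n" by (rule of_nat_less_two_power)
        then show ?thesis using n by (simp add: log_less_iff powr_realpow)
      qed
      finally have "real M < real n + 1" using M_lt by simp
      then show ?thesis by linarith
    qed
    then show ?thesis using that[OF approx _ b c] by simp
  qed
qed

text \<open>
  The summands on the left are, in this order, the prior weight of the dimension, the cost of the matrix, the
  cost of the level and of the coefficients, the squared bias with the perturbation errors, and the
  confidence term.
  The logarithms on the right are bounded below, \<open>ln (p * n)\<close> and \<open>ln (2 / \<delta>)\<close> by \<open>1 / 2\<close> and \<open>ln (C * n)\<close> by \<open>1\<close>,
  so that constants can be absorbed into them.
\<close>

lemma rate_bound:
  fixes C K q B2 \<xi> \<alpha> \<delta> :: real and N d p n i M D :: nat
  assumes C: "C \<ge> 1" and K: "K \<ge> 1" and q: "q \<ge> 0" and B2: "B2 \<ge> 0" and N: "N \<ge> 1"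
    and d: "d \<ge> 1" and p: "p \<ge> 1" and n: "n \<ge> 2" and ln: "ln (C * real n) \<ge> 1" and i: "d \<le> i"
    and \<delta>: "0 < \<delta>" "\<delta> < 1" and \<xi>: "0 \<le> \<xi>" "\<xi> \<le> C * real N ^ d"
    and D: "D \<ge> 1" "real D \<le> 2 * (6 * real N) ^ d * 2 ^ (M * d)"
    and x: "x = ln (C * real n) / real n" and r: "r \<ge> 0"
    and M: "2 powr (- 2 * real M * \<alpha>) \<le> r" "2 ^ (M * d) * x \<le> 2 ^ d * (ln C + 1) * r" "2 ^ (M * d) \<le> 2 ^ d * real n"
  defines "c1 \<equiv> 2 * (C + 1) * (12 * real N) ^ d" and "c3 \<equiv> 40 * (real d)\<^sup>2 * (C + 1) * K"
  shows "2 * q / real n * (real d * ln 10 + real i * ln (c3 * real p ^ 3 * real n)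
        + (real (M + 1) * ln 10 + real D * ln ((C + 1) * real D * real n)))
      + 4 * (3 * B2 * \<xi>\<^sup>2 * 2 powr (- 2 * real M * \<alpha>) + 6 / (real n)\<^sup>2) + 4 * q / real n * ln (1 / \<delta>)
    \<le> (2 * q * ((3 + 2 * (6 * real N) ^ d * (ln c1 + 2)) * (2 ^ d * (ln C + 1))) + 12 * B2 * (C * real N ^ d)\<^sup>2
        + 2 * q * (9 + 2 * ln c3) + 48 + 4 * q)
      * (r + real i * ln (real p * real n) / real n + ln (2 / \<delta>) / real n)"
proof -
  define Y where "Y = real i * ln (real p * real n) / real n"
  define Z where "Z = ln (2 / \<delta>) / real n"
  have n0: "real n \<ge> 2" "real n > 0" using n by auto
  have ln10: "ln 10 \<le> (3::real)"
  proof -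
    have "(1 + 1 / 2 :: real) ^ 6 \<le> exp (1 / 2) ^ 6" using exp_ge_add_one_self[of "1 / 2 :: real"] by (intro power_mono) auto
    also have "exp (1 / 2) ^ 6 = exp (3::real)" by (simp flip: exp_of_nat_mult)
    finally have "(10::real) \<le> exp 3" by (simp add: power_divide)
    then have "ln 10 \<le> ln (exp (3::real))" by (subst ln_le_cancel_iff) auto
    then show ?thesis by simp
  qed
  have ln2: "ln 2 \<ge> (1 / 2 :: real)"
    using ln_add_one_self_le_self[of 1] ln_2_less_1 ln2_ge_two_thirds by simp
  have c1: "c1 \<ge> 1" and c3: "c3 \<ge> 1"
  proof -
    have "1 * 1 \<le> (2 * (C + 1)) * (12 * real N) ^ d" using C N by (intro mult_mono one_le_power) auto
    then show "c1 \<ge> 1" by (simp add: c1_def)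
    have "1 * 1 * 1 * 1 \<le> 40 * (real d)\<^sup>2 * (C + 1) * K" using C K d by (intro mult_mono one_le_power) auto
    then show "c3 \<ge> 1" by (simp add: c3_def)
  qed
  have lnCn: "ln (real n) \<le> ln (C * real n)"
    using C n0 mult_right_mono[of 1 C "real n"] by simp
  have lnn: "ln (real n) \<ge> 0" using n0 by simp
  have lnpn: "ln (real p * real n) \<ge> 1 / 2"
  proof -
    have "1 * 2 \<le> real p * real n" using p n0 by (intro mult_mono) auto
    then have "ln 2 \<le> ln (real p * real n)" by (subst ln_le_cancel_iff) auto
    then show ?thesis using ln2 by linarith
  qed
  have Yn: "Y \<ge> 0" unfolding Y_def using lnpn n0 by (intro divide_nonneg_nonneg mult_nonneg_nonneg) auto
  have ln\<delta>: "ln (2 / \<delta>) \<ge> 1 / 2"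
  proof -
    have "2 \<le> 2 / \<delta>" using \<delta> by (simp add: le_divide_eq)
    then have "ln 2 \<le> ln (2 / \<delta>)" using \<delta> by (subst ln_le_cancel_iff) auto
    then show ?thesis using ln2 by linarith
  qed
  have Zn: "Z \<ge> 0" unfolding Z_def using ln\<delta> n0 by simp
  \<comment> \<open>Level and coefficients: \<open>M + 1\<close> and \<open>D\<close> are both at most of the order of \<open>2 ^ (M * d)\<close>.\<close>
  define b where "b = 3 + 2 * (6 * real N) ^ d * (ln c1 + 2)"
  have dim: "(real (M + 1) * ln 10 + real D * ln ((C + 1) * real D * real n)) / real n \<le> b * (2 ^ d * (ln C + 1)) * r"
  proof -
    have "real D \<le> 2 * (6 * real N) ^ d * (2 ^ d * real n)"
      by (rule order_trans[OF D(2)], intro mult_left_mono M(3)) simp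
    also have "\<dots> = 2 * (12 * real N) ^ d * real n"
      by (simp add: power_mult_distrib) (simp flip: power_mult_distrib)
    finally have Dn: "real D \<le> 2 * (12 * real N) ^ d * real n" .
    have "(C + 1) * real D * real n \<le> (C + 1) * (2 * (12 * real N) ^ d * real n) * real n"
      using C Dn by (intro mult_right_mono mult_left_mono) auto
    also have "\<dots> = c1 * (real n)\<^sup>2" by (simp add: c1_def power2_eq_square)
    finally have "ln ((C + 1) * real D * real n) \<le> ln (c1 * (real n)\<^sup>2)"
      using C D(1) n0 c1 by (subst ln_le_cancel_iff) auto
    also have "\<dots> = ln c1 + 2 * ln (real n)" using c1 n0 by (simp add: ln_mult ln_realpow)
    also have "\<dots> \<le> ln c1 * ln (C * real n) + 2 * ln (C * real n)"
      using lnCn ln c1 mult_left_mono[of 1 "ln (C * real n)" "ln c1"] by simp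
    finally have l: "ln ((C + 1) * real D * real n) \<le> (ln c1 + 2) * ln (C * real n)" by (simp add: distrib_right)
    have "M < 2 ^ M" by (rule less_exp)
    also have "(2::nat) ^ M \<le> 2 ^ (M * d)" using d by (intro power_increasing) auto
    finally have "real (M + 1) \<le> real (2 ^ (M * d))" by (simp only: of_nat_le_iff)
    then have "real (M + 1) * ln 10 \<le> 2 ^ (M * d) * 3" using ln10 by (intro mult_mono) auto
    also have "\<dots> \<le> 2 ^ (M * d) * (3 * ln (C * real n))" using ln by simp
    finally have M1: "real (M + 1) * ln 10 \<le> 2 ^ (M * d) * (3 * ln (C * real n))" .
    have lc: "0 \<le> (ln c1 + 2) * ln (C * real n)" using c1 ln by simp
    have "real D * ln ((C + 1) * real D * real n) \<le> real D * ((ln c1 + 2) * ln (C * real n))"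
      using l by (intro mult_left_mono) auto
    also have "\<dots> \<le> (2 * (6 * real N) ^ d * 2 ^ (M * d)) * ((ln c1 + 2) * ln (C * real n))"
      using D(2) lc by (rule mult_right_mono)
    finally have "real (M + 1) * ln 10 + real D * ln ((C + 1) * real D * real n)
        \<le> 2 ^ (M * d) * (3 * ln (C * real n)) + (2 * (6 * real N) ^ d * 2 ^ (M * d)) * ((ln c1 + 2) * ln (C * real n))"
      using M1 by linarith
    also have "\<dots> = b * (2 ^ (M * d) * ln (C * real n))" unfolding b_def by algebra
    finally have "(real (M + 1) * ln 10 + real D * ln ((C + 1) * real D * real n)) / real n \<le> b * (2 ^ (M * d) * ln (C * real n)) / real n"
      using n0 by (intro divide_right_mono) auto
    also have "\<dots> = b * (2 ^ (M * d) * x)" by (simp add: x)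
    also have "\<dots> \<le> b * (2 ^ d * (ln C + 1) * r)"
      using M(2) c1 by (intro mult_left_mono) (auto simp: b_def)
    finally show ?thesis by (simp add: mult.assoc)
  qed
  have sparse: "(real d * ln 10 + real i * ln (c3 * real p ^ 3 * real n)) / real n \<le> (9 + 2 * ln c3) * Y"
  proof -
    let ?l = "ln (real p * real n)"
    have "ln (c3 * real p ^ 3 * real n) = ln c3 + 3 * ln (real p) + ln (real n)"
      using c3 p n0 by (simp add: ln_mult ln_realpow)
    also have "\<dots> \<le> ln c3 + 3 * ?l" using p n0 lnn by (simp add: ln_mult)
    also have "\<dots> \<le> 2 * ln c3 * ?l + 3 * ?l"
      using c3 lnpn mult_left_mono[of "1 / 2" ?l "2 * ln c3"] by simp
    finally have "real i * ln (c3 * real p ^ 3 * real n) \<le> real i * (2 * ln c3 * ?l + 3 * ?l)"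
      by (intro mult_left_mono) auto
    moreover have "real d * ln 10 \<le> real i * (6 * ?l)"
      using i ln10 lnpn by (intro mult_mono) auto
    ultimately have "real d * ln 10 + real i * ln (c3 * real p ^ 3 * real n) \<le> (9 + 2 * ln c3) * (real i * ?l)"
      by (simp add: algebra_simps)
    then have "(real d * ln 10 + real i * ln (c3 * real p ^ 3 * real n)) / real n \<le> (9 + 2 * ln c3) * (real i * ?l) / real n"
      using n0 by (intro divide_right_mono) auto
    then show ?thesis by (simp add: Y_def)
  qed
  have bias: "4 * (3 * B2 * \<xi>\<^sup>2 * 2 powr (- 2 * real M * \<alpha>)) \<le> 12 * B2 * (C * real N ^ d)\<^sup>2 * r"
  proof -
    have "\<xi>\<^sup>2 \<le> (C * real N ^ d)\<^sup>2" using \<xi> by (intro power_mono) auto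
    then have "\<xi>\<^sup>2 * 2 powr (- 2 * real M * \<alpha>) \<le> (C * real N ^ d)\<^sup>2 * r" using M(1) by (intro mult_mono) auto
    from mult_left_mono[OF this, of "12 * B2"] B2 show ?thesis by (simp add: mult.assoc)
  qed
  have small: "4 * (6 / (real n)\<^sup>2) \<le> 48 * Z"
  proof -
    have "24 / (real n)\<^sup>2 = 24 / real n * (1 / real n)" by (simp add: power2_eq_square)
    also have "\<dots> \<le> 24 / real n * 1" using n0 by (intro mult_left_mono) auto
    also have "\<dots> = 48 * (1 / 2) / real n" by simp
    also have "\<dots> \<le> 48 * ln (2 / \<delta>) / real n" using ln\<delta> n0 by (intro divide_right_mono mult_left_mono) auto
    finally show ?thesis by (simp add: Z_def)
  qed
  have conf: "4 * q / real n * ln (1 / \<delta>) \<le> 4 * q * Z"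
  proof -
    have "ln (1 / \<delta>) \<le> ln (2 / \<delta>)" using \<delta> by (subst ln_le_cancel_iff) (auto simp: divide_right_mono)
    from mult_left_mono[OF this, of "4 * q / real n"] q n0 show ?thesis by (simp add: Z_def)
  qed
  have split: "2 * q / real n * (u + v) = 2 * q * (u / real n) + 2 * q * (v / real n)" for u v
    by (simp add: algebra_simps add_divide_distrib)
  define c2 where "c2 = b * (2 ^ d * (ln C + 1))"
  have c2n: "c2 \<ge> 0" unfolding c2_def b_def using c1 C by (intro mult_nonneg_nonneg add_nonneg_nonneg) auto
  have c3n: "ln c3 \<ge> 0" using c3 by simp
  have "2 * q / real n * (real d * ln 10 + real i * ln (c3 * real p ^ 3 * real n)
        + (real (M + 1) * ln 10 + real D * ln ((C + 1) * real D * real n)))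
      + 4 * (3 * B2 * \<xi>\<^sup>2 * 2 powr (- 2 * real M * \<alpha>) + 6 / (real n)\<^sup>2) + 4 * q / real n * ln (1 / \<delta>)
    \<le> 2 * q * ((9 + 2 * ln c3) * Y) + 2 * q * (c2 * r) + (12 * B2 * (C * real N ^ d)\<^sup>2 * r + 48 * Z) + 4 * q * Z"
    unfolding split distrib_left[of 4]
    using mult_left_mono[OF sparse, of "2 * q"] mult_left_mono[OF dim, of "2 * q"] bias small conf q
    unfolding c2_def by linarith
  also have "\<dots> \<le> (2 * q * c2 + 12 * B2 * (C * real N ^ d)\<^sup>2 + 2 * q * (9 + 2 * ln c3) + 48 + 4 * q) * (r + Y + Z)"
  proof -
    define u1 u2 u3 u4 where "u1 = 2 * q * c2" and "u2 = 12 * B2 * (C * real N ^ d)\<^sup>2"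
      and "u3 = 2 * q * (9 + 2 * ln c3)" and "u4 = 4 * q"
    have u: "u1 \<ge> 0" "u2 \<ge> 0" "u3 \<ge> 0" "u4 \<ge> 0"
      using q c2n B2 c3n by (auto simp: u1_def u2_def u3_def u4_def)
    have "u3 * Y + u1 * r + (u2 * r + 48 * Z) + u4 * Z \<le> (u1 + u2 + u3 + 48 + u4) * (r + Y + Z)"
      using u r Yn Zn by (simp add: algebra_simps add_nonneg_nonneg mult_nonneg_nonneg)
    then show ?thesis by (simp only: u1_def u2_def u3_def u4_def mult.assoc)
  qed
  finally show ?thesis by (simp only: Y_def Z_def c2_def b_def)
qed

section \<open>The posterior in the multi-index model\<close>

text \<open>
  What a large truncation constant has to guarantee. The rate depends on the wavelets only through \<open>N\<close>: the
  last conjunct lets \<open>N\<close> absorb the factor \<open>1 / wavelet_bound\<close> in the radius of the Besov ellipsoid.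
\<close>

definition adequate :: "(real \<Rightarrow> real) \<Rightarrow> (real \<Rightarrow> real) \<Rightarrow> real \<Rightarrow> nat \<Rightarrow> bool" where
  "adequate \<phi> \<psi> B1 N \<longleftrightarrow> (\<exists>h g m. two_scale_pair \<phi> \<psi> h g m \<and>
     \<lceil>B1\<rceil> + 1 + m \<le> int N \<and> 1 / wavelet_bound \<phi> \<psi> \<le> real N)"

lemma adequate_exists:
  assumes "wavelet_pair \<phi> \<psi>" shows "\<exists>N. adequate \<phi> \<psi> B1 N"
proof -
  obtain h g m where w: "two_scale_pair \<phi> \<psi> h g m" using wavelet_pair_two_scale[OF assms] .
  let ?N = "max (nat (\<lceil>B1\<rceil> + 1 + m)) (nat \<lceil>1 / wavelet_bound \<phi> \<psi>\<rceil>)"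
  have "\<lceil>B1\<rceil> + 1 + m \<le> int ?N" by simp
  moreover have "1 / wavelet_bound \<phi> \<psi> \<le> real ?N" using real_nat_ceiling_ge[of "1 / wavelet_bound \<phi> \<psi>"] by simp
  ultimately show ?thesis using w unfolding adequate_def by blast
qed

lemma adequate_mono: "adequate \<phi> \<psi> B1 N \<Longrightarrow> N \<le> N' \<Longrightarrow> adequate \<phi> \<psi> B1 N'"
  unfolding adequate_def by (meson of_nat_le_iff order_trans zle_int)

text \<open>
  The ratio of \<open>n\<close> to the inverse temperature \<open>lam\<close> of the posterior.
\<close>

definition temperature :: "real \<Rightarrow> real \<Rightarrow> real \<Rightarrow> real" where
  "temperature C \<Gamma> \<sigma> = 8 * (2 * C + 1) * max \<Gamma> (2 * C + 1) + 2 * ((2 * C + 1)\<^sup>2 + 4 * \<sigma>\<^sup>2)"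

text \<open>
  The four groups of terms come from the coefficients, the bias, the matrix, and the perturbation errors
  together with the confidence term.
\<close>

definition rate_constant :: "real \<Rightarrow> real \<Rightarrow> real \<Rightarrow> real \<Rightarrow> nat \<Rightarrow> real \<Rightarrow> nat \<Rightarrow> real" where
  "rate_constant C K \<Gamma> \<sigma> N B2 d =
    2 * temperature C \<Gamma> \<sigma> * ((3 + 2 * (6 * real N) ^ d * (ln (2 * (C + 1) * (12 * real N) ^ d) + 2)) * (2 ^ d * (ln C + 1)))
    + 12 * B2 * (C * real N ^ d)\<^sup>2
    + 2 * temperature C \<Gamma> \<sigma> * (9 + 2 * ln (40 * (real d)\<^sup>2 * (C + 1) * K)) + 48 + 4 * temperature C \<Gamma> \<sigma>"

locale multi_index_model =
  wavelets: link_prior \<phi> \<psi> h g m N n p C +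
  model: regression P p F \<sigma> \<Gamma> +
  link: besov_link \<phi> \<psi> h g m d N "\<lceil>B1\<rceil> + 1" \<alpha> \<xi> C f
  for \<phi> \<psi> :: "real \<Rightarrow> real" and h g m and N n p :: nat and C and P F \<sigma> \<Gamma>
    and d and B1 :: real and \<alpha> \<xi> f +
  fixes K B2 :: real and \<Theta> :: rmat and u :: "rvec \<Rightarrow> ennreal"
  assumes K: "K \<ge> 1" and B2: "B2 > 0" and d: "1 \<le> d" "d \<le> p" and n: "n \<ge> 2" "real n \<ge> 10 / C"
    and L_inv: "1 / wavelet_bound \<phi> \<psi> \<le> real N"
    and bounds: "AE z in P. (\<forall>j<p. \<bar>fst z j\<bar> \<le> K) \<and> \<bar>F (fst z)\<bar> \<le> C"
    and \<Theta>: "\<Theta> \<in> sparse_mats d p"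
    and F_eq: "AE z in P. F (fst z) = f (mat_vec d p \<Theta> (fst z))"
    and index_bound: "AE z in P. \<forall>i<d. \<bar>mat_vec d p \<Theta> (fst z) i\<bar> \<le> B1"
    and index_law: "distributed P (leb d) (\<lambda>z. mat_vec d p \<Theta> (fst z)) u"
    and index_density: "\<forall>v\<in>space (leb d). u v \<le> ennreal B2"
begin

abbreviation \<pi> where "\<pi> \<equiv> prior \<phi> \<psi> N n C p"
abbreviation q where "q \<equiv> temperature C \<Gamma> \<sigma>"
abbreviation lam where "lam \<equiv> real n / q"
abbreviation H where "H \<equiv> 2 * C + 1"

sublocale prior: prob_space "\<pi>" by (rule wavelets.prob_prior)

text \<open>
  The temperature is a sum of positive terms, and \<open>10 * H\<^sup>2\<close>, \<open>8 * H * \<Gamma>\<close> and \<open>8 * \<sigma>\<^sup>2\<close> are each dominated by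
  some of them.
\<close>

lemma q_bounds: "q > 0" "1 / q * (10 * H\<^sup>2) \<le> 1" "1 / q * (8 * H * \<Gamma>) \<le> 1" "1 / q * (8 * \<sigma>\<^sup>2) \<le> 1"
proof -
  have H: "H \<ge> 1" using link.C by simp
  have a: "8 * H * \<Gamma> \<le> 8 * H * max \<Gamma> H" using H by (intro mult_left_mono) auto
  have b: "8 * H * H \<le> 8 * H * max \<Gamma> H" using H by (intro mult_left_mono) auto
  have c: "8 * H * H = 8 * H\<^sup>2" by (simp add: power2_eq_square)
  have h2: "H\<^sup>2 > 0" using H by simp
  have e: "q = 8 * H * max \<Gamma> H + 2 * H\<^sup>2 + 8 * \<sigma>\<^sup>2" by (simp add: temperature_def)
  have s: "\<sigma>\<^sup>2 \<ge> 0" by simp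
  show q: "q > 0" using b c h2 s unfolding e by linarith
  have "10 * H\<^sup>2 \<le> q" using b c s unfolding e by linarith
  moreover have "8 * H * \<Gamma> \<le> q" using a h2 s unfolding e by linarith
  moreover have "8 * \<sigma>\<^sup>2 \<le> q" using b c h2 unfolding e by linarith
  ultimately show "1 / q * (10 * H\<^sup>2) \<le> 1" "1 / q * (8 * H * \<Gamma>) \<le> 1" "1 / q * (8 * \<sigma>\<^sup>2) \<le> 1"
    using q by (simp_all add: divide_le_eq)
qed

lemma mat_vec_space: "mat_vec d' p \<Theta>' x \<in> space (vec_space d')"
  by (simp add: mat_vec_def)

lemma space_prior: "space \<pi> = (SIGMA d:{1..p}. sparse_mats d p \<times> links \<phi> \<psi> N n C d)"
  using sets_eq_imp_space_eq[OF wavelets.sets_prior] by (simp only: space_param_space)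

lemma predictor_bound:
  assumes "\<theta> \<in> space \<pi>" shows "\<bar>predictor p \<theta> x\<bar> \<le> C + 1"
proof -
  obtain d' \<Theta>' f' where \<theta>: "\<theta> = (d', \<Theta>', f')" by (cases \<theta>)
  have "f' \<in> links \<phi> \<psi> N n C d'" using assms unfolding \<theta> space_prior by simp
  then show ?thesis unfolding \<theta> predictor_def prod.case by (rule wavelets.links_bound[OF _ mat_vec_space])
qed

lemma predictor_measurable_pair [measurable]:
  "(\<lambda>w. predictor p (fst w) (fst (snd w))) \<in> borel_measurable (\<pi> \<Otimes>\<^sub>M P)"
proof -
  have "(\<lambda>w. (fst w, fst (snd w))) \<in> measurable (\<pi> \<Otimes>\<^sub>M P) (\<pi> \<Otimes>\<^sub>M vec_space p)"
    by (intro measurable_Pair measurable_fst measurable_compose[OF measurable_snd model.fst_measurable])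
  moreover have "(\<lambda>z. predictor p (fst z) (snd z)) \<in> borel_measurable (\<pi> \<Otimes>\<^sub>M vec_space p)"
    using wavelets.predictor_measurable
    by (simp only: measurable_cong_sets[OF sets_pair_measure_cong[OF wavelets.sets_prior refl] refl])
  ultimately have "(\<lambda>w. predictor p (fst (fst w, fst (snd w))) (snd (fst w, fst (snd w)))) \<in> borel_measurable (\<pi> \<Otimes>\<^sub>M P)"
    by (rule measurable_compose)
  then show ?thesis by (simp only: fst_conv snd_conv)
qed

lemma predictor_fixed_measurable:
  assumes "\<theta> \<in> space \<pi>" shows "predictor p \<theta> \<in> borel_measurable (vec_space p)"
proof -
  have "(\<lambda>z. predictor p (fst z) (snd z)) \<in> borel_measurable (\<pi> \<Otimes>\<^sub>M vec_space p)"
    using wavelets.predictor_measurable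
    by (simp only: measurable_cong_sets[OF sets_pair_measure_cong[OF wavelets.sets_prior refl] refl])
  from measurable_compose[OF measurable_Pair1'[OF assms] this] show ?thesis by simp
qed

definition excess :: "nat \<times> rmat \<times> (rvec \<Rightarrow> real) \<Rightarrow> real" where
  "excess \<theta> = (\<integral>z. (F (fst z) - predictor p \<theta> (fst z))\<^sup>2 \<partial>P)"

lemma gap_bound:
  assumes "\<theta> \<in> space \<pi>" shows "AE z in P. \<bar>F (fst z) - predictor p \<theta> (fst z)\<bar> \<le> H"
  using bounds
proof eventually_elim
  case (elim z)
  then show ?case using predictor_bound[OF assms, of "fst z"] by linarith
qed

lemma excess_nn_integral:
  assumes "\<theta> \<in> space \<pi>"
  shows "(\<integral>\<^sup>+z. ennreal ((F (fst z) - predictor p \<theta> (fst z))\<^sup>2) \<partial>P) = ennreal (excess \<theta>)"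
  unfolding excess_def
proof (rule nn_integral_eq_integral)
  note [measurable] = predictor_fixed_measurable[OF assms]
  show "integrable P (\<lambda>z. (F (fst z) - predictor p \<theta> (fst z))\<^sup>2)"
  proof (rule model.integrable_const_bound[where B = "H\<^sup>2"])
    show "AE z in P. norm ((F (fst z) - predictor p \<theta> (fst z))\<^sup>2) \<le> H\<^sup>2"
      using gap_bound[OF assms]
    proof eventually_elim
      case (elim z)
      then have "(F (fst z) - predictor p \<theta> (fst z))\<^sup>2 \<le> H\<^sup>2"
        using link.C by (intro abs_le_square_iff[THEN iffD1]) auto
      then show ?case by simp
    qed
  qed measurable
qed simp

sublocale posterior: gibbs_model P \<pi> n p "1 / q" lam "\<lambda>z. (model.noise z)\<^sup>2" excess
proof
  show "(\<lambda>(\<theta>, z). loss p \<theta> z) \<in> borel_measurable (\<pi> \<Otimes>\<^sub>M P)"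
    unfolding loss_def case_prod_beta' by measurable
  have "(\<lambda>\<theta>. \<integral>z. (F (fst z) - predictor p \<theta> (fst z))\<^sup>2 \<partial>P) \<in> borel_measurable \<pi>"
  proof (rule model.borel_measurable_lebesgue_integral)
    have "(\<lambda>w. (F (fst (snd w)) - predictor p (fst w) (fst (snd w)))\<^sup>2) \<in> borel_measurable (\<pi> \<Otimes>\<^sub>M P)"
      by measurable
    then show "(\<lambda>(\<theta>, z). (F (fst z) - predictor p \<theta> (fst z))\<^sup>2) \<in> borel_measurable (\<pi> \<Otimes>\<^sub>M P)"
      by (simp only: case_prod_beta')
  qed
  then show "excess \<in> borel_measurable \<pi>" by (simp only: excess_def[abs_def])
  show "0 < n" using n by simp
  show "0 < 1 / q" using q_bounds(1) by simp
  show "lam = 1 / q * real n" by simp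
  fix \<theta> assume \<theta>: "\<theta> \<in> space \<pi>"
  show "0 \<le> excess \<theta>" by (simp add: excess_def)
  have H1: "1 \<le> H" using link.C by simp
  have q0: "0 < 1 / q" using q_bounds(1) by simp
  note b = model.loss_gap_exponential_moments[OF predictor_fixed_measurable[OF \<theta>] gap_bound[OF \<theta>] H1 q0 q_bounds(2-4)]
  show "(\<integral>\<^sup>+z. ennreal (exp (- (1 / q) * (loss p \<theta> z - (model.noise z)\<^sup>2))) \<partial>P) \<le> ennreal (exp (- (1 / q) * excess \<theta> / 2))"
    using b(1) unfolding loss_def excess_def .
  show "(\<integral>\<^sup>+z. ennreal (exp (1 / q * (loss p \<theta> z - (model.noise z)\<^sup>2))) \<partial>P) \<le> ennreal (exp (2 * (1 / q) * excess \<theta>))"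
    using b(2) unfolding loss_def excess_def .
qed measurable

lemma excess_risk_excess:
  assumes "\<theta> \<in> space \<pi>" shows "excess_risk P p \<theta> \<le> ennreal (excess \<theta>)"
proof -
  obtain d' \<Theta>' f' where \<theta>: "\<theta> = (d', \<Theta>', f')" by (cases \<theta>)
  have pr: "predictor p \<theta> = (\<lambda>x. f' (mat_vec d' p \<Theta>' x))" unfolding \<theta> predictor_def prod.case ..
  have "excess_risk P p (d', \<Theta>', f') \<le> (\<integral>\<^sup>+z. ennreal ((F (fst z) - f' (mat_vec d' p \<Theta>' (fst z)))\<^sup>2) \<partial>P)"
    using predictor_fixed_measurable[OF assms] unfolding pr by (rule model.excess_risk_le)
  also have "\<dots> = ennreal (excess \<theta>)" using excess_nn_integral[OF assms] unfolding pr .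
  finally show ?thesis unfolding \<theta> .
qed

text \<open>
  The infimum in the excess risk is a constant, so only the risk of the fixed parameter has to be measurable.
\<close>

lemma excess_risk_measurable [measurable]: "excess_risk P p \<in> borel_measurable \<pi>"
proof -
  have l: "(\<lambda>w. ennreal (loss p (fst w) (snd w))) \<in> borel_measurable (\<pi> \<Otimes>\<^sub>M P)"
    unfolding loss_def by measurable
  have "(\<lambda>\<theta>. \<integral>\<^sup>+z. ennreal (loss p \<theta> z) \<partial>P) \<in> borel_measurable \<pi>"
    by (rule model.borel_measurable_nn_integral) (use l in \<open>simp only: case_prod_beta'\<close>)
  then have m: "(\<lambda>\<theta>. (\<integral>\<^sup>+z. ennreal (loss p \<theta> z) \<partial>P) - c) \<in> borel_measurable \<pi>" for c :: ennreal
    by measurable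
  have risk: "risk P p d' \<Theta>' f' = (\<integral>\<^sup>+z. ennreal (loss p (d', \<Theta>', f') z) \<partial>P)" for d' \<Theta>' f'
    by (simp only: model.risk_eq loss_def predictor_def prod.case)
  define c where "c = (INF (d', \<Theta>', f') \<in> (SIGMA d':{1..p}. space (mat_space d' p) \<times> borel_measurable (vec_space d')).
        risk P p d' \<Theta>' f')"
  have "excess_risk P p \<theta> = (\<integral>\<^sup>+z. ennreal (loss p \<theta> z) \<partial>P) - c" for \<theta>
  proof -
    obtain d' \<Theta>' f' where \<theta>: "\<theta> = (d', \<Theta>', f')" by (cases \<theta>)
    show ?thesis unfolding \<theta> excess_risk_def prod.case c_def[symmetric] risk[of d' \<Theta>' f'] ..
  qed
  then have "excess_risk P p = (\<lambda>\<theta>. (\<integral>\<^sup>+z. ennreal (loss p \<theta> z) \<partial>P) - c)" by (rule ext)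
  then show ?thesis using m[of c] by (simp only:)
qed

definition index where "index z = mat_vec d p \<Theta> (fst z)" for z :: "rvec \<times> real"

text \<open>
  The density of the index is bounded, so mean squares under its law compare with Lebesgue mean squares.
\<close>

lemma bias:
  "(\<integral>\<^sup>+z. ennreal ((f (index z) - link.trunc M (index z))\<^sup>2) * indicator link.box (index z) \<partial>P)
    \<le> ennreal (B2 * (2 powr (- 2 * real M * \<alpha>) * \<xi>\<^sup>2))"
proof -
  let ?w = "\<lambda>v. ennreal ((f v - link.trunc M v)\<^sup>2) * indicator link.box v"
  have w: "?w \<in> borel_measurable (leb d)"
    using link.f_measurable link.trunc_measurable[of M] link.box_measurable(2) by measurable
  have "(\<integral>\<^sup>+z. ?w (index z) \<partial>P) = (\<integral>\<^sup>+v. u v * ?w v \<partial>leb d)"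
    unfolding index_def by (rule distributed_nn_integral[OF index_law w, symmetric])
  also have "\<dots> \<le> (\<integral>\<^sup>+v. ennreal B2 * ?w v \<partial>leb d)"
    using index_density by (intro nn_integral_mono mult_right_mono) auto
  also have "\<dots> = ennreal B2 * (\<integral>\<^sup>+v. ?w v \<partial>leb d)" by (rule nn_integral_cmult[OF w])
  also have "\<dots> \<le> ennreal B2 * ennreal (2 powr (- 2 * real M * \<alpha>) * \<xi>\<^sup>2)"
    by (rule mult_left_mono[OF link.trunc_error]) simp
  also have "\<dots> = ennreal (B2 * (2 powr (- 2 * real M * \<alpha>) * \<xi>\<^sup>2))"
    using B2 by (simp add: ennreal_mult)
  finally show ?thesis .
qed

text \<open>
  With this radius a change of the matrix moves a link value by at most \<open>1 / n\<close>, links being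
  \<open>(C + 1)\<close>-Lipschitz and covariates bounded by \<open>K\<close>.
\<close>

definition radius :: real where "radius = 1 / ((C + 1) * real d * real p * K * real n)"

text \<open>
  The error splits into the bias, the change of the coefficients and the change of the matrix; the last two are
  at most \<open>1 / n\<close> pointwise.
\<close>

lemma excess_near:
  assumes \<Theta>': "\<Theta>' \<in> sparse_mats d p" "\<forall>i<d. \<forall>j<p. \<bar>\<Theta>' i j - \<Theta> i j\<bar> \<le> radius"
    and b: "b \<in> wavelets.ball d M" "coeff_norm \<phi> \<psi> N d M (\<lambda>l. b l - link.\<beta> l) \<le> 1 / real n" and M: "M \<le> n"
  shows "(d, \<Theta>', expansion \<phi> \<psi> N d M b) \<in> space \<pi>"
    and "excess (d, \<Theta>', expansion \<phi> \<psi> N d M b) \<le> 3 * B2 * \<xi>\<^sup>2 * 2 powr (- 2 * real M * \<alpha>) + 6 / (real n)\<^sup>2"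
proof -
  let ?f = "expansion \<phi> \<psi> N d M b" and ?\<theta> = "(d, \<Theta>', expansion \<phi> \<psi> N d M b)"
  have fl: "?f \<in> links \<phi> \<psi> N n C d" unfolding links_def using b(1) M by auto
  show \<theta>: "?\<theta> \<in> space \<pi>" unfolding space_prior using fl \<Theta>' d by simp
  have C1: "C + 1 > 0" using link.C by simp
  have pos: "real n > 0" "real d > 0" "real p > 0" using n d by auto
  define V where "V = 2 powr (- 2 * real M * \<alpha>) * \<xi>\<^sup>2"
  have sq3: "(x + y + w)\<^sup>2 \<le> 3 * x\<^sup>2 + 3 * y\<^sup>2 + 3 * w\<^sup>2" for x y w :: real
  proof -
    have "0 \<le> (x - y)\<^sup>2 + (y - w)\<^sup>2 + (x - w)\<^sup>2" by simp
    then show ?thesis by (simp add: power2_eq_square algebra_simps)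
  qed
  have "ennreal (excess ?\<theta>) = (\<integral>\<^sup>+z. ennreal ((F (fst z) - ?f (mat_vec d p \<Theta>' (fst z)))\<^sup>2) \<partial>P)"
    using excess_nn_integral[OF \<theta>] by (simp add: predictor_def)
  also have "\<dots> \<le> (\<integral>\<^sup>+z. 3 * (ennreal ((f (index z) - link.trunc M (index z))\<^sup>2) * indicator link.box (index z)) + ennreal (6 / (real n)\<^sup>2) \<partial>P)"
  proof (rule nn_integral_mono_AE)
    show "AE z in P. ennreal ((F (fst z) - ?f (mat_vec d p \<Theta>' (fst z)))\<^sup>2) \<le>
        3 * (ennreal ((f (index z) - link.trunc M (index z))\<^sup>2) * indicator link.box (index z)) + ennreal (6 / (real n)\<^sup>2)"
      using bounds F_eq index_bound
    proof eventually_elim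
      case (elim z)
      let ?v = "index z" and ?v' = "mat_vec d p \<Theta>' (fst z)"
      have vs: "?v \<in> space (vec_space d)" "?v' \<in> space (vec_space d)" by (simp_all add: index_def mat_vec_def)
      have box: "?v \<in> link.box"
      proof -
        \<comment> \<open>The box is open on the left, hence the extra unit.\<close>
        have "B1 < of_int (\<lceil>B1\<rceil> + 1)" using le_of_int_ceiling[of B1] by linarith
        then have "- of_int (\<lceil>B1\<rceil> + 1) < ?v i \<and> ?v i \<le> of_int (\<lceil>B1\<rceil> + 1)" if "i < d" for i
          using elim(3) that unfolding index_def by (auto simp: abs_le_iff)
        then show ?thesis using vs(1) unfolding link.box_def by (simp add: PiE_iff)
      qed
      have t2: "\<bar>link.trunc M ?v - ?f ?v\<bar> \<le> 1 / real n"
      proof -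
        have "link.trunc M ?v - ?f ?v = - expansion \<phi> \<psi> N d M (\<lambda>l. b l - link.\<beta> l) ?v"
          using vs(1) by (simp add: link.trunc_def expansion_def left_diff_distrib sum_subtractf)
        then have "\<bar>link.trunc M ?v - ?f ?v\<bar> \<le> coeff_norm \<phi> \<psi> N d M (\<lambda>l. b l - link.\<beta> l)"
          using wavelets.expansion_bound[OF vs(1), of N M "\<lambda>l. b l - link.\<beta> l"] by simp
        then show ?thesis using b(2) by simp
      qed
      have t3: "\<bar>?f ?v - ?f ?v'\<bar> \<le> 1 / real n"
      proof -
        have "\<bar>?f ?v - ?f ?v'\<bar> \<le> (C + 1) * (\<Sum>i<d. \<bar>?v i - ?v' i\<bar>)" by (rule wavelets.links_lipschitz[OF fl vs])
        also have "\<dots> \<le> (C + 1) * (\<Sum>i<d. real p * (radius * K))"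
        proof (intro mult_left_mono sum_mono)
          fix i assume i: "i \<in> {..<d}"
          have "?v i - ?v' i = (\<Sum>j<p. (\<Theta> i j - \<Theta>' i j) * fst z j)"
            using i by (simp add: index_def mat_vec_def left_diff_distrib sum_subtractf)
          also have "\<bar>\<dots>\<bar> \<le> (\<Sum>j<p. \<bar>(\<Theta> i j - \<Theta>' i j) * fst z j\<bar>)" by (rule sum_abs)
          also have "\<dots> \<le> (\<Sum>j<p. radius * K)"
          proof (rule sum_mono)
            fix j assume j: "j \<in> {..<p}"
            have "\<bar>\<Theta> i j - \<Theta>' i j\<bar> \<le> radius" using \<Theta>'(2) i j by (simp add: abs_minus_commute)
            moreover have "\<bar>fst z j\<bar> \<le> K" using elim(1) j by simp
            ultimately show "\<bar>(\<Theta> i j - \<Theta>' i j) * fst z j\<bar> \<le> radius * K"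
              unfolding abs_mult by (intro mult_mono) auto
          qed
          finally show "\<bar>?v i - ?v' i\<bar> \<le> real p * (radius * K)" by simp
        qed (use C1 in simp)
        also have "\<dots> = 1 / real n" using C1 K pos by (simp add: radius_def)
        finally show ?thesis .
      qed
      have "(1 / real n)\<^sup>2 = 1 / (real n)\<^sup>2" by (simp add: power_divide)
      then have s2: "(link.trunc M ?v - ?f ?v)\<^sup>2 \<le> 1 / (real n)\<^sup>2" "(?f ?v - ?f ?v')\<^sup>2 \<le> 1 / (real n)\<^sup>2"
        using abs_le_square_iff[THEN iffD1, of "link.trunc M ?v - ?f ?v" "1 / real n"]
          abs_le_square_iff[THEN iffD1, of "?f ?v - ?f ?v'" "1 / real n"] t2 t3 pos by simp_all
      have split: "F (fst z) - ?f ?v' = (f ?v - link.trunc M ?v) + (link.trunc M ?v - ?f ?v) + (?f ?v - ?f ?v')"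
        using elim(2) by (simp add: index_def)
      have "(F (fst z) - ?f ?v')\<^sup>2 \<le> 3 * (f ?v - link.trunc M ?v)\<^sup>2 + 3 * (link.trunc M ?v - ?f ?v)\<^sup>2 + 3 * (?f ?v - ?f ?v')\<^sup>2"
        unfolding split by (rule sq3)
      also have "\<dots> \<le> 3 * (f ?v - link.trunc M ?v)\<^sup>2 + 6 / (real n)\<^sup>2" using s2 by simp
      finally have "ennreal ((F (fst z) - ?f ?v')\<^sup>2) \<le> ennreal (3 * (f ?v - link.trunc M ?v)\<^sup>2 + 6 / (real n)\<^sup>2)"
        by (rule ennreal_leI)
      also have "\<dots> = 3 * (ennreal ((f ?v - link.trunc M ?v)\<^sup>2) * indicator link.box ?v) + ennreal (6 / (real n)\<^sup>2)"
        using box by (simp add: ennreal_mult)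
      finally show ?case .
    qed
  qed
  also have "\<dots> = 3 * (\<integral>\<^sup>+z. ennreal ((f (index z) - link.trunc M (index z))\<^sup>2) * indicator link.box (index z) \<partial>P) + ennreal (6 / (real n)\<^sup>2)"
  proof -
    have "index \<in> measurable P (leb d)"
      using distributed_measurable[OF index_law] by (simp only: index_def[abs_def])
    from measurable_compose[OF this, of "\<lambda>v. ennreal ((f v - link.trunc M v)\<^sup>2) * indicator link.box v" borel]
    have m: "(\<lambda>z. ennreal ((f (index z) - link.trunc M (index z))\<^sup>2) * indicator link.box (index z)) \<in> borel_measurable P"
      using link.f_measurable link.trunc_measurable[of M] link.box_measurable(2) by measurable
    show ?thesis
      by (subst nn_integral_add) (use m in \<open>simp_all add: nn_integral_cmult model.emeasure_space_1\<close>)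
  qed
  also have "\<dots> \<le> 3 * ennreal (B2 * V) + ennreal (6 / (real n)\<^sup>2)"
    unfolding V_def by (intro add_right_mono mult_left_mono bias) simp
  also have "\<dots> = ennreal (3 * (B2 * V) + 6 / (real n)\<^sup>2)"
    using B2 by (simp add: ennreal_mult V_def)
  finally have "excess ?\<theta> \<le> 3 * (B2 * V) + 6 / (real n)\<^sup>2"
    using B2 by (subst (asm) ennreal_le_iff) (auto simp: V_def intro!: add_nonneg_nonneg mult_nonneg_nonneg)
  then show "excess ?\<theta> \<le> 3 * B2 * \<xi>\<^sup>2 * 2 powr (- 2 * real M * \<alpha>) + 6 / (real n)\<^sup>2" by (simp add: V_def mult_ac)
qed

lemma ln_pos: "ln (C * real n) \<ge> 1"
proof -
  have "C * (10 / C) \<le> C * real n" using n(2) link.C by (intro mult_left_mono) auto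
  then have "10 \<le> C * real n" using link.C by simp
  then have "exp 1 \<le> C * real n" using exp_le by linarith
  then have "ln (exp 1) \<le> ln (C * real n)" by (subst ln_le_cancel_iff) (auto intro: less_le_trans[OF exp_gt_zero])
  then show ?thesis by simp
qed

lemma \<xi>_le: "\<xi> \<le> C * real N ^ d"
proof -
  have N1: "real N \<ge> 1" using link.N_pos by simp
  have a: "1 \<le> real N powr (real d / 2)" "1 \<le> (8::real) powr (real d / 2)"
    using N1 by (auto intro: ge_one_powr_ge_zero)
  have Ld: "wavelet_bound \<phi> \<psi> ^ d > 0" using wavelets.L_pos by simp
  have "wavelet_bound \<phi> \<psi> ^ d * 1 * 1 * 1 \<le> wavelet_bound \<phi> \<psi> ^ d * 2 * real N powr (real d / 2) * 8 powr (real d / 2)"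
    using a Ld by (intro mult_mono) (auto intro: mult_nonneg_nonneg)
  then have "\<xi> \<le> C / wavelet_bound \<phi> \<psi> ^ d"
    unfolding link.\<xi> using Ld link.C by (intro divide_left_mono) (auto intro!: mult_pos_pos)
  also have "\<dots> = C * (1 / wavelet_bound \<phi> \<psi>) ^ d" by (simp add: power_divide)
  also have "\<dots> \<le> C * real N ^ d"
    using L_inv wavelets.L_pos link.C by (intro mult_left_mono power_mono) auto
  finally show ?thesis .
qed

text \<open>
  The oracle inequality for the event \<open>A\<close> of excess at most \<open>t\<close>, where \<open>t\<close> is the bound reached near the truth
  at the level chosen by \<open>resolution_level\<close>.
\<close>

theorem excess_risk_rate:
  assumes \<delta>: "0 < \<delta>" "\<delta> < 1"
  shows "1 - \<delta> \<le> measure (joint_law \<pi> lam P n p) {z \<in> space (joint_law \<pi> lam P n p). excess_risk P p (snd z) \<le>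
    ennreal (rate_constant C K \<Gamma> \<sigma> N B2 d * ((ln (C * real n) / real n) powr (2 * \<alpha> / (2 * \<alpha> + real d))
      + real (sparsity d p \<Theta>) * ln (real p * real n) / real n + ln (2 / \<delta>) / real n))}"
proof -
  let ?J = "joint_law \<pi> lam P n p"
  define x where "x = ln (C * real n) / real n"
  define r where "r = x powr (2 * \<alpha> / (2 * \<alpha> + real d))"
  define i where "i = sparsity d p \<Theta>"
  have C: "C \<ge> 1" by (rule wavelets.C)
  have pos: "real n > 0" "real d > 0" "real p > 0" using n d by auto
  have n1: "n \<ge> 1" and p1: "p \<ge> 1" using n d by auto
  have \<alpha>0: "\<alpha> > 0" using link.\<alpha> by simp
  obtain M where M: "2 powr (- 2 * real M * \<alpha>) \<le> r" "M \<le> n" "2 ^ (M * d) * x \<le> 2 ^ d * (ln C + 1) * r" "2 ^ (M * d) \<le> 2 ^ d * real n"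
    unfolding r_def x_def by (rule resolution_level[OF C n1 ln_pos d(1) \<alpha>0])
  define D where "D = card (wavelet_index d (enat M) (enat N))"
  have D: "D \<ge> 1" "real D \<le> 2 * (6 * real N) ^ d * 2 ^ (M * d)"
    unfolding D_def using wavelets.card_index_pos card_wavelet_index[OF link.N_pos d(1), of M] by auto
  define t where "t = 3 * B2 * \<xi>\<^sup>2 * 2 powr (- 2 * real M * \<alpha>) + 6 / (real n)\<^sup>2"
  define A where "A = {\<theta> \<in> space \<pi>. excess \<theta> \<le> t}"
  have A: "A \<in> sets \<pi>" unfolding A_def by measurable
  have radius: "0 < radius" "radius \<le> 1"
  proof -
    have "1 * 1 * 1 * 1 * 1 \<le> (C + 1) * real d * real p * K * real n"
      using C K d n by (intro mult_mono) auto
    then show "0 < radius" "radius \<le> 1" unfolding radius_def by (auto simp: divide_le_eq)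
  qed
  \<comment> \<open>The prior mass that perturbations of size \<open>radius\<close> and \<open>1 / n\<close> are known to carry.\<close>
  define w where "w = (1 / 10) ^ d * ((radius / (40 * real d * (real p)\<^sup>2)) ^ i * ((1 / 10) ^ (M + 1) * ((1 / real n) / ((C + 1) * real D)) ^ D))"
  have w_le: "w \<le> measure \<pi> A"
    unfolding w_def i_def D_def
  proof (rule wavelets.prior_near[OF _ \<Theta> radius link.coeff_norm_le _ _ M(2)])
    show "d \<in> {1..p}" using d by simp
    show "0 < 1 / real n" "1 / real n \<le> 1" using n by auto
    show "A \<in> sets wavelets.params" using A by (simp only: wavelets.sets_prior)
    fix \<Theta>' b assume "\<Theta>' \<in> sparse_mats d p" "\<forall>i<d. \<forall>j<p. \<bar>\<Theta>' i j - \<Theta> i j\<bar> \<le> radius" "b \<in> wavelets.ball d M"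
      "coeff_norm \<phi> \<psi> N d M (\<lambda>l. b l - link.\<beta> l) \<le> 1 / real n"
    from excess_near[OF this M(2)] show "(d, \<Theta>', expansion \<phi> \<psi> N d M b) \<in> A" by (simp add: A_def t_def)
  qed
  have base: "radius / (40 * real d * (real p)\<^sup>2) > 0" "(1 / real n) / ((C + 1) * real D) > 0"
    using radius pos C D(1) by (auto intro!: divide_pos_pos mult_pos_pos)
  have w_pos: "w > 0" unfolding w_def using base by (intro mult_pos_pos zero_less_power) auto
  have ln_w: "ln (1 / measure \<pi> A) \<le> real d * ln 10 + real i * ln (40 * (real d)\<^sup>2 * (C + 1) * K * real p ^ 3 * real n)
      + (real (M + 1) * ln 10 + real D * ln ((C + 1) * real D * real n))"
  proof -
    have "ln (1 / measure \<pi> A) \<le> - ln w"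
      using w_le w_pos by (simp add: ln_div)
    also have "ln w = real d * ln (1 / 10) + (real i * ln (radius / (40 * real d * (real p)\<^sup>2))
        + (real (M + 1) * ln (1 / 10) + real D * ln ((1 / real n) / ((C + 1) * real D))))"
      unfolding w_def using base by (simp add: ln_mult_pos ln_realpow del: power_Suc)
    also have "ln (1 / 10 :: real) = - ln 10" by (simp add: ln_div)
    also have "ln (radius / (40 * real d * (real p)\<^sup>2)) = - ln (40 * (real d)\<^sup>2 * (C + 1) * K * real p ^ 3 * real n)"
    proof -
      have "radius / (40 * real d * (real p)\<^sup>2) = 1 / (40 * (real d)\<^sup>2 * (C + 1) * K * real p ^ 3 * real n)"
        by (simp add: radius_def power2_eq_square power3_eq_cube mult_ac)
      then show ?thesis using C K pos by (simp add: ln_div)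
    qed
    also have "ln ((1 / real n) / ((C + 1) * real D)) = - ln ((C + 1) * real D * real n)"
    proof -
      have "(1 / real n) / ((C + 1) * real D) = 1 / ((C + 1) * real D * real n)" by (simp add: mult_ac)
      then show ?thesis using C D(1) pos by (simp add: ln_div)
    qed
    finally show ?thesis by (simp add: algebra_simps)
  qed
  define E where "E = rate_constant C K \<Gamma> \<sigma> N B2 d * (r + real i * ln (real p * real n) / real n + ln (2 / \<delta>) / real n)"
  \<comment> \<open>The threshold of the oracle inequality is at most the claimed rate.\<close>
  have thr: "2 / lam * ln (1 / measure \<pi> A) + 4 * t + 4 / lam * ln (1 / \<delta>) \<le> E"
  proof -
    have id: "d \<le> i"
    proof -
      obtain I where "I \<in> patterns d p" "pattern_size d I = i" using sparsity_pattern[OF \<Theta>] unfolding i_def by blast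
      then show ?thesis using pattern_size_bounds(1) by blast
    qed
    have q: "q > 0" by (rule q_bounds(1))
    have "2 / lam * ln (1 / measure \<pi> A) = 2 * q / real n * ln (1 / measure \<pi> A)" by simp
    also have "\<dots> \<le> 2 * q / real n * (real d * ln 10 + real i * ln (40 * (real d)\<^sup>2 * (C + 1) * K * real p ^ 3 * real n)
      + (real (M + 1) * ln 10 + real D * ln ((C + 1) * real D * real n)))"
      using q pos by (intro mult_left_mono ln_w) auto
    finally have "2 / lam * ln (1 / measure \<pi> A) + 4 * t + 4 / lam * ln (1 / \<delta>) \<le>
      2 * q / real n * (real d * ln 10 + real i * ln (40 * (real d)\<^sup>2 * (C + 1) * K * real p ^ 3 * real n)
        + (real (M + 1) * ln 10 + real D * ln ((C + 1) * real D * real n))) + 4 * t + 4 * q / real n * ln (1 / \<delta>)"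
      by simp
    also have "\<dots> \<le> E"
      unfolding E_def rate_constant_def t_def
      by (rule rate_bound[OF C K less_imp_le[OF q] less_imp_le[OF B2] link.N_pos d(1) p1 n(1) ln_pos id \<delta>
          less_imp_le[OF link.\<xi>_pos] \<xi>_le D x_def _ M(1) M(3) M(4)]) (simp add: r_def)
    finally show ?thesis .
  qed
  have "1 - \<delta> \<le> measure ?J {z \<in> space ?J. excess (snd z) \<le> 2 / lam * ln (1 / measure \<pi> A) + 4 * t + 4 / lam * ln (1 / \<delta>)}"
    by (rule posterior.pac_bayes[OF A _ _ \<delta>(1)]) (use w_le w_pos in \<open>auto simp: A_def\<close>)
  also have "\<dots> \<le> measure ?J {z \<in> space ?J. excess_risk P p (snd z) \<le> ennreal E}"
  proof -
    interpret J: prob_space ?J by (rule posterior.prob_J)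
    have spJ: "snd z \<in> space \<pi>" if "z \<in> space ?J" for z
      using that unfolding sets_eq_imp_space_eq[OF posterior.sets_J] by (auto simp: space_pair_measure)
    have sJ: "snd \<in> measurable ?J \<pi>"
      by (simp only: measurable_cong_sets[OF posterior.sets_J refl] measurable_snd)
    show ?thesis
    proof (rule J.finite_measure_mono)
      show "{z \<in> space ?J. excess (snd z) \<le> 2 / lam * ln (1 / measure \<pi> A) + 4 * t + 4 / lam * ln (1 / \<delta>)}
          \<subseteq> {z \<in> space ?J. excess_risk P p (snd z) \<le> ennreal E}"
      proof (rule subsetI, unfold mem_Collect_eq, elim conjE, intro conjI)
        fix z assume z: "z \<in> space ?J" "excess (snd z) \<le> 2 / lam * ln (1 / measure \<pi> A) + 4 * t + 4 / lam * ln (1 / \<delta>)"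
        have "excess_risk P p (snd z) \<le> ennreal (excess (snd z))" by (rule excess_risk_excess[OF spJ[OF z(1)]])
        also have "\<dots> \<le> ennreal E" using z(2) thr by (intro ennreal_leI) linarith
        finally show "excess_risk P p (snd z) \<le> ennreal E" .
      qed
      have "(\<lambda>z. excess_risk P p (snd z)) \<in> borel_measurable ?J"
        by (rule measurable_compose[OF sJ excess_risk_measurable])
      then show "{z \<in> space ?J. excess_risk P p (snd z) \<le> ennreal E} \<in> sets ?J" by measurable
    qed
  qed
  finally show ?thesis unfolding E_def r_def x_def i_def .
qed

end

text \<open>
  The threshold \<open>N0\<close> is any value that is adequate for the given wavelets and index bound; adequacy persists for
  larger \<open>N\<close>, and the model assumptions are then those of \<open>multi_index_model\<close>.
\<close>

theorem corollary5:
  "\<exists>N0 :: (real \<Rightarrow> real) \<Rightarrow> (real \<Rightarrow> real) \<Rightarrow> real \<Rightarrow> nat.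
   \<forall>(C::real) (K::real) (\<Gamma>::real) (\<sigma>::real) (N::nat) (B1::real) (B2::real) (d::nat).
     C \<ge> 1 \<longrightarrow> K \<ge> 1 \<longrightarrow> \<Gamma> > 0 \<longrightarrow> \<sigma> > 0 \<longrightarrow> B1 > 0 \<longrightarrow> B2 > 0 \<longrightarrow> d \<ge> 1 \<longrightarrow>
     (\<exists>\<Lambda>::real.
        \<forall>(\<phi> :: real \<Rightarrow> real) (\<psi> :: real \<Rightarrow> real) (p::nat) (n::nat) (\<alpha>::real)
          (P :: (rvec \<times> real) measure) (F :: rvec \<Rightarrow> real) (\<Theta> :: rmat) (f :: rvec \<Rightarrow> real).
          wavelet_pair \<phi> \<psi> \<longrightarrow>
          N \<ge> N0 \<phi> \<psi> B1 \<longrightarrow>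
          regression_model P p F \<longrightarrow>
          (AE (x, y) in P. (\<forall>j<p. \<bar>x j\<bar> \<le> K) \<and> \<bar>F x\<bar> \<le> C) \<longrightarrow>
          bernstein_noise P p F \<sigma> \<Gamma> \<longrightarrow>
          d \<le> p \<longrightarrow>
          \<Theta> \<in> sparse_mats d p \<longrightarrow>
          (AE (x, y) in P. F x = f (mat_vec d p \<Theta> x)) \<longrightarrow>
          (AE (x, y) in P. \<forall>i<d. \<bar>mat_vec d p \<Theta> x i\<bar> \<le> B1) \<longrightarrow>
          (\<exists>g. distributed P (leb d) (\<lambda>(x, y). mat_vec d p \<Theta> x) g \<and>
               (\<forall>u\<in>space (leb d). g u \<le> ennreal B2)) \<longrightarrow>
          real n \<ge> max (10 / C) (30 * sqrt 2 * exp 1 / (real p)\<^sup>2) \<longrightarrow>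
          n \<ge> 2 \<longrightarrow>
          \<alpha> > 2 + real d \<longrightarrow>
          f \<in> besov_ellipsoid \<phi> \<psi> \<alpha> 2 d
                (C / (wavelet_bound \<phi> \<psi> ^ d * 2 * real N powr (real d / 2) * 8 powr (real d / 2))) \<longrightarrow>
          (let Q = 8 * (2 * C + 1) * max \<Gamma> (2 * C + 1);
               lam = real n / (Q + 2 * ((2 * C + 1)\<^sup>2 + 4 * \<sigma>\<^sup>2));
               J = joint_law (prior \<phi> \<psi> N n C p) lam P n p
           in \<forall>\<delta>. 0 < \<delta> \<and> \<delta> < 1 \<longrightarrow>
                \<P>(z in J. excess_risk P p (snd z) \<le>
                   ennreal (\<Lambda> * ((ln (C * real n) / real n) powr (2 * \<alpha> / (2 * \<alpha> + real d))
                                 + real (sparsity d p \<Theta>) * ln (real p * real n) / real n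
                                 + ln (2 / \<delta>) / real n)))
                \<ge> 1 - \<delta>))"
proof -
  define N0 where "N0 = (\<lambda>(\<phi> :: real \<Rightarrow> real) \<psi> B1. SOME k. adequate \<phi> \<psi> B1 k)"
  have N0: "adequate \<phi> \<psi> B1 N" if "wavelet_pair \<phi> \<psi>" "N \<ge> N0 \<phi> \<psi> B1" for \<phi> \<psi> B1 N
    using someI_ex[OF adequate_exists[OF that(1), of B1]] that(2) unfolding N0_def by (rule adequate_mono)
  show ?thesis
  proof (rule exI[of _ N0], intro allI impI, rule exI, intro allI impI)
    fix C K \<Gamma> \<sigma> :: real and N :: nat and B1 B2 :: real and d :: nat
      and \<phi> \<psi> :: "real \<Rightarrow> real" and p n :: nat and \<alpha> :: real
      and P :: "(rvec \<times> real) measure" and F :: "rvec \<Rightarrow> real" and \<Theta> :: rmat and f :: "rvec \<Rightarrow> real"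
    assume const: "C \<ge> 1" "K \<ge> 1" "\<Gamma> > 0" "\<sigma> > 0" "B1 > 0" "B2 > 0" "d \<ge> 1"
      and wav: "wavelet_pair \<phi> \<psi>" and N: "N \<ge> N0 \<phi> \<psi> B1"
      and reg: "regression_model P p F"
      and bd: "AE (x, y) in P. (\<forall>j<p. \<bar>x j\<bar> \<le> K) \<and> \<bar>F x\<bar> \<le> C"
      and noise: "bernstein_noise P p F \<sigma> \<Gamma>" and dp: "d \<le> p" and \<Theta>: "\<Theta> \<in> sparse_mats d p"
      and F_eq: "AE (x, y) in P. F x = f (mat_vec d p \<Theta> x)"
      and ib: "AE (x, y) in P. \<forall>i<d. \<bar>mat_vec d p \<Theta> x i\<bar> \<le> B1"
      and dens: "\<exists>g. distributed P (leb d) (\<lambda>(x, y). mat_vec d p \<Theta> x) g \<and> (\<forall>u\<in>space (leb d). g u \<le> ennreal B2)"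
      and n: "real n \<ge> max (10 / C) (30 * sqrt 2 * exp 1 / (real p)\<^sup>2)" "n \<ge> 2"
      and \<alpha>: "\<alpha> > 2 + real d"
      and f: "f \<in> besov_ellipsoid \<phi> \<psi> \<alpha> 2 d
        (C / (wavelet_bound \<phi> \<psi> ^ d * 2 * real N powr (real d / 2) * 8 powr (real d / 2)))"
    obtain h g m where w: "two_scale_pair \<phi> \<psi> h g m" and Nm: "\<lceil>B1\<rceil> + 1 + m \<le> int N"
      and L: "1 / wavelet_bound \<phi> \<psi> \<le> real N"
      using N0[OF wav N] unfolding adequate_def by blast
    obtain u where u: "distributed P (leb d) (\<lambda>(x, y). mat_vec d p \<Theta> x) u" "\<forall>v\<in>space (leb d). u v \<le> ennreal B2"
      using dens by blast
    interpret two_scale_pair \<phi> \<psi> h g m by (rule w)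
    interpret multi_index_model \<phi> \<psi> h g m N n p C P F \<sigma> \<Gamma> d B1 \<alpha>
      "C / (wavelet_bound \<phi> \<psi> ^ d * 2 * real N powr (real d / 2) * 8 powr (real d / 2))" f K B2 \<Theta> u
    proof (intro multi_index_model.intro multi_index_model_axioms.intro link_prior.intro
        link_prior_axioms.intro regression.intro besov_link.intro besov_link_axioms.intro w)
      show "1 \<le> p" using const dp by simp
      show "0 \<le> \<lceil>B1\<rceil> + 1" using const by (simp add: less_imp_le add_nonneg_nonneg)
      show "C > 0" using const by simp
      show "AE z in P. (\<forall>j<p. \<bar>fst z j\<bar> \<le> K) \<and> \<bar>F (fst z)\<bar> \<le> C" using bd by (simp only: case_prod_beta')
      show "AE z in P. F (fst z) = f (mat_vec d p \<Theta> (fst z))" using F_eq by (simp only: case_prod_beta')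
      show "AE z in P. \<forall>i<d. \<bar>mat_vec d p \<Theta> (fst z) i\<bar> \<le> B1" using ib by (simp only: case_prod_beta')
      show "distributed P (leb d) (\<lambda>z. mat_vec d p \<Theta> (fst z)) u" using u(1) by (simp only: case_prod_beta')
      show "real n \<ge> 10 / C" using n(1) by simp
    qed (fact const Nm L reg noise dp \<Theta> u(2) n(2) \<alpha> f refl)+
    show "let Q = 8 * (2 * C + 1) * max \<Gamma> (2 * C + 1);
               lam = real n / (Q + 2 * ((2 * C + 1)\<^sup>2 + 4 * \<sigma>\<^sup>2));
               J = joint_law (prior \<phi> \<psi> N n C p) lam P n p
           in \<forall>\<delta>. 0 < \<delta> \<and> \<delta> < 1 \<longrightarrow>
                \<P>(z in J. excess_risk P p (snd z) \<le>
                   ennreal (rate_constant C K \<Gamma> \<sigma> N B2 d * ((ln (C * real n) / real n) powr (2 * \<alpha> / (2 * \<alpha> + real d))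
                                 + real (sparsity d p \<Theta>) * ln (real p * real n) / real n
                                 + ln (2 / \<delta>) / real n)))
                \<ge> 1 - \<delta>"
      unfolding Let_def temperature_def[symmetric] using excess_risk_rate by blast
  qed
qed

end
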